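(* Let $\Omega$ be an arbitrary domain in $\mathbb{R}^d$ and $f\in L^2(\Omega)$. Let $\kappa=\kappa(\epsilon)>0$ be such that $\kappa\to 0$ as $\epsilon\to 0$ and $\lim_{\epsilon\to0}\frac{\kappa}{\epsilon}=\theta\in[0,\infty]$. Let $u^\epsilon\in H^2(\Omega)$ be such that $u^\epsilon$ converges weakly to $u^*$ in $H^1(\Omega)$, $\kappa\Delta u^\epsilon$ is uniformly bounded in $L^2(\Omega)$, and $$\kappa^2\Delta^2u^\epsilon-\nabla\cdot A\left(\frac{x}{\epsilon}\right)\nabla u^\epsilon=f\quad\text{in }\Omega .$$ Let $A^{\mathrm{hom}}$ be the homogenized matrix associated with $\theta$ (defined in the context). Then: 1. $A\left(\frac{x}{\epsilon}\right)\nabla u^\epsilon(x)\rightharpoonup A^{\mathrm{hom}}\nabla u^*(x)$ weakly in $(L^2(\Omega))^d$. 2. The limit $u^*$ satisfies the homogenized equation $-\nabla\cdot A^{\mathrm{hom}}\nabla u^*=f$ in $\Omega$.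
   Context: $Y=[0,2\pi)^d$. $A(y)=(a_{jk}(y))_{j,k=1}^d$ is a matrix with real, bounded, measurable entries on $\mathbb{R}^d$ that is symmetric, $Y$-periodic ($A(y+2\pi p)=A(y)$ for all $p\in\mathbb{Z}^d$, a.e. $y$), and elliptic: there is $\alpha>0$ with $A(y)\xi\cdot\xi\ge\alpha|\xi|^2$ for all $\xi\in\mathbb{R}^d$, a.e. $y$. Equations in $\Omega$ are understood in the sense of distributions; no boundary condition is imposed. $H^s_\sharp(Y)$ is the Sobolev space of $Y$-periodic functions (identified with $H^s$ of the torus $\mathbb{R}^d/2\pi\mathbb{Z}^d$), and $\mathcal{M}_Y(u)=\frac1{|Y|}\int_Y u\,dy$. For $0\le\rho<\infty$ and $1\le j\le d$, $\chi^\rho_j$ (in $H^2_\sharp(Y)$ if $\rho>0$, in $H^1_\sharp(Y)$ if $\rho=0$) is the unique $Y$-periodic solution of $\rho^2\Delta^2\chi^\rho_j-\operatorname{div}A(y)(e_j+\nabla\chi_j^\rho)=0$ in $\mathbb{R}^d$ with $\mathcal{M}_Y(\chi^\rho_j)=0$, where $e_j$ is the $j$-th standard unit vector. $\mathcal{M}_Y(A+A\nabla\chi^\rho)$ denotes the matrix with $(k,l)$ entry $\mathcal{M}_Y(e_k\cdot Ae_l+e_k\cdot A\nabla\chi^\rho_l)$. The homogenized matrix is $A^{\mathrm{hom}}=\mathcal{M}_Y(A+A\nabla\chi^\theta)$ if $0<\theta<\infty$; $A^{\mathrm{hom}}=\mathcal{M}_Y(A+A\nabla\chi^0)$ if $\theta=0$;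 $A^{\mathrm{hom}}=\mathcal{M}_Y(A)$ if $\theta=\infty$. *)

theory Defs
  imports "HOL-Analysis.Analysis"
begin

section \<open>Test functions\<close>

definition pd :: "'d \<Rightarrow> (real^'d \<Rightarrow> real) \<Rightarrow> real^'d \<Rightarrow> real" where
  "pd i \<phi> x = frechet_derivative \<phi> (at x) (axis i 1)"

primrec Ck :: "nat \<Rightarrow> (real^'d \<Rightarrow> real) \<Rightarrow> bool" where
  "Ck 0 \<phi> \<longleftrightarrow> continuous_on UNIV \<phi>"
| "Ck (Suc k) \<phi> \<longleftrightarrow> (\<forall>x. \<phi> differentiable (at x)) \<and> (\<forall>i. Ck k (pd i \<phi>))"

definition test_functions :: "(real^'d) set \<Rightarrow> (real^'d \<Rightarrow> real) set" where
  "test_functions \<Omega> = {\<phi>. (\<forall>k. Ck k \<phi>) \<and>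
     compact (closure {x. \<phi> x \<noteq> 0}) \<and> closure {x. \<phi> x \<noteq> 0} \<subseteq> \<Omega>}"


section \<open>Distributions\<close>

text \<open>A distribution on \<open>\<Omega>\<close> is represented by its action on functions; only the values on
  \<open>test_functions \<Omega>\<close> are relevant, and \<open>distr_eq\<close> compares just these. Every distribution used
  below arises from locally integrable functions by differentiation, so linearity and continuity
  need not be imposed.\<close>

type_synonym 'd distr = "(real^'d \<Rightarrow> real) \<Rightarrow> real"

definition distr_of :: "(real^'d) set \<Rightarrow> (real^'d \<Rightarrow> real) \<Rightarrow> 'd distr" where
  "distr_of \<Omega> u = (\<lambda>\<phi>. \<integral>x. u x * \<phi> x \<partial>lebesgue_on \<Omega>)"

definition distr_pd :: "'d::finite \<Rightarrow> 'd distr \<Rightarrow> 'd distr" where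
  "distr_pd i T = (\<lambda>\<phi>. - T (pd i \<phi>))"

definition distr_laplace :: "'d::finite distr \<Rightarrow> 'd distr" where
  "distr_laplace T = (\<lambda>\<phi>. \<Sum>i\<in>UNIV. distr_pd i (distr_pd i T) \<phi>)"

definition distr_div :: "(real^'d) set \<Rightarrow> (real^'d \<Rightarrow> real^'d) \<Rightarrow> 'd distr" where
  "distr_div \<Omega> F = (\<lambda>\<phi>. \<Sum>i\<in>UNIV. distr_pd i (distr_of \<Omega> (\<lambda>x. F x $ i)) \<phi>)"

definition distr_eq :: "(real^'d) set \<Rightarrow> 'd distr \<Rightarrow> 'd distr \<Rightarrow> bool" where
  "distr_eq \<Omega> S T \<longleftrightarrow> (\<forall>\<phi>\<in>test_functions \<Omega>. S \<phi> = T \<phi>)"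


section \<open>Sobolev spaces\<close>

text \<open>Elements are functions rather than classes modulo null sets; accordingly the norms below are
  seminorms.\<close>

definition L2 :: "(real^'d) set \<Rightarrow> (real^'d \<Rightarrow> 'b::euclidean_space) set" where
  "L2 \<Omega> = {u \<in> borel_measurable (lebesgue_on \<Omega>). integrable (lebesgue_on \<Omega>) (\<lambda>x. (norm (u x))\<^sup>2)}"

definition L2_norm :: "(real^'d) set \<Rightarrow> (real^'d \<Rightarrow> 'b::euclidean_space) \<Rightarrow> real" where
  "L2_norm \<Omega> u = sqrt (\<integral>x. (norm (u x))\<^sup>2 \<partial>lebesgue_on \<Omega>)"

definition has_weak_pd :: "(real^'d) set \<Rightarrow> 'd \<Rightarrow> (real^'d \<Rightarrow> real) \<Rightarrow> (real^'d \<Rightarrow> real) \<Rightarrow> bool" where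
  "has_weak_pd \<Omega> i u v \<longleftrightarrow> distr_eq \<Omega> (distr_pd i (distr_of \<Omega> u)) (distr_of \<Omega> v)"

text \<open>\<open>sobolev B \<Omega> k\<close>: all distributional derivatives on \<open>\<Omega>\<close> up to order \<open>k\<close> belong to the space
  \<open>B\<close> of locally integrable functions. \<open>B\<close> is either \<open>L2 \<Omega>\<close> or, with \<open>\<Omega> = UNIV\<close>, the space
  \<open>L2_per\<close> below.\<close>

primrec sobolev ::
  "(real^'d \<Rightarrow> real) set \<Rightarrow> (real^'d) set \<Rightarrow> nat \<Rightarrow> (real^'d \<Rightarrow> real) set" where
  "sobolev B \<Omega> 0 = B"
| "sobolev B \<Omega> (Suc k) = {u \<in> B. \<forall>i. \<exists>v\<in>sobolev B \<Omega> k. has_weak_pd \<Omega> i u v}"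

text \<open>Weak derivatives in \<open>B\<close> are unique up to null sets, so the choice is immaterial.\<close>

definition weak_pd ::
  "(real^'d \<Rightarrow> real) set \<Rightarrow> (real^'d) set \<Rightarrow> 'd \<Rightarrow> (real^'d \<Rightarrow> real) \<Rightarrow> real^'d \<Rightarrow> real" where
  "weak_pd B \<Omega> i u = (SOME v. v \<in> B \<and> has_weak_pd \<Omega> i u v)"

definition weak_grad ::
  "(real^'d \<Rightarrow> real) set \<Rightarrow> (real^'d) set \<Rightarrow> (real^'d \<Rightarrow> real) \<Rightarrow> real^'d \<Rightarrow> real^'d" where
  "weak_grad B \<Omega> u x = (\<chi> i. weak_pd B \<Omega> i u x)"

abbreviation H :: "nat \<Rightarrow> (real^'d) set \<Rightarrow> (real^'d \<Rightarrow> real) set" where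
  "H k \<Omega> \<equiv> sobolev (L2 \<Omega>) \<Omega> k"

abbreviation grad :: "(real^'d) set \<Rightarrow> (real^'d \<Rightarrow> real) \<Rightarrow> real^'d \<Rightarrow> real^'d" where
  "grad \<Omega> \<equiv> weak_grad (L2 \<Omega>) \<Omega>"

definition laplacian :: "(real^'d) set \<Rightarrow> (real^'d \<Rightarrow> real) \<Rightarrow> real^'d \<Rightarrow> real" where
  "laplacian \<Omega> u x = (\<Sum>i\<in>UNIV. weak_pd (L2 \<Omega>) \<Omega> i (weak_pd (L2 \<Omega>) \<Omega> i u) x)"

definition H1_norm :: "(real^'d) set \<Rightarrow> (real^'d \<Rightarrow> real) \<Rightarrow> real" where
  "H1_norm \<Omega> u = sqrt ((L2_norm \<Omega> u)\<^sup>2 + (L2_norm \<Omega> (grad \<Omega> u))\<^sup>2)"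


section \<open>Weak convergence\<close>

definition bounded_functional ::
  "('a \<Rightarrow> 'b::real_vector) set \<Rightarrow> (('a \<Rightarrow> 'b) \<Rightarrow> real) \<Rightarrow> (('a \<Rightarrow> 'b) \<Rightarrow> real) \<Rightarrow> bool" where
  "bounded_functional V N l \<longleftrightarrow>
     (\<forall>f\<in>V. \<forall>g\<in>V. l (\<lambda>x. f x + g x) = l f + l g) \<and>
     (\<forall>c. \<forall>f\<in>V. l (\<lambda>x. c *\<^sub>R f x) = c * l f) \<and>
     (\<exists>C. \<forall>f\<in>V. \<bar>l f\<bar> \<le> C * N f)"

definition weakly_tendsto ::
  "('a \<Rightarrow> 'b::real_vector) set \<Rightarrow> (('a \<Rightarrow> 'b) \<Rightarrow> real) \<Rightarrow>
   ('i \<Rightarrow> 'a \<Rightarrow> 'b) \<Rightarrow> ('a \<Rightarrow> 'b) \<Rightarrow> 'i filter \<Rightarrow> bool" where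
  "weakly_tendsto V N u u\<^sub>0 F \<longleftrightarrow>
     (\<forall>\<^sub>F i in F. u i \<in> V) \<and> u\<^sub>0 \<in> V \<and>
     (\<forall>l. bounded_functional V N l \<longrightarrow> ((\<lambda>i. l (u i)) \<longlongrightarrow> l u\<^sub>0) F)"


section \<open>Periodic coefficients and periodic Sobolev spaces\<close>

definition cell :: "(real^'d) set" where
  "cell = {y. \<forall>i. 0 \<le> y $ i \<and> y $ i < 2 * pi}"

definition periodic :: "(real^'d \<Rightarrow> 'b) \<Rightarrow> bool" where
  "periodic u \<longleftrightarrow>
     (\<forall>p::real^'d. (\<forall>i. p $ i \<in> \<int>) \<longrightarrow> (AE y in lebesgue. u (y + (2 * pi) *\<^sub>R p) = u y))"

definition mean :: "(real^'d \<Rightarrow> real) \<Rightarrow> real" where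
  "mean u = (1 / measure lebesgue (cell :: (real^'d) set)) * (\<integral>y. u y \<partial>lebesgue_on cell)"

definition L2_per :: "(real^'d \<Rightarrow> real) set" where
  "L2_per = {u \<in> borel_measurable lebesgue. periodic u \<and> u \<in> L2 cell}"

text \<open>Distributions on the torus are the periodic distributions on \<open>\<real>\<^sup>d\<close>; hence the Sobolev space
  of the torus consists of the functions whose distributional derivatives on the whole space, up to
  the given order, are periodic and square integrable over the cell.\<close>

abbreviation H_per :: "nat \<Rightarrow> (real^'d \<Rightarrow> real) set" where
  "H_per k \<equiv> sobolev L2_per UNIV k"

abbreviation grad_per :: "(real^'d \<Rightarrow> real) \<Rightarrow> real^'d \<Rightarrow> real^'d" where
  "grad_per \<equiv> weak_grad L2_per UNIV"

definition periodic_elliptic :: "(real^'d \<Rightarrow> real^'d^'d) \<Rightarrow> bool" where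
  "periodic_elliptic A \<longleftrightarrow>
     (\<forall>j k. (\<lambda>y. A y $ j $ k) \<in> borel_measurable lebesgue) \<and>
     (\<exists>M. AE y in lebesgue. \<forall>j k. \<bar>A y $ j $ k\<bar> \<le> M) \<and>
     (AE y in lebesgue. transpose (A y) = A y) \<and>
     periodic A \<and>
     (\<exists>\<alpha>>0. AE y in lebesgue. \<forall>\<xi>. (A y *v \<xi>) \<bullet> \<xi> \<ge> \<alpha> * (norm \<xi>)\<^sup>2)"


section \<open>Correctors and the homogenized matrix\<close>

definition is_corrector ::
  "(real^'d \<Rightarrow> real^'d^'d) \<Rightarrow> real \<Rightarrow> 'd \<Rightarrow> (real^'d \<Rightarrow> real) \<Rightarrow> bool" where
  "is_corrector A \<rho> j w \<longleftrightarrow>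
     w \<in> H_per (if \<rho> > 0 then 2 else 1) \<and> mean w = 0 \<and>
     distr_eq UNIV
       (\<lambda>\<phi>. \<rho>\<^sup>2 * distr_laplace (distr_laplace (distr_of UNIV w)) \<phi>
            - distr_div UNIV (\<lambda>y. A y *v (axis j 1 + grad_per w y)) \<phi>)
       (\<lambda>\<phi>. 0)"

text \<open>For \<open>\<rho> \<ge> 0\<close> the corrector exists and is unique up to null sets.\<close>

definition corrector :: "(real^'d \<Rightarrow> real^'d^'d) \<Rightarrow> real \<Rightarrow> 'd \<Rightarrow> real^'d \<Rightarrow> real" where
  "corrector A \<rho> j = (SOME w. is_corrector A \<rho> j w)"

definition corrected_mean :: "(real^'d \<Rightarrow> real^'d^'d) \<Rightarrow> real \<Rightarrow> real^'d^'d" where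
  "corrected_mean A \<rho> = (\<chi> k l. mean (\<lambda>y.
     axis k 1 \<bullet> (A y *v axis l 1) + axis k 1 \<bullet> (A y *v grad_per (corrector A \<rho> l) y)))"

definition A_hom :: "(real^'d \<Rightarrow> real^'d^'d) \<Rightarrow> ennreal \<Rightarrow> real^'d^'d" where
  "A_hom A \<theta> =
     (if \<theta> = \<infinity> then (\<chi> k l. mean (\<lambda>y. A y $ k $ l))
      else if \<theta> = 0 then corrected_mean A 0
      else corrected_mean A (enn2real \<theta>))"

end

theory Submission imports Defs begin

text \<open>
  The proof is by oscillating test functions. Fix a direction \<open>j\<close> and a test function \<open>t\<close>. Put
  \<open>w = \<psi>(x/\<epsilon>)\<close> for a smooth periodic \<open>\<psi>\<close> and multiply the equation by \<open>\<epsilon> w t\<close>. Since \<open>A\<close> is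
  symmetric, the terms without a power of \<open>\<epsilon>\<close> or \<open>\<kappa>\<close> in front combine to

  \<open>\<integral> (A(x/\<epsilon>) \<nabla>u)\<^sub>j t = \<integral> q(x/\<epsilon>) \<bullet> \<nabla>u t + (\<kappa>\<^sup>2/\<epsilon>) \<integral> \<Delta>u (\<Delta>\<psi>)(x/\<epsilon>) t + o(1)\<close>,  where
  \<open>q = A (e\<^sub>j + \<nabla>\<psi>)\<close>.

  If \<open>q\<close> were smooth with \<open>div q = \<Delta>h\<close>, two integrations by parts would give
  \<open>\<integral> q(x/\<epsilon>) \<bullet> \<nabla>u t = - \<Sum>\<^sub>i \<integral> u q\<^sub>i(x/\<epsilon>) \<partial>\<^sub>i t - \<epsilon> \<integral> \<Delta>u h(x/\<epsilon>) t + o(1)\<close>. In the first term the oscillating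
  factor may be replaced by its mean, and what is left of the other two is
  \<open>\<integral> \<kappa> \<Delta>u ((\<kappa>/\<epsilon>) \<Delta>\<psi> - (\<epsilon>/\<kappa>) h)(x/\<epsilon>) t\<close>. As \<open>\<kappa> \<Delta>u\<close> is bounded in \<open>L\<^sup>2\<close>, this vanishes in the
  limit as soon as the bracket tends to \<open>0\<close> uniformly. For \<open>\<kappa>/\<epsilon> \<rightarrow> \<rho> < \<infinity>\<close> this forces
  \<open>h = \<rho>\<^sup>2 \<Delta>\<psi>\<close>, and \<open>div q = \<Delta>h\<close> is then exactly the corrector equation with parameter \<open>\<rho>\<close>. For
  \<open>\<kappa>/\<epsilon> \<rightarrow> \<infinity>\<close> it forces \<open>\<psi> = 0\<close>, there is no corrector, and \<open>h\<close> is any solution of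
  \<open>\<Delta>h = div (A e\<^sub>j)\<close>. In both cases the limit is \<open>\<Sum>\<^sub>i mean(q\<^sub>i) \<partial>\<^sub>i u\<^sup>*\<close>, and
  \<open>mean(q\<^sub>i)\<close> is the entry \<open>(i, j)\<close> of the homogenized matrix. That matrix is symmetric
  (\<open>A_hom_symmetric\<close>), so this is the \<open>j\<close>-th component of the claimed limit.

  Correctors and their fluxes are not smooth. They are replaced by mollifications, for which
  \<open>div g = \<Delta>h\<close> still holds exactly while \<open>g\<close> differs from \<open>A (e\<^sub>j + \<nabla>\<psi>)\<close> by an error that is
  small in \<open>L\<^sup>2\<close> of the cell (\<open>approx_flux\<close>). A periodic function rescaled by \<open>1/\<epsilon>\<close> has, on a ball,
  an \<open>L\<^sup>2\<close> norm bounded by that over the cell, uniformly in \<open>\<epsilon>\<close> (\<open>periodic_scaled_bound\<close>), so the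
  error stays small. The
  replacement of \<open>g\<^sub>i(x/\<epsilon>)\<close> by its mean uses that \<open>g\<^sub>i - mean(g\<^sub>i)\<close> is nearly a divergence of
  smooth periodic functions (\<open>antidivergence\<close>), which brings out a factor \<open>\<epsilon>\<close>
  (\<open>oscillation_mean\<close>). Hence weak convergence of \<open>u\<close> suffices at every step, without a compact
  embedding of the Sobolev space.

  Existence of correctors, and of the potentials \<open>h\<close>, is Lax-Milgram on smooth periodic functions of
  mean zero, with the Poincare inequality on the cell (\<open>periodic_existence\<close>). The bounds on \<open>u\<close>
  and its gradient come from the uniform boundedness principle (\<open>weakly_convergent_bounded\<close>), and the
  passage from test functions to all functionals from the density of test functions in \<open>L\<^sup>2\<close>
  and the Riesz theorem (\<open>weakly_tendsto_L2_vecI\<close>).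
\<close>

section \<open>Semi-inner products on spaces of functions\<close>

lemma discriminant_bound:
  fixes a b c :: real
  assumes "!!t. a * t^2 + 2 * b * t + c >= 0" and "a >= 0"
  shows "b^2 <= a * c"
proof (cases "a = 0")
  case True
  have "b = 0"
  proof (rule ccontr)
    assume b: "b ~= 0"
    have "2 * b * (-(c+1)/(2*b)) + c >= 0" using assms(1)[of "-(c+1)/(2*b)"] True by simp
    thus False using b by (simp add: field_simps)
  qed
  thus ?thesis using True by simp
next
  case False
  hence a: "a > 0" using assms by simp
  have "a * (-b/a)^2 + 2 * b * (-b/a) + c >= 0" by (rule assms(1))
  hence "c - b^2/a >= 0" using a by (simp add: power2_eq_square field_simps)
  thus ?thesis using a by (simp add: field_simps)
qed

text \<open>The energy of a periodic problem and the inner products of \<open>L\<^sup>2\<close> and \<open>H\<^sup>1(\<Omega>)\<close> are only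
  semidefinite on functions, and smooth periodic functions are not complete in energy. The facts of
  Hilbert space theory are therefore proved for a semidefinite form on a subspace.\<close>
locale semi_inner =
  fixes V :: "('a => real) set" and B :: "('a => real) => ('a => real) => real"
  assumes V_zero: "(%x. 0) \<in> V"
    and V_lin: "!!f g c. f \<in> V ==> g \<in> V ==> (%x. f x + c * g x) \<in> V"
    and B_sym: "!!f g. f \<in> V ==> g \<in> V ==> B f g = B g f"
    and B_lin: "!!f g h c. f \<in> V ==> g \<in> V ==> h \<in> V ==> B (%x. f x + c * g x) h = B f h + c * B g h"
    and B_pos: "!!f. f \<in> V ==> B f f >= 0"
begin

definition N :: "('a => real) => real" where "N f = sqrt (B f f)"

lemma N_sq: "f \<in> V ==> N f ^ 2 = B f f" by (simp add: N_def B_pos)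
lemma N_nonneg: "f \<in> V ==> N f >= 0" by (simp add: N_def B_pos)

lemma B_lin_right: "f \<in> V ==> g \<in> V ==> h \<in> V ==> B h (%x. f x + c * g x) = B h f + c * B h g"
  by (simp add: B_sym[of h] B_lin V_lin)

lemma B_expand:
  assumes "f \<in> V" "g \<in> V"
  shows "B (%x. f x + t * g x) (%x. f x + t * g x) = B g g * t^2 + 2 * B f g * t + B f f"
proof -
  have "B (%x. f x + t * g x) (%x. f x + t * g x) = B f (%x. f x + t * g x) + t * B g (%x. f x + t * g x)"
    using B_lin[OF assms V_lin[OF assms]] .
  also have "\<dots> = B f f + t * B f g + t * (B g f + t * B g g)"
    using assms by (simp add: B_lin_right)
  finally show ?thesis using B_sym[OF assms] by (simp add: power2_eq_square algebra_simps)
qed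

lemma Cauchy_Schwarz:
  assumes "f \<in> V" "g \<in> V"
  shows "\<bar>B f g\<bar> <= N f * N g"
proof -
  have "(B f g)^2 <= B g g * B f f"
  proof (rule discriminant_bound)
    show "B g g * t^2 + 2 * B f g * t + B f f >= 0" for t
      using B_pos[OF V_lin[OF assms, of t]] unfolding B_expand[OF assms] .
  qed (rule B_pos[OF assms(2)])
  hence "sqrt ((B f g)^2) <= sqrt (B g g * B f f)" by (rule real_sqrt_le_mono)
  thus ?thesis by (simp add: N_def real_sqrt_mult mult.commute)
qed

lemma N_triangle:
  assumes "f \<in> V" "g \<in> V"
  shows "N (%x. f x + g x) <= N f + N g"
proof -
  have "B (%x. f x + 1 * g x) (%x. f x + 1 * g x) = B g g + 2 * B f g + B f f"
    using B_expand[OF assms, of 1] by simp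
  also have "\<dots> <= N g^2 + 2 * (N f * N g) + N f ^2"
    using Cauchy_Schwarz[OF assms] by (simp add: N_sq assms)
  also have "\<dots> = (N f + N g)^2" by (simp add: power2_eq_square algebra_simps)
  finally have "sqrt (B (%x. f x + g x) (%x. f x + g x)) <= sqrt ((N f + N g)^2)"
    by (intro real_sqrt_le_mono) simp
  thus ?thesis using N_nonneg assms by (simp add: N_def)
qed

lemma N_scale:
  assumes "f \<in> V" shows "N (%x. c * f x) = \<bar>c\<bar> * N f"
proof -
  have "B (%x. 0 + c * f x) (%x. 0 + c * f x) = B f f * c^2 + 2 * B (%x. 0) f * c + B (%x. 0) (%x. 0)"
    by (rule B_expand[OF V_zero assms])
  moreover have "B (%x. 0) h = 0" if "h \<in> V" for h
    using B_lin[OF V_zero V_zero that, of "1"] by simp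
  ultimately have "B (%x. c * f x) (%x. c * f x) = B f f * c^2" using assms V_zero by simp
  thus ?thesis by (simp add: N_def real_sqrt_mult mult.commute)
qed

text \<open>Without completeness a bounded functional need not be represented by an element of \<open>V\<close>, but it is the
  limit of the functionals represented by a Cauchy sequence: any minimizing sequence of the quadratic
  functional \<open>B v v - 2 l v\<close> is Cauchy by the parallelogram law. Completeness enters later, when the
  limit is taken in \<open>L\<^sup>2\<close>.\<close>
lemma riesz_sequence:
  assumes l_lin: "!!f g c. f \<in> V ==> g \<in> V ==> l (%x. f x + c * g x) = l f + c * l g"
    and l_bd: "!!f. f \<in> V ==> \<bar>l f\<bar> <= C * N f"
  obtains s :: "nat => 'a => real" where "!!n. s n \<in> V"
    and "!!v. v \<in> V ==> (%n. B (s n) v) \<longlonglongrightarrow> l v"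
    and "!!e. e > 0 ==> \<exists>K. \<forall>m\<ge>K. \<forall>n\<ge>K. B (%x. s m x - s n x) (%x. s m x - s n x) < e"
proof -
  define J where "J v = B v v - 2 * l v" for v
  define m where "m = (INF v\<in>V. J v)"
  have low: "J v >= -(C^2)" if "v \<in> V" for v
  proof -
    have "J v >= N v ^2 - 2 * (C * N v)" using l_bd[OF that] N_sq[OF that] by (simp add: J_def)
    also have "N v ^2 - 2 * (C * N v) = (N v - C)^2 - C^2" by (simp add: power2_eq_square algebra_simps)
    finally show ?thesis by (smt (verit) zero_le_power2)
  qed
  have bdd: "bdd_below (J ` V)" using low by (auto simp: bdd_below_def)
  have mle: "m <= J v" if "v \<in> V" for v unfolding m_def using bdd that by (rule cINF_lower)
  have "\<exists>v\<in>V. J v < m + 1 / real (Suc n)" for n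
  proof -
    have "m < m + 1 / real (Suc n)" by simp
    thus ?thesis unfolding m_def using V_zero bdd by (subst (asm) cINF_less_iff) auto
  qed
  then obtain s where sV: "!!n. s n \<in> V" and sJ: "!!n. J (s n) < m + 1 / real (Suc n)" by metis
  have l_scale: "l (%x. c * f x) = c * l f" if "f \<in> V" for f c
  proof -
    have "l (%x. 0) = 0" using l_lin[OF V_zero V_zero, of 1] by simp
    thus ?thesis using l_lin[OF V_zero that, of c] by simp
  qed
  have cauchy: "B (%x. s i x - s j x) (%x. s i x - s j x) < 2 * (1 / real (Suc i) + 1 / real (Suc j))" for i j
  proof -
    define w where "w = (%x. (1/2) * (s i x + 1 * s j x))"
    have sij: "(%x. s i x + 1 * s j x) \<in> V" by (rule V_lin[OF sV sV])
    have wV: "w \<in> V" unfolding w_def using V_lin[OF V_zero sij, of "1/2"] by simp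
    have e1: "B (%x. s i x - s j x) (%x. s i x - s j x) = B (s j) (s j) - 2 * B (s i) (s j) + B (s i) (s i)"
      using B_expand[OF sV sV, of i "-1" j] by simp
    have "N w ^ 2 = (\<bar>1/2\<bar> * N (%x. s i x + 1 * s j x))^2" unfolding w_def by (subst N_scale[OF sij]) (rule refl)
    also have "\<dots> = 1/4 * (B (s j) (s j) + 2 * B (s i) (s j) + B (s i) (s i))"
      using B_expand[OF sV sV, of i 1 j] N_sq[OF sij] by (simp add: power_mult_distrib power2_eq_square)
    finally have e2: "B w w = 1/4 * (B (s j) (s j) + 2 * B (s i) (s j) + B (s i) (s i))"
      using N_sq[OF wV] by simp
    have e3: "l w = (1/2) * (l (s i) + l (s j))"
      unfolding w_def using l_scale[OF sij, of "1/2"] l_lin[OF sV sV, of i 1 j] by simp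
    have "m <= J w" by (rule mle[OF wV])
    thus ?thesis using e1 e2 e3 sJ[of i] sJ[of j] unfolding J_def by argo
  qed
  have lim: "(%n. B (s n) v) \<longlonglongrightarrow> l v" if v: "v \<in> V" for v
  proof -
    have "(B (s n) v - l v)^2 <= B v v * (1 / real (Suc n))" for n
    proof (rule discriminant_bound)
      show "B v v * t^2 + 2 * (B (s n) v - l v) * t + 1 / real (Suc n) >= 0" for t
      proof -
        have "m <= J (%x. s n x + t * v x)" by (rule mle[OF V_lin[OF sV v]])
        also have "\<dots> = J (s n) + B v v * t^2 + 2 * (B (s n) v - l v) * t"
          unfolding J_def by (simp add: B_expand[OF sV v] l_lin[OF sV v] algebra_simps)
        finally show ?thesis using sJ[of n] by simp
      qed
    qed (rule B_pos[OF v])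
    hence b: "\<bar>B (s n) v - l v\<bar> <= sqrt (B v v * (1 / real (Suc n)))" for n
      by (metis real_sqrt_abs real_sqrt_le_mono)
    have "(%n. sqrt (B v v * (1 / real (Suc n)))) \<longlonglongrightarrow> sqrt (B v v * 0)"
      by (intro tendsto_intros LIMSEQ_Suc[OF lim_1_over_n])
    hence z: "(%n. sqrt (B v v * (1 / real (Suc n)))) \<longlonglongrightarrow> 0" by simp
    have "(%n. B (s n) v - l v) \<longlonglongrightarrow> 0"
      by (rule Lim_null_comparison[OF _ z]) (use b in \<open>simp add: always_eventually\<close>)
    thus ?thesis by (simp add: LIM_zero_iff)
  qed
  have "\<exists>K. \<forall>i\<ge>K. \<forall>j\<ge>K. B (%x. s i x - s j x) (%x. s i x - s j x) < e" if e: "e > 0" for e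
  proof -
    obtain K where K: "1 / real (Suc K) < e/4" using e nat_approx_posE[of "e/4"] by auto
    have "B (%x. s i x - s j x) (%x. s i x - s j x) < e" if "i >= K" "j >= K" for i j
    proof -
      have "1 / real (Suc i) <= 1 / real (Suc K)" "1 / real (Suc j) <= 1 / real (Suc K)"
        using that by (simp_all add: frac_le)
      thus ?thesis using cauchy[of i j] K by argo
    qed
    thus ?thesis by blast
  qed
  with that[OF sV lim] show thesis by blast
qed

text \<open>A gliding hump argument. The functional
  \<open>l f = \<Sum>\<^sub>k s\<^sub>k 3\<^sup>-\<^sup>k B f (x k) / N (x k)\<close> is bounded for all signs \<open>s\<^sub>k\<close>. Choosing \<open>s\<^sub>k\<close> as the sign of
  the preceding partial sum at \<open>x k\<close>, the \<open>k\<close>-th term adds to that partial sum in modulus, and the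
  tail is only half as large as this term; so \<open>l (x k)\<close> is of order \<open>(4/3)\<^sup>k\<close>.\<close>
lemma uniform_boundedness:
  fixes x :: "nat => 'a => real"
  assumes xV: "!!n. x n \<in> V"
    and bd: "!!l. bounded_functional V N l ==> Bseq (%n. l (x n))"
  shows "\<not> (\<forall>k. N (x k) >= 4^k)"
proof
  assume big: "\<forall>k. N (x k) >= 4^k"
  define tt where "tt k f = (1/3)^k * (B f (x k) / N (x k))" for k f
  \<comment> \<open>\<open>L k\<close> is the \<open>k\<close>-th partial sum; it is defined recursively because the sign of a term depends on the sum before it.\<close>
  define L where "L = rec_nat (%f. 0::real) (%k Lk f. Lk f + (if Lk (x k) >= 0 then 1 else -1) * tt k f)"
  define s where "s k = (if L k (x k) >= 0 then 1 else -1 :: real)" for k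
  have L0: "L 0 f = 0" for f by (simp add: L_def)
  have LS: "L (Suc k) f = L k f + s k * tt k f" for k f by (simp add: L_def s_def)
  have L: "L k f = (\<Sum>i<k. s i * tt i f)" for k f by (induction k) (simp_all add: L0 LS)
  have s1: "\<bar>s k\<bar> = 1" for k by (simp add: s_def)
  have Npos: "N (x k) > 0" for k
  proof -
    have "(0::real) < 4^k" by simp
    thus ?thesis using big by (meson less_le_trans)
  qed
  have tb: "\<bar>s k * tt k f\<bar> <= (1/3)^k * N f" if "f \<in> V" for k f
  proof -
    have "\<bar>B f (x k) / N (x k)\<bar> <= N f" using Cauchy_Schwarz[OF that xV, of k] Npos[of k] by (simp add: field_simps)
    hence "(1/3)^k * \<bar>B f (x k) / N (x k)\<bar> <= (1/3)^k * N f" by (intro mult_left_mono) auto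
    thus ?thesis by (simp add: tt_def abs_mult s1)
  qed
  have gs: "summable (%k. (1/3::real)^k * c)" for c by (intro summable_mult2 summable_geometric) simp
  have sm: "summable (%k. s k * tt k f)" if "f \<in> V" for f
    by (rule summable_comparison_test'[OF gs[of "N f"]]) (use tb[OF that] in auto)
  define l where "l f = (\<Sum>k. s k * tt k f)" for f
  have ttlin: "tt k (%x. f x + c * g x) = tt k f + c * tt k g" if "f \<in> V" "g \<in> V" for k f g c
    using B_lin[OF that xV, of c k] Npos[of k] by (simp add: tt_def add_divide_distrib ring_distribs)
  have llin: "l (%x. f x + c * g x) = l f + c * l g" if "f \<in> V" "g \<in> V" for f g c
  proof -
    have "l (%x. f x + c * g x) = (\<Sum>k. s k * tt k f + c * (s k * tt k g))"
      unfolding l_def by (simp add: ttlin[OF that] algebra_simps)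
    also have "\<dots> = l f + c * l g"
      unfolding l_def suminf_mult[OF sm[OF that(2)], symmetric]
      by (rule suminf_add[symmetric]) (intro sm summable_mult that)+
    finally show ?thesis .
  qed
  have lb: "\<bar>l f\<bar> <= (3/2) * N f" if "f \<in> V" for f
  proof -
    have "\<bar>l f\<bar> <= (\<Sum>k. (1/3)^k * N f)"
    proof -
      have su: "summable (%k. \<bar>s k * tt k f\<bar>)"
        by (rule summable_comparison_test'[OF gs[of "N f"]]) (use tb[OF that] in auto)
      show ?thesis unfolding l_def
        by (rule order_trans[OF summable_rabs[OF su]]) (rule suminf_le[OF tb[OF that] su gs])
    qed
    also have "\<dots> = (3/2) * N f" by (subst suminf_mult2[symmetric]) (auto simp: suminf_geometric)
    finally show ?thesis .
  qed
  have "bounded_functional V N l"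
    unfolding bounded_functional_def
  proof (intro conjI ballI allI)
    show "l (%x. f x + g x) = l f + l g" if "f \<in> V" "g \<in> V" for f g using llin[OF that, of 1] by simp
    show "l (%x. c *\<^sub>R f x) = c * l f" if "f \<in> V" for c f
      using llin[OF V_zero that, of c] llin[OF V_zero V_zero, of 1] by simp
    show "\<exists>C. \<forall>f\<in>V. \<bar>l f\<bar> <= C * N f" using lb by blast
  qed
  from bd[OF this] obtain M where M: "!!n. \<bar>l (x n)\<bar> <= M" by (auto simp: Bseq_def)
  have low: "\<bar>l (x K)\<bar> >= (1/2) * (4/3)^K" for K
  proof -
    let ?t = "%k. s k * tt k (x K)"
    have tK: "tt K (x K) = (1/3)^K * N (x K)"
      using N_sq[OF xV, of K] Npos[of K] by (simp add: tt_def power2_eq_square field_simps)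
    have a1: "\<bar>L (Suc K) (x K)\<bar> >= (1/3)^K * N (x K)"
    proof -
      have "tt K (x K) >= 0" using Npos[of K] by (simp add: tK less_imp_le)
      thus ?thesis unfolding LS tK[symmetric] s_def by auto
    qed
    have "l (x K) = (\<Sum>k. ?t (k + Suc K)) + L (Suc K) (x K)"
      unfolding l_def L by (rule suminf_split_initial_segment[OF sm[OF xV]])
    moreover have "\<bar>\<Sum>k. ?t (k + Suc K)\<bar> <= (1/2) * (1/3)^K * N (x K)"
    proof -
      have b: "\<bar>?t (k + Suc K)\<bar> <= (1/3)^k * ((1/3)^Suc K * N (x K))" for k
        using tb[OF xV, of "k + Suc K" K] by (simp add: power_add mult_ac)
      have su: "summable (%k. \<bar>?t (k + Suc K)\<bar>)"
        by (rule summable_comparison_test'[OF gs[of "(1/3)^Suc K * N (x K)"]]) (use b in simp)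
      have "\<bar>\<Sum>k. ?t (k + Suc K)\<bar> <= (\<Sum>k. \<bar>?t (k + Suc K)\<bar>)"
        by (rule summable_rabs[OF su])
      also have "\<dots> <= (\<Sum>k. (1/3)^k * ((1/3)^Suc K * N (x K)))"
        by (rule suminf_le[OF b su gs])
      also have "\<dots> = (1/2) * (1/3)^K * N (x K)"
        by (subst suminf_mult2[symmetric]) (auto simp: suminf_geometric)
      finally show ?thesis .
    qed
    ultimately have "\<bar>l (x K)\<bar> >= (1/2) * (1/3)^K * N (x K)" using a1 by linarith
    moreover have "(1/3::real)^K * N (x K) >= (1/3)^K * 4^K" using big by (intro mult_left_mono) auto
    ultimately show ?thesis by (simp add: power_divide field_simps)
  qed
  obtain K where "2 * M < (4/3::real)^K" using real_arch_pow[of "4/3" "2 * M"] by auto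
  thus False using low[of K] M[of K] by linarith
qed

end

section \<open>Square integrable functions\<close>

definition sqint :: "'a measure => ('a => real) => bool" where
  "sqint M u \<longleftrightarrow> u \<in> borel_measurable M & integrable M (%x. (u x)\<^sup>2)"

definition L2_ip :: "'a measure => ('a => real) => ('a => real) => real" where
  "L2_ip M u v = (LINT x|M. u x * v x)"

definition nrm :: "'a measure => ('a => real) => real" where
  "nrm M u = sqrt (LINT x|M. (u x)\<^sup>2)"

lemma sqintD:
  assumes "sqint M u"
  shows "u \<in> borel_measurable M" "integrable M (%x. (u x)\<^sup>2)"
  using assms by (auto simp: sqint_def)

lemma sqint_mult:
  assumes "sqint M u" "sqint M v"
  shows "integrable M (%x. u x * v x)"
proof (rule Bochner_Integration.integrable_bound)
  show "integrable M (%x. (u x)\<^sup>2 + (v x)\<^sup>2)" using assms by (auto simp: sqint_def)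
  show "(%x. u x * v x) \<in> borel_measurable M"
    using assms by (auto simp: sqint_def)
  have ab: "\<bar>a * b\<bar> <= a\<^sup>2 + b\<^sup>2" for a b :: real
  proof -
    have "2 * \<bar>a\<bar> * \<bar>b\<bar> <= a\<^sup>2 + b\<^sup>2" using sum_squares_bound[of "\<bar>a\<bar>" "\<bar>b\<bar>"] by simp
    moreover have "0 <= \<bar>a\<bar> * \<bar>b\<bar>" by simp
    ultimately show ?thesis unfolding abs_mult by linarith
  qed
  have ab': "norm (a * b) <= norm (a\<^sup>2 + b\<^sup>2)" for a b :: real
    using ab[of a b] by simp
  thus "AE x in M. norm (u x * v x) <= norm ((u x)\<^sup>2 + (v x)\<^sup>2)" by (intro always_eventually allI ab')
qed

lemma sqint_lin:
  assumes "sqint M u" "sqint M v"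
  shows "sqint M (%x. u x + c * v x)"
proof -
  have "integrable M (%x. (u x)\<^sup>2 + c\<^sup>2 * (v x)\<^sup>2 + 2 * c * (u x * v x))"
    using assms sqint_mult[OF assms] by (auto simp: sqint_def)
  moreover have "(%x. (u x)\<^sup>2 + c\<^sup>2 * (v x)\<^sup>2 + 2 * c * (u x * v x)) = (%x. (u x + c * v x)\<^sup>2)"
    by (auto simp: power2_eq_square algebra_simps)
  ultimately show ?thesis using assms by (auto simp: sqint_def)
qed

lemma sqint_0: "sqint M (%x. 0)"
  by (simp add: sqint_def)

lemma sqint_add: "sqint M u ==> sqint M v ==> sqint M (%x. u x + v x)"
  using sqint_lin[of M u v 1] by simp

lemma sqint_diff: "sqint M u ==> sqint M v ==> sqint M (%x. u x - v x)"
  using sqint_lin[of M u v "-1"] by simp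

lemma sqint_scale: "sqint M u ==> sqint M (%x. c * u x)"
  using sqint_lin[OF sqint_0, of M u c] by simp

lemma sqint_sum:
  "finite I ==> (!!i. i \<in> I ==> sqint M (u i)) ==> sqint M (%x. \<Sum>i\<in>I. u i x)"
proof (induction I rule: finite_induct)
  case empty show ?case by (simp add: sqint_0)
next
  case (insert i I)
  have "sqint M (%x. u i x + (\<Sum>i\<in>I. u i x))"
    by (rule sqint_add) (use insert in blast)+
  thus ?case using insert by simp
qed

lemma sqint_bound:
  assumes "sqint M u" and [measurable]: "v \<in> borel_measurable M"
    and "AE x in M. \<bar>v x\<bar> <= \<bar>u x\<bar>"
  shows "sqint M v"
  unfolding sqint_def
proof
  show "integrable M (%x. (v x)\<^sup>2)"
  proof (rule Bochner_Integration.integrable_bound)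
    show "integrable M (%x. (u x)\<^sup>2)" using assms by (simp add: sqint_def)
    show "AE x in M. norm ((v x)\<^sup>2) <= norm ((u x)\<^sup>2)"
      using assms(3) by eventually_elim (simp add: abs_le_square_iff)
  qed simp
qed (rule assms(2))

lemma sqint_bounded_mult:
  assumes "sqint M u" and [measurable]: "w \<in> borel_measurable M"
    and "AE x in M. \<bar>w x\<bar> <= C"
  shows "sqint M (%x. w x * u x)"
proof (rule sqint_bound)
  show "sqint M (%x. C * u x)" by (intro sqint_scale assms)
  have [measurable]: "u \<in> borel_measurable M" using assms by (simp add: sqint_def)
  show "(%x. w x * u x) \<in> borel_measurable M" by simp
  show "AE x in M. \<bar>w x * u x\<bar> <= \<bar>C * u x\<bar>"
    using assms(3) by eventually_elim (auto simp: abs_mult intro!: mult_right_mono)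
qed

lemma semi_inner_L2: "semi_inner {u. sqint M u} (L2_ip M)"
proof
  fix f g h :: "'a => real" and c
  assume "f \<in> {u. sqint M u}" "g \<in> {u. sqint M u}" "h \<in> {u. sqint M u}"
  thus "L2_ip M (%x. f x + c * g x) h = L2_ip M f h + c * L2_ip M g h"
    unfolding L2_ip_def by (simp add: ring_distribs mult.assoc sqint_mult)
qed (auto simp: L2_ip_def sqint_0 sqint_lin mult.commute)

interpretation L2: semi_inner "{u. sqint M u}" "L2_ip M" for M by (rule semi_inner_L2)

lemma L2_N: "L2.N M u = nrm M u"
  by (simp add: L2.N_def L2_ip_def nrm_def power2_eq_square)

lemma L2_Cauchy_Schwarz:
  "sqint M u ==> sqint M v ==> \<bar>LINT x|M. u x * v x\<bar> <= nrm M u * nrm M v"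
  using L2.Cauchy_Schwarz[of u M v] by (simp add: L2_N L2_ip_def)

lemma nrm_triangle:
  "sqint M u ==> sqint M v ==> nrm M (%x. u x + v x) <= nrm M u + nrm M v"
  using L2.N_triangle[of u M v] by (simp add: L2_N)

lemma nrm_scale: "nrm M (%x. c * u x) = \<bar>c\<bar> * nrm M u"
  by (simp add: nrm_def power_mult_distrib real_sqrt_mult)

lemma nrm_nonneg: "nrm M u >= 0" by (simp add: nrm_def)

lemma nrm_sq: "(nrm M u)\<^sup>2 = (LINT x|M. (u x)\<^sup>2)" by (simp add: nrm_def)

lemma nrm_minus_commute: "nrm M (%x. u x - v x) = nrm M (%x. v x - u x)"
  by (simp add: nrm_def power2_commute)

lemma nrm_cong: "(AE x in M. u x = v x) ==> u \<in> borel_measurable M ==> v \<in> borel_measurable M ==> nrm M u = nrm M v"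
  unfolding nrm_def by (intro arg_cong[where f=sqrt] integral_cong_AE) auto

lemma nrm_mono:
  assumes "sqint M v" "u \<in> borel_measurable M" "AE x in M. \<bar>u x\<bar> <= \<bar>v x\<bar>"
  shows "nrm M u <= nrm M v"
  unfolding nrm_def
proof (intro real_sqrt_le_mono integral_mono_AE)
  have "sqint M u" by (rule sqint_bound[OF assms])
  thus "integrable M (%x. (u x)\<^sup>2)" by (simp add: sqint_def)
  show "integrable M (%x. (v x)\<^sup>2)" using assms by (simp add: sqint_def)
  show "AE x in M. (u x)\<^sup>2 <= (v x)\<^sup>2"
    using assms(3) by eventually_elim (simp add: abs_le_square_iff)
qed

lemma nrm_sum:
  "finite I ==> (!!i. i \<in> I ==> sqint M (u i)) ==> nrm M (%x. \<Sum>i\<in>I. u i x) <= (\<Sum>i\<in>I. nrm M (u i))"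
proof (induction I rule: finite_induct)
  case empty show ?case by (simp add: nrm_def)
next
  case (insert i I)
  have "nrm M (%x. u i x + (\<Sum>i\<in>I. u i x)) <= nrm M (u i) + nrm M (%x. \<Sum>i\<in>I. u i x)"
    by (intro nrm_triangle sqint_sum) (use insert in auto)
  thus ?case using insert by simp
qed

lemma L2_ip_tendsto:
  assumes "sqint M u" "!!n. sqint M (s n)" "sqint M v"
    and "(%n. nrm M (%x. s n x - u x)) \<longlonglongrightarrow> 0"
  shows "(%n. LINT x|M. s n x * v x) \<longlonglongrightarrow> (LINT x|M. u x * v x)"
proof -
  have "(%n. (LINT x|M. s n x * v x) - (LINT x|M. u x * v x)) \<longlonglongrightarrow> 0"
  proof (rule Lim_null_comparison)
    show "\<forall>\<^sub>F n in sequentially. norm ((LINT x|M. s n x * v x) - (LINT x|M. u x * v x)) <= nrm M (%x. s n x - u x) * nrm M v"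
    proof (intro always_eventually allI)
      fix n
      have "(LINT x|M. s n x * v x) - (LINT x|M. u x * v x) = (LINT x|M. (s n x - u x) * v x)"
        using assms by (simp add: left_diff_distrib sqint_mult)
      thus "norm ((LINT x|M. s n x * v x) - (LINT x|M. u x * v x)) <= nrm M (%x. s n x - u x) * nrm M v"
        using L2_Cauchy_Schwarz[OF sqint_diff[OF assms(2,1)] assms(3), of n] by simp
    qed
    show "(%n. nrm M (%x. s n x - u x) * nrm M v) \<longlonglongrightarrow> 0"
      using tendsto_mult_right[OF assms(4), of "nrm M v"] by simp
  qed
  thus ?thesis by (simp add: LIM_zero_iff)
qed

text \<open>A pointwise limit with a default value. For a sequence of exactly periodic functions the
  result is exactly periodic, with no null set to discard.\<close>
definition ae_lim :: "(nat => 'a => real) => 'a => real" where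
  "ae_lim s x = (if convergent (%n. s n x) then lim (%n. s n x) else 0)"

lemma borel_measurable_ae_lim:
  assumes [measurable]: "!!n. s n \<in> borel_measurable M"
  shows "ae_lim s \<in> borel_measurable M"
  unfolding ae_lim_def[abs_def] Cauchy_convergent_iff[symmetric] by measurable

text \<open>The Riesz-Fischer theorem. The limit is stated as the pointwise limit of a subsequence because
  periodicity is inherited through that form.\<close>
lemma L2_complete:
  assumes sq: "!!n. sqint M (s n)"
    and cauchy: "!!e. e > 0 ==> \<exists>K. \<forall>m\<ge>K. \<forall>n\<ge>K. (LINT x|M. (s m x - s n x)\<^sup>2) < e"
  obtains r :: "nat => nat" where "strict_mono r"
    and "sqint M (ae_lim (%n. s (r n)))"
    and "(%n. nrm M (%x. s n x - ae_lim (%n. s (r n)) x)) \<longlonglongrightarrow> 0"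
    and "AE x in M. (%n. s (r n) x) \<longlonglongrightarrow> ae_lim (%n. s (r n)) x"
proof -
  have [measurable]: "s n \<in> borel_measurable M" for n using sq by (simp add: sqint_def)
  have "\<exists>K. \<forall>m\<ge>K. \<forall>n\<ge>K. (LINT x|M. (s m x - s n x)\<^sup>2) < (1/4)^k" for k :: nat
    by (rule cauchy) simp
  then obtain K where K: "!!k m n. m >= K k ==> n >= K k ==> (LINT x|M. (s m x - s n x)\<^sup>2) < (1/4)^k" by metis
  define r where "r n = (\<Sum>k\<le>n. Suc (K k))" for n
  have rS: "r n < r (Suc n)" for n by (simp add: r_def)
  hence sm: "strict_mono r" by (simp add: strict_mono_Suc_iff)
  have rK: "r n >= K n" for n unfolding r_def by (induction n) auto
  define f where "f = ae_lim (%n. s (r n))"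
  have [measurable]: "f \<in> borel_measurable M" unfolding f_def by (rule borel_measurable_ae_lim) simp
  have int: "integrable M (%x. (s m x - s n x)\<^sup>2)" for m n
    using sqint_diff[OF sq sq] by (simp add: sqint_def)
  have nn: "(\<integral>\<^sup>+x. ennreal ((s m x - s n x)\<^sup>2) \<partial>M) = ennreal (LINT x|M. (s m x - s n x)\<^sup>2)" for m n
    by (rule nn_integral_eq_integral[OF int]) simp
  define d where "d n x = s (r (Suc n)) x - s (r n) x" for n x
  have [measurable]: "d n \<in> borel_measurable M" for n unfolding d_def[abs_def] by simp
  have dn: "(\<integral>\<^sup>+x. ennreal (2^n * (d n x)\<^sup>2) \<partial>M) <= ennreal ((1/2)^n)" for n
  proof -
    have "(\<integral>\<^sup>+x. ennreal (2^n * (d n x)\<^sup>2) \<partial>M) = ennreal (2^n) * (\<integral>\<^sup>+x. ennreal ((d n x)\<^sup>2) \<partial>M)"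
      by (subst nn_integral_cmult[symmetric]) (auto simp: ennreal_mult)
    also have "(\<integral>\<^sup>+x. ennreal ((d n x)\<^sup>2) \<partial>M) <= ennreal ((1/4)^n)"
      unfolding d_def nn using K[of n "r (Suc n)" "r n"] rK[of n] rS[of n] by (intro ennreal_leI) simp
    also have "ennreal (2^n) * ennreal ((1/4)^n) = ennreal ((1/2)^n)"
      by (simp add: ennreal_mult[symmetric] power_mult_distrib[symmetric])
    finally show ?thesis by (simp add: mult_left_mono)
  qed
  have "(\<integral>\<^sup>+x. (\<Sum>n. ennreal (2^n * (d n x)\<^sup>2)) \<partial>M) = (\<Sum>n. \<integral>\<^sup>+x. ennreal (2^n * (d n x)\<^sup>2) \<partial>M)"
    by (rule nn_integral_suminf) simp
  also have "\<dots> <= (\<Sum>n. ennreal ((1/2)^n))" by (intro suminf_le dn) auto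
  also have "\<dots> = ennreal (\<Sum>n. (1/2)^n)" by (rule suminf_ennreal2) (auto intro: summable_geometric)
  finally have fin: "(\<integral>\<^sup>+x. (\<Sum>n. ennreal (2^n * (d n x)\<^sup>2)) \<partial>M) < \<infinity>" by (rule le_less_trans) simp
  have "AE x in M. (\<Sum>n. ennreal (2^n * (d n x)\<^sup>2)) ~= \<infinity>"
    by (rule nn_integral_PInf_AE) (use fin in auto)
  hence ae: "AE x in M. (%n. s (r n) x) \<longlonglongrightarrow> f x"
  proof eventually_elim
    case (elim x)
    have bd: "ennreal (2^n * (d n x)\<^sup>2) <= (\<Sum>n. ennreal (2^n * (d n x)\<^sup>2))" for n
    proof -
      have "(\<Sum>n\<in>{n}. ennreal (2^n * (d n x)\<^sup>2)) <= (\<Sum>n. ennreal (2^n * (d n x)\<^sup>2))"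
        by (rule sum_le_suminf[OF summableI]) simp_all
      thus ?thesis by simp
    qed
    then obtain C where C: "C >= 0" "(\<Sum>n. ennreal (2^n * (d n x)\<^sup>2)) = ennreal C"
      using elim ennreal_cases[of "\<Sum>n. ennreal (2^n * (d n x)\<^sup>2)"] by (metis infinity_ennreal_def)
    have "2^n * (d n x)\<^sup>2 <= C" for n using bd[of n] C by simp
    hence "(d n x)\<^sup>2 <= C * (1/2)^n" for n by (simp add: power_divide field_simps)
    hence "sqrt ((d n x)\<^sup>2) <= sqrt (C * (1/2)^n)" for n by (rule real_sqrt_le_mono)
    moreover have "sqrt (C * (1/2)^n) = sqrt C * (sqrt (1/2))^n" for n
      by (simp only: real_sqrt_mult real_sqrt_power)
    ultimately have "norm (d n x) <= sqrt C * (sqrt (1/2))^n" for n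
      by (simp only: real_sqrt_abs real_norm_def)
    moreover have "summable (%n. sqrt C * (sqrt (1/2))^n)"
      by (intro summable_mult summable_geometric) simp
    ultimately have "summable (%n. d n x)" by (rule summable_comparison_test'[rotated])
    hence "convergent (%n. \<Sum>k<n. d k x)" by (simp add: summable_iff_convergent)
    moreover have "(\<Sum>k<n. d k x) = s (r n) x - s (r 0) x" for n
      unfolding d_def by (rule sum_lessThan_telescope)
    ultimately have "convergent (%n. s (r n) x - s (r 0) x)" by simp
    hence "convergent (%n. s (r n) x)" using convergent_add[OF _ convergent_const[of "s (r 0) x"], of "%n. s (r n) x - s (r 0) x"] by simp
    thus ?case by (simp add: f_def ae_lim_def convergent_LIMSEQ_iff)
  qed
  have fatou: "(\<integral>\<^sup>+x. ennreal ((s m x - f x)\<^sup>2) \<partial>M) <= ennreal e"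
    if e: "e > 0" and m: "\<forall>n\<ge>k. (LINT x|M. (s m x - s n x)\<^sup>2) < e" for e m k
  proof -
    have "(\<integral>\<^sup>+x. ennreal ((s m x - f x)\<^sup>2) \<partial>M) = (\<integral>\<^sup>+x. liminf (%n. ennreal ((s m x - s (r n) x)\<^sup>2)) \<partial>M)"
    proof (rule nn_integral_cong_AE, use ae in eventually_elim)
      case (elim x)
      have "(%n. ennreal ((s m x - s (r n) x)\<^sup>2)) \<longlonglongrightarrow> ennreal ((s m x - f x)\<^sup>2)"
        by (intro tendsto_intros elim)
      thus ?case by (rule lim_imp_Liminf[OF sequentially_bot, symmetric])
    qed
    also have "\<dots> <= liminf (%n. \<integral>\<^sup>+x. ennreal ((s m x - s (r n) x)\<^sup>2) \<partial>M)"
      by (rule nn_integral_liminf) simp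
    also have "\<dots> <= ennreal e"
    proof (rule Liminf_le)
      show "\<forall>\<^sub>F n in sequentially. (\<integral>\<^sup>+x. ennreal ((s m x - s (r n) x)\<^sup>2) \<partial>M) <= ennreal e"
        using eventually_ge_at_top[of k]
      proof eventually_elim
        case (elim n)
        hence "r n >= k" using seq_suble[OF sm, of n] by simp
        thus ?case unfolding nn using m by (intro ennreal_leI less_imp_le) simp
      qed
    qed simp
    finally show ?thesis .
  qed
  have diff: "sqint M (%x. s (K 0) x - f x)"
    unfolding sqint_def
  proof
    have "(\<integral>\<^sup>+x. ennreal ((s (K 0) x - f x)\<^sup>2) \<partial>M) <= ennreal 1"
      by (rule fatou[of _ "K 0"]) (use K[of 0 "K 0"] in auto)
    hence "(\<integral>\<^sup>+x. ennreal (norm ((s (K 0) x - f x)\<^sup>2)) \<partial>M) < \<infinity>"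
      by (simp add: order_le_less_trans[OF _ ennreal_one_less_top])
    thus "integrable M (%x. (s (K 0) x - f x)\<^sup>2)" by (intro integrableI_bounded) simp_all
  qed simp
  have fsq: "sqint M f"
    using sqint_diff[OF sq[of "K 0"] diff] by simp
  have "(%n. nrm M (%x. s n x - f x)) \<longlonglongrightarrow> 0"
  proof (rule LIMSEQ_I)
    fix e :: real assume e: "e > 0"
    obtain k where k: "\<forall>m\<ge>k. \<forall>n\<ge>k. (LINT x|M. (s m x - s n x)\<^sup>2) < (e/2)\<^sup>2"
      using cauchy[of "(e/2)\<^sup>2"] e by auto
    have "norm (nrm M (%x. s m x - f x) - 0) < e" if "m >= k" for m
    proof -
      have "(\<integral>\<^sup>+x. ennreal ((s m x - f x)\<^sup>2) \<partial>M) <= ennreal ((e/2)\<^sup>2)"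
        by (rule fatou[of _ k]) (use e k that in auto)
      hence "(LINT x|M. (s m x - f x)\<^sup>2) <= (e/2)\<^sup>2"
        by (intro integral_real_bounded) auto
      hence "nrm M (%x. s m x - f x) <= e/2"
        unfolding nrm_def using e by (intro real_le_lsqrt) auto
      thus ?thesis using e nrm_nonneg[of M "%x. s m x - f x"] by simp
    qed
    thus "\<exists>no. \<forall>n\<ge>no. norm (nrm M (%x. s n x - f x) - 0) < e" by blast
  qed
  from that[OF sm, folded f_def, OF fsq this ae] show thesis .
qed

text \<open>Riesz representation in \<open>L\<^sup>2\<close>: the sequence of \<open>riesz_sequence\<close> converges by completeness.\<close>
lemma L2_riesz:
  assumes l_lin: "!!f g c. sqint M f ==> sqint M g ==> l (%x. f x + c * g x) = l f + c * l g"
    and l_bd: "!!f. sqint M f ==> \<bar>l f\<bar> <= C * nrm M f"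
  obtains g where "sqint M g" "!!f. sqint M f ==> l f = (LINT x|M. f x * g x)"
proof -
  obtain s where s: "!!n. s n \<in> {u. sqint M u}"
      "!!v. v \<in> {u. sqint M u} ==> (%n. L2_ip M (s n) v) \<longlonglongrightarrow> l v"
      "!!e. e > 0 ==> \<exists>K. \<forall>m\<ge>K. \<forall>n\<ge>K. L2_ip M (%x. s m x - s n x) (%x. s m x - s n x) < e"
    by (rule L2.riesz_sequence[where M=M and l=l and C=C]) (auto simp: L2_N l_lin l_bd)
  obtain r where r: "sqint M (ae_lim (%n. s (r n)))"
      "(%n. nrm M (%x. s n x - ae_lim (%n. s (r n)) x)) \<longlonglongrightarrow> 0"
    by (rule L2_complete[of M s]) (use s in \<open>auto simp: L2_ip_def power2_eq_square\<close>)
  have "l f = (LINT x|M. f x * ae_lim (%n. s (r n)) x)" if "sqint M f" for f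
  proof -
    have "(%n. L2_ip M (s n) f) \<longlonglongrightarrow> L2_ip M (ae_lim (%n. s (r n))) f"
      unfolding L2_ip_def by (rule L2_ip_tendsto) (use r s that in auto)
    from LIMSEQ_unique[OF this s(2)] that show ?thesis by (simp add: L2_ip_def mult.commute)
  qed
  thus thesis using that r by blast
qed

text \<open>The orthogonal projection of \<open>u\<close> to \<open>V\<close> is the limit of the sequence that
  \<open>riesz_sequence\<close> provides for the functional \<open>v \<mapsto> \<langle>u, v\<rangle>\<close>. The difference between \<open>u\<close> and
  its projection is orthogonal to \<open>V\<close>, hence zero.\<close>
lemma L2_dense:
  assumes VL: "!!f. f \<in> V ==> sqint M f"
    and V0: "(%x. 0) \<in> V" and Vlin: "!!f g c. f \<in> V ==> g \<in> V ==> (%x. f x + c * g x) \<in> V"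
    and orth: "!!v. sqint M v ==> (!!f. f \<in> V ==> (LINT x|M. v x * f x) = 0) ==> AE x in M. v x = 0"
    and u: "sqint M u" and e: "e > 0"
  shows "\<exists>f\<in>V. nrm M (%x. f x - u x) < e"
proof -
  interpret V: semi_inner V "L2_ip M"
    using VL V0 Vlin by unfold_locales (auto simp: L2.B_lin L2.B_sym L2.B_pos)
  have VN: "V.N f = nrm M f" for f by (simp add: V.N_def L2_N[symmetric] L2.N_def)
  obtain s where s: "!!n. s n \<in> V"
      "!!v. v \<in> V ==> (%n. L2_ip M (s n) v) \<longlonglongrightarrow> L2_ip M u v"
      "!!e. e > 0 ==> \<exists>K. \<forall>m\<ge>K. \<forall>n\<ge>K. L2_ip M (%x. s m x - s n x) (%x. s m x - s n x) < e"
  proof (rule V.riesz_sequence[where l="L2_ip M u" and C="nrm M u"])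
    show "L2_ip M u (%x. f x + c * g x) = L2_ip M u f + c * L2_ip M u g" if "f \<in> V" "g \<in> V" for f g c
      using L2.B_lin_right[of f M g u c] that VL u by simp
    show "\<bar>L2_ip M u f\<bar> <= nrm M u * V.N f" if "f \<in> V" for f
      using L2.Cauchy_Schwarz[of u M f] that VL u by (simp add: VN L2_N)
  qed blast
  have ssq: "sqint M (s n)" for n using s VL by auto
  obtain r where r: "sqint M (ae_lim (%n. s (r n)))"
      "(%n. nrm M (%x. s n x - ae_lim (%n. s (r n)) x)) \<longlonglongrightarrow> 0"
    by (rule L2_complete[of M s]) (use s ssq in \<open>auto simp: L2_ip_def power2_eq_square\<close>)
  let ?f = "ae_lim (%n. s (r n))"
  have "AE x in M. ?f x - u x = 0"
  proof (rule orth)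
    show "sqint M (%x. ?f x - u x)" by (intro sqint_diff r u)
    fix f assume f: "f \<in> V"
    have "(%n. L2_ip M (s n) f) \<longlonglongrightarrow> L2_ip M ?f f"
      unfolding L2_ip_def by (rule L2_ip_tendsto) (use r ssq VL f in auto)
    from LIMSEQ_unique[OF this s(2)[OF f]]
    show "(LINT x|M. (?f x - u x) * f x) = 0"
      using r u f VL by (simp add: L2_ip_def left_diff_distrib sqint_mult)
  qed
  moreover have [measurable]: "?f \<in> borel_measurable M" "u \<in> borel_measurable M" "!!n. s n \<in> borel_measurable M"
    using r u ssq by (auto simp: sqint_def)
  ultimately have "nrm M (%x. s n x - u x) = nrm M (%x. s n x - ?f x)" for n
    by (intro nrm_cong) (auto elim: eventually_mono)
  with r(2) have "(%n. nrm M (%x. s n x - u x)) \<longlonglongrightarrow> 0" by simp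
  hence "\<forall>\<^sub>F n in sequentially. nrm M (%x. s n x - u x) < e" using e by (rule order_tendstoD)
  then obtain n where "nrm M (%x. s n x - u x) < e" by (auto simp: eventually_sequentially)
  thus ?thesis using s by blast
qed

section \<open>Smooth functions and test functions\<close>

definition smooth :: "(real^'d => real) => bool" where
  "smooth \<phi> \<longleftrightarrow> (\<forall>k. Ck k \<phi>)"

lemma has_derivative_pd:
  "(\<phi> has_derivative D) (at x) ==> pd i \<phi> x = D (axis i 1)"
  unfolding pd_def by (simp add: frechet_derivative_at[symmetric])

lemma linear_axis_expansion:
  fixes L :: "real^'d => real" assumes "linear L"
  shows "L h = (\<Sum>i\<in>UNIV. h $ i * L (axis i 1))"
proof -
  have "L h = L (\<Sum>i\<in>UNIV. h $ i *\<^sub>R axis i 1)"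
    using basis_expansion[of h] by (simp add: scalar_mult_eq_scaleR)
  also have "\<dots> = (\<Sum>i\<in>UNIV. h $ i * L (axis i 1))"
    by (simp add: linear_sum[OF assms] linear_cmul[OF assms])
  finally show ?thesis .
qed

lemma differentiable_has_derivative_pd:
  fixes \<phi> :: "real^'d => real"
  assumes "\<phi> differentiable (at x)"
  shows "(\<phi> has_derivative (%h. \<Sum>i\<in>UNIV. h $ i * pd i \<phi> x)) (at x)"
proof -
  have d: "(\<phi> has_derivative frechet_derivative \<phi> (at x)) (at x)"
    using assms by (simp add: frechet_derivative_works)
  hence "linear (frechet_derivative \<phi> (at x))" by (rule has_derivative_linear)
  hence "frechet_derivative \<phi> (at x) = (%h. \<Sum>i\<in>UNIV. h $ i * pd i \<phi> x)"
    unfolding pd_def by (intro ext linear_axis_expansion)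
  thus ?thesis using d by simp
qed

lemma Ck_continuous: "Ck k \<phi> ==> continuous_on UNIV \<phi>"
  by (cases k) (auto simp: continuous_on_eq_continuous_at differentiable_imp_continuous_within)

lemma Ck_Suc_imp: "Ck (Suc k) \<phi> ==> Ck k \<phi>"
proof (induction k arbitrary: \<phi>)
  case 0 thus ?case using Ck_continuous[of "Suc 0"] by simp
next
  case (Suc k) thus ?case by (simp only: Ck.simps) blast
qed

lemma pd_lin:
  assumes "f differentiable (at x)" "g differentiable (at x)"
  shows "pd i (%x. f x + c * g x) x = pd i f x + c * pd i g x"
    "(%x. f x + c * g x) differentiable (at x)"
proof -
  have "((%x. f x + c * g x) has_derivative (%h. (\<Sum>i\<in>UNIV. h $ i * pd i f x) + c * (\<Sum>i\<in>UNIV. h $ i * pd i g x))) (at x)"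
    by (intro derivative_intros differentiable_has_derivative_pd assms)
  from has_derivative_pd[OF this, of i] differentiableI[OF this]
  show "pd i (%x. f x + c * g x) x = pd i f x + c * pd i g x" "(%x. f x + c * g x) differentiable (at x)"
    by (simp_all add: axis_def if_distrib[of "%a. a * _"] cong: if_cong)
qed

lemma pd_mult:
  assumes "f differentiable (at x)" "g differentiable (at x)"
  shows "pd i (%x. f x * g x) x = f x * pd i g x + pd i f x * g x"
    "(%x. f x * g x) differentiable (at x)"
proof -
  have "((%x. f x * g x) has_derivative (%h. f x * (\<Sum>i\<in>UNIV. h $ i * pd i g x) + (\<Sum>i\<in>UNIV. h $ i * pd i f x) * g x)) (at x)"
    by (intro derivative_intros differentiable_has_derivative_pd assms)
  from has_derivative_pd[OF this, of i] differentiableI[OF this]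
  show "pd i (%x. f x * g x) x = f x * pd i g x + pd i f x * g x" "(%x. f x * g x) differentiable (at x)"
    by (simp_all add: axis_def if_distrib[of "%a. a * _"] cong: if_cong)
qed

lemma pd_affine:
  fixes f :: "real^'d => real"
  assumes "f differentiable (at (a + c *\<^sub>R x))"
  shows "pd i (%x. f (a + c *\<^sub>R x)) x = c * pd i f (a + c *\<^sub>R x)"
    "(%x. f (a + c *\<^sub>R x)) differentiable (at x)"
proof -
  have "((%x. a + c *\<^sub>R x) has_derivative (%h. c *\<^sub>R h)) (at x)"
    by (auto intro!: derivative_eq_intros)
  from has_derivative_compose[OF this differentiable_has_derivative_pd[OF assms]]
  have *: "((%x. f (a + c *\<^sub>R x)) has_derivative (%h. \<Sum>i\<in>UNIV. (c *\<^sub>R h) $ i * pd i f (a + c *\<^sub>R x))) (at x)" .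
  from has_derivative_pd[OF *, of i] differentiableI[OF *]
  show "pd i (%x. f (a + c *\<^sub>R x)) x = c * pd i f (a + c *\<^sub>R x)" "(%x. f (a + c *\<^sub>R x)) differentiable (at x)"
    by (simp_all add: axis_def if_distrib[of "%a. a * _"] if_distrib[of "%a. _ * a"] cong: if_cong)
qed

lemma Ck_lin: "Ck k f ==> Ck k g ==> Ck k (%x. f x + c * g x)"
proof (induction k arbitrary: f g)
  case 0 thus ?case by (simp add: continuous_on_add continuous_on_mult continuous_on_const)
next
  case (Suc k)
  have "pd i (%x. f x + c * g x) = (%x. pd i f x + c * pd i g x)" for i
    using Suc.prems by (auto simp: pd_lin)
  thus ?case using Suc by (auto simp: pd_lin)
qed

lemma Ck_mult: "Ck k f ==> Ck k g ==> Ck k (%x. f x * g x)"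
proof (induction k arbitrary: f g)
  case 0 thus ?case by (simp add: continuous_on_add continuous_on_mult continuous_on_const)
next
  case (Suc k)
  have *: "pd i (%x. f x * g x) = (%x. f x * pd i g x + 1 * (pd i f x * g x))" for i
    using Suc.prems by (auto simp: pd_mult)
  have "Ck k (%x. f x * pd i g x + 1 * (pd i f x * g x))" for i
    using Suc.prems Ck_Suc_imp[OF Suc.prems(1)] Ck_Suc_imp[OF Suc.prems(2)] by (intro Ck_lin Suc.IH) auto
  thus ?case using Suc.prems by (auto simp: pd_mult(2) *)
qed

lemma pd_const: "pd i (%x. c) = (%x. 0)"
  by (rule ext, rule has_derivative_pd[of _ "%h. 0", simplified]) (auto intro: derivative_intros)

lemma Ck_const: "Ck k (%x. c)"
  by (induction k arbitrary: c) (auto simp: pd_const)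

lemma Ck_affine: "Ck k f ==> Ck k (%x. f (a + c *\<^sub>R x))"
proof (induction k arbitrary: f)
  case 0
  have "continuous_on UNIV (%x. f (a + c *\<^sub>R x))"
    by (rule continuous_on_compose2[of UNIV f])
      (use 0 in \<open>simp_all add: continuous_on_add continuous_on_scaleR continuous_on_const\<close>)
  thus ?case by simp
next
  case (Suc k)
  have *: "pd i (%x. f (a + c *\<^sub>R x)) = (%x. 0 + c * pd i f (a + c *\<^sub>R x))" for i
    using Suc.prems by (auto simp: pd_affine)
  have "Ck k (%x. 0 + c * pd i f (a + c *\<^sub>R x))" for i
    using Suc.prems by (intro Ck_lin Ck_const Suc.IH) auto
  thus ?case using Suc.prems by (auto simp: pd_affine(2) *)
qed

lemma smoothD: "smooth f ==> Ck k f" "smooth f ==> f differentiable (at x)" "smooth f ==> smooth (pd i f)"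
  "smooth f ==> continuous_on UNIV f"
proof -
  assume f: "smooth f"
  show "Ck k f" using f by (simp add: smooth_def)
  show "continuous_on UNIV f" using f Ck_continuous[of 0] unfolding smooth_def by blast
  have "Ck (Suc k) f" for k using f unfolding smooth_def by blast
  thus "f differentiable (at x)" "smooth (pd i f)" by (auto simp: smooth_def)
qed

lemma smooth_lin: "smooth f ==> smooth g ==> smooth (%x. f x + c * g x)"
  by (simp add: smooth_def Ck_lin)
lemma smooth_const: "smooth (%x. c)" by (simp add: smooth_def Ck_const)
lemma smooth_add: "smooth f ==> smooth g ==> smooth (%x. f x + g x)"
  using smooth_lin[of f g 1] by simp
lemma smooth_diff: "smooth f ==> smooth g ==> smooth (%x. f x - g x)"
  using smooth_lin[of f g "-1"] by simp
lemma smooth_mult: "smooth f ==> smooth g ==> smooth (%x. f x * g x)"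
  by (simp add: smooth_def Ck_mult)
lemma smooth_affine: "smooth f ==> smooth (%x. f (a + c *\<^sub>R x))"
  by (simp add: smooth_def Ck_affine)
lemma smooth_sum: "finite I ==> (!!i. i \<in> I ==> smooth (f i)) ==> smooth (%x. \<Sum>i\<in>I. f i x)"
proof (induction I rule: finite_induct)
  case empty show ?case by (simp add: smooth_const)
next
  case (insert i I)
  have "smooth (%x. f i x + (\<Sum>i\<in>I. f i x))"
    by (rule smooth_add) (use insert in blast)+
  thus ?case using insert by simp
qed

lemma smooth_pd_lin: "smooth f ==> smooth g ==> pd i (%x. f x + c * g x) = (%x. pd i f x + c * pd i g x)"
  by (auto simp: pd_lin smoothD)
lemma smooth_pd_add: "smooth f ==> smooth g ==> pd i (%x. f x + g x) = (%x. pd i f x + pd i g x)"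
  using smooth_pd_lin[of f g i 1] by simp
lemma smooth_pd_scale: "smooth f ==> pd i (%x. c * f x) = (%x. c * pd i f x)"
  using smooth_pd_lin[OF smooth_const[of 0], of f i c] by (simp add: pd_const)
lemma smooth_pd_mult: "smooth f ==> smooth g ==> pd i (%x. f x * g x) = (%x. f x * pd i g x + pd i f x * g x)"
  by (auto simp: pd_mult smoothD)
lemma smooth_pd_affine: "smooth f ==> pd i (%x. f (a + c *\<^sub>R x)) = (%x. c * pd i f (a + c *\<^sub>R x))"
  by (auto simp: pd_affine smoothD)
lemma smooth_pd_sum: "finite I ==> (!!i. i \<in> I ==> smooth (f i)) ==> pd j (%x. \<Sum>i\<in>I. f i x) = (%x. \<Sum>i\<in>I. pd j (f i) x)"
proof (induction I rule: finite_induct)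
  case empty show ?case by (simp add: pd_const)
next
  case (insert i I)
  have "smooth (f i)" "smooth (%x. \<Sum>i\<in>I. f i x)" using insert by (auto intro: smooth_sum)
  from smooth_pd_add[OF this] show ?case using insert by simp
qed

lemma Ck_local:
  assumes "!!x. \<exists>U g. open U & x \<in> U & Ck k g & (\<forall>y\<in>U. f y = g y)"
  shows "Ck k f"
  using assms
proof (induction k arbitrary: f)
  case 0
  have "isCont f x" for x
  proof -
    obtain U g where U: "open U" "x \<in> U" "Ck 0 g" "\<forall>y\<in>U. f y = g y" using 0[of x] by blast
    have "isCont g x" using U(3) by (simp add: continuous_on_eq_continuous_at)
    moreover have "\<forall>\<^sub>F y in nhds x. f y = g y" using U eventually_nhds by blast
    ultimately show ?thesis using isCont_cong[of f g x] by (simp only:)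
  qed
  thus ?case by (simp add: continuous_on_eq_continuous_at)
next
  case (Suc k)
  have *: "\<exists>U g. open U & x \<in> U & Ck (Suc k) g & (\<forall>y\<in>U. f y = g y & f differentiable (at y) & (\<forall>i. pd i f y = pd i g y))" for x
  proof -
    obtain U g where U: "open U" "x \<in> U" "Ck (Suc k) g" "!!y. y \<in> U ==> f y = g y" using Suc.prems[of x] by blast
    have "f differentiable (at y) & (\<forall>i. pd i f y = pd i g y)" if y: "y \<in> U" for y
    proof -
      have g: "g differentiable (at y)" using U(3) by simp
      have d: "(g has_derivative (%h. \<Sum>i\<in>UNIV. h $ i * pd i g y)) (at y)"
        by (rule differentiable_has_derivative_pd[OF g])
      have "(f has_derivative (%h. \<Sum>i\<in>UNIV. h $ i * pd i g y)) (at y)"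
        by (rule has_derivative_transform_within_open[OF d U(1) y]) (simp add: U(4))
      from has_derivative_pd[OF this] differentiableI[OF this] show ?thesis
        by (simp add: axis_def if_distrib[of "%a. a * _"] cong: if_cong)
    qed
    thus ?thesis using U by blast
  qed
  have "Ck k (pd i f)" for i
  proof (rule Suc.IH)
    fix x
    obtain U g where "open U" "x \<in> U" "Ck (Suc k) g" "\<forall>y\<in>U. \<forall>i. pd i f y = pd i g y" using * by meson
    thus "\<exists>U g. open U & x \<in> U & Ck k g & (\<forall>y\<in>U. pd i f y = g y)" by (intro exI[of _ U] exI[of _ "pd i g"]) auto
  qed
  moreover have "f differentiable (at x)" for x using *[of x] by blast
  ultimately show ?case by simp
qed

lemma smooth_local:
  assumes "!!x. \<exists>U g. open U & x \<in> U & smooth g & (\<forall>y\<in>U. f y = g y)"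
  shows "smooth f"
  unfolding smooth_def
proof
  fix k show "Ck k f"
  proof (rule Ck_local)
    fix x
    obtain U g where "open U" "x \<in> U" "smooth g" "\<forall>y\<in>U. f y = g y" using assms by blast
    thus "\<exists>U g. open U & x \<in> U & Ck k g & (\<forall>y\<in>U. f y = g y)" using smoothD(1) by blast
  qed
qed

lemma pd_local:
  assumes "open U" "x \<in> U" "!!y. y \<in> U ==> f y = g y" "smooth g"
  shows "pd i f x = pd i g x"
proof -
  have "(f has_derivative (%h. \<Sum>i\<in>UNIV. h $ i * pd i g x)) (at x)"
    by (rule has_derivative_transform_within_open[OF differentiable_has_derivative_pd[OF smoothD(2)[OF assms(4)]] assms(1,2)])
       (simp add: assms(3))
  from has_derivative_pd[OF this] show ?thesis
    by (simp add: axis_def if_distrib[of "%a. a * _"] cong: if_cong)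
qed

lemma smooth_coord: "smooth (%x::real^'d. x $ i)"
proof -
  have d: "((%x::real^'d. x $ i) has_derivative (%h. h $ i)) (at x)" for x
    by (rule bounded_linear_imp_has_derivative[OF bounded_linear_vec_nth])
  have "pd j (%x::real^'d. x $ i) = (%x. axis j 1 $ i)" for j
    by (rule ext) (rule has_derivative_pd[OF d])
  hence "Ck (Suc k) (%x::real^'d. x $ i)" for k
    using d by (auto simp: Ck_const differentiable_def)
  from Ck_Suc_imp[OF this] show ?thesis by (simp add: smooth_def)
qed

text \<open>The outer function comes with a sequence of its successive derivatives, so that the statement can be
  proved by induction on the order without a notion of smoothness on the line.\<close>
lemma smooth_chain:
  fixes F :: "nat => real => real"
  assumes F: "!!n t. (F n has_real_derivative F (Suc n) t) (at t)" and g: "smooth g"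
  shows "smooth (%x. F n (g x))"
proof -
  have der: "((%x. F n (g x)) has_derivative (%h. F (Suc n) (g x) * (\<Sum>i\<in>UNIV. h $ i * pd i g x))) (at x)" for n x
    using has_derivative_compose[OF differentiable_has_derivative_pd[OF smoothD(2)[OF g, of x]] F[of n "g x", THEN has_field_derivative_imp_has_derivative]]
    by simp
  have pdF: "pd i (%x. F n (g x)) = (%x. F (Suc n) (g x) * pd i g x)" for n i
    by (rule ext, subst has_derivative_pd[OF der])
       (simp add: axis_def if_distrib[of "%a. a * _"] cong: if_cong)
  have "Ck k (%x. F n (g x))" for k n
  proof (induction k arbitrary: n)
    case 0
    show ?case using der[of n] by (auto simp: continuous_on_eq_continuous_at intro: has_derivative_continuous)
  next
    case (Suc k)
    have "Ck k (%x. F (Suc n) (g x) * pd i g x)" for i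
      by (intro Ck_mult Suc.IH smoothD(1)[OF smoothD(3)[OF g]])
    thus ?case using differentiableI[OF der[of n]] by (auto simp: pdF)
  qed
  thus ?thesis by (simp add: smooth_def)
qed

subsection \<open>Bump functions\<close>

text \<open>With \<open>p = 1\<close> this is the classical \<open>e\<^sup>-\<^sup>1\<^sup>/\<^sup>t\<close>. The polynomial in \<open>1/t\<close> makes the family closed under
  differentiation, which acts on \<open>p\<close> as \<open>flat_step\<close>.\<close>
definition flat :: "real poly => real => real" where
  "flat p t = (if t > 0 then poly p (1/t) * exp (- (1/t)) else 0)"

definition flat_step :: "real poly => real poly" where
  "flat_step p = [:0, 0, 1:] * (p - pderiv p)"

lemma poly_exp_tendsto: "((%s. poly p s * exp (- s)) \<longlongrightarrow> (0::real)) at_top"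
proof -
  have "((%s. \<Sum>i\<le>degree p. coeff p i * (s ^ i / exp s)) \<longlongrightarrow> (\<Sum>i\<le>degree p. coeff p i * 0)) at_top"
    by (intro tendsto_intros tendsto_power_div_exp_0)
  thus ?thesis by (simp add: poly_altdef sum_distrib_right exp_minus divide_inverse mult.assoc)
qed

lemma flat_tendsto: "(flat p \<longlongrightarrow> 0) (at_right 0)"
proof -
  have "((%t. poly p (inverse t) * exp (- inverse t)) \<longlongrightarrow> 0) (at_right (0::real))"
    by (rule filterlim_compose[OF poly_exp_tendsto filterlim_inverse_at_top_right])
  moreover have "\<forall>\<^sub>F t in at_right 0. poly p (inverse t) * exp (- inverse t) = flat p t"
    by (auto simp: flat_def eventually_at_right_field inverse_eq_divide intro: exI[of _ 1])
  ultimately show ?thesis using tendsto_cong by force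
qed

lemma flat_derivative: "(flat p has_real_derivative flat (flat_step p) t) (at t)"
proof -
  consider "t > 0" | "t < 0" | "t = 0" by linarith
  thus ?thesis
  proof cases
    case 1
    have "((%t. poly p (1/t) * exp (- (1/t))) has_real_derivative flat (flat_step p) t) (at t)"
      using 1 unfolding flat_def flat_step_def
      by (auto intro!: derivative_eq_intros simp: power2_eq_square field_simps)
    thus ?thesis
      by (rule has_field_derivative_transform_within_open[of _ _ _ "{0<..}"]) (use 1 in \<open>auto simp: flat_def\<close>)
  next
    case 2
    have "((%t. 0) has_real_derivative flat (flat_step p) t) (at t)"
      using 2 by (simp add: flat_def)
    thus ?thesis
      by (rule has_field_derivative_transform_within_open[of _ _ _ "{..<0}"]) (use 2 in \<open>auto simp: flat_def\<close>)
  next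
    case 3
    have "((%h. (flat p h - flat p 0) / h) \<longlongrightarrow> 0) (at_right 0)"
      by (rule Lim_transform_eventually[OF flat_tendsto[of "[:0,1:] * p"]])
         (auto simp: flat_def eventually_at_right_field field_simps intro!: exI[of _ 1])
    moreover have "((%h. (flat p h - flat p 0) / h) \<longlongrightarrow> 0) (at_left 0)"
      by (rule Lim_transform_eventually[OF tendsto_const])
         (auto simp: flat_def eventually_at_left_field intro!: exI[of _ "-1"])
    ultimately have "((%h. (flat p h - flat p 0) / h) \<longlongrightarrow> 0) (at 0)"
      by (simp add: filterlim_at_split)
    thus ?thesis using 3 by (simp add: has_field_derivative_iff flat_def)
  qed
qed

lemma bump_exists:
  fixes a :: "real^'d" assumes "r > 0"
  obtains b where "smooth b" "!!x. x \<in> ball a r ==> b x > 0" "!!x. x \<notin> ball a r ==> b x = 0" "!!x. b x <= 1" "!!x. 0 <= b x"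
proof -
  define g where "g x = r^2 - (\<Sum>i\<in>UNIV. (x $ i - a $ i) * (x $ i - a $ i))" for x :: "real^'d"
  have "smooth g" unfolding g_def
    by (intro smooth_diff smooth_const smooth_sum smooth_mult smooth_coord) simp
  have ge: "g x = r^2 - (norm (x - a))^2" for x
    by (simp add: g_def norm_vec_def L2_set_def sum_nonneg power2_eq_square)
  have "smooth (%x. flat ((flat_step ^^ 0) 1) (g x))"
    by (rule smooth_chain[where F="%n. flat ((flat_step ^^ n) 1)"]) (use flat_derivative \<open>smooth g\<close> in auto)
  hence 1: "smooth (%x. flat 1 (g x))" by simp
  have 2: "g x > 0 \<longleftrightarrow> x \<in> ball a r" for x
    using assms power2_less_imp_less[of "norm (x-a)" r] power_strict_mono[of "norm (x-a)" r 2]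
    by (auto simp: ge dist_norm norm_minus_commute)
  have 3: "flat 1 (g x) <= 1" "0 <= flat 1 (g x)" for x by (simp_all add: flat_def)
  show thesis
  proof (rule that[OF 1])
    show "flat 1 (g x) > 0" if "x \<in> ball a r" for x using 2[of x] that by (simp add: flat_def)
    show "flat 1 (g x) = 0" if "x \<notin> ball a r" for x using 2[of x] that by (simp add: flat_def)
  qed (use 3 in auto)
qed

subsection \<open>Lebesgue measure under affine maps\<close>

lemma lebesgue_affine_map:
  fixes a :: "real^'d" assumes c: "c ~= 0"
  shows "(%x. a + c *\<^sub>R x) \<in> lebesgue \<rightarrow>\<^sub>M lebesgue"
    and "lebesgue = density (distr lebesgue lebesgue (%x. a + c *\<^sub>R x)) (%_. ennreal (\<bar>c\<bar> ^ CARD('d)))"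
proof -
  have *: "(%x. a + (\<Sum>j\<in>Basis. (c * (x \<bullet> j)) *\<^sub>R j)) = (%x::real^'d. a + c *\<^sub>R x)"
    by (simp add: scaleR_scaleR[symmetric] scaleR_sum_right[symmetric] euclidean_representation del: scaleR_scaleR)
  show "(%x. a + c *\<^sub>R x) \<in> lebesgue \<rightarrow>\<^sub>M lebesgue"
    using lebesgue_affine_measurable[of "%_. c" a] c by (simp add: *)
  show "lebesgue = density (distr lebesgue lebesgue (%x. a + c *\<^sub>R x)) (%_. ennreal (\<bar>c\<bar> ^ CARD('d)))"
    using lebesgue_affine_euclidean[of "%_. c" a] c by (simp add: *)
qed

lemma nn_integral_lebesgue_affine:
  fixes f :: "real^'d => ennreal" assumes f[measurable]: "f \<in> borel_measurable lebesgue" and c: "c ~= 0"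
  shows "(\<integral>\<^sup>+x. f x \<partial>lebesgue) = ennreal (\<bar>c\<bar> ^ CARD('d)) * (\<integral>\<^sup>+x. f (a + c *\<^sub>R x) \<partial>lebesgue)"
proof -
  note [measurable] = lebesgue_affine_map(1)[OF c, of a]
  have "(\<integral>\<^sup>+x. f x \<partial>lebesgue) = (\<integral>\<^sup>+x. f x \<partial>density (distr lebesgue lebesgue (%x. a + c *\<^sub>R x)) (%_. ennreal (\<bar>c\<bar> ^ CARD('d))))"
    using lebesgue_affine_map(2)[OF c, of a] by simp
  also have "\<dots> = (\<integral>\<^sup>+x. ennreal (\<bar>c\<bar> ^ CARD('d)) * f x \<partial>distr lebesgue lebesgue (%x. a + c *\<^sub>R x))"
    by (subst nn_integral_density) auto
  also have "\<dots> = ennreal (\<bar>c\<bar> ^ CARD('d)) * (\<integral>\<^sup>+x. f x \<partial>distr lebesgue lebesgue (%x. a + c *\<^sub>R x))"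
    by (rule nn_integral_cmult) simp
  also have "(\<integral>\<^sup>+x. f x \<partial>distr lebesgue lebesgue (%x. a + c *\<^sub>R x)) = (\<integral>\<^sup>+x. f (a + c *\<^sub>R x) \<partial>lebesgue)"
    by (rule nn_integral_distr) simp_all
  finally show ?thesis .
qed

lemma measurable_lebesgue_affine:
  fixes a :: "real^'d"
  assumes "f \<in> borel_measurable lebesgue" "c ~= 0"
  shows "(%x. f (a + c *\<^sub>R x)) \<in> borel_measurable lebesgue"
  using measurable_compose[OF lebesgue_affine_map(1)[OF assms(2), of a] assms(1)] .

lemma AE_lebesgue_affine:
  fixes a :: "real^'d"
  assumes "AE x in lebesgue. P x" "c ~= 0"
  shows "AE x in lebesgue. P (a + c *\<^sub>R x)"
proof -
  obtain N where N: "N \<in> null_sets lebesgue" "{x. \<not> P x} \<subseteq> N"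
    using assms(1) by (auto simp: eventually_ae_filter)
  hence Ns: "N \<in> sets lebesgue" by auto
  have "0 = (\<integral>\<^sup>+x. indicator N x \<partial>(lebesgue :: (real^'d) measure))" using N Ns by auto
  also have "\<dots> = ennreal (\<bar>c\<bar> ^ CARD('d)) * (\<integral>\<^sup>+x. indicator N (a + c *\<^sub>R x) \<partial>lebesgue)"
    by (rule nn_integral_lebesgue_affine[OF _ assms(2)]) (use Ns in auto)
  finally have z0: "0 = ennreal (\<bar>c\<bar> ^ CARD('d)) * (\<integral>\<^sup>+x. indicator N (a + c *\<^sub>R x) \<partial>(lebesgue :: (real^'d) measure))" .
  have "(\<integral>\<^sup>+x. indicator N (a + c *\<^sub>R x) \<partial>(lebesgue :: (real^'d) measure)) = 0"
  proof -
    have "\<not> \<bar>c\<bar> ^ CARD('d) <= 0" using assms(2) by (simp add: not_le)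
    with z0 show ?thesis by (simp add: ennreal_eq_0_iff)
  qed
  hence "AE x in lebesgue. indicator N (a + c *\<^sub>R x) = (0::ennreal)"
    by (subst (asm) nn_integral_0_iff_AE) (use Ns in \<open>auto intro!: measurable_lebesgue_affine[OF _ assms(2)]\<close>)
  thus ?thesis by eventually_elim (use N in \<open>auto simp: indicator_eq_0_iff\<close>)
qed

lemma integral_lebesgue_affine:
  fixes f :: "real^'d => real" assumes f[measurable]: "f \<in> borel_measurable lebesgue" and c: "c ~= 0"
  shows "(LINT x|lebesgue. f x) = \<bar>c\<bar> ^ CARD('d) * (LINT x|lebesgue. f (a + c *\<^sub>R x))"
proof -
  note [measurable] = lebesgue_affine_map(1)[OF c, of a]
  have "(LINT x|lebesgue. f x) = (\<integral>x. f x \<partial>density (distr lebesgue lebesgue (%x. a + c *\<^sub>R x)) (%_. ennreal (\<bar>c\<bar> ^ CARD('d))))"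
    using lebesgue_affine_map(2)[OF c, of a] by simp
  also have "\<dots> = (\<integral>x. \<bar>c\<bar> ^ CARD('d) * f x \<partial>distr lebesgue lebesgue (%x. a + c *\<^sub>R x))"
    by (subst integral_density) auto
  also have "\<dots> = \<bar>c\<bar> ^ CARD('d) * (LINT x|lebesgue. f (a + c *\<^sub>R x))"
    by (subst integral_distr) auto
  finally show ?thesis .
qed

lemma integral_lebesgue_translate:
  fixes f :: "real^'d => real" assumes "f \<in> borel_measurable lebesgue"
  shows "(LINT x|lebesgue. f (x + a)) = (LINT x|lebesgue. f x)"
  using integral_lebesgue_affine[OF assms, of 1 a] by (simp add: add.commute)

lemma integral_lebesgue_reflect:
  fixes f :: "real^'d => real" assumes "f \<in> borel_measurable lebesgue"
  shows "(LINT x|lebesgue. f (a - x)) = (LINT x|lebesgue. f x)"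
  using integral_lebesgue_affine[OF assms, of "-1" a] by simp

lemma borel_imp_lebesgue: "f \<in> borel_measurable borel ==> f \<in> borel_measurable (lebesgue :: (real^'d) measure)"
  by (simp add: measurable_completion)

lemma continuous_imp_lebesgue: "continuous_on UNIV (f::real^'d => real) ==> f \<in> borel_measurable lebesgue"
  by (intro borel_imp_lebesgue borel_measurable_continuous_onI)

lemma smooth_measurable: "smooth f ==> f \<in> borel_measurable lebesgue"
  by (intro continuous_imp_lebesgue smoothD)

subsection \<open>Test functions\<close>

lemma test_functionsI:
  assumes "smooth \<psi>" "compact K" "K \<subseteq> \<Omega>" "!!x. x \<notin> K ==> \<psi> x = 0"
  shows "\<psi> \<in> test_functions \<Omega>"
proof -
  have "closure {x. \<psi> x ~= 0} \<subseteq> K"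
    by (rule closure_minimal) (use assms compact_imp_closed in auto)
  moreover from this have "compact (closure {x. \<psi> x ~= 0})"
    using assms(2) closed_closure compact_Int_closed by (metis inf.absorb2)
  ultimately show ?thesis using assms unfolding test_functions_def smooth_def by auto
qed

lemma test_functionsE:
  assumes "\<psi> \<in> test_functions \<Omega>"
  obtains K where "compact K" "K \<subseteq> \<Omega>" "!!x. x \<notin> K ==> \<psi> x = 0"
proof (rule that)
  show "compact (closure {x. \<psi> x ~= 0})" "closure {x. \<psi> x ~= 0} \<subseteq> \<Omega>"
    using assms by (auto simp: test_functions_def)
  show "\<psi> x = 0" if "x \<notin> closure {x. \<psi> x ~= 0}" for x
    using that closure_subset[of "{x. \<psi> x ~= 0}"] by blast
qed

lemma test_smooth: "\<psi> \<in> test_functions \<Omega> ==> smooth \<psi>"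
  unfolding test_functions_def smooth_def by auto

lemma test_outside: "\<psi> \<in> test_functions \<Omega> ==> x \<notin> \<Omega> ==> \<psi> x = 0"
  by (erule test_functionsE) blast

lemma test_mono: "\<psi> \<in> test_functions \<Omega> ==> \<Omega> \<subseteq> \<Omega>' ==> \<psi> \<in> test_functions \<Omega>'"
  unfolding test_functions_def by auto

lemma test_zero: "(%x. 0) \<in> test_functions \<Omega>"
  by (rule test_functionsI[of _ "{}"]) (auto simp: smooth_const)

lemma test_lin:
  assumes "f \<in> test_functions \<Omega>" "g \<in> test_functions \<Omega>"
  shows "(%x. f x + c * g x) \<in> test_functions \<Omega>"
proof -
  obtain K where K: "compact K" "K \<subseteq> \<Omega>" "!!x. x \<notin> K ==> f x = 0" by (rule test_functionsE[OF assms(1)]) blast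
  obtain L where L: "compact L" "L \<subseteq> \<Omega>" "!!x. x \<notin> L ==> g x = 0" by (rule test_functionsE[OF assms(2)]) blast
  show ?thesis
    by (rule test_functionsI[of _ "K \<union> L"])
       (use K L assms in \<open>auto intro: smooth_lin test_smooth\<close>)
qed

lemma test_smooth_mult:
  assumes "smooth g" "f \<in> test_functions \<Omega>"
  shows "(%x. g x * f x) \<in> test_functions \<Omega>"
proof -
  obtain K where K: "compact K" "K \<subseteq> \<Omega>" "!!x. x \<notin> K ==> f x = 0" by (rule test_functionsE[OF assms(2)]) blast
  show ?thesis
    by (rule test_functionsI[of _ K]) (use K assms in \<open>auto intro: smooth_mult test_smooth\<close>)
qed

lemma test_pd:
  assumes "f \<in> test_functions \<Omega>" shows "pd i f \<in> test_functions \<Omega>"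
proof -
  obtain K where K: "compact K" "K \<subseteq> \<Omega>" "!!x. x \<notin> K ==> f x = 0" by (rule test_functionsE[OF assms]) blast
  have "pd i f x = 0" if "x \<notin> K" for x
  proof -
    have "pd i f x = pd i (%x. 0) x"
      by (rule pd_local[of "-K"]) (use K that smooth_const in \<open>auto simp: open_Compl compact_imp_closed\<close>)
    thus ?thesis by (simp add: pd_const)
  qed
  thus ?thesis
    by (intro test_functionsI[of _ K] smoothD(3) test_smooth[OF assms] K)
qed

lemma test_bounded:
  assumes "f \<in> test_functions \<Omega>" obtains M where "M > 0" "!!x. \<bar>f x\<bar> <= M"
proof -
  obtain K where K: "compact K" "!!x. x \<notin> K ==> f x = 0" by (rule test_functionsE[OF assms]) blast
  have "continuous_on K f" using smoothD(4)[OF test_smooth[OF assms]] continuous_on_subset by blast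
  hence "bounded (f ` K)" using K compact_continuous_image compact_imp_bounded by blast
  then obtain M where M: "M > 0" "!!x. x \<in> K ==> \<bar>f x\<bar> <= M" by (auto simp: bounded_pos)
  show thesis
  proof (rule that[OF M(1)])
    show "\<bar>f x\<bar> <= M" for x using M K(2)[of x] by (cases "x \<in> K") auto
  qed
qed

lemma bounded_compact_sqint:
  fixes f :: "real^'d => real"
  assumes [measurable]: "f \<in> borel_measurable lebesgue" and "compact K" "!!x. x \<notin> K ==> f x = 0" "!!x. \<bar>f x\<bar> <= M"
  shows "sqint lebesgue f" "integrable lebesgue f"
proof -
  have K: "K \<in> sets lebesgue" "emeasure lebesgue K < \<infinity>"
    using assms(2) lmeasurable_compact by (auto simp: fmeasurable_def)
  show "integrable lebesgue f"
    by (rule integrableI_bounded_set[where A=K and B=M]) (use K assms in auto)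
  have "(f x)\<^sup>2 <= M\<^sup>2" for x using power_mono[OF assms(4)[of x], of 2] by simp
  hence "integrable lebesgue (%x. (f x)\<^sup>2)"
    by (intro integrableI_bounded_set[where A=K and B="M\<^sup>2"]) (use K assms in auto)
  thus "sqint lebesgue f" by (simp add: sqint_def)
qed

lemma sqint_restrict:
  fixes f :: "real^'d => real"
  assumes "\<Omega> \<in> sets lebesgue"
  shows "sqint (lebesgue_on \<Omega>) f \<longleftrightarrow> sqint lebesgue (%x. indicator \<Omega> x * f x)"
proof -
  have "\<Omega> \<inter> space lebesgue \<in> sets lebesgue" using assms by simp
  moreover have "(%x. (indicator \<Omega> x * f x)\<^sup>2) = (%x. indicator \<Omega> x *\<^sub>R (f x)\<^sup>2)"
    by (auto simp: indicator_def)
  ultimately show ?thesis unfolding sqint_def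
    by (simp add: integrable_restrict_space borel_measurable_restrict_space_iff mult.commute)
qed

lemma sqint_restrictI:
  fixes f :: "real^'d => real"
  assumes "\<Omega> \<in> sets lebesgue" "sqint lebesgue f"
  shows "sqint (lebesgue_on \<Omega>) f"
  unfolding sqint_restrict[OF assms(1)]
  by (rule sqint_bounded_mult[where C=1]) (use assms in \<open>auto simp: indicator_def\<close>)

lemma test_sqint:
  assumes "f \<in> test_functions \<Omega>'" shows "sqint lebesgue f" "integrable lebesgue f"
proof -
  obtain K where K: "compact K" "!!x. x \<notin> K ==> f x = 0" by (rule test_functionsE[OF assms]) blast
  obtain M where M: "!!x. \<bar>f x\<bar> <= M" by (rule test_bounded[OF assms]) blast
  show "sqint lebesgue f" "integrable lebesgue f"
    by (rule bounded_compact_sqint[OF smooth_measurable[OF test_smooth[OF assms]] K(1), of M], use K M in blast, use M in blast)+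
qed

lemma test_sqint_on:
  assumes "f \<in> test_functions \<Omega>'" "\<Omega> \<in> sets lebesgue" shows "sqint (lebesgue_on \<Omega>) f"
  by (intro sqint_restrictI test_sqint(1)[OF assms(1)] assms(2))

lemma integral_on_eq:
  fixes f :: "real^'d => real"
  assumes "\<Omega> \<in> sets lebesgue" "!!x. x \<notin> \<Omega> ==> f x = 0"
  shows "(LINT x|lebesgue_on \<Omega>. f x) = (LINT x|lebesgue. f x)"
proof -
  have "indicator \<Omega> x *\<^sub>R f x = f x" for x using assms(2)[of x] by (cases "x \<in> \<Omega>") auto
  hence "(%x. indicator \<Omega> x *\<^sub>R f x) = f" by (rule ext)
  thus ?thesis using assms(1) by (simp only: integral_restrict_space sets.Int_space_eq2)
qed

subsection \<open>The fundamental lemma of the calculus of variations\<close>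

lemma smooth_prod: "finite I ==> (!!i. i \<in> I ==> smooth (f i)) ==> smooth (%x. \<Prod>i\<in>I. f i x)"
proof (induction I rule: finite_induct)
  case empty show ?case by (simp add: smooth_const)
next
  case (insert i I)
  have "smooth (%x. f i x * (\<Prod>i\<in>I. f i x))"
    by (rule smooth_mult) (use insert in blast)+
  thus ?case using insert by simp
qed

lemma smooth_power: "smooth f ==> smooth (%x. f x ^ n)"
proof (induction n)
  case (Suc n) thus ?case using smooth_mult[of f "%x. f x ^ n"] by simp
qed (simp add: smooth_const)

text \<open>With \<open>q\<close> the product of \<open>1 - b\<^sub>c\<close> over bumps \<open>b\<^sub>c\<close> supported in the balls, \<open>0 \<le> q \<le> 1\<close>, and \<open>q < 1\<close> exactly on the
  union. So \<open>1 - q\<^sup>n\<close> tends to the indicator of the union.\<close>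
lemma test_approx_indicator:
  fixes C :: "(real^'d) set"
  assumes C: "finite C" and r: "r > 0" and sub: "(\<Union>c\<in>C. cball c r) \<subseteq> \<Omega>"
  obtains \<psi> where "!!n::nat. \<psi> n \<in> test_functions \<Omega>" "!!n x. 0 <= \<psi> n x & \<psi> n x <= indicator (\<Union>c\<in>C. ball c r) x"
    "!!x. (%n. \<psi> n x) \<longlonglongrightarrow> indicator (\<Union>c\<in>C. ball c r) x"
proof -
  have "\<forall>c::real^'d. \<exists>b. smooth b & (\<forall>x\<in>ball c r. b x > 0) & (\<forall>x. x \<notin> ball c r --> b x = 0) & (\<forall>x. b x <= 1) & (\<forall>x. 0 <= b x)"
  proof
    fix c :: "real^'d"
    show "\<exists>b. smooth b & (\<forall>x\<in>ball c r. b x > 0) & (\<forall>x. x \<notin> ball c r --> b x = 0) & (\<forall>x. b x <= 1) & (\<forall>x. 0 <= b x)"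
      by (rule bump_exists[OF r, of c]) blast
  qed
  from choice[OF this] obtain b where b': "\<forall>c::real^'d. smooth (b c) & (\<forall>x\<in>ball c r. b c x > 0)
    & (\<forall>x. x \<notin> ball c r --> b c x = 0) & (\<forall>x. b c x <= 1) & (\<forall>x. 0 <= b c x)" ..
  have b: "!!c. smooth (b c)" "!!c x. x \<in> ball c r ==> b c x > 0"
      "!!c x. x \<notin> ball c r ==> b c x = 0" "!!c x. b c x <= 1" "!!c x. 0 <= b c x"
    using b' by blast+
  define q where "q x = (\<Prod>c\<in>C. 1 - b c x)" for x
  define \<psi> where "\<psi> n x = 1 - q x ^ n" for n x
  have q01: "0 <= q x" "q x <= 1" for x
    unfolding q_def using b by (auto intro!: prod_nonneg prod_le_1)
  have qin: "q x < 1" if x: "x \<in> (\<Union>c\<in>C. ball c r)" for x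
  proof -
    obtain c where c: "c \<in> C" "x \<in> ball c r" using x by blast
    have "q x = (1 - b c x) * (\<Prod>c\<in>C-{c}. 1 - b c x)"
      unfolding q_def by (rule prod.remove[OF C c(1)])
    also have "\<dots> <= (1 - b c x) * 1"
      using b by (intro mult_left_mono prod_le_1) auto
    finally show ?thesis using b(2)[OF c(2)] by simp
  qed
  have qout: "q x = 1" if x: "x \<notin> (\<Union>c\<in>C. ball c r)" for x
    unfolding q_def using b(3) x by (intro prod.neutral) auto
  have "smooth (\<psi> n)" for n
    unfolding \<psi>_def q_def by (intro smooth_diff smooth_const smooth_power smooth_prod C b)
  moreover have "\<psi> n x = 0" if "x \<notin> (\<Union>c\<in>C. cball c r)" for n x
    unfolding \<psi>_def using that by (subst qout) auto
  moreover have "compact (\<Union>c\<in>C. cball c r)" using C by (intro compact_UN) auto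
  ultimately have 1: "\<psi> n \<in> test_functions \<Omega>" for n by (intro test_functionsI[OF _ _ sub]) auto
  have 2: "0 <= \<psi> n x & \<psi> n x <= indicator (\<Union>c\<in>C. ball c r) x" for n x
  proof (cases "x \<in> (\<Union>c\<in>C. ball c r)")
    case True thus ?thesis using q01[of x] by (auto simp: \<psi>_def power_le_one)
  next
    case False thus ?thesis by (simp add: \<psi>_def qout)
  qed
  have 3: "(%n. \<psi> n x) \<longlonglongrightarrow> indicator (\<Union>c\<in>C. ball c r) x" for x
  proof (cases "x \<in> (\<Union>c\<in>C. ball c r)")
    case True
    have "(%n. 1 - q x ^ n) \<longlonglongrightarrow> 1 - 0"
      by (intro tendsto_diff tendsto_const LIMSEQ_power_zero) (use q01[of x] qin[OF True] in auto)
    thus ?thesis using True by (simp add: \<psi>_def)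
  next
    case False thus ?thesis by (simp add: \<psi>_def qout)
  qed
  show thesis using that[OF 1 2 3] .
qed

lemma integrable_on_lmeasurable:
  fixes v :: "real^'d => real"
  assumes v: "sqint (lebesgue_on \<Omega>) v" and O: "\<Omega> \<in> sets lebesgue" and S: "S \<in> lmeasurable"
  shows "integrable (lebesgue_on \<Omega>) (%x. v x * indicator S x)"
proof (rule sqint_mult[OF v])
  have "sqint lebesgue (indicator S :: real^'d => real)"
  proof -
    have "(%x. (indicator S x :: real)\<^sup>2) = indicator S" by (auto simp: indicator_def)
    thus ?thesis using S by (auto simp: sqint_def fmeasurable_def)
  qed
  thus "sqint (lebesgue_on \<Omega>) (indicator S)" by (rule sqint_restrictI[OF O])
qed

text \<open>A compact set is the decreasing limit of finite unions of balls, and the indicator of such a union is a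
  bounded limit of test functions.\<close>
lemma fundamental_lemma_compact:
  fixes v :: "real^'d => real"
  assumes v: "sqint (lebesgue_on \<Omega>) v" and O: "open \<Omega>"
    and z: "!!\<phi>. \<phi> \<in> test_functions \<Omega> ==> (LINT x|lebesgue_on \<Omega>. v x * \<phi> x) = 0"
    and K: "compact K" "K \<subseteq> \<Omega>"
  shows "(LINT x|lebesgue_on \<Omega>. v x * indicator K x) = 0"
proof -
  have Os: "\<Omega> \<in> sets lebesgue" using O by simp
  have [measurable]: "v \<in> borel_measurable (lebesgue_on \<Omega>)" using v by (simp add: sqint_def)
  have lmeas: "S \<in> sets (lebesgue :: (real^'d) measure) ==> (indicator S :: real^'d => real) \<in> borel_measurable (lebesgue_on \<Omega>)" for S
    by (intro measurable_restrict_space1) simp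
  obtain d where d: "d > 0" "(\<Union>x\<in>K. cball x d) \<subseteq> \<Omega>"
    by (rule compact_subset_open_imp_cball_epsilon_subset[OF K(1) O K(2)])
  define r where "r n = d / real (Suc n)" for n
  have r: "r n > 0" "r n <= d" for n using d by (auto simp: r_def divide_le_eq)
  have "\<forall>n. \<exists>C. finite C & C \<subseteq> K & K \<subseteq> (\<Union>c\<in>C. ball c (r n))"
  proof
    fix n
    have "K \<subseteq> (\<Union>c\<in>K. ball c (r n))" using r(1)[of n] by auto
    then obtain C where "C \<subseteq> K" "finite C" "K \<subseteq> (\<Union>c\<in>C. ball c (r n))"
      by (rule compactE_image[OF K(1) open_ball])
    thus "\<exists>C. finite C & C \<subseteq> K & K \<subseteq> (\<Union>c\<in>C. ball c (r n))" by blast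
  qed
  from choice[OF this] obtain C where C': "\<forall>n. finite (C n) & C n \<subseteq> K & K \<subseteq> (\<Union>c\<in>C n. ball c (r n))" ..
  hence C: "!!n. finite (C n)" "!!n. C n \<subseteq> K" "!!n. K \<subseteq> (\<Union>c\<in>C n. ball c (r n))" by simp_all
  \<comment> \<open>Open neighbourhoods of \<open>K\<close> of width \<open>r n\<close>, inside \<open>\<Omega>\<close>.\<close>
  define T where "T n = (\<Union>c\<in>C n. ball c (r n))" for n
  obtain R where R: "!!x. x \<in> K ==> norm x <= R" using compact_imp_bounded[OF K(1)] by (auto simp: bounded_iff)
  have TR: "T n \<subseteq> cball 0 (R + d)" for n
  proof
    fix x assume "x \<in> T n"
    then obtain c where c: "c \<in> C n" "dist c x < r n" by (auto simp: T_def)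
    have "norm x <= norm c + dist c x" using norm_triangle_sub[of x c] by (simp add: dist_norm norm_minus_commute)
    thus "x \<in> cball 0 (R + d)" using R[of c] c C(2)[of n] r(2)[of n] by auto
  qed
  have lmR: "cball 0 (R+d) \<in> (lmeasurable :: (real^'d) set set)" by simp
  have intR: "integrable (lebesgue_on \<Omega>) (%x. \<bar>v x\<bar> * indicator (cball 0 (R+d)) x)"
    using integrable_abs[OF integrable_on_lmeasurable[OF v Os lmR]] by (simp add: abs_mult)
  have Tm: "T n \<in> sets lebesgue" for n 
  proof -
    have "open (T n)" unfolding T_def by blast
    thus ?thesis by simp
  qed
  have T0: "(LINT x|lebesgue_on \<Omega>. v x * indicator (T n) x) = 0" for n
  proof -
    have "(\<Union>c\<in>C n. cball c (r n)) \<subseteq> \<Omega>" 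
    proof
      fix x assume "x \<in> (\<Union>c\<in>C n. cball c (r n))"
      then obtain c where "c \<in> C n" "dist c x <= r n" by auto
      hence "c \<in> K" "x \<in> cball c d" using C(2)[of n] r(2)[of n] by auto
      thus "x \<in> \<Omega>" using d(2) by blast
    qed
    obtain \<psi> where
      \<psi>: "!!k::nat. \<psi> k \<in> test_functions \<Omega>" "!!k x. 0 <= \<psi> k x & \<psi> k x <= indicator (T n) x"
        "!!x. (%k. \<psi> k x) \<longlonglongrightarrow> indicator (T n) x"
      by (rule test_approx_indicator[OF C(1) r(1) \<open>(\<Union>c\<in>C n. cball c (r n)) \<subseteq> \<Omega>\<close>, folded T_def]) blast
    have [measurable]: "\<psi> k \<in> borel_measurable (lebesgue_on \<Omega>)" for k
      by (intro measurable_restrict_space1 smooth_measurable test_smooth[OF \<psi>(1)])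
    have "(%k. LINT x|lebesgue_on \<Omega>. v x * \<psi> k x) \<longlonglongrightarrow> (LINT x|lebesgue_on \<Omega>. v x * indicator (T n) x)"
    proof (rule integral_dominated_convergence[OF _ _ intR])
      show "(%x. v x * indicator (T n) x) \<in> borel_measurable (lebesgue_on \<Omega>)"
        using lmeas[OF Tm] by simp
      show "AE x in lebesgue_on \<Omega>. (%k. v x * \<psi> k x) \<longlonglongrightarrow> v x * indicator (T n) x"
        by (intro always_eventually allI tendsto_mult tendsto_const \<psi>)
      show "AE x in lebesgue_on \<Omega>. norm (v x * \<psi> k x) <= \<bar>v x\<bar> * indicator (cball 0 (R+d)) x" for k
      proof (intro always_eventually allI)
        fix x
        have "indicator (T n) x <= (indicator (cball 0 (R+d)) x :: real)"
          using TR[of n] by (auto simp: indicator_def)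
        hence "\<bar>\<psi> k x\<bar> <= indicator (cball 0 (R+d)) x" using \<psi>(2)[of k x] by linarith
        thus "norm (v x * \<psi> k x) <= \<bar>v x\<bar> * indicator (cball 0 (R+d)) x"
          by (simp add: abs_mult mult_left_mono)
      qed
    qed simp
    thus ?thesis using z[OF \<psi>(1)] by (simp add: LIMSEQ_const_iff)
  qed
  have "(%n. LINT x|lebesgue_on \<Omega>. v x * indicator (T n) x) \<longlonglongrightarrow> (LINT x|lebesgue_on \<Omega>. v x * indicator K x)"
  proof (rule integral_dominated_convergence[OF _ _ intR])
    have "K \<in> sets lebesgue" using K by (simp add: lebesgue_closedin compact_imp_closed)
    thus "(%x. v x * indicator K x) \<in> borel_measurable (lebesgue_on \<Omega>)"
      using lmeas by simp
    show "(%x. v x * indicator (T n) x) \<in> borel_measurable (lebesgue_on \<Omega>)" for n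
      using lmeas[OF Tm] by simp
    show "AE x in lebesgue_on \<Omega>. (%n. v x * indicator (T n) x) \<longlonglongrightarrow> v x * indicator K x"
    proof (intro always_eventually allI tendsto_mult tendsto_const)
      fix x
      show "(%n. indicator (T n) x) \<longlonglongrightarrow> (indicator K x :: real)"
      proof (cases "x \<in> K")
        case True
        hence "x \<in> T n" for n using C(3)[of n] unfolding T_def by blast
        thus ?thesis using True by simp
      next
        case False
        then obtain e where e: "e > 0" "ball x e \<subseteq> - K" using compact_imp_closed[OF K(1)]
          openE[of "-K" x] by (auto simp: closed_def)
        have "r \<longlonglongrightarrow> 0" unfolding r_def by (rule LIMSEQ_Suc[OF lim_const_over_n])
        hence "\<forall>\<^sub>F n in sequentially. r n < e" by (rule order_tendstoD(2)) (rule e(1))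
        hence "\<forall>\<^sub>F n in sequentially. 0 = (indicator (T n) x :: real)"
        proof eventually_elim
          case (elim n)
          have "x \<notin> T n"
          proof
            assume "x \<in> T n"
            then obtain c where c: "c \<in> C n" "dist c x < r n" by (auto simp: T_def)
            hence "c \<in> ball x e" using elim by (simp add: dist_commute)
            thus False using e c C(2) by blast
          qed
          thus ?case by simp
        qed
        hence "(%n. indicator (T n) x :: real) \<longlonglongrightarrow> 0"
          by (rule Lim_transform_eventually[OF tendsto_const])
        thus ?thesis using False by simp
      qed
    qed
    show "AE x in lebesgue_on \<Omega>. norm (v x * indicator (T n) x) <= \<bar>v x\<bar> * indicator (cball 0 (R+d)) x" for n
      using TR[of n] by (intro always_eventually allI) (auto simp: abs_mult indicator_def)
  qed
  thus ?thesis using T0 by (simp add: LIMSEQ_const_iff)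
qed

text \<open>The set where \<open>v > 0\<close> is exhausted by compact sets up to small measure, and \<open>v\<close> has integral zero over each
  of them.\<close>
lemma fundamental_lemma_le:
  fixes v :: "real^'d => real"
  assumes v: "sqint (lebesgue_on \<Omega>) v" and O: "open \<Omega>"
    and z: "!!\<phi>. \<phi> \<in> test_functions \<Omega> ==> (LINT x|lebesgue_on \<Omega>. v x * \<phi> x) = 0"
  shows "AE x in lebesgue_on \<Omega>. v x <= 0"
proof -
  have Os: "\<Omega> \<in> sets lebesgue" using O by simp
  have vm[measurable]: "v \<in> borel_measurable (lebesgue_on \<Omega>)" using v by (simp add: sqint_def)
  define E where "E R = {x \<in> \<Omega>. v x > 0} \<inter> cball 0 (real R)" for R
  have Em: "E R \<in> sets lebesgue" for R
  proof -
    have "{x \<in> space (lebesgue_on \<Omega>). v x > 0} \<in> sets (lebesgue_on \<Omega>)" by measurable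
    hence "{x \<in> \<Omega>. v x > 0} \<in> sets lebesgue"
      using Os by (simp add: space_restrict_space sets_restrict_space_iff)
    thus ?thesis unfolding E_def by (intro sets.Int) auto
  qed
  have "E R \<in> null_sets lebesgue" for R
  proof -
    have "emeasure lebesgue (E R) <= ennreal e" if e: "e > 0" for e
    proof -
      obtain T where T: "closed T" "T \<subseteq> E R" "E R - T \<in> lmeasurable" "emeasure lebesgue (E R - T) < ennreal e"
        by (rule sets_lebesgue_inner_closed[OF Em e])
      have "T \<subseteq> cball 0 (real R)" using T(2) by (auto simp: E_def)
      hence cT: "compact T" using T(1) compact_Int_closed[OF compact_cball, of T 0 "real R"] by (simp add: inf.absorb2)
      have TO: "T \<subseteq> \<Omega>" using T(2) by (auto simp: E_def)
      have Ts: "T \<in> sets lebesgue" using T(1) by (simp add: lebesgue_closedin)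
      have i0: "(LINT x|lebesgue_on \<Omega>. v x * indicator T x) = 0"
        by (rule fundamental_lemma_compact[OF v O z cT TO])
      have ii: "integrable (lebesgue_on \<Omega>) (%x. v x * indicator T x)"
        using cT by (intro integrable_on_lmeasurable v Os lmeasurable_compact)
      have "AE x in lebesgue_on \<Omega>. v x * indicator T x = 0"
        using i0 ii by (subst integral_nonneg_eq_0_iff_AE[symmetric])
          (use T(2) in \<open>auto simp: E_def indicator_def intro!: always_eventually\<close>)
      hence "AE x in lebesgue. x \<in> \<Omega> --> v x * indicator T x = 0"
        using Os by (subst (asm) AE_restrict_space_iff) auto
      hence "AE x in lebesgue. x \<notin> T"
      proof eventually_elim
        case (elim x)
        show ?case
        proof
          assume x: "x \<in> T"
          hence "v x > 0" "x \<in> \<Omega>" using T(2) by (auto simp: E_def)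
          thus False using elim x by simp
        qed
      qed
      hence "emeasure lebesgue T = 0"
        using Ts AE_iff_null_sets[OF Ts] by auto
      moreover have "emeasure lebesgue (E R) = emeasure lebesgue T + emeasure lebesgue (E R - T)"
        using T Ts Em by (subst plus_emeasure) (auto simp: Un_absorb1)
      ultimately show ?thesis using T(4) by (simp only: add_0 less_imp_le)
    qed
    note le = this
    have "emeasure lebesgue (E R) <= 0"
    proof (rule ennreal_le_epsilon)
      fix e :: real assume "0 < e"
      from le[OF this] show "emeasure lebesgue (E R) <= 0 + ennreal e" by (simp only: add_0)
    qed
    thus ?thesis using Em[of R] by (simp add: null_sets_def)
  qed
  hence "(\<Union>R. E R) \<in> null_sets lebesgue" by auto
  hence "AE x in lebesgue. x \<notin> (\<Union>R. E R)" by (rule AE_not_in)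
  hence "AE x in lebesgue. x \<in> \<Omega> --> v x <= 0"
  proof eventually_elim
    case (elim x)
    obtain R where "norm x <= real R" using real_arch_simple by blast
    thus ?case using elim by (auto simp: E_def not_less)
  qed
  thus ?thesis using Os by (subst AE_restrict_space_iff) auto
qed

lemma fundamental_lemma:
  fixes v :: "real^'d => real"
  assumes v: "sqint (lebesgue_on \<Omega>) v" and O: "open \<Omega>"
    and z: "!!\<phi>. \<phi> \<in> test_functions \<Omega> ==> (LINT x|lebesgue_on \<Omega>. v x * \<phi> x) = 0"
  shows "AE x in lebesgue_on \<Omega>. v x = 0"
proof -
  have "AE x in lebesgue_on \<Omega>. v x <= 0" by (rule fundamental_lemma_le[OF assms])
  moreover have "AE x in lebesgue_on \<Omega>. - v x <= 0"
    by (rule fundamental_lemma_le) (use assms sqint_scale[OF v, of "-1"] in auto)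
  ultimately show ?thesis by eventually_elim simp
qed

text \<open>By the fundamental lemma only zero is orthogonal to all test functions.\<close>
lemma test_dense_L2:
  fixes v :: "real^'d => real"
  assumes O: "open \<Omega>" and v: "sqint (lebesgue_on \<Omega>) v" and "e > 0"
  shows "\<exists>\<phi>\<in>test_functions \<Omega>. nrm (lebesgue_on \<Omega>) (%x. \<phi> x - v x) < e"
proof (rule L2_dense)
  show "sqint (lebesgue_on \<Omega>) f" if "f \<in> test_functions \<Omega>" for f
    using O by (intro test_sqint_on[OF that]) simp
  show "AE x in lebesgue_on \<Omega>. w x = 0" if "sqint (lebesgue_on \<Omega>) w"
    "!!f. f \<in> test_functions \<Omega> ==> (LINT x|lebesgue_on \<Omega>. w x * f x) = 0" for w
    by (rule fundamental_lemma[OF that(1) O that(2)])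
qed (use assms test_zero test_lin in auto)

section \<open>Mixed derivatives and convolution\<close>

lemma smooth_line_derivative:
  assumes "smooth \<psi>"
  shows "((%t. \<psi> (x + t *\<^sub>R axis i 1)) has_real_derivative pd i \<psi> (x + t *\<^sub>R axis i 1)) (at t)"
proof -
  have "((%t. x + t *\<^sub>R axis i (1::real)) has_derivative (%h. h *\<^sub>R axis i 1)) (at t)"
    by (auto intro!: derivative_eq_intros)
  from has_derivative_compose[OF this differentiable_has_derivative_pd[OF smoothD(2)[OF assms]]]
  have d: "((%t. \<psi> (x + t *\<^sub>R axis i 1)) has_derivative
      (%h. \<Sum>j\<in>UNIV. (h *\<^sub>R axis i (1::real)) $ j * pd j \<psi> (x + t *\<^sub>R axis i 1))) (at t)" .
  have "(\<Sum>j\<in>UNIV. (h *\<^sub>R axis i (1::real)) $ j * pd j \<psi> y) = h * pd i \<psi> y" for h y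
    by (simp add: axis_def if_distrib[of "%a. a * _"] if_distrib[of "%a. _ * a"] cong: if_cong)
  thus ?thesis using d by (simp only: has_field_derivative_def mult.commute[of _ "pd i \<psi> _"])
qed

lemma diffquot_tendsto:
  assumes "smooth \<psi>" "t \<longlonglongrightarrow> 0" "!!n. t n ~= (0::real)"
  shows "(%n. (\<psi> (x + t n *\<^sub>R axis i 1) - \<psi> x) / t n) \<longlonglongrightarrow> pd i \<psi> x"
proof -
  have "((%h. (\<psi> (x + h *\<^sub>R axis i 1) - \<psi> x) / h) \<longlongrightarrow> pd i \<psi> x) (at 0)"
    using smooth_line_derivative[OF assms(1), of x i 0] by (simp add: has_field_derivative_iff)
  thus ?thesis using assms(2,3) by (auto simp: tendsto_at_iff_sequentially o_def)
qed

lemma diffquot_bound: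
  assumes "smooth \<psi>" "!!y. \<bar>pd i \<psi> y\<bar> <= L" "t ~= 0"
  shows "\<bar>(\<psi> (x + t *\<^sub>R axis i 1) - \<psi> x) / t\<bar> <= L"
proof -
  have "norm (\<psi> (x + t *\<^sub>R axis i 1) - \<psi> (x + 0 *\<^sub>R axis i 1)) <= L * norm (t - 0)"
    by (rule field_differentiable_bound[of UNIV "%t. \<psi> (x + t *\<^sub>R axis i 1)" "%t. pd i \<psi> (x + t *\<^sub>R axis i 1)"])
       (use assms in \<open>auto intro: smooth_line_derivative[THEN has_field_derivative_at_within]\<close>)
  thus ?thesis using assms(3) by (simp add: abs_div divide_le_eq)
qed

subsection \<open>Mixed partial derivatives\<close>

text \<open>Two applications of the mean value theorem, one for each direction.\<close>
lemma second_difference: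
  assumes f: "smooth f" and h: "h > 0"
  shows "\<exists>p. dist p x <= 2 * h &
    f (x + h *\<^sub>R axis i 1 + h *\<^sub>R axis j 1) - f (x + h *\<^sub>R axis i 1) - f (x + h *\<^sub>R axis j 1) + f x
      = h * (h * pd j (pd i f) p)"
proof -
  define a b where "a = (axis i 1 :: real^'a)" and "b = (axis j 1 :: real^'a)"
  define g where "g s = f ((x + h *\<^sub>R b) + s *\<^sub>R a) - f (x + s *\<^sub>R a)" for s
  have "(g has_real_derivative (pd i f ((x + h *\<^sub>R b) + s *\<^sub>R a) - pd i f (x + s *\<^sub>R a))) (at s)" for s
    unfolding g_def a_def by (intro DERIV_diff smooth_line_derivative f)
  hence "\<exists>s. s > 0 & s < h & g h - g 0 = (h - 0) * (pd i f ((x + h *\<^sub>R b) + s *\<^sub>R a) - pd i f (x + s *\<^sub>R a))"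
    by (intro MVT2 h)
  then obtain s where s: "0 < s" "s < h" "g h - g 0 = h * (pd i f ((x + h *\<^sub>R b) + s *\<^sub>R a) - pd i f (x + s *\<^sub>R a))"
    by auto
  define k where "k t = pd i f ((x + s *\<^sub>R a) + t *\<^sub>R b)" for t
  have "(k has_real_derivative (pd j (pd i f) ((x + s *\<^sub>R a) + t *\<^sub>R b))) (at t)" for t
    unfolding k_def b_def by (intro smooth_line_derivative smoothD(3) f)
  hence "\<exists>t. t > 0 & t < h & k h - k 0 = (h - 0) * (pd j (pd i f) ((x + s *\<^sub>R a) + t *\<^sub>R b))"
    by (intro MVT2 h)
  then obtain t where t: "0 < t" "t < h" "k h - k 0 = h * (pd j (pd i f) ((x + s *\<^sub>R a) + t *\<^sub>R b))"
    by auto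
  have "k h - k 0 = pd i f ((x + h *\<^sub>R b) + s *\<^sub>R a) - pd i f (x + s *\<^sub>R a)"
    by (simp add: k_def algebra_simps)
  hence "g h - g 0 = h * (h * (pd j (pd i f) ((x + s *\<^sub>R a) + t *\<^sub>R b)))"
    using s(3) t(3) by simp
  moreover have "g h - g 0 = f (x + h *\<^sub>R a + h *\<^sub>R b) - f (x + h *\<^sub>R a) - f (x + h *\<^sub>R b) + f x"
    by (simp add: g_def algebra_simps)
  moreover have "dist ((x + s *\<^sub>R a) + t *\<^sub>R b) x <= 2 * h"
  proof -
    have "dist ((x + s *\<^sub>R a) + t *\<^sub>R b) x = norm (s *\<^sub>R a + t *\<^sub>R b)" by (simp add: dist_norm add.assoc)
    also have "\<dots> <= norm (s *\<^sub>R a) + norm (t *\<^sub>R b)" by (rule norm_triangle_ineq)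
    also have "\<dots> = s + t" using s t by (simp add: a_def b_def)
    finally show ?thesis using s t by simp
  qed
  ultimately show ?thesis unfolding a_def b_def by (intro exI conjI) auto
qed

text \<open>The second difference is symmetric in the two directions, so both mixed derivatives are limits of it.\<close>
lemma pd_commute:
  assumes f: "smooth f" shows "pd i (pd j f) = pd j (pd i f)"
proof
  fix x
  define h where "h n = 1 / real (Suc n)" for n
  have h: "h \<longlonglongrightarrow> 0" "h n > 0" for n
    unfolding h_def using LIMSEQ_Suc[OF lim_1_over_n] by auto
  have "\<forall>n. \<exists>p q. dist p x <= 2 * h n & dist q x <= 2 * h n & pd j (pd i f) p = pd i (pd j f) q"
  proof
    fix n
    obtain p where p: "dist p x <= 2 * h n"
      "f (x + h n *\<^sub>R axis i 1 + h n *\<^sub>R axis j 1) - f (x + h n *\<^sub>R axis i 1) - f (x + h n *\<^sub>R axis j 1) + f x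
      = h n * (h n * pd j (pd i f) p)" using second_difference[OF f h(2)] by blast
    obtain q where q: "dist q x <= 2 * h n"
      "f (x + h n *\<^sub>R axis j 1 + h n *\<^sub>R axis i 1) - f (x + h n *\<^sub>R axis j 1) - f (x + h n *\<^sub>R axis i 1) + f x
      = h n * (h n * pd i (pd j f) q)" using second_difference[OF f h(2)] by blast
    have sw: "x + h n *\<^sub>R axis j 1 + h n *\<^sub>R axis i 1 = x + h n *\<^sub>R axis i 1 + h n *\<^sub>R axis j 1" by simp
    have "h n * (h n * pd j (pd i f) p) = h n * (h n * pd i (pd j f) q)"
      using p(2) q(2) unfolding sw by linarith
    hence "pd j (pd i f) p = pd i (pd j f) q" using h(2)[of n] by simp
    thus "\<exists>p q. dist p x <= 2 * h n & dist q x <= 2 * h n & pd j (pd i f) p = pd i (pd j f) q"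
      using p q by blast
  qed
  from choice[OF this] obtain p where "\<forall>n. \<exists>q. dist (p n) x <= 2 * h n & dist q x <= 2 * h n & pd j (pd i f) (p n) = pd i (pd j f) q" ..
  from choice[OF this] obtain q where pq: "\<forall>n. dist (p n) x <= 2 * h n & dist (q n) x <= 2 * h n & pd j (pd i f) (p n) = pd i (pd j f) (q n)" ..
  have h2: "(%n. 2 * h n) \<longlonglongrightarrow> 0" using tendsto_mult_right_zero[OF h(1), of 2] by simp
  have pl: "p \<longlonglongrightarrow> x" and ql: "q \<longlonglongrightarrow> x"
  proof -
    have "dist (p n) x <= dist (2 * h n) 0" "dist (q n) x <= dist (2 * h n) 0" for n
      using pq h(2)[of n] by auto
    thus "p \<longlonglongrightarrow> x" "q \<longlonglongrightarrow> x"
      by (auto intro!: metric_tendsto_imp_tendsto[OF h2] always_eventually simp del: dist_0_norm)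
  qed
  have c: "isCont (pd i (pd j f)) x" for i j
    using smoothD(4)[OF smoothD(3)[OF smoothD(3)[OF f]]] by (simp add: continuous_on_eq_continuous_at)
  have "(%n. pd j (pd i f) (p n)) \<longlonglongrightarrow> pd j (pd i f) x" by (rule isCont_tendsto_compose[OF c pl])
  moreover have "(%n. pd i (pd j f) (q n)) \<longlonglongrightarrow> pd i (pd j f) x" by (rule isCont_tendsto_compose[OF c ql])
  ultimately show "pd i (pd j f) x = pd j (pd i f) x"
    using pq by (simp add: LIMSEQ_unique)
qed

subsection \<open>Convolution and mollification\<close>

definition loc_integrable :: "(real^'d => real) => bool" where
  "loc_integrable v \<longleftrightarrow> v \<in> borel_measurable lebesgue &
     (\<forall>R. integrable lebesgue (%x. indicator (cball 0 R) x * v x))"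

definition conv :: "(real^'d => real) => (real^'d => real) => real^'d => real" where
  "conv \<eta> v x = (LINT y|lebesgue. \<eta> (x - y) * v y)"

lemma test_reflect:
  assumes "\<eta> \<in> test_functions UNIV"
  shows "(%y. \<eta> (x - y)) \<in> test_functions UNIV" "pd i (%y. \<eta> (x - y)) = (%y. - pd i \<eta> (x - y))"
proof -
  have sm: "smooth \<eta>" by (rule test_smooth[OF assms])
  obtain K where K: "compact K" "K \<subseteq> UNIV" "!!x. x \<notin> K ==> \<eta> x = 0" by (rule test_functionsE[OF assms]) blast
  have "(%y. \<eta> (x + (-1) *\<^sub>R y)) \<in> test_functions UNIV"
  proof (rule test_functionsI)
    show "smooth (%y. \<eta> (x + (-1) *\<^sub>R y))" by (rule smooth_affine[OF sm])
    show "compact ((%y. x - y) ` K)" by (intro compact_continuous_image K continuous_intros)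
    show "\<eta> (x + (-1) *\<^sub>R y) = 0" if "y \<notin> (%y. x - y) ` K" for y
      using that K(3)[of "x - y"] by (force simp: image_iff)
  qed simp
  thus "(%y. \<eta> (x - y)) \<in> test_functions UNIV" by simp
  show "pd i (%y. \<eta> (x - y)) = (%y. - pd i \<eta> (x - y))"
    using smooth_pd_affine[OF sm, of i x "-1"] by simp
qed

lemma test_support_ball:
  assumes "\<eta> \<in> test_functions \<Omega>" obtains R where "R > 0" "!!x. norm x > R ==> \<eta> x = 0"
proof -
  obtain K where K: "compact K" "K \<subseteq> \<Omega>" "!!x. x \<notin> K ==> \<eta> x = 0" by (rule test_functionsE[OF assms]) blast
  obtain R where R: "R > 0" "\<forall>x\<in>K. norm x <= R" using compact_imp_bounded[OF K(1)] by (auto simp: bounded_pos)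
  show thesis by (rule that[OF R(1)]) (use R K(3) not_less in blast)
qed

lemma conv_integrable:
  assumes \<eta>: "\<eta> \<in> test_functions UNIV" and v: "loc_integrable v"
  shows "integrable lebesgue (%y. \<eta> (x - y) * v y)"
proof -
  obtain M where M: "M > 0" "!!x. \<bar>\<eta> x\<bar> <= M" by (rule test_bounded[OF \<eta>]) blast
  obtain R where R: "R > 0" "!!x. norm x > R ==> \<eta> x = 0" by (rule test_support_ball[OF \<eta>]) blast
  have [measurable]: "v \<in> borel_measurable lebesgue" using v by (simp add: loc_integrable_def)
  have [measurable]: "(%y. \<eta> (x - y)) \<in> borel_measurable lebesgue"
    by (intro smooth_measurable test_smooth[OF test_reflect(1)[OF \<eta>]])
  show ?thesis
  proof (rule Bochner_Integration.integrable_bound)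
    show "integrable lebesgue (%y. M * (indicator (cball 0 (norm x + R)) y * v y))"
      using v by (simp add: loc_integrable_def)
    show "AE y in lebesgue. norm (\<eta> (x - y) * v y) <= norm (M * (indicator (cball 0 (norm x + R)) y * v y))"
    proof (intro always_eventually allI)
      fix y
      show "norm (\<eta> (x - y) * v y) <= norm (M * (indicator (cball 0 (norm x + R)) y * v y))"
      proof (cases "y \<in> cball 0 (norm x + R)")
        case True thus ?thesis using M by (simp add: abs_mult mult_right_mono)
      next
        case False
        have "norm y <= norm x + norm (x - y)" using norm_triangle_ineq4[of x "x - y"] by simp
        thus ?thesis using R(2)[of "x - y"] False by simp
      qed
    qed
  qed simp
qed

lemma test_lipschitz:
  fixes \<eta> :: "real^'d => real"
  assumes \<eta>: "\<eta> \<in> test_functions UNIV"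
  obtains L where "L > 0" "!!a b. \<bar>\<eta> a - \<eta> b\<bar> <= L * norm (a - b)" "!!x h. \<bar>\<Sum>i\<in>UNIV. h $ i * pd i \<eta> x\<bar> <= L * norm h"
proof -
  have "\<forall>i. \<exists>M. M > 0 & (\<forall>x. \<bar>pd i \<eta> x\<bar> <= M)"
  proof
    fix i show "\<exists>M. M > 0 & (\<forall>x. \<bar>pd i \<eta> x\<bar> <= M)"
      by (rule test_bounded[OF test_pd[OF \<eta>, of i]]) blast
  qed
  from choice[OF this] obtain M where M: "\<forall>i. M i > 0 & (\<forall>x. \<bar>pd i \<eta> x\<bar> <= M i)" ..
  define L where "L = (\<Sum>i\<in>UNIV. M i)"
  have L: "L > 0" unfolding L_def using M by (intro sum_pos) auto
  have D: "\<bar>\<Sum>i\<in>UNIV. h $ i * pd i \<eta> x\<bar> <= L * norm h" for x h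
  proof -
    have "\<bar>\<Sum>i\<in>UNIV. h $ i * pd i \<eta> x\<bar> <= (\<Sum>i\<in>UNIV. \<bar>h $ i * pd i \<eta> x\<bar>)" by (rule sum_abs)
    also have "\<dots> <= (\<Sum>i\<in>UNIV. norm h * M i)"
      using M component_le_norm_cart[of h] by (intro sum_mono) (auto simp: abs_mult intro!: mult_mono)
    finally show ?thesis by (simp add: L_def sum_distrib_left mult.commute)
  qed
  have lip: "\<bar>\<eta> a - \<eta> b\<bar> <= L * norm (a - b)" for a b
  proof -
    have "norm (\<eta> a - \<eta> b) <= L * norm (a - b)"
    proof (rule differentiable_bound[of UNIV])
      show "(\<eta> has_derivative (%h. \<Sum>i\<in>UNIV. h $ i * pd i \<eta> x)) (at x within UNIV)" for x
        by (intro differentiable_has_derivative_pd smoothD(2) test_smooth[OF \<eta>])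
      show "onorm (%h. \<Sum>i\<in>UNIV. h $ i * pd i \<eta> x) <= L" for x
        by (rule onorm_le) (use D in auto)
    qed auto
    thus ?thesis by simp
  qed
  show thesis by (rule that[OF L lip D])
qed

text \<open>As \<open>\<eta>\<close> is Lipschitz with compact support, its difference quotients are bounded and, for bounded increments, vanish
  outside a fixed ball, where \<open>v\<close> is integrable; so they converge under the integral.\<close>
lemma conv_has_derivative:
  fixes \<eta> :: "real^'d => real"
  assumes \<eta>: "\<eta> \<in> test_functions UNIV" and v: "loc_integrable v"
  shows "(conv \<eta> v has_derivative (%h. \<Sum>i\<in>UNIV. h $ i * conv (pd i \<eta>) v x)) (at x)"
proof -
  obtain L where L: "L > 0" "!!a b. \<bar>\<eta> a - \<eta> b\<bar> <= L * norm (a - b)"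
    "!!x h. \<bar>\<Sum>i\<in>UNIV. h $ i * pd i \<eta> x\<bar> <= L * norm h" by (rule test_lipschitz[OF \<eta>]) blast
  obtain R where R: "R > 0" "!!x. norm x > R ==> \<eta> x = 0" by (rule test_support_ball[OF \<eta>]) blast
  have sm: "smooth \<eta>" by (rule test_smooth[OF \<eta>])
  have vm[measurable]: "v \<in> borel_measurable lebesgue" using v by (simp add: loc_integrable_def)
  have [measurable]: "(%y. \<eta> (z - y)) \<in> borel_measurable lebesgue" for z
    by (intro smooth_measurable test_smooth[OF test_reflect(1)[OF \<eta>]])
  have [measurable]: "(%y. pd i \<eta> (z - y)) \<in> borel_measurable lebesgue" for z i
    by (intro smooth_measurable test_smooth[OF test_reflect(1)[OF test_pd[OF \<eta>]]])
  have pd0: "pd i \<eta> z = 0" if "norm z > R" for i z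
  proof -
    have "pd i \<eta> z = pd i (%x. 0) z"
    proof (rule pd_local[of "- cball 0 R"])
      show "\<eta> y = 0" if "y \<in> - cball 0 R" for y using that R(2)[of y] by simp
    qed (use that smooth_const in \<open>auto simp: open_Compl\<close>)
    thus ?thesis by (simp add: pd_const)
  qed
  define Q where "Q h y = (\<eta> (x + h - y) - \<eta> (x - y) - (\<Sum>i\<in>UNIV. h $ i * pd i \<eta> (x - y))) / norm h * v y" for h y
  have Qint: "(LINT y|lebesgue. Q h y) = (conv \<eta> v (x + h) - conv \<eta> v x - (\<Sum>i\<in>UNIV. h $ i * conv (pd i \<eta>) v x)) / norm h" for h
  proof -
    have i1: "integrable lebesgue (%y. \<eta> (z - y) * v y)" for z by (rule conv_integrable[OF \<eta> v])
    have i2: "integrable lebesgue (%y. h $ i * (pd i \<eta> (x - y) * v y))" for i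
      by (intro integrable_mult_right conv_integrable[OF test_pd[OF \<eta>] v])
    have "Q h = (%y. (\<eta> (x + h - y) * v y - \<eta> (x - y) * v y - (\<Sum>i\<in>UNIV. h $ i * (pd i \<eta> (x - y) * v y))) / norm h)"
      by (auto simp: Q_def sum_distrib_right left_diff_distrib mult.assoc)
    hence "(LINT y|lebesgue. Q h y) = ((LINT y|lebesgue. \<eta> (x + h - y) * v y) - (LINT y|lebesgue. \<eta> (x - y) * v y)
        - (\<Sum>i\<in>UNIV. LINT y|lebesgue. h $ i * (pd i \<eta> (x - y) * v y))) / norm h"
      using i1 i2 by simp
    thus ?thesis by (simp add: conv_def)
  qed
  have "(%h. norm (conv \<eta> v (x + h) - conv \<eta> v x - (\<Sum>i\<in>UNIV. h $ i * conv (pd i \<eta>) v x)) / norm h) \<midarrow>0\<rightarrow> 0"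
    unfolding tendsto_at_iff_sequentially o_def
  proof (intro allI impI)
    fix h :: "nat => real^'d"
    assume hn: "\<forall>n. h n \<in> UNIV - {0}" and hl: "h \<longlonglongrightarrow> 0"
    have "Bseq h" using hl by (intro convergent_imp_Bseq) (auto simp: convergent_def)
    then obtain S where S: "S > 0" "!!n. norm (h n) <= S" by (auto simp: Bseq_def)
    have "(%n. LINT y|lebesgue. Q (h n) y) \<longlonglongrightarrow> (LINT y|(lebesgue :: (real^'d) measure). 0)"
    proof (rule integral_dominated_convergence)
      show "integrable lebesgue (%y. 2 * L * \<bar>indicator (cball 0 (norm x + S + R)) y * v y\<bar>)"
        using v by (intro integrable_mult_right integrable_abs) (simp add: loc_integrable_def)
      show "Q (h n) \<in> borel_measurable lebesgue" for n unfolding Q_def by measurable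
      show "AE y in lebesgue. (%n. Q (h n) y) \<longlonglongrightarrow> 0"
      proof (intro always_eventually allI)
        fix y
        have "(%h. norm (\<eta> ((x - y) + h) - \<eta> (x - y) - (\<Sum>i\<in>UNIV. h $ i * pd i \<eta> (x - y))) / norm h) \<midarrow>0\<rightarrow> 0"
          using differentiable_has_derivative_pd[OF smoothD(2)[OF sm], of "x - y"] by (simp add: has_derivative_at)
        hence l: "(%n. norm (\<eta> ((x - y) + h n) - \<eta> (x - y) - (\<Sum>i\<in>UNIV. h n $ i * pd i \<eta> (x - y))) / norm (h n)) \<longlonglongrightarrow> 0"
          using hn hl by (auto simp: tendsto_at_iff_sequentially o_def)
        have "(%n. norm (Q (h n) y)) = (%n. norm (\<eta> ((x - y) + h n) - \<eta> (x - y) - (\<Sum>i\<in>UNIV. h n $ i * pd i \<eta> (x - y))) / norm (h n) * \<bar>v y\<bar>)"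
          by (simp add: Q_def abs_mult add_diff_eq diff_add_eq)
        hence "(%n. norm (Q (h n) y)) \<longlonglongrightarrow> 0" using tendsto_mult_left_zero[OF l] by simp
        thus "(%n. Q (h n) y) \<longlonglongrightarrow> 0" by (rule tendsto_norm_zero_cancel)
      qed
      show "AE y in lebesgue. norm (Q (h n) y) <= 2 * L * \<bar>indicator (cball 0 (norm x + S + R)) y * v y\<bar>" for n
      proof (intro always_eventually allI)
        fix y
        have np: "norm (h n) > 0" using hn by auto
        show "norm (Q (h n) y) <= 2 * L * \<bar>indicator (cball 0 (norm x + S + R)) y * v y\<bar>"
        proof (cases "y \<in> cball 0 (norm x + S + R)")
          case True
          have "\<bar>\<eta> (x + h n - y) - \<eta> (x - y)\<bar> <= L * norm (h n)"
            using L(2)[of "x + h n - y" "x - y"] by simp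
          hence "\<bar>\<eta> (x + h n - y) - \<eta> (x - y) - (\<Sum>i\<in>UNIV. h n $ i * pd i \<eta> (x - y))\<bar> <= 2 * L * norm (h n)"
            using L(3)[of "h n" "x - y"] by linarith
          hence "\<bar>\<eta> (x + h n - y) - \<eta> (x - y) - (\<Sum>i\<in>UNIV. h n $ i * pd i \<eta> (x - y))\<bar> / norm (h n) <= 2 * L"
            using np by (simp add: divide_le_eq)
          hence "\<bar>\<eta> (x + h n - y) - \<eta> (x - y) - (\<Sum>i\<in>UNIV. h n $ i * pd i \<eta> (x - y))\<bar> / norm (h n) * \<bar>v y\<bar> <= 2 * L * \<bar>v y\<bar>"
            by (rule mult_right_mono) simp
          thus ?thesis using True by (simp add: Q_def abs_mult)
        next
          case False
          have "norm y <= norm x + norm (x - y)" using norm_triangle_ineq4[of x "x - y"] by simp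
          hence g1: "norm (x - y) > R" using False S(1) by simp
          have "norm (x - y) <= norm (x + h n - y) + norm (h n)"
            using norm_triangle_ineq4[of "x + h n - y" "h n"] by (simp add: algebra_simps)
          hence g2: "norm (x + h n - y) > R" using False S(2)[of n] \<open>norm y <= norm x + norm (x - y)\<close> by simp
          show ?thesis using R(2)[OF g1] R(2)[OF g2] pd0[OF g1] False by (simp add: Q_def)
        qed
      qed
    qed simp
    hence "(%n. norm (LINT y|lebesgue. Q (h n) y)) \<longlonglongrightarrow> 0" using tendsto_norm_zero by fastforce
    thus "(%n. norm (conv \<eta> v (x + h n) - conv \<eta> v x - (\<Sum>i\<in>UNIV. h n $ i * conv (pd i \<eta>) v x)) / norm (h n)) \<longlonglongrightarrow> 0"
      by (simp add: Qint)
  qed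
  moreover have "bounded_linear (%h::real^'d. \<Sum>i\<in>UNIV. h $ i * conv (pd i \<eta>) v x)"
    by (intro bounded_linear_sum bounded_linear_mult_const bounded_linear_vec_nth)
  ultimately show ?thesis by (simp add: has_derivative_at)
qed

lemma conv_smooth:
  assumes \<eta>: "\<eta> \<in> test_functions UNIV" and v: "loc_integrable v"
  shows "smooth (conv \<eta> v)" "pd i (conv \<eta> v) = conv (pd i \<eta>) v"
proof -
  have pdc: "pd i (conv \<eta> v) = conv (pd i \<eta>) v" if "\<eta> \<in> test_functions UNIV" for \<eta> i
    by (rule ext, subst has_derivative_pd[OF conv_has_derivative[OF that v]])
       (simp add: axis_def if_distrib[of "%a. a * _"] cong: if_cong)
  show "pd i (conv \<eta> v) = conv (pd i \<eta>) v" by (rule pdc[OF \<eta>])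
  have "Ck k (conv \<eta> v)" if "\<eta> \<in> test_functions UNIV" for k \<eta>
    using that
  proof (induction k arbitrary: \<eta>)
    case 0
    show ?case using has_derivative_continuous[OF conv_has_derivative[OF 0 v]] by (simp add: continuous_on_eq_continuous_at)
  next
    case (Suc k)
    show ?case using differentiableI[OF conv_has_derivative[OF Suc.prems v]] Suc.IH[OF test_pd[OF Suc.prems]]
      by (simp add: pdc[OF Suc.prems])
  qed
  thus "smooth (conv \<eta> v)" using \<eta> by (simp add: smooth_def)
qed

lemma mollifier_exists:
  "\<exists>\<eta> \<in> test_functions UNIV. (\<forall>x. \<eta> x >= 0) & (LINT x|(lebesgue :: (real^'d) measure). \<eta> x) = 1
      & (\<forall>x. norm x >= r --> \<eta> x = 0)" if r: "r > 0" for r :: real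
proof -
  obtain b where b: "smooth b" "!!x::real^'d. x \<in> ball 0 r ==> b x > 0" "!!x. x \<notin> ball 0 r ==> b x = 0"
    "!!x. b x <= 1" "!!x. 0 <= b x" by (rule bump_exists[OF r, of 0]) blast
  have t: "b \<in> test_functions UNIV"
    by (rule test_functionsI[OF b(1) compact_cball[of 0 r]]) (use b(3) in auto)
  have int: "integrable lebesgue b" by (rule test_sqint[OF t])
  define I where "I = (LINT x|lebesgue. b x)"
  have I0: "I >= 0" unfolding I_def by (rule Bochner_Integration.integral_nonneg) (rule b(5))
  have "I ~= 0"
  proof
    assume "I = 0"
    hence "AE x in lebesgue. b x = 0"
      unfolding I_def using int b(5) by (subst (asm) integral_nonneg_eq_0_iff_AE) auto
    hence "AE x in lebesgue. x \<notin> ball (0::real^'d) r" 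
    proof eventually_elim
      case (elim x) thus ?case using b(2)[of x] by auto
    qed
    hence "ball 0 r \<in> null_sets (lebesgue :: (real^'d) measure)" by (subst AE_iff_null_sets) auto
    hence "negligible (ball (0::real^'d) r)" by (simp add: negligible_iff_null_sets)
    thus False using open_not_negligible[of "ball (0::real^'d) r"] r by simp
  qed
  hence I: "I > 0" using I0 by simp
  have "(%x. (1 / I) * b x) \<in> test_functions UNIV"
    using test_smooth_mult[OF smooth_const t] .
  moreover have "(LINT x|lebesgue. (1 / I) * b x) = 1" using I by (simp add: I_def)
  moreover have "\<forall>x. (1 / I) * b x >= 0" using I b(5) by simp
  moreover have "\<forall>x. norm x >= r --> (1 / I) * b x = 0" using b(3) by simp
  ultimately show ?thesis by (intro bexI[of _ "%x. (1 / I) * b x"] conjI)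
qed

lemma sqint_loc_integrable:
  fixes v :: "real^'d => real"
  assumes v: "sqint lebesgue v" shows "loc_integrable v"
  unfolding loc_integrable_def
proof (intro conjI allI)
  show "v \<in> borel_measurable lebesgue" using v by (simp add: sqint_def)
  fix R
  have "integrable lebesgue (%x. v x * indicator (cball 0 R) x)"
    using integrable_on_lmeasurable[of UNIV v "cball 0 R"] v by (simp add: lebesgue_on_UNIV_eq)
  thus "integrable lebesgue (%x. indicator (cball 0 R) x * v x)" by (simp add: mult.commute)
qed

lemma conv_diff:
  assumes "\<eta> \<in> test_functions UNIV" "loc_integrable u" "loc_integrable v"
  shows "conv \<eta> (%x. u x - v x) x = conv \<eta> u x - conv \<eta> v x"
  unfolding conv_def using conv_integrable[OF assms(1,2), of x] conv_integrable[OF assms(1,3), of x]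
  by (simp add: right_diff_distrib)

lemma conv_sq_le:
  fixes v :: "real^'d => real"
  assumes \<eta>: "\<eta> \<in> test_functions UNIV" and pos: "!!x. \<eta> x >= 0" and one: "(LINT x|lebesgue. \<eta> x) = 1"
    and v: "sqint lebesgue v"
  shows "integrable lebesgue (%y. \<eta> (x - y) * (v y)\<^sup>2)" "(conv \<eta> v x)\<^sup>2 <= (LINT y|lebesgue. \<eta> (x - y) * (v y)\<^sup>2)"
proof -
  obtain M where M: "M > 0" "!!x. \<bar>\<eta> x\<bar> <= M" by (rule test_bounded[OF \<eta>]) blast
  have vm[measurable]: "v \<in> borel_measurable lebesgue" using v by (simp add: sqint_def)
  have t: "(%y. \<eta> (x - y)) \<in> test_functions UNIV" by (rule test_reflect[OF \<eta>])
  have [measurable]: "(%y. \<eta> (x - y)) \<in> borel_measurable lebesgue"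
    by (intro smooth_measurable test_smooth[OF t])
  show i2: "integrable lebesgue (%y. \<eta> (x - y) * (v y)\<^sup>2)"
  proof (rule Bochner_Integration.integrable_bound)
    show "integrable lebesgue (%y. M * (v y)\<^sup>2)" using v by (simp add: sqint_def)
    show "AE y in lebesgue. norm (\<eta> (x - y) * (v y)\<^sup>2) <= norm (M * (v y)\<^sup>2)"
      using M by (intro always_eventually allI) (auto simp: abs_mult intro!: mult_right_mono)
  qed simp
  have i1: "integrable lebesgue (%y. \<eta> (x - y) * v y)"
    by (rule conv_integrable[OF \<eta> sqint_loc_integrable[OF v]])
  have i0: "integrable lebesgue (%y. \<eta> (x - y))" by (rule test_sqint[OF t])
  have one': "(LINT y|lebesgue. \<eta> (x - y)) = 1"
    using integral_lebesgue_reflect[OF smooth_measurable[OF test_smooth[OF \<eta>]], of x] one by simp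
  define m where "m = conv \<eta> v x"
  have "0 <= (LINT y|lebesgue. \<eta> (x - y) * (v y - m)\<^sup>2)"
    by (rule Bochner_Integration.integral_nonneg) (simp add: pos)
  also have "(LINT y|lebesgue. \<eta> (x - y) * (v y - m)\<^sup>2)
     = (LINT y|lebesgue. \<eta> (x - y) * (v y)\<^sup>2 - 2 * m * (\<eta> (x - y) * v y) + m\<^sup>2 * \<eta> (x - y))"
    by (intro Bochner_Integration.integral_cong refl) (simp add: power2_eq_square algebra_simps)
  also have "\<dots> = (LINT y|lebesgue. \<eta> (x - y) * (v y)\<^sup>2) - 2 * m * m + m\<^sup>2 * 1"
    using i0 i1 i2 by (simp add: one' m_def conv_def)
  finally show "(conv \<eta> v x)\<^sup>2 <= (LINT y|lebesgue. \<eta> (x - y) * (v y)\<^sup>2)"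
    by (simp add: m_def power2_eq_square)
qed

text \<open>Jensen's inequality bounds \<open>(conv \<eta> v)\<^sup>2\<close> by \<open>conv \<eta> (v\<^sup>2)\<close>, and integrating in \<open>x\<close> first gives the norm of \<open>v\<close>.\<close>
lemma conv_contract:
  fixes v :: "real^'d => real"
  assumes \<eta>: "\<eta> \<in> test_functions UNIV" and pos: "!!x. \<eta> x >= 0" and one: "(LINT x|lebesgue. \<eta> x) = 1"
    and v: "sqint lebesgue v"
  shows "sqint lebesgue (conv \<eta> v)" "nrm lebesgue (conv \<eta> v) <= nrm lebesgue v"
proof -
  have vm: "v \<in> borel_measurable lebesgue" using v by (simp add: sqint_def)
  obtain w where w[measurable]: "w \<in> borel_measurable lborel" and vw: "AE x in lborel. v x = w x"
    using completion_ex_borel_measurable_real[OF vm] by blast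
  have eb[measurable]: "\<eta> \<in> borel_measurable borel"
    by (intro borel_measurable_continuous_onI smoothD(4) test_smooth[OF \<eta>])
  have cm: "conv \<eta> v \<in> borel_measurable lebesgue"
    by (intro smooth_measurable conv_smooth(1)[OF \<eta> sqint_loc_integrable[OF v]])
  have shift: "(\<integral>\<^sup>+x. ennreal (\<eta> (x - y)) \<partial>lborel) = 1" for y
  proof -
    have t: "(%x. \<eta> ((- y) + 1 *\<^sub>R x)) \<in> test_functions UNIV"
    proof -
      obtain K where K: "compact K" "K \<subseteq> UNIV" "!!x. x \<notin> K ==> \<eta> x = 0" by (rule test_functionsE[OF \<eta>]) blast
      show ?thesis
      proof (rule test_functionsI)
        show "smooth (%x. \<eta> ((- y) + 1 *\<^sub>R x))" by (intro smooth_affine test_smooth[OF \<eta>])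
        show "compact ((%x. x + y) ` K)" by (intro compact_continuous_image K continuous_intros)
        show "\<eta> ((- y) + 1 *\<^sub>R x) = 0" if "x \<notin> (%x. x + y) ` K" for x
          using that K(3)[of "- y + x"] by (force simp: image_iff)
      qed simp
    qed
    hence "integrable lebesgue (%x. \<eta> (x - y))" using test_sqint(2)[OF t] by simp
    hence "(\<integral>\<^sup>+x. ennreal (\<eta> (x - y)) \<partial>lebesgue) = ennreal (LINT x|lebesgue. \<eta> (x - y))"
      by (rule nn_integral_eq_integral) (simp add: pos)
    also have "(LINT x|lebesgue. \<eta> (x - y)) = 1"
      using integral_lebesgue_translate[OF smooth_measurable[OF test_smooth[OF \<eta>]], of "- y"] one by simp
    finally show ?thesis by (simp add: nn_integral_completion)
  qed
  have "(\<integral>\<^sup>+x. ennreal ((conv \<eta> v x)\<^sup>2) \<partial>lebesgue) <= (\<integral>\<^sup>+x. (\<integral>\<^sup>+y. ennreal (\<eta> (x - y) * (w y)\<^sup>2) \<partial>lborel) \<partial>lborel)"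
    unfolding nn_integral_completion
  proof (rule nn_integral_mono)
    fix x
    have "ennreal ((conv \<eta> v x)\<^sup>2) <= ennreal (LINT y|lebesgue. \<eta> (x - y) * (v y)\<^sup>2)"
      by (intro ennreal_leI conv_sq_le assms)
    also have "\<dots> = (\<integral>\<^sup>+y. ennreal (\<eta> (x - y) * (v y)\<^sup>2) \<partial>lebesgue)"
      by (rule nn_integral_eq_integral[symmetric, OF conv_sq_le(1)[OF assms]]) (simp add: pos)
    also have "\<dots> = (\<integral>\<^sup>+y. ennreal (\<eta> (x - y) * (v y)\<^sup>2) \<partial>lborel)" by (rule nn_integral_completion)
    also have "\<dots> = (\<integral>\<^sup>+y. ennreal (\<eta> (x - y) * (w y)\<^sup>2) \<partial>lborel)"
      by (rule nn_integral_cong_AE) (use vw in eventually_elim, simp)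
    finally show "ennreal ((conv \<eta> v x)\<^sup>2) <= (\<integral>\<^sup>+y. ennreal (\<eta> (x - y) * (w y)\<^sup>2) \<partial>lborel)" .
  qed
  also have "\<dots> = (\<integral>\<^sup>+y. (\<integral>\<^sup>+x. ennreal (\<eta> (x - y) * (w y)\<^sup>2) \<partial>lborel) \<partial>lborel)"
    by (rule lborel_pair.Fubini') measurable
  also have "\<dots> = (\<integral>\<^sup>+y. (\<integral>\<^sup>+x. ennreal ((w y)\<^sup>2) * ennreal (\<eta> (x - y)) \<partial>lborel) \<partial>lborel)"
    by (simp add: ennreal_mult[symmetric] pos mult.commute)
  also have "\<dots> = (\<integral>\<^sup>+y. ennreal ((w y)\<^sup>2) \<partial>lborel)"
    by (subst nn_integral_cmult) (auto simp: shift)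
  also have "\<dots> = (\<integral>\<^sup>+y. ennreal ((v y)\<^sup>2) \<partial>lborel)"
    by (rule nn_integral_cong_AE) (use vw in eventually_elim, simp)
  also have "\<dots> = (\<integral>\<^sup>+y. ennreal ((v y)\<^sup>2) \<partial>lebesgue)" by (rule nn_integral_completion[symmetric])
  also have "\<dots> = ennreal (LINT y|lebesgue. (v y)\<^sup>2)"
    using v by (intro nn_integral_eq_integral) (auto simp: sqint_def)
  finally have le: "(\<integral>\<^sup>+x. ennreal ((conv \<eta> v x)\<^sup>2) \<partial>lebesgue) <= ennreal (LINT y|lebesgue. (v y)\<^sup>2)" .
  have fin: "(\<integral>\<^sup>+x. ennreal (norm ((conv \<eta> v x)\<^sup>2)) \<partial>lebesgue) < \<infinity>"
    using le_less_trans[OF le] by simp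
  have "integrable lebesgue (%x. (conv \<eta> v x)\<^sup>2)"
    by (rule integrableI_bounded[OF _ fin]) (use cm in simp)
  thus "sqint lebesgue (conv \<eta> v)" using cm by (simp add: sqint_def)
  have "(LINT x|lebesgue. (conv \<eta> v x)\<^sup>2) <= (LINT y|lebesgue. (v y)\<^sup>2)"
    by (rule integral_real_bounded[OF _ le]) simp
  thus "nrm lebesgue (conv \<eta> v) <= nrm lebesgue v" by (simp add: nrm_def)
qed

definition mollifiers :: "(nat => real^'d => real) => bool" where
  "mollifiers \<eta> \<longleftrightarrow> (\<forall>n. \<eta> n \<in> test_functions UNIV & (\<forall>x. \<eta> n x >= 0) & (LINT x|lebesgue. \<eta> n x) = 1
      & (\<forall>x. norm x >= 1 / real (Suc n) --> \<eta> n x = 0))"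

lemma mollifiers_exist: "\<exists>\<eta> :: nat => real^'d => real. mollifiers \<eta>"
proof -
  have "\<forall>n. \<exists>\<eta> :: real^'d => real. \<eta> \<in> test_functions UNIV & (\<forall>x. \<eta> x >= 0) & (LINT x|lebesgue. \<eta> x) = 1
      & (\<forall>x. norm x >= 1 / real (Suc n) --> \<eta> x = 0)"
  proof
    fix n :: nat
    have "1 / real (Suc n) > 0" by simp
    from mollifier_exists[OF this] show "\<exists>\<eta> :: real^'d => real. \<eta> \<in> test_functions UNIV & (\<forall>x. \<eta> x >= 0) & (LINT x|lebesgue. \<eta> x) = 1
      & (\<forall>x. norm x >= 1 / real (Suc n) --> \<eta> x = 0)" by blast
  qed
  from choice[OF this] show ?thesis unfolding mollifiers_def .
qed

lemma mollify_test:
  assumes m: "mollifiers \<eta>" and \<phi>: "\<phi> \<in> test_functions UNIV"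
  shows "(%n. nrm lebesgue (%x. conv (\<eta> n) \<phi> x - \<phi> x)) \<longlonglongrightarrow> 0"
proof -
  obtain L where L: "L > 0" "!!a b. \<bar>\<phi> a - \<phi> b\<bar> <= L * norm (a - b)" by (rule test_lipschitz[OF \<phi>]) blast
  obtain R where R: "R > 0" "!!x. norm x > R ==> \<phi> x = 0" by (rule test_support_ball[OF \<phi>]) blast
  let ?B = "cball (0::real^'a) (R + 1)"
  have \<eta>: "\<eta> n \<in> test_functions UNIV" "!!x. \<eta> n x >= 0" "(LINT x|lebesgue. \<eta> n x) = 1" "!!x. norm x >= 1 / real (Suc n) ==> \<eta> n x = 0" for n
    using m by (auto simp: mollifiers_def)
  have loc: "loc_integrable \<phi>" by (intro sqint_loc_integrable test_sqint[OF \<phi>])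
  have pw: "\<bar>conv (\<eta> n) \<phi> x - \<phi> x\<bar> <= L / real (Suc n) * indicator ?B x" for n x
  proof -
    have t: "(%y. \<eta> n (x - y)) \<in> test_functions UNIV" by (rule test_reflect[OF \<eta>(1)])
    have i0: "integrable lebesgue (%y. \<eta> n (x - y))" by (rule test_sqint[OF t])
    have i1: "integrable lebesgue (%y. \<eta> n (x - y) * \<phi> y)" by (rule conv_integrable[OF \<eta>(1) loc])
    have one': "(LINT y|lebesgue. \<eta> n (x - y)) = 1"
      using integral_lebesgue_reflect[OF smooth_measurable[OF test_smooth[OF \<eta>(1)[of n]]], of x] \<eta>(3) by simp
    have "conv (\<eta> n) \<phi> x - \<phi> x = (LINT y|lebesgue. \<eta> n (x - y) * \<phi> y - \<phi> x * \<eta> n (x - y))"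
      using i0 i1 one' by (simp add: conv_def)
    also have "\<bar>\<dots>\<bar> <= (LINT y|lebesgue. \<bar>\<eta> n (x - y) * \<phi> y - \<phi> x * \<eta> n (x - y)\<bar>)"
      by (rule integral_abs_bound)
    also have "\<dots> <= (LINT y|lebesgue. (L / real (Suc n) * indicator ?B x) * \<eta> n (x - y))"
    proof (rule integral_mono)
      show "integrable lebesgue (%y. \<bar>\<eta> n (x - y) * \<phi> y - \<phi> x * \<eta> n (x - y)\<bar>)"
        using i0 i1 by simp
      show "integrable lebesgue (%y. (L / real (Suc n) * indicator ?B x) * \<eta> n (x - y))"
        using i0 by simp
      fix y
      show "\<bar>\<eta> n (x - y) * \<phi> y - \<phi> x * \<eta> n (x - y)\<bar> <= (L / real (Suc n) * indicator ?B x) * \<eta> n (x - y)"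
      proof (cases "norm (x - y) >= 1 / real (Suc n)")
        case True thus ?thesis using \<eta>(4)[OF True] by simp
      next
        case False
        have e: "\<eta> n (x - y) * \<phi> y - \<phi> x * \<eta> n (x - y) = (\<phi> y - \<phi> x) * \<eta> n (x - y)" by (simp add: algebra_simps)
        have "\<bar>\<phi> y - \<phi> x\<bar> <= L / real (Suc n) * indicator ?B x"
        proof (cases "x \<in> ?B")
          case True
          have "\<bar>\<phi> y - \<phi> x\<bar> <= L * norm (x - y)" using L(2)[of y x] by (simp add: norm_minus_commute)
          also have "\<dots> <= L * (1 / real (Suc n))" using False L(1) by (intro mult_left_mono) auto
          finally show ?thesis using True by simp
        next
          case F: False
          have "norm x <= norm y + norm (x - y)" using norm_triangle_ineq[of y "x - y"] by simp
          moreover have "1 / real (Suc n) <= 1" by simp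
          moreover have "norm x > R + 1" using F by simp
          moreover have "norm (x - y) < 1 / real (Suc n)" using False by simp
          ultimately have "norm y > R" "norm x > R" by linarith+
          thus ?thesis using F R(2) by simp
        qed
        hence "\<bar>\<phi> y - \<phi> x\<bar> * \<eta> n (x - y) <= (L / real (Suc n) * indicator ?B x) * \<eta> n (x - y)"
          by (rule mult_right_mono[OF _ \<eta>(2)])
        thus ?thesis unfolding e abs_mult by (simp only: abs_of_nonneg[OF \<eta>(2)])
      qed
    qed
    also have "\<dots> = L / real (Suc n) * indicator ?B x" using one' by simp
    finally show ?thesis .
  qed
  have sqB: "sqint lebesgue (indicator ?B :: _ => real)"
  proof (rule bounded_compact_sqint[of _ ?B 1])
    show "(indicator ?B :: _ => real) \<in> borel_measurable lebesgue" by (rule borel_measurable_indicator) simp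
  qed (auto simp: indicator_def)
  have b: "nrm lebesgue (%x. conv (\<eta> n) \<phi> x - \<phi> x) <= L / real (Suc n) * nrm lebesgue (indicator ?B :: _ => real)" for n
  proof -
    have "nrm lebesgue (%x. conv (\<eta> n) \<phi> x - \<phi> x) <= nrm lebesgue (%x. L / real (Suc n) * indicator ?B x)"
    proof (rule nrm_mono)
      show "sqint lebesgue (%x. L / real (Suc n) * indicator ?B x)"
        by (rule sqint_scale[OF sqB])
      show "(%x. conv (\<eta> n) \<phi> x - \<phi> x) \<in> borel_measurable lebesgue"
        by (intro smooth_measurable smooth_diff conv_smooth(1)[OF \<eta>(1) loc] test_smooth[OF \<phi>])
      show "AE x in lebesgue. \<bar>conv (\<eta> n) \<phi> x - \<phi> x\<bar> <= \<bar>L / real (Suc n) * indicator ?B x\<bar>"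
        using pw by (intro always_eventually allI) (rule order_trans[OF _ abs_ge_self])
    qed
    also have "\<dots> = L / real (Suc n) * nrm lebesgue (indicator ?B :: _ => real)"
      using L(1) by (subst nrm_scale) simp
    finally show ?thesis .
  qed
  have z: "(%n. L / real (Suc n) * nrm lebesgue (indicator ?B :: _ => real)) \<longlonglongrightarrow> 0"
    by (rule tendsto_mult_left_zero[OF LIMSEQ_Suc[OF lim_const_over_n]])
  show ?thesis
  proof (rule Lim_null_comparison[OF _ z], intro always_eventually allI)
    fix n
    show "norm (nrm lebesgue (%x. conv (\<eta> n) \<phi> x - \<phi> x)) <= L / real (Suc n) * nrm lebesgue (indicator ?B :: _ => real)"
      using b[of n] nrm_nonneg[of lebesgue "%x. conv (\<eta> n) \<phi> x - \<phi> x"] by simp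
  qed
qed

text \<open>Convolution is a contraction, so the claim extends from the dense set of test functions.\<close>
lemma mollify_L2:
  fixes v :: "real^'d => real"
  assumes m: "mollifiers \<eta>" and v: "sqint lebesgue v"
  shows "(%n. nrm lebesgue (%x. conv (\<eta> n) v x - v x)) \<longlonglongrightarrow> 0"
proof (rule LIMSEQ_I)
  fix e :: real assume e: "e > 0"
  have \<eta>: "\<eta> n \<in> test_functions UNIV" "!!x. \<eta> n x >= 0" "(LINT x|lebesgue. \<eta> n x) = 1" for n
    using m by (auto simp: mollifiers_def)
  obtain \<phi> where \<phi>: "\<phi> \<in> test_functions UNIV" "nrm lebesgue (%x. \<phi> x - v x) < e / 3"
    using test_dense_L2[of UNIV v "e/3"] v e by (auto simp: lebesgue_on_UNIV_eq)
  have "\<forall>\<^sub>F n in sequentially. nrm lebesgue (%x. conv (\<eta> n) \<phi> x - \<phi> x) < e / 3"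
    by (rule order_tendstoD(2)[OF mollify_test[OF m \<phi>(1)]]) (use e in simp)
  then obtain N where N: "!!n. n >= N ==> nrm lebesgue (%x. conv (\<eta> n) \<phi> x - \<phi> x) < e / 3"
    by (auto simp: eventually_sequentially)
  have sq\<phi>: "sqint lebesgue \<phi>" by (rule test_sqint[OF \<phi>(1)])
  have "norm (nrm lebesgue (%x. conv (\<eta> n) v x - v x) - 0) < e" if n: "n >= N" for n
  proof -
    let ?d = "%x. v x - \<phi> x"
    have sqd: "sqint lebesgue ?d" by (intro sqint_diff v sq\<phi>)
    note c1 = conv_contract[OF \<eta> sqd, of n]
    have s2: "sqint lebesgue (%x. conv (\<eta> n) \<phi> x - \<phi> x)"
      by (intro sqint_diff sq\<phi> conv_contract(1)[OF \<eta> sq\<phi>])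
    have s3: "sqint lebesgue (%x. \<phi> x - v x)" by (intro sqint_diff v sq\<phi>)
    have cd: "conv (\<eta> n) ?d x = conv (\<eta> n) v x - conv (\<eta> n) \<phi> x" for x
      by (intro conv_diff \<eta> sqint_loc_integrable v sq\<phi>)
    have "nrm lebesgue (%x. conv (\<eta> n) v x - v x) = nrm lebesgue (%x. conv (\<eta> n) ?d x + ((conv (\<eta> n) \<phi> x - \<phi> x) + (\<phi> x - v x)))"
      by (simp add: cd)
    also have "\<dots> <= nrm lebesgue (conv (\<eta> n) ?d) + nrm lebesgue (%x. (conv (\<eta> n) \<phi> x - \<phi> x) + (\<phi> x - v x))"
      by (intro nrm_triangle c1(1) sqint_add s2 s3)
    also have "\<dots> <= nrm lebesgue (conv (\<eta> n) ?d) + (nrm lebesgue (%x. conv (\<eta> n) \<phi> x - \<phi> x) + nrm lebesgue (%x. \<phi> x - v x))"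
      by (intro add_left_mono nrm_triangle s2 s3)
    also have "\<dots> < e" using c1(2) \<phi>(2) N[OF n] nrm_minus_commute[of lebesgue v \<phi>] by simp
    finally show ?thesis by (simp add: nrm_nonneg)
  qed
  thus "\<exists>N. \<forall>n\<ge>N. norm (nrm lebesgue (%x. conv (\<eta> n) v x - v x) - 0) < e" by blast
qed

text \<open>On a bounded set the convolution only sees the values of \<open>v\<close> within distance one, so \<open>v\<close> may be cut off.\<close>
lemma mollify_loc:
  fixes v :: "real^'d => real"
  assumes m: "mollifiers \<eta>" and v: "!!R. sqint lebesgue (%x. indicator (cball 0 R) x * v x)"
    and S: "S \<in> sets lebesgue" "S \<subseteq> cball 0 R"
  shows "(%n. nrm (lebesgue_on S) (%x. conv (\<eta> n) v x - v x)) \<longlonglongrightarrow> 0"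
    "sqint (lebesgue_on S) (conv (\<eta> n) v)" "sqint (lebesgue_on S) v"
proof -
  define w where "w x = indicator (cball 0 (R + 1)) x * v x" for x
  have w: "sqint lebesgue w" unfolding w_def by (rule v)
  have \<eta>: "\<eta> n \<in> test_functions UNIV" "!!x. \<eta> n x >= 0" "(LINT x|lebesgue. \<eta> n x) = 1" "!!x. norm x >= 1 / real (Suc n) ==> \<eta> n x = 0" for n
    using m by (auto simp: mollifiers_def)
  have cw: "conv (\<eta> n) v x = conv (\<eta> n) w x" if "x \<in> S" for n x
    unfolding conv_def
  proof (intro Bochner_Integration.integral_cong refl)
    fix y
    show "\<eta> n (x - y) * v y = \<eta> n (x - y) * w y"
    proof (cases "y \<in> cball 0 (R + 1)")
      case True thus ?thesis by (simp add: w_def)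
    next
      case False
      have "norm y <= norm x + norm (x - y)" using norm_triangle_ineq4[of x "x - y"] by simp
      moreover have "norm x <= R" using that S by auto
      moreover have "1 / real (Suc n) <= 1" by simp
      moreover have "norm y > R + 1" using False by simp
      ultimately have "norm (x - y) >= 1 / real (Suc n)" by linarith
      thus ?thesis using \<eta>(4) by simp
    qed
  qed
  have vw: "v x = w x" if "x \<in> S" for x
  proof -
    have "x \<in> cball 0 R" using that S by blast
    thus ?thesis by (simp add: w_def)
  qed
  have sw: "sqint (lebesgue_on S) w" by (rule sqint_restrictI[OF S(1) w])
  have sc: "sqint (lebesgue_on S) (conv (\<eta> n) w)" for n
    by (rule sqint_restrictI[OF S(1) conv_contract(1)[OF \<eta>(1-3) w]])
  have sp: "space (lebesgue_on S) = S" by (simp add: space_restrict_space)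
  have cong: "sqint (lebesgue_on S) f \<longleftrightarrow> sqint (lebesgue_on S) g" if "!!x. x \<in> S ==> f x = g x" for f g :: "real^'d => real"
    unfolding sqint_def
    by (intro conj_cong measurable_cong Bochner_Integration.integrable_cong refl) (auto simp: sp that)
  show "sqint (lebesgue_on S) (conv (\<eta> n) v)" using sc[of n] cong[of "conv (\<eta> n) v" "conv (\<eta> n) w"] cw by blast
  show "sqint (lebesgue_on S) v" using sw cong[of v w] vw by blast
  have sd: "sqint lebesgue (%x. conv (\<eta> n) w x - w x)" for n
    by (intro sqint_diff w conv_contract(1)[OF \<eta>(1-3) w])
  have b: "nrm (lebesgue_on S) (%x. conv (\<eta> n) v x - v x) <= nrm lebesgue (%x. conv (\<eta> n) w x - w x)" for n
  proof -
    have "nrm (lebesgue_on S) (%x. conv (\<eta> n) v x - v x) = nrm (lebesgue_on S) (%x. conv (\<eta> n) w x - w x)"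
      unfolding nrm_def by (intro arg_cong[where f=sqrt] Bochner_Integration.integral_cong refl) (simp add: sp cw vw)
    also have "\<dots> <= nrm lebesgue (%x. conv (\<eta> n) w x - w x)"
      unfolding nrm_def
    proof (rule real_sqrt_le_mono)
      have "(LINT x|lebesgue_on S. (conv (\<eta> n) w x - w x)\<^sup>2) = (LINT x|lebesgue. indicator S x *\<^sub>R (conv (\<eta> n) w x - w x)\<^sup>2)"
        using S(1) by (simp add: integral_restrict_space)
      also have "\<dots> <= (LINT x|lebesgue. (conv (\<eta> n) w x - w x)\<^sup>2)"
      proof (rule integral_mono)
        show i: "integrable lebesgue (%x. (conv (\<eta> n) w x - w x)\<^sup>2)" using sd by (simp add: sqint_def)
        show "integrable lebesgue (%x. indicator S x *\<^sub>R (conv (\<eta> n) w x - w x)\<^sup>2)"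
          using i S(1) by (rule integrable_mult_indicator[rotated])
      qed (auto simp: indicator_def)
      finally show "(LINT x|lebesgue_on S. (conv (\<eta> n) w x - w x)\<^sup>2) <= (LINT x|lebesgue. (conv (\<eta> n) w x - w x)\<^sup>2)" .
    qed
    finally show ?thesis .
  qed
  show "(%n. nrm (lebesgue_on S) (%x. conv (\<eta> n) v x - v x)) \<longlonglongrightarrow> 0"
  proof (rule Lim_null_comparison[OF _ mollify_L2[OF m w]], intro always_eventually allI)
    fix n
    show "norm (nrm (lebesgue_on S) (%x. conv (\<eta> n) v x - v x)) <= nrm lebesgue (%x. conv (\<eta> n) w x - w x)"
      using b[of n] nrm_nonneg[of "lebesgue_on S" "%x. conv (\<eta> n) v x - v x"] by simp
  qed
qed

text \<open>The function \<open>y \<mapsto> \<eta> (x - y)\<close> is itself a test function, and its derivative carries a minus sign that cancels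
  the one in the definition of weak derivatives.\<close>
lemma conv_weak_pd:
  assumes \<eta>: "\<eta> \<in> test_functions UNIV" and w: "has_weak_pd UNIV i u v"
  shows "conv (pd i \<eta>) u = conv \<eta> v"
proof
  fix x
  have "- (LINT y|lebesgue. u y * pd i (%y. \<eta> (x - y)) y) = (LINT y|lebesgue. v y * \<eta> (x - y))"
    using w test_reflect(1)[OF \<eta>, of x] unfolding has_weak_pd_def distr_eq_def distr_pd_def distr_of_def
    by (simp add: lebesgue_on_UNIV_eq)
  thus "conv (pd i \<eta>) u x = conv \<eta> v x"
    by (simp add: test_reflect(2)[OF \<eta>] conv_def mult.commute)
qed

section \<open>Periodic functions\<close>

definition lattice :: "(real^'d) set" where
  "lattice = {p. \<forall>i. p $ i \<in> \<int>}"

definition lattice_floor :: "real^'d => real^'d" where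
  "lattice_floor x = (\<chi> i. of_int \<lfloor>x $ i / (2 * pi)\<rfloor>)"

lemma lattice_floor_in: "lattice_floor x \<in> lattice"
  by (simp add: lattice_def lattice_floor_def)

lemma cell_lattice_unique:
  assumes "p \<in> lattice"
  shows "x - (2 * pi) *\<^sub>R p \<in> cell \<longleftrightarrow> p = lattice_floor x"
proof -
  have "0 <= x $ i - 2 * pi * p $ i & x $ i - 2 * pi * p $ i < 2 * pi \<longleftrightarrow> p $ i = of_int \<lfloor>x $ i / (2 * pi)\<rfloor>" for i
  proof -
    obtain k where k: "p $ i = of_int k" using assms by (auto simp: lattice_def elim: Ints_cases)
    have "0 <= x $ i - 2 * pi * p $ i \<longleftrightarrow> of_int k <= x $ i / (2 * pi)"
      using pi_gt_zero by (simp add: k le_divide_eq mult.commute)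
    moreover have "x $ i - 2 * pi * p $ i < 2 * pi \<longleftrightarrow> x $ i / (2 * pi) < of_int k + 1"
      using pi_gt_zero by (simp add: k divide_less_eq algebra_simps)
    moreover have "\<lfloor>x $ i / (2 * pi)\<rfloor> = k \<longleftrightarrow> of_int k <= x $ i / (2 * pi) & x $ i / (2 * pi) < of_int k + 1"
      by (rule floor_eq_iff)
    ultimately show ?thesis by (auto simp: k)
  qed
  thus ?thesis by (simp add: cell_def lattice_floor_def vec_eq_iff)
qed

lemma lattice_eq_range: "(lattice :: (real^'d) set) = range (%f::int^'d. \<chi> i. real_of_int (f $ i))"
proof
  show "lattice \<subseteq> range (%f::int^'d. \<chi> i. real_of_int (f $ i))"
  proof
    fix p :: "real^'d" assume "p \<in> lattice"
    hence "p = (\<chi> i. of_int ((\<chi> i. \<lfloor>p $ i\<rfloor>) $ i))" by (auto simp: lattice_def vec_eq_iff elim: Ints_cases)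
    thus "p \<in> range (%f::int^'d. \<chi> i. real_of_int (f $ i))" by (rule range_eqI)
  qed
qed (auto simp: lattice_def)

lemma countable_lattice: "countable (lattice :: (real^'d) set)"
  unfolding lattice_eq_range by (rule countable_image) (rule countableI_type)

lemma finite_lattice_ball: "finite {p \<in> (lattice :: (real^'d) set). norm p <= r}"
proof -
  obtain N :: nat where N: "r <= real N" using real_arch_simple by blast
  have "{p \<in> (lattice :: (real^'d) set). norm p <= r} \<subseteq> (%f. \<chi> i. real_of_int (f i)) ` (Pi\<^sub>E UNIV (%_. {- int N..int N}))"
  proof
    fix p :: "real^'d" assume p: "p \<in> {p \<in> lattice. norm p <= r}"
    have "p = (\<chi> i. of_int ((%i. \<lfloor>p $ i\<rfloor>) i))" using p by (auto simp: lattice_def vec_eq_iff elim: Ints_cases)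
    moreover have "(%i. \<lfloor>p $ i\<rfloor>) \<in> Pi\<^sub>E UNIV (%_. {- int N..int N})"
    proof -
      have "\<bar>p $ i\<bar> <= real N" for i using component_le_norm_cart[of p i] p N by auto
      hence "- real N <= p $ i & p $ i <= real N" for i by (simp add: abs_le_iff minus_le_iff)
      hence "- int N <= \<lfloor>p $ i\<rfloor> & \<lfloor>p $ i\<rfloor> <= int N" for i
        by (simp add: le_floor_iff floor_le_iff) (smt (verit) of_int_of_nat_eq)
      thus ?thesis by auto
    qed
    ultimately show "p \<in> (%f. \<chi> i. real_of_int (f i)) ` (Pi\<^sub>E UNIV (%_. {- int N..int N}))" by (rule image_eqI)
  qed
  moreover have "finite (Pi\<^sub>E (UNIV :: 'd set) (%_. {- int N..int N}))" by (intro finite_PiE) auto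
  ultimately show ?thesis using finite_surj by blast
qed

lemma lattice_minus: "p \<in> lattice ==> - p \<in> lattice"
  by (simp add: lattice_def)
lemma cell_sets: "cell \<in> sets (lebesgue :: (real^'d) measure)"
proof -
  have "cell = (\<Inter>i\<in>UNIV. {y::real^'d. 0 <= y $ i} \<inter> {y. y $ i < 2 * pi})" by (auto simp: cell_def)
  also have "\<dots> \<in> sets borel"
    by (intro sets.finite_INT sets.Int borel_closed borel_open closed_halfspace_component_ge_cart open_halfspace_component_lt_cart) auto
  finally show ?thesis by simp
qed

definition cell_radius :: "'d itself => real" where "cell_radius _ = real CARD('d) * (2 * pi)"

lemma cell_bounded: "(x::real^'d) \<in> cell ==> norm x <= cell_radius TYPE('d)"
proof -
  assume x: "x \<in> cell"
  have "norm x <= (\<Sum>i\<in>UNIV. \<bar>x $ i\<bar>)" by (rule norm_le_l1_cart)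
  also have "\<dots> <= (\<Sum>i\<in>(UNIV::'d set). 2 * pi)"
    using x by (intro sum_mono) (auto simp: cell_def abs_of_nonneg less_imp_le)
  finally show ?thesis by (simp add: cell_radius_def)
qed

lemma cell_radius_nonneg: "cell_radius T >= 0" by (simp add: cell_radius_def)

lemma cell_subset_ball: "(cell :: (real^'d) set) \<subseteq> cball 0 (cell_radius TYPE('d))"
  using cell_bounded by auto

lemma cell_finite: "emeasure lebesgue (cell :: (real^'d) set) < \<infinity>"
proof -
  have "emeasure lebesgue (cell :: (real^'d) set) <= emeasure lebesgue (cball (0::real^'d) (cell_radius TYPE('d)))"
    by (rule emeasure_mono[OF cell_subset_ball]) simp
  also have "\<dots> < \<infinity>" using lmeasurable_cball[of "0::real^'d"] by (simp add: fmeasurable_def)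
  finally show ?thesis .
qed

lemma cell_lmeasurable: "cell \<in> lmeasurable"
  using cell_sets cell_finite by (simp add: fmeasurable_def)

lemma cell_pos: "measure lebesgue (cell :: (real^'d) set) > 0"
proof -
  let ?b = "box (0::real^'d) (\<chi> i. 2 * pi)"
  have sub: "?b \<subseteq> cell" by (auto simp: cell_def mem_box_cart less_imp_le)
  have "(\<chi> i. pi) \<in> ?b" by (auto simp: mem_box_cart)
  hence "?b ~= {}" by blast
  hence "\<not> negligible ?b" using open_not_negligible[OF open_box] by blast
  hence "\<not> negligible (cell :: (real^'d) set)" using sub negligible_subset by blast
  moreover have "(cell :: (real^'d) set) \<in> lmeasurable" by (rule cell_lmeasurable)
  ultimately have "measure lebesgue (cell :: (real^'d) set) ~= 0" by (simp add: negligible_iff_measure0)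
  thus ?thesis by (simp add: zero_less_measure_iff)
qed

lemma emeasure_cell: "emeasure lebesgue (cell :: (real^'d) set) = ennreal (measure lebesgue (cell :: (real^'d) set))"
  using cell_finite[where 'd='d] by (intro emeasure_eq_ennreal_measure) auto

subsection \<open>Integration over the cell and over the whole space\<close>

text \<open>Exactly one lattice translate of the cell contains \<open>x\<close>. Integrating over the counting measure turns
  sums over the lattice into integrals, to which Tonelli's theorem applies.\<close>
lemma lattice_cell_sum:
  fixes c :: ennreal
  shows "(\<integral>\<^sup>+p. c * indicator cell (x - (2 * pi) *\<^sub>R p) \<partial>count_space lattice) = c"
proof -
  have "(\<integral>\<^sup>+p. c * indicator cell (x - (2 * pi) *\<^sub>R p) \<partial>count_space lattice)
      = (\<integral>\<^sup>+p. c * indicator {lattice_floor x} p \<partial>count_space lattice)"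
    by (rule nn_integral_cong) (simp add: cell_lattice_unique indicator_def)
  also have "\<dots> = c" by (subst nn_integral_cmult) (auto simp: lattice_floor_in)
  finally show ?thesis .
qed

lemma nn_integral_unfold:
  fixes f :: "real^'d => ennreal"
  assumes f: "f \<in> borel_measurable lebesgue"
  shows "(\<integral>\<^sup>+x. f x \<partial>lebesgue) = (\<integral>\<^sup>+p. (\<integral>\<^sup>+x. f (x + (2 * pi) *\<^sub>R p) * indicator cell x \<partial>lebesgue) \<partial>count_space lattice)"
proof -
  have cm: "(indicator cell :: real^'d => ennreal) \<in> borel_measurable lebesgue"
    using cell_sets by (rule borel_measurable_indicator)
  have m: "(%x. f x * indicator cell (x - (2 * pi) *\<^sub>R p)) \<in> borel_measurable lebesgue" for p
  proof (rule borel_measurable_times_ennreal[OF f])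
    have "(%x. indicator cell (- ((2 * pi) *\<^sub>R p) + 1 *\<^sub>R x) :: ennreal) \<in> borel_measurable lebesgue"
      by (rule measurable_lebesgue_affine[OF cm]) simp
    thus "(%x. indicator cell (x - (2 * pi) *\<^sub>R p) :: ennreal) \<in> borel_measurable lebesgue" by simp
  qed
  have "(\<integral>\<^sup>+x. f x \<partial>lebesgue) = (\<integral>\<^sup>+x. (\<integral>\<^sup>+p. f x * indicator cell (x - (2 * pi) *\<^sub>R p) \<partial>count_space lattice) \<partial>lebesgue)"
    by (simp only: lattice_cell_sum)
  also have "\<dots> = (\<integral>\<^sup>+p. (\<integral>\<^sup>+x. f x * indicator cell (x - (2 * pi) *\<^sub>R p) \<partial>lebesgue) \<partial>count_space lattice)"
    by (rule nn_integral_count_space_nn_integral[OF countable_lattice m])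
  also have "\<dots> = (\<integral>\<^sup>+p. (\<integral>\<^sup>+x. f (x + (2 * pi) *\<^sub>R p) * indicator cell x \<partial>lebesgue) \<partial>count_space lattice)"
  proof (rule nn_integral_cong)
    fix p
    show "(\<integral>\<^sup>+x. f x * indicator cell (x - (2 * pi) *\<^sub>R p) \<partial>lebesgue) = (\<integral>\<^sup>+x. f (x + (2 * pi) *\<^sub>R p) * indicator cell x \<partial>lebesgue)"
      using nn_integral_lebesgue_affine[OF m, of 1 p "(2 * pi) *\<^sub>R p"] by (simp add: add.commute)
  qed
  finally show ?thesis .
qed

lemma nn_integral_unfold_periodic:
  fixes g k :: "real^'d => ennreal"
  assumes g: "g \<in> borel_measurable lebesgue" and k: "k \<in> borel_measurable lebesgue"
    and per: "!!p. p \<in> lattice ==> AE x in lebesgue. g (x + (2 * pi) *\<^sub>R p) = g x"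
  shows "(\<integral>\<^sup>+x. g x * k x \<partial>lebesgue) = (\<integral>\<^sup>+x. g x * indicator cell x * (\<integral>\<^sup>+p. k (x + (2 * pi) *\<^sub>R p) \<partial>count_space lattice) \<partial>lebesgue)"
proof -
  have cm: "(indicator cell :: real^'d => ennreal) \<in> borel_measurable lebesgue"
    using cell_sets by (rule borel_measurable_indicator)
  have km: "(%x. k (x + (2 * pi) *\<^sub>R p)) \<in> borel_measurable lebesgue" for p
    using measurable_lebesgue_affine[OF k, of 1 "(2 * pi) *\<^sub>R p"] by (simp add: add.commute)
  have "(\<integral>\<^sup>+x. g x * k x \<partial>lebesgue) = (\<integral>\<^sup>+p. (\<integral>\<^sup>+x. g (x + (2 * pi) *\<^sub>R p) * k (x + (2 * pi) *\<^sub>R p) * indicator cell x \<partial>lebesgue) \<partial>count_space lattice)"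
    by (rule nn_integral_unfold) (intro borel_measurable_times_ennreal g k)
  also have "\<dots> = (\<integral>\<^sup>+p. (\<integral>\<^sup>+x. (g x * indicator cell x) * k (x + (2 * pi) *\<^sub>R p) \<partial>lebesgue) \<partial>count_space lattice)"
  proof (rule nn_integral_cong)
    fix p assume "p \<in> space (count_space (lattice :: (real^'d) set))"
    hence p: "p \<in> lattice" by simp
    show "(\<integral>\<^sup>+x. g (x + (2 * pi) *\<^sub>R p) * k (x + (2 * pi) *\<^sub>R p) * indicator cell x \<partial>lebesgue) = (\<integral>\<^sup>+x. (g x * indicator cell x) * k (x + (2 * pi) *\<^sub>R p) \<partial>lebesgue)"
      by (rule nn_integral_cong_AE) (use per[OF p] in eventually_elim, simp add: mult_ac)
  qed
  also have "\<dots> = (\<integral>\<^sup>+x. (\<integral>\<^sup>+p. (g x * indicator cell x) * k (x + (2 * pi) *\<^sub>R p) \<partial>count_space lattice) \<partial>lebesgue)"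
    by (rule nn_integral_count_space_nn_integral[OF countable_lattice, symmetric]) (intro borel_measurable_times_ennreal g cm km)
  also have "\<dots> = (\<integral>\<^sup>+x. (g x * indicator cell x) * (\<integral>\<^sup>+p. k (x + (2 * pi) *\<^sub>R p) \<partial>count_space lattice) \<partial>lebesgue)"
    by (intro nn_integral_cong nn_integral_cmult) simp
  finally show ?thesis .
qed

text \<open>Unfold the integral over the shifted cell into lattice translates, use periodicity, and fold again.\<close>
lemma nn_integral_cell_translate:
  fixes g :: "real^'d => ennreal"
  assumes g: "g \<in> borel_measurable lebesgue"
    and per: "!!p. p \<in> lattice ==> AE x in lebesgue. g (x + (2 * pi) *\<^sub>R p) = g x"
  shows "(\<integral>\<^sup>+x. g (x + h) * indicator cell x \<partial>lebesgue) = (\<integral>\<^sup>+x. g x * indicator cell x \<partial>lebesgue)"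
proof -
  have cm: "(indicator cell :: real^'d => ennreal) \<in> borel_measurable lebesgue"
    using cell_sets by (rule borel_measurable_indicator)
  have km: "(%x. indicator cell (x - h) :: ennreal) \<in> borel_measurable lebesgue"
    using measurable_lebesgue_affine[OF cm, of 1 "- h"] by simp
  have one: "(\<integral>\<^sup>+p. indicator cell (x + (2 * pi) *\<^sub>R p - h) \<partial>count_space lattice) = (1::ennreal)" for x :: "real^'d"
  proof -
    have bij: "bij_betw uminus (lattice :: (real^'d) set) lattice"
      by (rule bij_betw_byWitness[of _ uminus]) (auto intro: lattice_minus)
    have "(\<integral>\<^sup>+p. indicator cell (x + (2 * pi) *\<^sub>R p - h) \<partial>count_space lattice)
       = (\<integral>\<^sup>+p. indicator cell (x + (2 * pi) *\<^sub>R (- p) - h) \<partial>count_space lattice :: ennreal)"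
      by (rule nn_integral_bij_count_space[OF bij, symmetric])
    also have "\<dots> = (\<integral>\<^sup>+p. 1 * indicator cell ((x - h) - (2 * pi) *\<^sub>R p) \<partial>count_space lattice)"
      by (intro nn_integral_cong) (simp add: algebra_simps)
    also have "\<dots> = 1" by (rule lattice_cell_sum)
    finally show ?thesis .
  qed
  have "(\<integral>\<^sup>+x. g (x + h) * indicator cell x \<partial>lebesgue) = (\<integral>\<^sup>+x. g x * indicator cell (x - h) \<partial>lebesgue)"
    using nn_integral_lebesgue_affine[OF borel_measurable_times_ennreal[OF g km], of 1 h] by (simp add: add.commute)
  also have "\<dots> = (\<integral>\<^sup>+x. g x * indicator cell x * (\<integral>\<^sup>+p. indicator cell (x + (2 * pi) *\<^sub>R p - h) \<partial>count_space lattice) \<partial>lebesgue)"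
    by (rule nn_integral_unfold_periodic[OF g km per])
  finally show ?thesis by (simp add: one)
qed

text \<open>A ball meets only finitely many translates of the cell. Their number is at most the volume of a slightly
  larger ball divided by that of the cell.\<close>
lemma nn_integral_ball_periodic:
  fixes g :: "real^'d => ennreal"
  assumes g: "g \<in> borel_measurable lebesgue"
    and per: "!!p. p \<in> lattice ==> AE x in lebesgue. g (x + (2 * pi) *\<^sub>R p) = g x"
  shows "(\<integral>\<^sup>+x. g x * indicator (cball 0 R) x \<partial>lebesgue)
     <= ennreal (measure lebesgue (cball (0::real^'d) (R + 2 * cell_radius TYPE('d))) / measure lebesgue (cell :: (real^'d) set))
         * (\<integral>\<^sup>+x. g x * indicator cell x \<partial>lebesgue)"
proof -
  let ?B = "cball (0::real^'d) (R + 2 * cell_radius TYPE('d))" and ?c = "emeasure lebesgue (cell :: (real^'d) set)"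
  let ?K = "ennreal (measure lebesgue ?B / measure lebesgue (cell :: (real^'d) set))"
  have im: "(indicator S :: real^'d => ennreal) \<in> borel_measurable lebesgue" if "S \<in> sets lebesgue" for S
    using that by (rule borel_measurable_indicator)
  define n where "n S x = (\<integral>\<^sup>+p. indicator S (x + (2 * pi) *\<^sub>R p) \<partial>count_space lattice :: ennreal)" for S :: "(real^'d) set" and x
  have nn: "n (cball 0 R) x <= n ?B y" if "x \<in> cell" "y \<in> cell" for x y
    unfolding n_def
  proof (rule nn_integral_mono)
    fix p
    have "norm (y + (2 * pi) *\<^sub>R p) <= norm (x + (2 * pi) *\<^sub>R p) + norm (y - x)"
      using norm_triangle_ineq[of "x + (2 * pi) *\<^sub>R p" "y - x"] by (simp add: add.commute)
    moreover have "norm (y - x) <= 2 * cell_radius TYPE('d)"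
      using norm_triangle_ineq4[of y x] cell_bounded[OF that(1)] cell_bounded[OF that(2)] by simp
    ultimately show "indicator (cball 0 R) (x + (2 * pi) *\<^sub>R p) <= (indicator ?B (y + (2 * pi) *\<^sub>R p) :: ennreal)"
      by (auto simp: indicator_def)
  qed
  have bd: "n (cball 0 R) x <= ?K" if x: "x \<in> cell" for x
  proof -
    have "n (cball 0 R) x * ?c = (\<integral>\<^sup>+y. n (cball 0 R) x * indicator (cell :: (real^'d) set) y \<partial>lebesgue)"
      by (rule nn_integral_cmult_indicator[OF cell_sets, symmetric])
    also have "\<dots> <= (\<integral>\<^sup>+y. 1 * indicator cell y * n ?B y \<partial>lebesgue)"
      by (rule nn_integral_mono) (use nn[OF x] in \<open>auto simp: indicator_def\<close>)
    also have "\<dots> = (\<integral>\<^sup>+y. 1 * indicator ?B y \<partial>lebesgue)"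
      unfolding n_def by (rule nn_integral_unfold_periodic[symmetric]) (auto intro: im)
    also have "\<dots> = emeasure lebesgue ?B" by simp
    also have "\<dots> = ennreal (measure lebesgue ?B)"
      by (rule emeasure_eq_measure2) simp
    finally have "n (cball 0 R) x * ?c / ?c <= ennreal (measure lebesgue ?B) / ?c" by (rule divide_right_mono_ennreal)
    moreover have "n (cball 0 R) x * ?c / ?c = n (cball 0 R) x"
      using cell_pos[where 'd='d] by (intro ennreal_mult_divide_eq) (auto simp: emeasure_cell)
    ultimately show ?thesis using cell_pos[where 'd='d] by (simp add: emeasure_cell divide_ennreal)
  qed
  have "(\<integral>\<^sup>+x. g x * indicator (cball 0 R) x \<partial>lebesgue) = (\<integral>\<^sup>+x. g x * indicator cell x * n (cball 0 R) x \<partial>lebesgue)"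
    unfolding n_def by (rule nn_integral_unfold_periodic[OF g _ per]) (auto intro: im)
  also have "\<dots> <= (\<integral>\<^sup>+x. ?K * (g x * indicator cell x) \<partial>lebesgue)"
  proof (rule nn_integral_mono)
    fix x
    show "g x * indicator cell x * n (cball 0 R) x <= ?K * (g x * indicator cell x)"
    proof (cases "x \<in> cell")
      case True
      have "n (cball 0 R) x * g x <= ?K * g x" by (intro mult_right_mono bd True) simp
      thus ?thesis using True by (simp add: mult_ac)
    qed simp
  qed
  also have "\<dots> = ?K * (\<integral>\<^sup>+x. g x * indicator cell x \<partial>lebesgue)"
    using g im[OF cell_sets] by (intro nn_integral_cmult borel_measurable_times_ennreal)
  finally show ?thesis .
qed

text \<open>Periodicity at every point, in contrast to \<open>periodic\<close>, which allows an exceptional null set for each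
  translation.\<close>
definition zperiodic :: "(real^'d => real) => bool" where
  "zperiodic f \<longleftrightarrow> (\<forall>p\<in>lattice. \<forall>x. f (x + (2 * pi) *\<^sub>R p) = f x)"

lemma periodicD: "periodic u ==> p \<in> lattice ==> AE x in lebesgue. u (x + (2 * pi) *\<^sub>R p) = u x"
  by (simp add: periodic_def lattice_def)

lemma zperiodic_imp_periodic: "zperiodic u ==> periodic u"
  by (simp add: periodic_def zperiodic_def lattice_def)

lemma measure_cball_scale:
  assumes "r >= 0"
  shows "measure lebesgue (cball (0::real^'d) r) = unit_ball_vol (real CARD('d)) * r ^ CARD('d)"
  using content_cball[OF assms, of "0::real^'d"] by simp

text \<open>Rescaling by \<open>\<epsilon>\<close> turns the ball of radius \<open>R\<close> into one of radius \<open>R/\<epsilon>\<close>. It is covered by about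
  \<open>(R/\<epsilon>)\<^sup>d\<close> cells, which the Jacobian \<open>\<epsilon>\<^sup>d\<close> compensates. This uniform bound is what allows
  coefficients to be approximated in \<open>L\<^sup>2\<close> of the cell rather than uniformly.\<close>
lemma periodic_scaled_bound:
  assumes R: "R >= 0"
  obtains C :: real where "C >= 0"
    "!!(g::real^'d => real) eps. g \<in> borel_measurable lebesgue ==> periodic g ==> sqint (lebesgue_on cell) g ==> 0 < eps ==> eps <= 1
      ==> sqint lebesgue (%x. indicator (cball 0 R) x * g ((1 / eps) *\<^sub>R x))
        & nrm lebesgue (%x. indicator (cball 0 R) x * g ((1 / eps) *\<^sub>R x)) <= C * nrm (lebesgue_on cell) g"
proof -
  let ?cr = "cell_radius TYPE('d)"
  let ?v = "unit_ball_vol (real CARD('d))" and ?mc = "measure lebesgue (cell :: (real^'d) set)"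
  define K where "K = ?v * (R + 2 * ?cr) ^ CARD('d) / ?mc"
  have v0: "?v >= 0" by simp
  have K0: "K >= 0" unfolding K_def using cell_pos[where 'd='d] cell_radius_nonneg[of "TYPE('d)"] R v0 by simp
  show thesis
  proof (rule that[of "sqrt K"])
    show "sqrt K >= 0" using K0 by simp
    fix g :: "real^'d => real" and eps :: real
    assume gm[measurable]: "g \<in> borel_measurable lebesgue" and gp: "periodic g" and gs: "sqint (lebesgue_on cell) g"
      and e: "0 < eps" "eps <= 1"
    let ?h = "%x. indicator (cball 0 R) x * g ((1 / eps) *\<^sub>R x)"
    have gem: "(%x. g (0 + (1 / eps) *\<^sub>R x)) \<in> borel_measurable lebesgue"
      by (rule measurable_lebesgue_affine[OF gm]) (use e in simp)
    have im: "indicator (cball 0 r) \<in> borel_measurable (lebesgue :: (real^'d) measure)" for r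
      by (rule borel_measurable_indicator) simp
    have hm[measurable]: "?h \<in> borel_measurable lebesgue"
      using borel_measurable_times[OF im[of R] gem] by simp
    have indsq: "ennreal ((indicator S x * y)\<^sup>2) = ennreal (y\<^sup>2) * indicator S x" for S :: "(real^'d) set" and x y
      by (simp add: indicator_def)
    have cellint: "(\<integral>\<^sup>+y. ennreal ((g y)\<^sup>2) * indicator cell y \<partial>lebesgue) = ennreal ((nrm (lebesgue_on cell) g)\<^sup>2)"
    proof -
      have "(\<integral>\<^sup>+y. ennreal ((g y)\<^sup>2) * indicator cell y \<partial>lebesgue) = (\<integral>\<^sup>+y. ennreal ((g y)\<^sup>2) \<partial>lebesgue_on cell)"
        using cell_sets by (subst nn_integral_restrict_space) auto
      also have "\<dots> = ennreal (LINT y|lebesgue_on cell. (g y)\<^sup>2)"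
        using gs by (intro nn_integral_eq_integral) (auto simp: sqint_def)
      finally show ?thesis by (simp add: nrm_sq)
    qed
    have "(\<integral>\<^sup>+x. ennreal ((?h x)\<^sup>2) \<partial>lebesgue) = ennreal (\<bar>eps\<bar> ^ CARD('d)) * (\<integral>\<^sup>+y. ennreal ((?h (0 + eps *\<^sub>R y))\<^sup>2) \<partial>lebesgue)"
      by (rule nn_integral_lebesgue_affine) (use e in auto)
    also have "(\<integral>\<^sup>+y. ennreal ((?h (0 + eps *\<^sub>R y))\<^sup>2) \<partial>lebesgue) = (\<integral>\<^sup>+y. ennreal ((g y)\<^sup>2) * indicator (cball 0 (R / eps)) y \<partial>lebesgue)"
    proof (rule nn_integral_cong)
      fix y :: "real^'d"
      have "indicator (cball 0 R) (eps *\<^sub>R y) = (indicator (cball 0 (R / eps)) y :: real)"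
        using e by (simp add: indicator_def le_divide_eq mult.commute)
      thus "ennreal ((?h (0 + eps *\<^sub>R y))\<^sup>2) = ennreal ((g y)\<^sup>2) * indicator (cball 0 (R / eps)) y"
        using e by (simp add: indsq)
    qed
    also have "\<dots> <= ennreal (measure lebesgue (cball (0::real^'d) (R / eps + 2 * ?cr)) / ?mc) * (\<integral>\<^sup>+y. ennreal ((g y)\<^sup>2) * indicator cell y \<partial>lebesgue)"
    proof (rule nn_integral_ball_periodic)
      fix p :: "real^'d" assume "p \<in> lattice"
      from periodicD[OF gp this] show "AE x in lebesgue. ennreal ((g (x + (2 * pi) *\<^sub>R p))\<^sup>2) = ennreal ((g x)\<^sup>2)"
        by eventually_elim simp
    qed simp
    also have "\<dots> = ennreal (measure lebesgue (cball (0::real^'d) (R / eps + 2 * ?cr)) / ?mc * (nrm (lebesgue_on cell) g)\<^sup>2)"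
      unfolding cellint by (rule ennreal_mult[symmetric]) auto
    also have "ennreal (\<bar>eps\<bar> ^ CARD('d)) * \<dots> = ennreal (\<bar>eps\<bar> ^ CARD('d) * (measure lebesgue (cball (0::real^'d) (R / eps + 2 * ?cr)) / ?mc * (nrm (lebesgue_on cell) g)\<^sup>2))"
      by (rule ennreal_mult[symmetric]) auto
    also have "\<dots> <= ennreal (K * (nrm (lebesgue_on cell) g)\<^sup>2)"
    proof (rule ennreal_leI)
      have "\<bar>eps\<bar> ^ CARD('d) * measure lebesgue (cball (0::real^'d) (R / eps + 2 * ?cr)) = ?v * (eps * (R / eps + 2 * ?cr)) ^ CARD('d)"
        using e R cell_radius_nonneg[of "TYPE('d)"] by (subst measure_cball_scale) (auto simp: power_mult_distrib)
      also have "eps * (R / eps + 2 * ?cr) = R + eps * (2 * ?cr)" using e by (simp add: distrib_left)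
      also have "?v * (R + eps * (2 * ?cr)) ^ CARD('d) <= ?v * (R + 2 * ?cr) ^ CARD('d)"
        using e R cell_radius_nonneg[of "TYPE('d)"] v0 mult_left_le_one_le[of "2 * ?cr" eps]
        by (intro mult_left_mono power_mono) auto
      finally have "\<bar>eps\<bar> ^ CARD('d) * measure lebesgue (cball (0::real^'d) (R / eps + 2 * ?cr)) / ?mc <= K"
        unfolding K_def using cell_pos[where 'd='d] by (intro divide_right_mono) auto
      hence "\<bar>eps\<bar> ^ CARD('d) * measure lebesgue (cball (0::real^'d) (R / eps + 2 * ?cr)) / ?mc * (nrm (lebesgue_on cell) g)\<^sup>2 <= K * (nrm (lebesgue_on cell) g)\<^sup>2"
        by (rule mult_right_mono) simp
      thus "\<bar>eps\<bar> ^ CARD('d) * (measure lebesgue (cball (0::real^'d) (R / eps + 2 * ?cr)) / ?mc * (nrm (lebesgue_on cell) g)\<^sup>2) <= K * (nrm (lebesgue_on cell) g)\<^sup>2"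
        by simp
    qed
    finally have le: "(\<integral>\<^sup>+x. ennreal ((?h x)\<^sup>2) \<partial>lebesgue) <= ennreal (K * (nrm (lebesgue_on cell) g)\<^sup>2)" by (simp add: mult_left_mono)
    have "integrable lebesgue (%x. (?h x)\<^sup>2)"
    proof (rule integrableI_bounded)
      show "(\<integral>\<^sup>+x. ennreal (norm ((?h x)\<^sup>2)) \<partial>lebesgue) < \<infinity>"
        using le_less_trans[OF le] by simp
    qed simp
    hence s: "sqint lebesgue ?h" using hm by (simp add: sqint_def)
    have "(LINT x|lebesgue. (?h x)\<^sup>2) <= K * (nrm (lebesgue_on cell) g)\<^sup>2"
      by (rule integral_real_bounded[OF _ le]) (use K0 in simp)
    hence "nrm lebesgue ?h <= sqrt (K * (nrm (lebesgue_on cell) g)\<^sup>2)" unfolding nrm_def[of lebesgue] by (rule real_sqrt_le_mono)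
    also have "\<dots> = sqrt K * nrm (lebesgue_on cell) g" by (simp add: real_sqrt_mult nrm_nonneg)
    finally show "sqint lebesgue ?h & nrm lebesgue ?h <= sqrt K * nrm (lebesgue_on cell) g" using s by simp
  qed
qed

lemma periodic_loc_sqint:
  fixes g :: "real^'d => real"
  assumes "g \<in> borel_measurable lebesgue" "periodic g" "sqint (lebesgue_on cell) g"
  shows "sqint lebesgue (%x. indicator (cball 0 R) x * g x)"
proof (cases "R >= 0")
  case True
  obtain C where C: "!!(g::real^'d => real) eps. g \<in> borel_measurable lebesgue ==> periodic g ==> sqint (lebesgue_on cell) g ==> 0 < eps ==> eps <= 1
      ==> sqint lebesgue (%x. indicator (cball 0 R) x * g ((1 / eps) *\<^sub>R x))
        & nrm lebesgue (%x. indicator (cball 0 R) x * g ((1 / eps) *\<^sub>R x)) <= C * nrm (lebesgue_on cell) g"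
    by (rule periodic_scaled_bound[OF True, where 'd='d]) blast
  from C[OF assms, of 1] show ?thesis by simp
next
  case False
  hence "(%x. indicator (cball 0 R) x * g x) = (%x. 0)" by (auto simp: indicator_def fun_eq_iff)
  thus ?thesis by (simp add: sqint_0)
qed

subsection \<open>Smooth periodic functions\<close>

lemma cell_bounded_integrable:
  fixes f :: "real^'d => real"
  assumes f: "f \<in> borel_measurable lebesgue" and b: "!!x. \<bar>f x\<bar> <= M"
  shows "sqint (lebesgue_on cell) f" "integrable (lebesgue_on cell) f"
proof -
  have fm: "f \<in> borel_measurable (lebesgue_on cell)" by (rule measurable_restrict_space1[OF f])
  have em: "emeasure (lebesgue_on cell) (space (lebesgue_on cell :: (real^'d) measure)) < \<infinity>"
    using cell_sets[where 'd='d] cell_finite[where 'd='d] by (simp add: space_restrict_space emeasure_restrict_space)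
  show "integrable (lebesgue_on cell) f"
    by (rule integrableI_bounded_set[OF sets.top fm em, of M]) (use b in auto)
  have b2: "\<bar>(f x)\<^sup>2\<bar> <= M\<^sup>2" for x using power_mono[OF b[of x], of 2] by simp
  have "integrable (lebesgue_on cell) (%x. (f x)\<^sup>2)"
    by (rule integrableI_bounded_set[OF sets.top _ em, of _ "M\<^sup>2"]) (use fm b2 in auto)
  thus "sqint (lebesgue_on cell) f" using fm by (simp add: sqint_def)
qed

lemma zperiodic_bounded:
  assumes p: "zperiodic f" and c: "continuous_on UNIV f"
  obtains M :: real where "M > 0" "!!x. \<bar>f x\<bar> <= M"
proof -
  let ?B = "cball (0::real^'a) (cell_radius TYPE('a))"
  have "compact (f ` ?B)" by (intro compact_continuous_image continuous_on_subset[OF c]) auto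
  hence "bounded (f ` ?B)" by (rule compact_imp_bounded)
  then obtain M where M: "M > 0" "\<forall>y\<in>f ` ?B. norm y <= M" unfolding bounded_pos by blast
  show thesis
  proof (rule that[OF M(1)])
    fix x :: "real^'a"
    have "x - (2 * pi) *\<^sub>R lattice_floor x \<in> cell" using cell_lattice_unique[OF lattice_floor_in] by blast
    hence "x - (2 * pi) *\<^sub>R lattice_floor x \<in> ?B" using cell_subset_ball by blast
    hence "norm (f (x - (2 * pi) *\<^sub>R lattice_floor x)) <= M" using M(2) by blast
    moreover have "f (x - (2 * pi) *\<^sub>R lattice_floor x) = f x"
      using p lattice_floor_in[of x] unfolding zperiodic_def by (metis diff_add_cancel)
    ultimately show "\<bar>f x\<bar> <= M" by simp
  qed
qed

lemma zperiodic_translate: "zperiodic f ==> zperiodic (%x. f (x + h))"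
  unfolding zperiodic_def by (simp add: add.assoc add.commute[of _ h]) (metis add.commute add.left_commute)

lemma integral_cell_translate:
  fixes f :: "real^'d => real"
  assumes p: "zperiodic f" and m: "f \<in> borel_measurable lebesgue" and b: "!!x. \<bar>f x\<bar> <= M"
  shows "(LINT x|lebesgue_on cell. f (x + h)) = (LINT x|lebesgue_on cell. f x)"
proof -
  define g where "g x = ennreal (f x + M)" for x
  have pos: "f x + M >= 0" for x using b[of x] by (simp add: abs_le_iff)
  have gm: "g \<in> borel_measurable lebesgue" unfolding g_def using m by measurable
  have mh: "(%x. f (x + h)) \<in> borel_measurable lebesgue"
    using measurable_lebesgue_affine[OF m, of 1 h] by (simp add: add.commute)
  have key: "(\<integral>\<^sup>+x. g (x + h) * indicator cell x \<partial>lebesgue) = (\<integral>\<^sup>+x. g x * indicator cell x \<partial>lebesgue)"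
  proof (rule nn_integral_cell_translate[OF gm])
    fix q :: "real^'d" assume "q \<in> lattice"
    thus "AE x in lebesgue. g (x + (2 * pi) *\<^sub>R q) = g x"
      using p by (intro always_eventually allI) (simp add: g_def zperiodic_def)
  qed
  have conv: "(\<integral>\<^sup>+x. ennreal (k x + M) * indicator cell x \<partial>lebesgue) = ennreal ((LINT x|lebesgue_on cell. k x) + M * measure lebesgue (cell::(real^'d) set))"
    if "k \<in> borel_measurable lebesgue" "!!x. \<bar>k x\<bar> <= M" for k :: "real^'d => real"
  proof -
    have i: "integrable (lebesgue_on cell) k" by (rule cell_bounded_integrable[OF that])
    have ic: "integrable (lebesgue_on cell) (%x::real^'d. M)" by (rule cell_bounded_integrable[of _ "\<bar>M\<bar>"]) auto
    have k0: "k x + M >= 0" for x using that(2)[of x] by (simp add: abs_le_iff)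
    have "(\<integral>\<^sup>+x. ennreal (k x + M) * indicator cell x \<partial>lebesgue) = (\<integral>\<^sup>+x. ennreal (k x + M) \<partial>lebesgue_on cell)"
      using cell_sets by (subst nn_integral_restrict_space) auto
    also have "\<dots> = ennreal (LINT x|lebesgue_on cell. k x + M)"
      by (rule nn_integral_eq_integral[OF Bochner_Integration.integrable_add[OF i ic]]) (use k0 in auto)
    also have "(LINT x|lebesgue_on cell. k x + M) = (LINT x|lebesgue_on cell. k x) + (\<integral>x. M \<partial>lebesgue_on (cell::(real^'d) set))"
      by (rule Bochner_Integration.integral_add[OF i ic])
    also have "(\<integral>x. M \<partial>lebesgue_on (cell::(real^'d) set)) = M * measure lebesgue (cell::(real^'d) set)"
      using cell_sets[where 'd='d] by (simp add: measure_restrict_space space_restrict_space)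
    finally show ?thesis .
  qed
  have nn: "(LINT x|lebesgue_on cell. k x) + M * measure lebesgue (cell::(real^'d) set) >= 0"
    if "k \<in> borel_measurable lebesgue" "!!x. \<bar>k x\<bar> <= M" for k :: "real^'d => real"
  proof -
    have i: "integrable (lebesgue_on cell) k" by (rule cell_bounded_integrable[OF that])
    have ic: "integrable (lebesgue_on cell) (%x::real^'d. M)" by (rule cell_bounded_integrable[of _ "\<bar>M\<bar>"]) auto
    have k0: "k x + M >= 0" for x using that(2)[of x] by (simp add: abs_le_iff)
    have "0 <= (LINT x|lebesgue_on cell. k x + M)" by (rule Bochner_Integration.integral_nonneg) (rule k0)
    also have "\<dots> = (LINT x|lebesgue_on cell. k x) + (\<integral>x. M \<partial>lebesgue_on (cell::(real^'d) set))"
      by (rule Bochner_Integration.integral_add[OF i ic])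
    also have "(\<integral>x. M \<partial>lebesgue_on (cell::(real^'d) set)) = M * measure lebesgue (cell::(real^'d) set)"
      using cell_sets[where 'd='d] by (simp add: measure_restrict_space space_restrict_space)
    finally show ?thesis .
  qed
  have bh: "\<bar>f (x + h)\<bar> <= M" for x by (rule b)
  show ?thesis using key unfolding g_def conv[OF m b] conv[OF mh bh]
    using nn[OF m b] nn[OF mh bh] by simp
qed

definition smooth_per :: "(real^'d => real) => bool" where
  "smooth_per \<psi> \<longleftrightarrow> smooth \<psi> & zperiodic \<psi>"

lemma smooth_perD:
  assumes "smooth_per \<psi>" shows "smooth \<psi>" "zperiodic \<psi>"
  using assms by (auto simp: smooth_per_def)

lemma smooth_per_bounded:
  assumes "smooth_per \<psi>" obtains M :: real where "M > 0" "!!x. \<bar>\<psi> x\<bar> <= M"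
  using zperiodic_bounded[OF smooth_perD(2)[OF assms] smoothD(4)[OF smooth_perD(1)[OF assms]]] by blast

lemma smooth_per_sqint:
  assumes "smooth_per \<psi>"
  shows "sqint (lebesgue_on cell) \<psi>" "integrable (lebesgue_on cell) \<psi>"
proof -
  obtain M where M: "M > 0" "!!x. \<bar>\<psi> x\<bar> <= M" by (rule smooth_per_bounded[OF assms]) blast
  show "sqint (lebesgue_on cell) \<psi>" "integrable (lebesgue_on cell) \<psi>"
    by (rule cell_bounded_integrable[OF smooth_measurable[OF smooth_perD(1)[OF assms]]], rule M(2))+
qed

lemma smooth_per_pd: "smooth_per \<psi> ==> smooth_per (pd i \<psi>)"
  unfolding smooth_per_def
proof (elim conjE, intro conjI)
  assume s: "smooth \<psi>" and z: "zperiodic \<psi>"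
  show "smooth (pd i \<psi>)" by (rule smoothD(3)[OF s])
  show "zperiodic (pd i \<psi>)" unfolding zperiodic_def
  proof (intro ballI allI)
    fix p x assume p: "p \<in> (lattice :: (real^'a) set)"
    have "(%x. \<psi> ((2 * pi) *\<^sub>R p + 1 *\<^sub>R x)) = \<psi>" using z p by (auto simp: zperiodic_def add.commute)
    hence "pd i \<psi> x = pd i (%x. \<psi> ((2 * pi) *\<^sub>R p + 1 *\<^sub>R x)) x" by simp
    also have "\<dots> = pd i \<psi> (x + (2 * pi) *\<^sub>R p)" by (subst smooth_pd_affine[OF s]) (simp add: add.commute)
    finally show "pd i \<psi> (x + (2 * pi) *\<^sub>R p) = pd i \<psi> x" by simp
  qed
qed

lemma smooth_per_lin: "smooth_per f ==> smooth_per g ==> smooth_per (%x. f x + c * g x)"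
  by (simp add: smooth_per_def smooth_lin zperiodic_def)
lemma smooth_per_const: "smooth_per (%x. c)"
  by (simp add: smooth_per_def smooth_const zperiodic_def)
lemma smooth_per_mult: "smooth_per f ==> smooth_per g ==> smooth_per (%x. f x * g x)"
  by (simp add: smooth_per_def smooth_mult zperiodic_def)
lemma smooth_per_diff: "smooth_per f ==> smooth_per g ==> smooth_per (%x. f x - g x)"
  using smooth_per_lin[of f g "-1"] by simp
lemma smooth_per_scale: "smooth_per f ==> smooth_per (%x. c * f x)"
  using smooth_per_lin[OF smooth_per_const[of 0], of f c] by simp
lemma smooth_per_sum:
  assumes "finite I" "!!i. i \<in> I ==> smooth_per (f i)" shows "smooth_per (%x. \<Sum>i\<in>I. f i x)"
  using assms by (simp add: smooth_per_def smooth_sum zperiodic_def)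

lemma smooth_per_measurable: "smooth_per f ==> f \<in> borel_measurable lebesgue"
  by (rule smooth_measurable[OF smooth_perD(1)])

text \<open>The cell integral of \<open>\<psi> (x + t e\<^sub>i)\<close> does not depend on \<open>t\<close>; its derivative is the integral of \<open>\<partial>\<^sub>i \<psi>\<close>.\<close>
lemma cell_integral_pd:
  assumes \<psi>: "smooth_per \<psi>" shows "(LINT x|lebesgue_on cell. pd i \<psi> x) = 0"
proof -
  note sm = smooth_perD(1)[OF \<psi>]
  note m = smooth_per_measurable[OF \<psi>]
  obtain M where M: "M > 0" "!!x. \<bar>\<psi> x\<bar> <= M" by (rule smooth_per_bounded[OF \<psi>]) blast
  obtain L where L: "L > 0" "!!x. \<bar>pd i \<psi> x\<bar> <= L" by (rule smooth_per_bounded[OF smooth_per_pd[OF \<psi>]]) blast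
  define t where "t n = 1 / real (Suc n)" for n
  have t: "t \<longlonglongrightarrow> 0" "t n ~= 0" for n
    unfolding t_def using LIMSEQ_Suc[OF lim_1_over_n] by auto
  have mh: "(%x. \<psi> (x + h)) \<in> borel_measurable lebesgue" for h
    using measurable_lebesgue_affine[OF m, of 1 h] by (simp add: add.commute)
  define D where "D n x = (\<psi> (x + t n *\<^sub>R axis i 1) - \<psi> x) / t n" for n x
  have Dm: "D n \<in> borel_measurable lebesgue" for n unfolding D_def using m mh by measurable
  have D0: "(LINT x|lebesgue_on cell. D n x) = 0" for n
  proof -
    have i1: "integrable (lebesgue_on cell) \<psi>" by (rule smooth_per_sqint[OF \<psi>])
    have i2: "integrable (lebesgue_on cell) (%x. \<psi> (x + t n *\<^sub>R axis i 1))"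
      by (rule cell_bounded_integrable[OF mh M(2)])
    have "(LINT x|lebesgue_on cell. D n x) = ((LINT x|lebesgue_on cell. \<psi> (x + t n *\<^sub>R axis i 1)) - (LINT x|lebesgue_on cell. \<psi> x)) / t n"
      unfolding D_def using i1 i2 by simp
    thus ?thesis by (simp add: integral_cell_translate[OF smooth_perD(2)[OF \<psi>] m M(2)])
  qed
  have "(%n. LINT x|lebesgue_on cell. D n x) \<longlonglongrightarrow> (LINT x|lebesgue_on cell. pd i \<psi> x)"
  proof (rule integral_dominated_convergence)
    show "pd i \<psi> \<in> borel_measurable (lebesgue_on cell)"
      by (intro measurable_restrict_space1 smooth_measurable smoothD(3) sm)
    show "D n \<in> borel_measurable (lebesgue_on cell)" for n by (intro measurable_restrict_space1 Dm)
    show "integrable (lebesgue_on cell) (%x. L)" by (rule cell_bounded_integrable[of _ "\<bar>L\<bar>"]) auto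
    show "AE x in lebesgue_on cell. (%n. D n x) \<longlonglongrightarrow> pd i \<psi> x"
      unfolding D_def by (intro always_eventually allI diffquot_tendsto sm t)
    show "AE x in lebesgue_on cell. norm (D n x) <= L" for n
      unfolding D_def real_norm_def by (intro always_eventually allI diffquot_bound sm L t)
  qed
  thus ?thesis using D0 by (simp add: LIMSEQ_const_iff)
qed

lemma cell_by_parts:
  assumes f: "smooth_per f" and g: "smooth_per g"
  shows "(LINT x|lebesgue_on cell. f x * pd i g x) = - (LINT x|lebesgue_on cell. pd i f x * g x)"
proof -
  have "0 = (LINT x|lebesgue_on cell. f x * pd i g x + pd i f x * g x)"
    using cell_integral_pd[OF smooth_per_mult[OF f g], of i] smooth_pd_mult[OF smooth_perD(1)[OF f] smooth_perD(1)[OF g], of i] by simp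
  also have "\<dots> = (LINT x|lebesgue_on cell. f x * pd i g x) + (LINT x|lebesgue_on cell. pd i f x * g x)"
    by (intro Bochner_Integration.integral_add smooth_per_sqint(2) smooth_per_mult smooth_per_pd f g)
  finally show ?thesis by simp
qed

subsection \<open>The Poincare inequality\<close>

lemma smooth_direction_derivative:
  assumes "smooth \<psi>"
  shows "((%t. \<psi> (x + t *\<^sub>R h)) has_real_derivative (\<Sum>i\<in>UNIV. h $ i * pd i \<psi> (x + t *\<^sub>R h))) (at t)"
proof -
  have "((%t. x + t *\<^sub>R h) has_derivative (%s. s *\<^sub>R h)) (at t)"
    by (auto intro!: derivative_eq_intros)
  from has_derivative_compose[OF this differentiable_has_derivative_pd[OF smoothD(2)[OF assms]]]
  have d: "((%t. \<psi> (x + t *\<^sub>R h)) has_derivative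
      (%s. \<Sum>j\<in>UNIV. (s *\<^sub>R h) $ j * pd j \<psi> (x + t *\<^sub>R h))) (at t)" .
  have "(\<Sum>j\<in>UNIV. (s *\<^sub>R h) $ j * pd j \<psi> y) = (\<Sum>i\<in>UNIV. h $ i * pd i \<psi> y) * s" for s y
    unfolding sum_distrib_right by (rule sum.cong[OF refl]) simp
  thus ?thesis using d by (simp only: has_field_derivative_def)
qed

abbreviation cellm :: "(real^'d) measure" where "cellm \<equiv> lebesgue_on cell"

lemma measurable_translate:
  fixes f :: "real^'d => real"
  shows "f \<in> borel_measurable lebesgue ==> (%x. f (x + h)) \<in> borel_measurable lebesgue"
  using measurable_lebesgue_affine[of f 1 h] by (simp add: add.commute)

lemma cell_nrm_translate:
  fixes f :: "real^'d => real"
  assumes p: "zperiodic f" and m: "f \<in> borel_measurable lebesgue" and b: "!!x. \<bar>f x\<bar> <= M"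
  shows "nrm cellm (%x. f (x + h)) = nrm cellm f"
proof -
  have b2: "\<bar>(f x)\<^sup>2\<bar> <= M\<^sup>2" for x using power_mono[OF b[of x], of 2] by simp
  have "(LINT x|cellm. (%x. (f x)\<^sup>2) (x + h)) = (LINT x|cellm. (%x. (f x)\<^sup>2) x)"
    by (rule integral_cell_translate[OF _ _ b2]) (use p m in \<open>simp_all add: zperiodic_def\<close>)
  thus ?thesis by (simp add: nrm_def)
qed

text \<open>The step \<open>h\<close> is divided into \<open>n\<close> equal steps. By translation invariance each of them contributes the same cell
  norm, so the left-hand side is at most the norm of the difference quotient for the step \<open>h/n\<close>, which
  converges to the norm of the directional derivative.\<close>
lemma cell_nrm_difference:
  fixes \<psi> :: "real^'d => real"
  assumes \<psi>: "smooth_per \<psi>"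
  shows "nrm cellm (%x. \<psi> (x + h) - \<psi> x) <= (\<Sum>i\<in>UNIV. \<bar>h $ i\<bar> * nrm cellm (pd i \<psi>))"
proof -
  note sm = smooth_perD(1)[OF \<psi>]
  note m = smooth_per_measurable[OF \<psi>]
  obtain M where M: "M > 0" "!!x. \<bar>\<psi> x\<bar> <= M" by (rule smooth_per_bounded[OF \<psi>]) blast
  define dh where "dh x = (\<Sum>i\<in>UNIV. h $ i * pd i \<psi> x)" for x
  have dhp: "smooth_per dh" unfolding dh_def by (intro smooth_per_sum smooth_per_scale smooth_per_pd \<psi>) simp
  obtain L where L: "L > 0" "!!x. \<bar>dh x\<bar> <= L" by (rule smooth_per_bounded[OF dhp]) blast
  define n where "n k = nrm cellm (%x. \<psi> (x + k) - \<psi> x)" for k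
  have sqt: "sqint cellm (%x. \<psi> (x + a) - \<psi> (x + b))" for a b
    by (intro sqint_diff cell_bounded_integrable(1)[OF measurable_translate[OF m] M(2)])
  have multi: "n (real j *\<^sub>R k) <= real j * n k" for j k
  proof (induction j)
    case 0 show ?case by (simp add: n_def nrm_def)
  next
    case (Suc j)
    let ?a = "real j *\<^sub>R k"
    have "n (real (Suc j) *\<^sub>R k) = nrm cellm (%x. (\<psi> (x + (?a + k)) - \<psi> (x + ?a)) + (\<psi> (x + ?a) - \<psi> (x + 0)))"
    proof -
      have "real (Suc j) *\<^sub>R k = ?a + k" by (simp add: scaleR_left_distrib)
      thus ?thesis by (simp add: n_def)
    qed
    also have "\<dots> <= nrm cellm (%x. \<psi> (x + (?a + k)) - \<psi> (x + ?a)) + nrm cellm (%x. \<psi> (x + ?a) - \<psi> (x + 0))"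
      by (intro nrm_triangle sqt)
    also have "nrm cellm (%x. \<psi> (x + (?a + k)) - \<psi> (x + ?a)) = n k"
    proof -
      have z: "zperiodic (%x. \<psi> (x + k) - \<psi> x)"
        using zperiodic_translate[OF smooth_perD(2)[OF \<psi>], of k] smooth_perD(2)[OF \<psi>] by (simp add: zperiodic_def)
      have mm: "(%x. \<psi> (x + k) - \<psi> x) \<in> borel_measurable lebesgue" using measurable_translate[OF m] m by simp
      have bb: "\<bar>\<psi> (x + k) - \<psi> x\<bar> <= 2 * M" for x using M(2)[of "x + k"] M(2)[of x] by linarith
      show ?thesis using cell_nrm_translate[OF z mm bb, of ?a] by (simp add: n_def add.assoc)
    qed
    also have "nrm cellm (%x. \<psi> (x + ?a) - \<psi> (x + 0)) = n ?a" by (simp add: n_def)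
    finally show ?case using Suc.IH by (simp add: algebra_simps)
  qed
  define t where "t j = 1 / real (Suc j)" for j
  have t: "t \<longlonglongrightarrow> 0" "t j > 0" "t j ~= 0" for j
    unfolding t_def using LIMSEQ_Suc[OF lim_1_over_n] by auto
  define D where "D j x = (\<psi> (x + t j *\<^sub>R h) - \<psi> x) / t j" for j x
  have Dm: "D j \<in> borel_measurable lebesgue" for j
    unfolding D_def using m measurable_translate[OF m] by (intro borel_measurable_divide borel_measurable_diff) auto
  have le: "n h <= nrm cellm (D j)" for j
  proof -
    have hh: "real (Suc j) *\<^sub>R (t j *\<^sub>R h) = h" by (simp add: t_def)
    have "n h <= real (Suc j) * n (t j *\<^sub>R h)" using multi[of "Suc j" "t j *\<^sub>R h"] unfolding hh .
    also have "\<dots> = \<bar>real (Suc j)\<bar> * n (t j *\<^sub>R h)" by simp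
    also have "\<dots> = nrm cellm (%x. real (Suc j) * (\<psi> (x + t j *\<^sub>R h) - \<psi> x))" unfolding n_def by (rule nrm_scale[symmetric])
    also have "(%x. real (Suc j) * (\<psi> (x + t j *\<^sub>R h) - \<psi> x)) = D j" by (auto simp: D_def t_def)
    finally show ?thesis .
  qed
  have lim: "(%j. LINT x|cellm. (D j x)\<^sup>2) \<longlonglongrightarrow> (LINT x|cellm. (dh x)\<^sup>2)"
  proof (rule integral_dominated_convergence)
    show "(%x. (dh x)\<^sup>2) \<in> borel_measurable cellm"
      using measurable_restrict_space1[OF smooth_per_measurable[OF dhp]] by simp
    show "(%x. (D j x)\<^sup>2) \<in> borel_measurable cellm" for j using measurable_restrict_space1[OF Dm] by simp
    show "integrable cellm (%x::real^'d. L\<^sup>2)" by (rule cell_bounded_integrable[of _ "\<bar>L\<^sup>2\<bar>"]) auto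
    show "AE x in cellm. (%j. (D j x)\<^sup>2) \<longlonglongrightarrow> (dh x)\<^sup>2"
    proof (intro always_eventually allI tendsto_power)
      fix x
      have "((%s. (\<psi> (x + s *\<^sub>R h) - \<psi> x) / s) \<longlongrightarrow> dh x) (at 0)"
        using smooth_direction_derivative[OF sm, of x h 0] by (simp add: has_field_derivative_iff dh_def)
      thus "(%j. D j x) \<longlonglongrightarrow> dh x" using t(1,3) by (auto simp: tendsto_at_iff_sequentially o_def D_def)
    qed
    show "AE x in cellm. norm ((D j x)\<^sup>2) <= L\<^sup>2" for j
    proof (intro always_eventually allI)
      fix x
      have "norm (\<psi> (x + t j *\<^sub>R h) - \<psi> (x + 0 *\<^sub>R h)) <= L * norm (t j - 0)"
        by (rule field_differentiable_bound[of UNIV "%s. \<psi> (x + s *\<^sub>R h)" "%s. dh (x + s *\<^sub>R h)"])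
           (use L(2) in \<open>auto simp: dh_def intro: smooth_direction_derivative[OF sm, THEN has_field_derivative_at_within]\<close>)
      hence "\<bar>D j x\<bar> <= L" using t(2)[of j] by (simp add: D_def abs_div divide_le_eq)
      thus "norm ((D j x)\<^sup>2) <= L\<^sup>2" using power_mono[of "\<bar>D j x\<bar>" L 2] by simp
    qed
  qed
  have lim2: "(%j. nrm cellm (D j)) \<longlonglongrightarrow> nrm cellm dh" unfolding nrm_def by (rule tendsto_real_sqrt[OF lim])
  have "n h <= nrm cellm dh" by (rule LIMSEQ_le_const[OF lim2]) (use le in blast)
  also have "\<dots> <= (\<Sum>i\<in>UNIV. nrm cellm (%x. h $ i * pd i \<psi> x))"
    unfolding dh_def by (rule nrm_sum) (simp_all add: sqint_scale smooth_per_sqint(1) smooth_per_pd \<psi>)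
  also have "\<dots> = (\<Sum>i\<in>UNIV. \<bar>h $ i\<bar> * nrm cellm (pd i \<psi>))" by (simp add: nrm_scale)
  finally show ?thesis by (simp add: n_def)
qed

lemma cell_borel: "cell \<in> sets (borel :: (real^'d) measure)"
proof -
  have "cell = (\<Inter>i\<in>UNIV. {y::real^'d. 0 <= y $ i} \<inter> {y. y $ i < 2 * pi})" by (auto simp: cell_def)
  also have "\<dots> \<in> sets borel"
    by (intro sets.finite_INT sets.Int borel_closed borel_open closed_halfspace_component_ge_cart open_halfspace_component_lt_cart) auto
  finally show ?thesis .
qed

text \<open>The mean is an average of \<open>\<psi> (x + h)\<close> over \<open>h\<close> in the cell, so \<open>\<psi> - mean \<psi>\<close> is an average of differences, each of which is
  bounded by \<open>cell_nrm_difference\<close> with coordinates of \<open>h\<close> at most \<open>2\<pi>\<close>.\<close>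
lemma poincare_inequality:
  fixes \<psi> :: "real^'d => real"
  assumes \<psi>: "smooth_per \<psi>"
  shows "nrm cellm (%x. \<psi> x - mean \<psi>) <= 2 * pi * (\<Sum>i\<in>UNIV. nrm cellm (pd i \<psi>))"
proof -
  note sm = smooth_perD(1)[OF \<psi>]
  note m = smooth_per_measurable[OF \<psi>]
  obtain M where M: "M > 0" "!!x. \<bar>\<psi> x\<bar> <= M" by (rule smooth_per_bounded[OF \<psi>]) blast
  define c where "c = measure lebesgue (cell :: (real^'d) set)"
  have c: "c > 0" unfolding c_def by (rule cell_pos)
  define K where "K = 2 * pi * (\<Sum>i\<in>UNIV. nrm cellm (pd i \<psi>))"
  have K0: "K >= 0" unfolding K_def by (intro mult_nonneg_nonneg sum_nonneg nrm_nonneg) auto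
  define \<mu> where "\<mu> = mean \<psi>"
  have cm: "c * \<mu> = (LINT x|cellm. \<psi> x)" using c by (simp add: \<mu>_def mean_def c_def)
  have Kh: "nrm cellm (%x. \<psi> (x + h) - \<psi> x) <= K" if "h \<in> cell" for h
  proof -
    have "nrm cellm (%x. \<psi> (x + h) - \<psi> x) <= (\<Sum>i\<in>UNIV. \<bar>h $ i\<bar> * nrm cellm (pd i \<psi>))"
      by (rule cell_nrm_difference[OF \<psi>])
    also have "\<dots> <= (\<Sum>i\<in>UNIV. 2 * pi * nrm cellm (pd i \<psi>))"
      using that by (intro sum_mono mult_right_mono nrm_nonneg) (auto simp: cell_def less_imp_le)
    finally show ?thesis by (simp add: K_def sum_distrib_left)
  qed
  have intc: "integrable cellm (%h::real^'d. k)" for k :: real by (rule cell_bounded_integrable[of _ "\<bar>k\<bar>"]) auto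
  have intc': "(LINT h|(cellm :: (real^'d) measure). k) = k * c" for k :: real
    using cell_sets[where 'd='d] by (simp add: measure_restrict_space space_restrict_space c_def)
  have mcell: "measure (cellm :: (real^'d) measure) cell = c"
    using cell_sets[where 'd='d] by (simp add: measure_restrict_space c_def)
  have bt: "\<bar>\<psi> (x + h)\<bar> <= M" for x h by (rule M(2))
  have mth: "(%h. \<psi> (x + h)) \<in> borel_measurable lebesgue" for x
    using measurable_translate[OF m, of x] by (simp add: add.commute)
  have sqth: "sqint cellm (%h. \<psi> (x + h))" "integrable cellm (%h. \<psi> (x + h))" for x
    using cell_bounded_integrable[OF mth bt] .
  have sqc: "sqint cellm (%h::real^'d. k)" for k :: real by (rule cell_bounded_integrable[of _ "\<bar>k\<bar>"]) auto
  have pt: "c * (\<psi> x - \<mu>)\<^sup>2 <= (LINT h|cellm. (\<psi> (x + h) - \<psi> x)\<^sup>2)" for x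
  proof -
    have tr: "(LINT h|cellm. \<psi> (x + h)) = c * \<mu>"
      using integral_cell_translate[OF smooth_perD(2)[OF \<psi>] m M(2), of x] by (simp add: cm add.commute)
    have i2: "integrable cellm (%h. (\<psi> (x + h) - \<mu>)\<^sup>2)"
      using sqint_diff[OF sqth(1) sqc] by (simp add: sqint_def)
    have "(LINT h|cellm. (\<psi> (x + h) - \<psi> x)\<^sup>2)
        = (LINT h|cellm. (\<psi> (x + h) - \<mu>)\<^sup>2 + (2 * (\<mu> - \<psi> x) * \<psi> (x + h) + ((\<mu> - \<psi> x)\<^sup>2 - 2 * (\<mu> - \<psi> x) * \<mu>)))"
      by (intro Bochner_Integration.integral_cong refl) (simp add: power2_eq_square algebra_simps)
    also have "\<dots> = (LINT h|cellm. (\<psi> (x + h) - \<mu>)\<^sup>2) + (2 * (\<mu> - \<psi> x) * (c * \<mu>) + ((\<mu> - \<psi> x)\<^sup>2 - 2 * (\<mu> - \<psi> x) * \<mu>) * c)"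
      using i2 sqth(2) intc by (simp add: tr intc' mcell del: Bochner_Integration.integral_diff)
    also have "\<dots> = (LINT h|cellm. (\<psi> (x + h) - \<mu>)\<^sup>2) + c * (\<psi> x - \<mu>)\<^sup>2"
      by (simp add: power2_eq_square algebra_simps)
    finally show ?thesis by (simp add: Bochner_Integration.integral_nonneg)
  qed
  have nn_cell: "(\<integral>\<^sup>+x. f x \<partial>cellm) = (\<integral>\<^sup>+x. f x * indicator cell x \<partial>lborel)" for f :: "real^'d => ennreal"
    using cell_sets by (subst nn_integral_restrict_space) (auto simp: nn_integral_completion)
  have [measurable]: "\<psi> \<in> borel_measurable borel" by (intro borel_measurable_continuous_onI smoothD(4) sm)
  have [measurable]: "(cell :: (real^'d) set) \<in> sets borel" by (rule cell_borel)
  have int2: "integrable cellm (%x. (\<psi> x - \<mu>)\<^sup>2)"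
    using sqint_diff[OF smooth_per_sqint(1)[OF \<psi>] sqc] by (simp add: sqint_def)
  have i3: "integrable cellm (%h. (\<psi> (x + h) - \<psi> x)\<^sup>2)" for x
    using sqint_diff[OF sqth(1) sqc] by (simp add: sqint_def)
  have i4: "integrable cellm (%x. (\<psi> (x + h) - \<psi> x)\<^sup>2)" for h
  proof -
    have "sqint cellm (%x. \<psi> (x + h))"
      by (rule cell_bounded_integrable[OF measurable_translate[OF m] bt])
    from sqint_diff[OF this smooth_per_sqint(1)[OF \<psi>]]
    show ?thesis by (simp add: sqint_def)
  qed
  have "ennreal (c * (nrm cellm (%x. \<psi> x - \<mu>))\<^sup>2) = (\<integral>\<^sup>+x. ennreal (c * (\<psi> x - \<mu>)\<^sup>2) \<partial>cellm)"
    using int2 c by (subst nn_integral_eq_integral) (auto simp: nrm_sq)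
  also have "\<dots> <= (\<integral>\<^sup>+x. (\<integral>\<^sup>+h. ennreal ((\<psi> (x + h) - \<psi> x)\<^sup>2) \<partial>cellm) \<partial>cellm)"
  proof (rule nn_integral_mono)
    fix x
    have "ennreal (c * (\<psi> x - \<mu>)\<^sup>2) <= ennreal (LINT h|cellm. (\<psi> (x + h) - \<psi> x)\<^sup>2)" by (rule ennreal_leI[OF pt])
    also have "\<dots> = (\<integral>\<^sup>+h. ennreal ((\<psi> (x + h) - \<psi> x)\<^sup>2) \<partial>cellm)"
      by (rule nn_integral_eq_integral[OF i3, symmetric]) simp
    finally show "ennreal (c * (\<psi> x - \<mu>)\<^sup>2) <= (\<integral>\<^sup>+h. ennreal ((\<psi> (x + h) - \<psi> x)\<^sup>2) \<partial>cellm)" .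
  qed
  also have "\<dots> = (\<integral>\<^sup>+x. (\<integral>\<^sup>+h. ennreal ((\<psi> (x + h) - \<psi> x)\<^sup>2) * indicator cell h * indicator cell x \<partial>lborel) \<partial>lborel)"
    unfolding nn_cell by (intro nn_integral_cong nn_integral_multc[symmetric]) measurable
  also have "\<dots> = (\<integral>\<^sup>+h. (\<integral>\<^sup>+x. ennreal ((\<psi> (x + h) - \<psi> x)\<^sup>2) * indicator cell h * indicator cell x \<partial>lborel) \<partial>lborel)"
    by (rule lborel_pair.Fubini') measurable
  also have "\<dots> <= (\<integral>\<^sup>+h. ennreal (K\<^sup>2) * indicator (cell :: (real^'d) set) h \<partial>lborel)"
  proof (rule nn_integral_mono)
    fix h :: "real^'d"
    show "(\<integral>\<^sup>+x. ennreal ((\<psi> (x + h) - \<psi> x)\<^sup>2) * indicator cell h * indicator cell x \<partial>lborel) <= ennreal (K\<^sup>2) * indicator cell h"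
    proof (cases "h \<in> cell")
      case True
      have "(\<integral>\<^sup>+x. ennreal ((\<psi> (x + h) - \<psi> x)\<^sup>2) * indicator cell h * indicator cell x \<partial>lborel) = (\<integral>\<^sup>+x. ennreal ((\<psi> (x + h) - \<psi> x)\<^sup>2) \<partial>cellm)"
        using True by (simp add: nn_cell)
      also have "\<dots> = ennreal ((nrm cellm (%x. \<psi> (x + h) - \<psi> x))\<^sup>2)"
        by (subst nn_integral_eq_integral[OF i4]) (auto simp: nrm_sq)
      also have "\<dots> <= ennreal (K\<^sup>2)" by (intro ennreal_leI power_mono Kh True nrm_nonneg)
      finally show ?thesis using True by simp
    qed simp
  qed
  also have "\<dots> = ennreal (K\<^sup>2) * emeasure lborel (cell :: (real^'d) set)" by (rule nn_integral_cmult_indicator) (simp add: cell_borel)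
  also have "emeasure lborel (cell :: (real^'d) set) = ennreal c"
    using emeasure_cell[where 'd='d] cell_borel[where 'd='d] by (simp add: c_def)
  also have "ennreal (K\<^sup>2) * ennreal c = ennreal (K\<^sup>2 * c)" using c by (simp add: ennreal_mult)
  finally have "c * (nrm cellm (%x. \<psi> x - \<mu>))\<^sup>2 <= K\<^sup>2 * c" using c by (simp add: ennreal_le_iff)
  hence "(nrm cellm (%x. \<psi> x - \<mu>))\<^sup>2 <= K\<^sup>2" using c by (simp add: mult.commute)
  hence "nrm cellm (%x. \<psi> x - \<mu>) <= K" by (rule power2_le_imp_le) (rule K0)
  thus ?thesis by (simp add: K_def \<mu>_def)
qed

subsection \<open>Periodization of test functions\<close>

text \<open>The set over which the sum ranges is finite for a test function, so that no summability question arises.\<close>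
definition periodize :: "(real^'d => real) => real^'d => real" where
  "periodize \<phi> x = (\<Sum>p | p \<in> lattice & \<phi> (x + (2 * pi) *\<^sub>R p) ~= 0. \<phi> (x + (2 * pi) *\<^sub>R p))"

definition lattice_ball :: "real => (real^'d) set" where
  "lattice_ball r = {p \<in> lattice. norm p <= r}"

lemma periodize_finite:
  assumes R: "!!x. norm x > R ==> \<phi> x = 0" and x: "norm x <= r" and s: "(r + R) / (2 * pi) <= s"
  shows "periodize \<phi> x = (\<Sum>p\<in>lattice_ball s. \<phi> (x + (2 * pi) *\<^sub>R p))"
  unfolding periodize_def
proof (rule sum.mono_neutral_left)
  show "finite (lattice_ball s)" unfolding lattice_ball_def by (rule finite_lattice_ball)
  show "{p \<in> lattice. \<phi> (x + (2 * pi) *\<^sub>R p) ~= 0} \<subseteq> lattice_ball s"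
  proof
    fix p assume p: "p \<in> {p \<in> lattice. \<phi> (x + (2 * pi) *\<^sub>R p) ~= 0}"
    hence "norm (x + (2 * pi) *\<^sub>R p) <= R" using R not_less by blast
    moreover have "norm ((2 * pi) *\<^sub>R p) <= norm (x + (2 * pi) *\<^sub>R p) + norm x"
      using norm_triangle_ineq4[of "x + (2 * pi) *\<^sub>R p" x] by simp
    ultimately have "2 * pi * norm p <= r + R" using x by simp
    hence "norm p <= (r + R) / (2 * pi)" by (simp add: le_divide_eq mult.commute)
    thus "p \<in> lattice_ball s" using p s by (auto simp: lattice_ball_def)
  qed
qed (auto simp: lattice_ball_def)

lemma pd_support:
  assumes "!!x. norm x > R ==> \<phi> x = 0" "norm z > R" shows "pd i \<phi> z = 0"
proof -
  have "pd i \<phi> z = pd i (%x. 0) z"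
  proof (rule pd_local[of "- cball 0 R"])
    show "\<phi> y = 0" if "y \<in> - cball 0 R" for y using that assms(1)[of y] by simp
  qed (use assms smooth_const in \<open>auto simp: open_Compl\<close>)
  thus ?thesis by (simp add: pd_const)
qed

lemma periodize_smooth:
  assumes \<phi>: "\<phi> \<in> test_functions \<Omega>"
  shows "smooth_per (periodize \<phi>)" "pd i (periodize \<phi>) = periodize (pd i \<phi>)"
proof -
  note sm = test_smooth[OF \<phi>]
  obtain R where R: "R > 0" "!!x. norm x > R ==> \<phi> x = 0" by (rule test_support_ball[OF \<phi>]) blast
  define S where "S x = (lattice_ball ((norm x + 1 + R) / (2 * pi)) :: (real^'a) set)" for x :: "real^'a"
  define g where "g x y = (\<Sum>p\<in>S x. \<phi> ((2 * pi) *\<^sub>R p + 1 *\<^sub>R y))" for x y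
  have fS: "finite (S x)" for x unfolding S_def lattice_ball_def by (rule finite_lattice_ball)
  have smp: "smooth (%y. \<phi> ((2 * pi) *\<^sub>R p + 1 *\<^sub>R y))" for p by (rule smooth_affine[OF sm])
  have sg: "smooth (g x)" for x unfolding g_def by (rule smooth_sum[OF fS smp])
  have loc: "periodize \<phi> y = g x y" if "y \<in> ball 0 (norm x + 1)" for x y
    unfolding g_def S_def using that
    by (subst periodize_finite[where R=R and r="norm x + 1", OF R(2)]) (auto simp: add.commute)
  have xb: "x \<in> ball 0 (norm x + 1)" for x :: "real^'a" by simp
  have s: "smooth (periodize \<phi>)"
  proof (rule smooth_local)
    fix x
    show "\<exists>U g. open U & x \<in> U & smooth g & (\<forall>y\<in>U. periodize \<phi> y = g y)"
      using loc sg xb by (intro exI[of _ "ball 0 (norm x + 1)"] exI[of _ "g x"]) auto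
  qed
  have z: "zperiodic (periodize \<phi>)" unfolding zperiodic_def
  proof (intro ballI allI)
    fix q x assume q: "q \<in> (lattice :: (real^'a) set)"
    show "periodize \<phi> (x + (2 * pi) *\<^sub>R q) = periodize \<phi> x" unfolding periodize_def
      by (rule sum.reindex_bij_witness[of _ "%p. p - q" "%p. p + q"])
         (use q in \<open>auto simp: lattice_def scaleR_add_right scaleR_diff_right add.assoc add.commute[of "_ *\<^sub>R q"]\<close>)
  qed
  show "smooth_per (periodize \<phi>)" using s z by (simp add: smooth_per_def)
  show "pd i (periodize \<phi>) = periodize (pd i \<phi>)"
  proof
    fix x
    have "pd i (periodize \<phi>) x = pd i (g x) x"
      by (rule pd_local[of "ball 0 (norm x + 1)"]) (use loc sg xb in auto)
    also have "\<dots> = (\<Sum>p\<in>S x. pd i (%y. \<phi> ((2 * pi) *\<^sub>R p + 1 *\<^sub>R y)) x)"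
      unfolding g_def by (subst smooth_pd_sum[OF fS smp]) simp
    also have "\<dots> = (\<Sum>p\<in>S x. pd i \<phi> (x + (2 * pi) *\<^sub>R p))"
      by (subst smooth_pd_affine[OF sm]) (simp add: add.commute)
    also have "\<dots> = periodize (pd i \<phi>) x"
      unfolding S_def by (rule periodize_finite[where R=R and r="norm x + 1", symmetric, OF pd_support[OF R(2)]]) auto
    finally show "pd i (periodize \<phi>) x = periodize (pd i \<phi>) x" .
  qed
qed

text \<open>This converts equations tested against compactly supported functions on the whole space into
  equations tested against smooth periodic functions on the cell, and back.\<close>
lemma integral_periodize:
  fixes F :: "real^'d => real"
  assumes Fm: "F \<in> borel_measurable lebesgue" and Fp: "periodic F" and Fs: "sqint cellm F"
    and \<phi>: "\<phi> \<in> test_functions UNIV"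
  shows "(LINT x|lebesgue. F x * \<phi> x) = (LINT x|cellm. F x * periodize \<phi> x)"
proof -
  obtain R where R: "R > 0" "!!x. norm x > R ==> \<phi> x = 0" by (rule test_support_ball[OF \<phi>]) blast
  let ?cr = "cell_radius TYPE('d)"
  define S where "S = (lattice_ball ((?cr + R) / (2 * pi)) :: (real^'d) set)"
  have fS: "finite S" unfolding S_def lattice_ball_def by (rule finite_lattice_ball)
  have SL: "p \<in> lattice" if "p \<in> S" for p using that by (simp add: S_def lattice_ball_def)
  have \<phi>m: "\<phi> \<in> borel_measurable lebesgue" by (rule smooth_measurable[OF test_smooth[OF \<phi>]])
  have Fsq: "sqint lebesgue (%x. indicator (cball 0 R) x * F x)" by (rule periodic_loc_sqint[OF Fm Fp Fs])
  have F\<phi>: "integrable lebesgue (%x. F x * \<phi> x)"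
  proof -
    have "integrable lebesgue (%x. (indicator (cball 0 R) x * F x) * \<phi> x)"
      by (rule sqint_mult[OF Fsq test_sqint(1)[OF \<phi>]])
    moreover have "(indicator (cball 0 R) x * F x) * \<phi> x = F x * \<phi> x" for x
      using R(2)[of x] by (cases "norm x > R") auto
    ultimately show ?thesis by simp
  qed
  have im: "indicator cell \<in> borel_measurable (lebesgue :: (real^'d) measure)" by (rule borel_measurable_indicator[OF cell_sets])
  have imt: "(%x. indicator cell (x - a) :: real) \<in> borel_measurable (lebesgue :: (real^'d) measure)" for a
    using measurable_translate[OF im, of "- a"] by simp
  have dec: "F x * \<phi> x = (\<Sum>p\<in>S. indicator cell (x - (2 * pi) *\<^sub>R p) * (F x * \<phi> x))" for x
  proof (cases "norm x > R")
    case True thus ?thesis using R(2) by simp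
  next
    case False
    have "(2 * pi) *\<^sub>R lattice_floor x = x - (x - (2 * pi) *\<^sub>R lattice_floor x)" by simp
    moreover have "norm (x - (2 * pi) *\<^sub>R lattice_floor x) <= ?cr"
      using cell_lattice_unique[OF lattice_floor_in, of x x] cell_bounded by blast
    ultimately have "norm ((2 * pi) *\<^sub>R lattice_floor x) <= R + ?cr"
      using norm_triangle_ineq4[of x "x - (2 * pi) *\<^sub>R lattice_floor x"] False by simp
    hence "2 * pi * norm (lattice_floor x) <= ?cr + R" by simp
    hence fl: "lattice_floor x \<in> S"
      using lattice_floor_in by (simp add: S_def lattice_ball_def le_divide_eq mult.commute)
    have "(\<Sum>p\<in>S. indicator cell (x - (2 * pi) *\<^sub>R p) * (F x * \<phi> x)) = (\<Sum>p\<in>S. (if p = lattice_floor x then F x * \<phi> x else 0))"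
      by (rule sum.cong[OF refl]) (use SL cell_lattice_unique in \<open>auto simp: indicator_def\<close>)
    also have "\<dots> = F x * \<phi> x" using fS fl by simp
    finally show ?thesis by simp
  qed
  have ip: "integrable lebesgue (%x. indicator cell (x - (2 * pi) *\<^sub>R p) * (F x * \<phi> x))" for p
  proof (rule Bochner_Integration.integrable_bound[OF F\<phi>])
    show "(%x. indicator cell (x - (2 * pi) *\<^sub>R p) * (F x * \<phi> x)) \<in> borel_measurable lebesgue"
      using imt Fm \<phi>m by (intro borel_measurable_times)
  qed (auto simp: indicator_def)
  have shift: "(LINT x|lebesgue. indicator cell (x - (2 * pi) *\<^sub>R p) * (F x * \<phi> x)) = (LINT x|cellm. F x * \<phi> (x + (2 * pi) *\<^sub>R p))" if p: "p \<in> lattice" for p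
  proof -
    have m1: "(%x. indicator cell (x - (2 * pi) *\<^sub>R p) * (F x * \<phi> x)) \<in> borel_measurable lebesgue"
      using imt Fm \<phi>m by (intro borel_measurable_times)
    have "(LINT x|lebesgue. indicator cell (x - (2 * pi) *\<^sub>R p) * (F x * \<phi> x))
        = (LINT x|lebesgue. indicator cell x * (F (x + (2 * pi) *\<^sub>R p) * \<phi> (x + (2 * pi) *\<^sub>R p)))"
      using integral_lebesgue_translate[OF m1, of "(2 * pi) *\<^sub>R p"] by simp
    also have "\<dots> = (LINT x|lebesgue. indicator cell x * (F x * \<phi> (x + (2 * pi) *\<^sub>R p)))"
    proof (rule integral_cong_AE)
      show "AE x in lebesgue. indicator cell x * (F (x + (2 * pi) *\<^sub>R p) * \<phi> (x + (2 * pi) *\<^sub>R p)) = indicator cell x * (F x * \<phi> (x + (2 * pi) *\<^sub>R p))"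
        using periodicD[OF Fp p] by eventually_elim simp
    qed (intro borel_measurable_times im measurable_translate Fm \<phi>m)+
    also have "\<dots> = (LINT x|cellm. F x * \<phi> (x + (2 * pi) *\<^sub>R p))"
      using cell_sets by (subst integral_restrict_space) auto
    finally show ?thesis .
  qed
  have ic: "integrable cellm (%x. F x * \<phi> (x + (2 * pi) *\<^sub>R p))" for p
  proof (rule sqint_mult[OF Fs])
    obtain M where M: "M > 0" "!!x. \<bar>\<phi> x\<bar> <= M" by (rule test_bounded[OF \<phi>]) blast
    show "sqint cellm (%x. \<phi> (x + (2 * pi) *\<^sub>R p))"
      by (rule cell_bounded_integrable[OF measurable_translate[OF \<phi>m] M(2)])
  qed
  have "(LINT x|lebesgue. F x * \<phi> x) = (LINT x|lebesgue. (\<Sum>p\<in>S. indicator cell (x - (2 * pi) *\<^sub>R p) * (F x * \<phi> x)))"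
    by (subst dec) (rule refl)
  also have "\<dots> = (\<Sum>p\<in>S. LINT x|lebesgue. indicator cell (x - (2 * pi) *\<^sub>R p) * (F x * \<phi> x))"
    by (rule Bochner_Integration.integral_sum[OF ip])
  also have "\<dots> = (\<Sum>p\<in>S. LINT x|cellm. F x * \<phi> (x + (2 * pi) *\<^sub>R p))"
    by (rule sum.cong[OF refl shift[OF SL]])
  also have "\<dots> = (LINT x|cellm. (\<Sum>p\<in>S. F x * \<phi> (x + (2 * pi) *\<^sub>R p)))"
    by (rule Bochner_Integration.integral_sum[OF ic, symmetric])
  also have "\<dots> = (LINT x|cellm. F x * periodize \<phi> x)"
  proof (rule Bochner_Integration.integral_cong[OF refl])
    fix x assume "x \<in> space (cellm :: (real^'d) measure)"
    hence "norm x <= ?cr" using cell_bounded by (simp add: space_restrict_space)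
    thus "(\<Sum>p\<in>S. F x * \<phi> (x + (2 * pi) *\<^sub>R p)) = F x * periodize \<phi> x"
      unfolding S_def by (subst periodize_finite[where R=R and r="?cr", OF R(2)]) (auto simp: sum_distrib_left)
  qed
  finally show ?thesis .
qed

section \<open>Existence of periodic solutions\<close>

lemma mean_lin:
  assumes "integrable cellm f" "integrable cellm g"
  shows "mean (%x. f x + c * g x) = mean f + c * mean g"
  unfolding mean_def using assms by (simp add: ring_distribs)

lemma mean_const: "mean (%x::real^'d. c) = c"
  unfolding mean_def using cell_pos[where 'd='d] cell_sets[where 'd='d]
  by (simp add: measure_restrict_space space_restrict_space)

lemma L2_perD:
  assumes "u \<in> L2_per"
  shows "u \<in> borel_measurable lebesgue" "periodic u" "sqint cellm u"
  using assms by (auto simp: L2_per_def L2_def sqint_def)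

lemma L2_perI:
  assumes "u \<in> borel_measurable lebesgue" "periodic u" "sqint cellm u"
  shows "u \<in> L2_per"
  using assms by (auto simp: L2_per_def L2_def sqint_def)

lemma periodic_compose2:
  assumes "periodic u" "periodic v" shows "periodic (%x. h (u x) (v x))"
  unfolding periodic_def
proof (intro allI impI)
  fix p :: "real^'a" assume p: "\<forall>i. p $ i \<in> \<int>"
  have "AE y in lebesgue. u (y + (2 * pi) *\<^sub>R p) = u y" "AE y in lebesgue. v (y + (2 * pi) *\<^sub>R p) = v y"
    using assms p unfolding periodic_def by auto
  thus "AE y in lebesgue. h (u (y + (2 * pi) *\<^sub>R p)) (v (y + (2 * pi) *\<^sub>R p)) = h (u y) (v y)"
    by eventually_elim simp
qed

lemma periodic_const: "periodic (%x. c)" by (simp add: periodic_def)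

lemma L2_per_lin: "u \<in> L2_per ==> v \<in> L2_per ==> (%x. u x + c * v x) \<in> L2_per"
proof -
  assume u: "u \<in> L2_per" and v: "v \<in> L2_per"
  have [measurable]: "u \<in> borel_measurable lebesgue" "v \<in> borel_measurable lebesgue" using u v by (auto dest: L2_perD)
  show ?thesis
  proof (rule L2_perI)
    show "periodic (%x. u x + c * v x)"
      by (rule periodic_compose2[OF L2_perD(2)[OF u] L2_perD(2)[OF v], where h="%a b. a + c * b"])
    show "sqint cellm (%x. u x + c * v x)"
      by (rule sqint_lin[OF L2_perD(3)[OF u] L2_perD(3)[OF v]])
  qed simp
qed

lemma L2_per_const: "(%x. c) \<in> (L2_per :: (real^'d => real) set)"
  by (intro L2_perI periodic_const cell_bounded_integrable[of _ "\<bar>c\<bar>"]) auto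

lemma L2_per_scale: "u \<in> L2_per ==> (%x. c * u x) \<in> L2_per"
  using L2_per_lin[OF L2_per_const[of 0], of u c] by simp

lemma L2_per_sum:
  "finite I ==> (!!i. i \<in> I ==> u i \<in> L2_per) ==> (%x. \<Sum>i\<in>I. u i x) \<in> L2_per"
proof (induction I rule: finite_induct)
  case empty show ?case by (simp add: L2_per_const)
next
  case (insert i I)
  have "(%x. u i x + 1 * (\<Sum>i\<in>I. u i x)) \<in> L2_per"
    by (rule L2_per_lin) (use insert in blast)+
  thus ?case using insert by simp
qed

lemma smooth_per_L2_per: "smooth_per u ==> u \<in> L2_per"
  by (intro L2_perI smooth_per_measurable zperiodic_imp_periodic smooth_perD(2) smooth_per_sqint(1))

lemma L2_per_bounded_mult:
  assumes b: "b \<in> borel_measurable lebesgue" "periodic b" "AE y in lebesgue. \<bar>b y\<bar> <= M" and u: "u \<in> L2_per"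
  shows "(%x. b x * u x) \<in> L2_per"
proof (rule L2_perI)
  show "(%x. b x * u x) \<in> borel_measurable lebesgue" using b L2_perD[OF u] by simp
  show "periodic (%x. b x * u x)" by (rule periodic_compose2[OF b(2) L2_perD(2)[OF u]])
  show "sqint cellm (%x. b x * u x)"
  proof (rule sqint_bounded_mult[OF L2_perD(3)[OF u]])
    show "b \<in> borel_measurable cellm" by (rule measurable_restrict_space1[OF b(1)])
    show "AE x in cellm. \<bar>b x\<bar> <= M" using b(3) cell_sets by (subst AE_restrict_space_iff) (auto elim: eventually_mono)
  qed
qed

lemma periodic_ellipticE:
  fixes A :: "real^'d => real^'d^'d"
  assumes "periodic_elliptic A"
  obtains M \<alpha> where "M > 0" "\<alpha> > 0" "!!j k. (%y. A y $ j $ k) \<in> borel_measurable lebesgue"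
    "!!j k. periodic (%y. A y $ j $ k)" "!!j k. AE y in lebesgue. \<bar>A y $ j $ k\<bar> <= M"
    "!!j k. AE y in lebesgue. A y $ j $ k = A y $ k $ j"
    "AE y in lebesgue. \<forall>\<xi>. (A y *v \<xi>) \<bullet> \<xi> >= \<alpha> * (norm \<xi>)\<^sup>2"
proof -
  obtain M \<alpha> where M: "AE y in lebesgue. \<forall>j k. \<bar>A y $ j $ k\<bar> <= M" and a: "\<alpha> > 0" "AE y in lebesgue. \<forall>\<xi>. (A y *v \<xi>) \<bullet> \<xi> >= \<alpha> * (norm \<xi>)\<^sup>2"
    using assms unfolding periodic_elliptic_def by blast
  have s: "AE y in lebesgue. transpose (A y) = A y" and p: "periodic A" and m: "!!j k. (%y. A y $ j $ k) \<in> borel_measurable lebesgue"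
    using assms unfolding periodic_elliptic_def by blast+
  show thesis
  proof (rule that[of "\<bar>M\<bar> + 1" \<alpha>])
    show "AE y in lebesgue. \<bar>A y $ j $ k\<bar> <= \<bar>M\<bar> + 1" for j k
      using M
    proof eventually_elim
      case (elim y)
      hence "\<bar>A y $ j $ k\<bar> <= M" by blast
      thus ?case by linarith
    qed
    show "periodic (%y. A y $ j $ k)" for j k
      by (rule periodic_compose2[OF p p, where h="%a b. a $ j $ k"])
    show "AE y in lebesgue. A y $ j $ k = A y $ k $ j" for j k
      using s
    proof eventually_elim
      case (elim y)
      have "A y $ j $ k = transpose (A y) $ j $ k" using elim by simp
      thus ?case by (simp add: transpose_def)
    qed
  qed (use m a in auto)
qed

lemma periodic_closed:
  fixes s :: "nat => real^'d => real"
  assumes s: "!!n. smooth_per (s n)"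
    and c: "!!e. e > 0 ==> \<exists>K. \<forall>m\<ge>K. \<forall>n\<ge>K. (LINT x|cellm. (s m x - s n x)\<^sup>2) < e"
  obtains w where "w \<in> L2_per" "(%n. nrm cellm (%x. s n x - w x)) \<longlonglongrightarrow> 0"
proof -
  obtain r where r: "sqint cellm (ae_lim (%n. s (r n)))"
    "(%n. nrm cellm (%x. s n x - ae_lim (%n. s (r n)) x)) \<longlonglongrightarrow> 0"
    by (rule L2_complete[OF smooth_per_sqint(1)[OF s] c]) blast
  have "ae_lim (%n. s (r n)) \<in> L2_per"
  proof (rule L2_perI[OF _ _ r(1)])
    show "ae_lim (%n. s (r n)) \<in> borel_measurable lebesgue"
      by (intro borel_measurable_ae_lim smooth_per_measurable s)
    have "zperiodic (ae_lim (%n. s (r n)))"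
      using smooth_perD(2)[OF s] by (simp add: zperiodic_def ae_lim_def)
    thus "periodic (ae_lim (%n. s (r n)))" by (rule zperiodic_imp_periodic)
  qed
  from that[OF this r(2)] show thesis .
qed

lemma has_weak_pd_UNIV:
  "has_weak_pd UNIV i u v \<longleftrightarrow> (\<forall>\<phi>\<in>test_functions UNIV. (LINT x|lebesgue. u x * pd i \<phi> x) = - (LINT x|lebesgue. v x * \<phi> x))"
  unfolding has_weak_pd_def distr_eq_def distr_pd_def distr_of_def
  by (auto simp: lebesgue_on_UNIV_eq minus_equation_iff eq_commute)

text \<open>For smooth periodic functions the formula is integration by parts on the cell, after periodizing the test function.
  Both sides pass to the limit.\<close>
lemma periodic_weak_pd_limit:
  fixes w D :: "real^'d => real"
  assumes s: "!!n. smooth_per (s n)" and w: "w \<in> L2_per" and D: "D \<in> L2_per"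
    and lw: "(%n. nrm cellm (%x. s n x - w x)) \<longlonglongrightarrow> 0"
    and lD: "(%n. nrm cellm (%x. pd i (s n) x - D x)) \<longlonglongrightarrow> 0"
  shows "has_weak_pd UNIV i w D"
  unfolding has_weak_pd_UNIV
proof
  fix \<phi> :: "real^'d => real" assume \<phi>: "\<phi> \<in> test_functions UNIV"
  let ?\<Phi> = "periodize \<phi>"
  have P: "smooth_per ?\<Phi>" and pP: "pd i ?\<Phi> = periodize (pd i \<phi>)" by (rule periodize_smooth[OF \<phi>])+
  have sq: "sqint cellm (s n)" "sqint cellm (pd i (s n))" for n
    by (intro smooth_per_sqint(1) smooth_per_pd s)+
  have "(%n. LINT x|cellm. s n x * pd i ?\<Phi> x) \<longlonglongrightarrow> (LINT x|cellm. w x * pd i ?\<Phi> x)"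
    by (rule L2_ip_tendsto[OF L2_perD(3)[OF w] sq(1) _ lw]) (intro smooth_per_sqint(1) smooth_per_pd P)
  moreover have "(%n. - (LINT x|cellm. pd i (s n) x * ?\<Phi> x)) \<longlonglongrightarrow> - (LINT x|cellm. D x * ?\<Phi> x)"
    by (intro tendsto_minus L2_ip_tendsto[OF L2_perD(3)[OF D] sq(2) _ lD] smooth_per_sqint(1) P)
  moreover have "(LINT x|cellm. s n x * pd i ?\<Phi> x) = - (LINT x|cellm. pd i (s n) x * ?\<Phi> x)" for n
    by (rule cell_by_parts[OF s P])
  ultimately have "(LINT x|cellm. w x * pd i ?\<Phi> x) = - (LINT x|cellm. D x * ?\<Phi> x)"
    using LIMSEQ_unique by simp
  thus "(LINT x|lebesgue. w x * pd i \<phi> x) = - (LINT x|lebesgue. D x * \<phi> x)"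
    using integral_periodize[OF L2_perD[OF w] test_pd[OF \<phi>, of i]] integral_periodize[OF L2_perD[OF D] \<phi>] by (simp add: pP)
qed

lemma cell_mult_integrable: "u \<in> L2_per ==> v \<in> L2_per ==> integrable cellm (%x. u x * v x)"
  by (intro sqint_mult L2_perD(3))

text \<open>Lax-Milgram for the energy form
  \<open>Q \<psi> \<phi> = \<rho>\<^sup>2 \<Sum>\<^sub>i\<^sub>j \<integral> \<partial>\<^sub>i\<^sub>j \<psi> \<partial>\<^sub>i\<^sub>j \<phi> + \<integral> B \<nabla>\<psi> \<bullet> \<nabla>\<phi>\<close> on smooth periodic functions of mean zero. The sequence of
  \<open>riesz_sequence\<close> is Cauchy in energy, hence together with its derivatives in \<open>L\<^sup>2\<close> of the
  cell, and the limits solve the equation. Using the full matrix of second derivatives, rather than the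
  Laplacian alone, makes the second derivatives converge without an elliptic regularity estimate. The lemma
  serves for correctors (\<open>\<gamma> = 0\<close>, \<open>F = - A e\<^sub>j\<close>), for potentials of a divergence
  (\<open>B = 1\<close>, \<open>\<rho> = 0\<close>) and for \<open>- \<Delta>w = \<gamma>\<close>.\<close>
lemma periodic_existence:
  fixes B :: "real^'d => real^'d^'d" and F :: "'d => real^'d => real" and \<gamma> :: "real^'d => real"
  assumes Bell: "periodic_elliptic B" and F: "!!i. F i \<in> L2_per" and \<gamma>: "\<gamma> \<in> L2_per" and \<gamma>0: "(LINT x|cellm. \<gamma> x) = 0"
  obtains w D E where "w \<in> L2_per" "mean w = 0" "!!i. D i \<in> L2_per" "!!i. has_weak_pd UNIV i w (D i)"
    "!!i j. \<rho> ~= 0 ==> E i j \<in> L2_per" "!!i j. \<rho> ~= 0 ==> has_weak_pd UNIV i (D j) (E i j)"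
    "!!\<phi>. \<phi> \<in> test_functions UNIV ==>
       \<rho>\<^sup>2 * (\<Sum>i\<in>UNIV. \<Sum>j\<in>UNIV. LINT x|lebesgue. w x * pd j (pd j (pd i (pd i \<phi>))) x)
       + (\<Sum>i\<in>UNIV. LINT x|lebesgue. (\<Sum>k\<in>UNIV. B x $ i $ k * D k x) * pd i \<phi> x)
       = (LINT x|lebesgue. \<gamma> x * \<phi> x) + (\<Sum>i\<in>UNIV. LINT x|lebesgue. F i x * pd i \<phi> x)"
proof -
  obtain M \<alpha> where M: "M > 0" and \<alpha>: "\<alpha> > 0" and Bm: "!!j k. (%y. B y $ j $ k) \<in> borel_measurable lebesgue"
    and Bp: "!!j k. periodic (%y. B y $ j $ k)" and Bb: "!!j k. AE y in lebesgue. \<bar>B y $ j $ k\<bar> <= M"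
    and Bs: "!!j k. AE y in lebesgue. B y $ j $ k = B y $ k $ j"
    and Be: "AE y in lebesgue. \<forall>\<xi>. (B y *v \<xi>) \<bullet> \<xi> >= \<alpha> * (norm \<xi>)\<^sup>2"
    by (rule periodic_ellipticE[OF Bell]) blast
  have AEc: "AE x in cellm. P x" if "AE x in lebesgue. P x" for P :: "real^'d => bool"
    using that cell_sets by (subst AE_restrict_space_iff) (auto elim: eventually_mono)
  define V where "V = {\<psi> :: real^'d => real. smooth_per \<psi> & mean \<psi> = 0}"
  define Q where "Q \<psi> \<phi> = \<rho>\<^sup>2 * (\<Sum>i\<in>UNIV. \<Sum>j\<in>UNIV. LINT x|cellm. pd i (pd j \<psi>) x * pd i (pd j \<phi>) x)
      + (\<Sum>i\<in>UNIV. \<Sum>k\<in>UNIV. LINT x|cellm. (B x $ i $ k * pd k \<psi> x) * pd i \<phi> x)" for \<psi> \<phi> :: "real^'d => real"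
  have BL: "(%x. B x $ i $ k * u x) \<in> L2_per" if "u \<in> L2_per" for i k u
    by (rule L2_per_bounded_mult[OF Bm Bp Bb that])
  have V: "smooth_per \<psi>" "mean \<psi> = 0" if "\<psi> \<in> V" for \<psi> using that by (auto simp: V_def)
  have pL: "pd i \<psi> \<in> L2_per" "pd i (pd j \<psi>) \<in> L2_per" if "smooth_per \<psi>" for \<psi> i j
    by (intro smooth_per_L2_per smooth_per_pd that)+
  have pdl: "pd i (%x. f x + c * g x) = (%x. pd i f x + c * pd i g x)" if "smooth_per f" "smooth_per g" for f g i c
    using that by (intro smooth_pd_lin smooth_perD(1))
  have pdl2: "pd i (pd j (%x. f x + c * g x)) = (%x. pd i (pd j f) x + c * pd i (pd j g) x)" if "smooth_per f" "smooth_per g" for f g i j c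
    unfolding pdl[OF that] by (rule pdl[OF smooth_per_pd[OF that(1)] smooth_per_pd[OF that(2)]])
  have ilin: "(LINT x|cellm. (u x + c * v x) * z x) = (LINT x|cellm. u x * z x) + c * (LINT x|cellm. v x * z x)"
    if "u \<in> L2_per" "v \<in> L2_per" "z \<in> L2_per" for u v z c
    using cell_mult_integrable[OF that(1,3)] cell_mult_integrable[OF that(2,3)] by (simp add: ring_distribs mult.assoc)
  have Qlin: "Q (%x. f x + c * g x) h = Q f h + c * Q g h" if "smooth_per f" "smooth_per g" "smooth_per h" for f g h c
  proof -
    have 1: "(LINT x|cellm. pd i (pd j (%x. f x + c * g x)) x * pd i (pd j h) x)
        = (LINT x|cellm. pd i (pd j f) x * pd i (pd j h) x) + c * (LINT x|cellm. pd i (pd j g) x * pd i (pd j h) x)" for i j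
      unfolding pdl2[OF that(1,2)] by (intro ilin pL that)
    have 2: "(LINT x|cellm. (B x $ i $ k * pd k (%x. f x + c * g x) x) * pd i h x)
        = (LINT x|cellm. (B x $ i $ k * pd k f x) * pd i h x) + c * (LINT x|cellm. (B x $ i $ k * pd k g x) * pd i h x)" for i k
    proof -
      have e: "B x $ i $ k * (pd k f x + c * pd k g x) = B x $ i $ k * pd k f x + c * (B x $ i $ k * pd k g x)" for x
        by (simp add: algebra_simps)
      show ?thesis unfolding pdl[OF that(1,2)] e
        by (rule ilin[OF BL[OF pL(1)[OF that(1)]] BL[OF pL(1)[OF that(2)]] pL(1)[OF that(3)]])
    qed
    show ?thesis unfolding Q_def 1 2 by (simp add: sum.distrib sum_distrib_left algebra_simps)
  qed
  have Qsym: "Q f g = Q g f" if that: "smooth_per f" "smooth_per g" for f g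
  proof -
    have e: "(LINT x|cellm. (B x $ i $ k * pd k f x) * pd i g x) = (LINT x|cellm. (B x $ k $ i * pd i g x) * pd k f x)" for i k
    proof (rule integral_cong_AE)
      show "AE x in cellm. B x $ i $ k * pd k f x * pd i g x = B x $ k $ i * pd i g x * pd k f x"
        using AEc[OF Bs[of i k]] by eventually_elim simp
      show "(%x. B x $ i $ k * pd k f x * pd i g x) \<in> borel_measurable cellm"
        by (rule borel_measurable_integrable[OF cell_mult_integrable[OF BL[OF pL(1)[OF that(1)]] pL(1)[OF that(2)]]])
      show "(%x. B x $ k $ i * pd i g x * pd k f x) \<in> borel_measurable cellm"
        by (rule borel_measurable_integrable[OF cell_mult_integrable[OF BL[OF pL(1)[OF that(2)]] pL(1)[OF that(1)]]])
    qed
    have "(\<Sum>i\<in>UNIV. \<Sum>k\<in>UNIV. LINT x|cellm. (B x $ i $ k * pd k f x) * pd i g x) = (\<Sum>i\<in>UNIV. \<Sum>k\<in>UNIV. LINT x|cellm. (B x $ k $ i * pd i g x) * pd k f x)"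
      by (simp only: e)
    also have "\<dots> = (\<Sum>i\<in>UNIV. \<Sum>k\<in>UNIV. LINT x|cellm. (B x $ i $ k * pd k g x) * pd i f x)"
      by (rule sum.swap)
    finally show ?thesis by (simp add: Q_def mult.commute)
  qed
  have Qpos: "Q f f >= \<alpha> * (\<Sum>i\<in>UNIV. (nrm cellm (pd i f))\<^sup>2) + \<rho>\<^sup>2 * (\<Sum>i\<in>UNIV. \<Sum>j\<in>UNIV. (nrm cellm (pd i (pd j f)))\<^sup>2)"
    if f: "smooth_per f" for f
  proof -
    have "\<alpha> * (\<Sum>i\<in>UNIV. (nrm cellm (pd i f))\<^sup>2) = (LINT x|cellm. \<alpha> * (\<Sum>i\<in>UNIV. (pd i f x)\<^sup>2))"
      using L2_perD(3)[OF pL(1)[OF f]] by (simp add: nrm_sq sqint_def)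
    also have "\<dots> <= (LINT x|cellm. (\<Sum>i\<in>UNIV. \<Sum>k\<in>UNIV. (B x $ i $ k * pd k f x) * pd i f x))"
    proof (rule integral_mono_AE)
      show "integrable cellm (%x. \<alpha> * (\<Sum>i\<in>UNIV. (pd i f x)\<^sup>2))"
        using L2_perD(3)[OF pL(1)[OF f]] by (simp add: sqint_def)
      show "integrable cellm (%x. \<Sum>i\<in>UNIV. \<Sum>k\<in>UNIV. (B x $ i $ k * pd k f x) * pd i f x)"
        by (intro Bochner_Integration.integrable_sum cell_mult_integrable BL pL f)
      show "AE x in cellm. \<alpha> * (\<Sum>i\<in>UNIV. (pd i f x)\<^sup>2) <= (\<Sum>i\<in>UNIV. \<Sum>k\<in>UNIV. (B x $ i $ k * pd k f x) * pd i f x)"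
        using AEc[OF Be]
      proof eventually_elim
        case (elim x)
        have "\<alpha> * (norm (\<chi> i. pd i f x))\<^sup>2 <= (B x *v (\<chi> i. pd i f x)) \<bullet> (\<chi> i. pd i f x)" using elim by blast
        thus ?case by (simp add: norm_vec_def L2_set_def sum_nonneg inner_vec_def matrix_vector_mult_def sum_distrib_right)
      qed
    qed
    also have "\<dots> = (\<Sum>i\<in>UNIV. \<Sum>k\<in>UNIV. LINT x|cellm. (B x $ i $ k * pd k f x) * pd i f x)"
    proof -
      have "integrable cellm (%x. (B x $ i $ k * pd k f x) * pd i f x)" for i k by (intro cell_mult_integrable BL pL f)
      thus ?thesis by (simp add: Bochner_Integration.integral_sum)
    qed
    finally have le: "\<alpha> * (\<Sum>i\<in>UNIV. (nrm cellm (pd i f))\<^sup>2) <= (\<Sum>i\<in>UNIV. \<Sum>k\<in>UNIV. LINT x|cellm. (B x $ i $ k * pd k f x) * pd i f x)" .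
    have "(nrm cellm (pd i (pd j f)))\<^sup>2 = (LINT x|cellm. pd i (pd j f) x * pd i (pd j f) x)" for i j
      unfolding nrm_sq by (simp add: power2_eq_square)
    thus ?thesis using le by (simp add: Q_def)
  qed
  interpret V: semi_inner V Q
  proof
    show "(%x. 0) \<in> V" by (simp add: V_def smooth_per_const mean_const)
    show "(%x. f x + c * g x) \<in> V" if "f \<in> V" "g \<in> V" for f g c
      using V[OF that(1)] V[OF that(2)] smooth_per_lin[of f g c]
        mean_lin[OF smooth_per_sqint(2)[OF V(1)[OF that(1)]] smooth_per_sqint(2)[OF V(1)[OF that(2)]], of c]
      by (simp add: V_def)
    show "Q f g = Q g f" if "f \<in> V" "g \<in> V" for f g by (rule Qsym[OF V(1)[OF that(1)] V(1)[OF that(2)]])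
    show "Q (%x. f x + c * g x) h = Q f h + c * Q g h" if "f \<in> V" "g \<in> V" "h \<in> V" for f g h c
      by (rule Qlin[OF V(1)[OF that(1)] V(1)[OF that(2)] V(1)[OF that(3)]])
    show "Q f f >= 0" if "f \<in> V" for f
    proof -
      have "0 <= \<alpha> * (\<Sum>i\<in>UNIV. (nrm cellm (pd i f))\<^sup>2) + \<rho>\<^sup>2 * (\<Sum>i\<in>UNIV. \<Sum>j\<in>UNIV. (nrm cellm (pd i (pd j f)))\<^sup>2)"
        using \<alpha> by (intro add_nonneg_nonneg mult_nonneg_nonneg sum_nonneg) auto
      thus ?thesis using Qpos[OF V(1)[OF that]] by linarith
    qed
  qed
  have grad_le: "(nrm cellm (pd i f))\<^sup>2 <= Q f f / \<alpha>" if f: "smooth_per f" for f i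
  proof -
    have "(nrm cellm (pd i f))\<^sup>2 <= (\<Sum>i\<in>UNIV. (nrm cellm (pd i f))\<^sup>2)" by (rule member_le_sum) auto
    hence "\<alpha> * (nrm cellm (pd i f))\<^sup>2 <= \<alpha> * (\<Sum>i\<in>UNIV. (nrm cellm (pd i f))\<^sup>2)" using \<alpha> by simp
    also have "\<dots> <= Q f f"
    proof -
      have "0 <= \<rho>\<^sup>2 * (\<Sum>i\<in>UNIV. \<Sum>j\<in>UNIV. (nrm cellm (pd i (pd j f)))\<^sup>2)" by (intro mult_nonneg_nonneg sum_nonneg) auto
      thus ?thesis using Qpos[OF f] by linarith
    qed
    finally show ?thesis using \<alpha> by (simp add: le_divide_eq mult.commute)
  qed
  have hess_le: "\<rho>\<^sup>2 * (nrm cellm (pd i (pd j f)))\<^sup>2 <= Q f f" if f: "smooth_per f" for f i j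
  proof -
    have "(nrm cellm (pd i (pd j f)))\<^sup>2 <= (\<Sum>j\<in>UNIV. (nrm cellm (pd i (pd j f)))\<^sup>2)" by (rule member_le_sum) auto
    also have "\<dots> <= (\<Sum>i\<in>UNIV. \<Sum>j\<in>UNIV. (nrm cellm (pd i (pd j f)))\<^sup>2)"
      by (rule member_le_sum[of i UNIV "%i. \<Sum>j\<in>UNIV. (nrm cellm (pd i (pd j f)))\<^sup>2"]) (auto intro: sum_nonneg)
    finally have "\<rho>\<^sup>2 * (nrm cellm (pd i (pd j f)))\<^sup>2 <= \<rho>\<^sup>2 * (\<Sum>i\<in>UNIV. \<Sum>j\<in>UNIV. (nrm cellm (pd i (pd j f)))\<^sup>2)" by (rule mult_left_mono) simp
    also have "\<dots> <= Q f f"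
    proof -
      have "0 <= \<alpha> * (\<Sum>i\<in>UNIV. (nrm cellm (pd i f))\<^sup>2)" using \<alpha> by (intro mult_nonneg_nonneg sum_nonneg) auto
      thus ?thesis using Qpos[OF f] by linarith
    qed
    finally show ?thesis .
  qed
  have grad_N: "nrm cellm (pd i f) <= V.N f / sqrt \<alpha>" if f: "f \<in> V" for f i
  proof -
    have "sqrt ((nrm cellm (pd i f))\<^sup>2) <= sqrt (Q f f / \<alpha>)" by (rule real_sqrt_le_mono[OF grad_le[OF V(1)[OF f]]])
    thus ?thesis by (simp add: nrm_nonneg V.N_def real_sqrt_divide)
  qed
  define l where "l \<phi> = (LINT x|cellm. \<gamma> x * \<phi> x) + (\<Sum>i\<in>UNIV. LINT x|cellm. F i x * pd i \<phi> x)" for \<phi> :: "real^'d => real"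
  have l_lin: "l (%x. f x + c * g x) = l f + c * l g" if "smooth_per f" "smooth_per g" for f g c
  proof -
    have e: "(LINT x|cellm. z x * (u x + c * v x)) = (LINT x|cellm. z x * u x) + c * (LINT x|cellm. z x * v x)"
      if "u \<in> L2_per" "v \<in> L2_per" "z \<in> L2_per" for u v z
      using ilin[OF that, of c] by (simp add: mult.commute)
    show ?thesis unfolding l_def pdl[OF that]
      using e[OF smooth_per_L2_per[OF that(1)] smooth_per_L2_per[OF that(2)] \<gamma>] e[OF pL(1)[OF that(1)] pL(1)[OF that(2)] F]
      by (simp add: sum.distrib sum_distrib_left algebra_simps)
  qed
  define Cl where "Cl = (nrm cellm \<gamma> * (2 * pi * real CARD('d)) + (\<Sum>i\<in>UNIV. nrm cellm (F i))) / sqrt \<alpha>"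
  have l_bd: "\<bar>l f\<bar> <= Cl * V.N f" if f: "f \<in> V" for f
  proof -
    have 1: "\<bar>LINT x|cellm. \<gamma> x * f x\<bar> <= nrm cellm \<gamma> * (2 * pi * real CARD('d) * (V.N f / sqrt \<alpha>))"
    proof -
      have "\<bar>LINT x|cellm. \<gamma> x * f x\<bar> <= nrm cellm \<gamma> * nrm cellm f"
        by (intro L2_Cauchy_Schwarz L2_perD(3) \<gamma> smooth_per_L2_per V(1)[OF f])
      also have "\<dots> <= nrm cellm \<gamma> * (2 * pi * real CARD('d) * (V.N f / sqrt \<alpha>))"
      proof (rule mult_left_mono[OF _ nrm_nonneg])
        have "nrm cellm f <= 2 * pi * (\<Sum>i\<in>UNIV. nrm cellm (pd i f))" using poincare_inequality[OF V(1)[OF f]] V(2)[OF f] by simp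
        also have "\<dots> <= 2 * pi * (\<Sum>i\<in>(UNIV::'d set). V.N f / sqrt \<alpha>)"
          by (intro mult_left_mono sum_mono grad_N[OF f]) simp
        finally show "nrm cellm f <= 2 * pi * real CARD('d) * (V.N f / sqrt \<alpha>)" by (simp add: mult.assoc)
      qed
      finally show ?thesis .
    qed
    have 2: "\<bar>LINT x|cellm. F i x * pd i f x\<bar> <= nrm cellm (F i) * (V.N f / sqrt \<alpha>)" for i
    proof -
      have "\<bar>LINT x|cellm. F i x * pd i f x\<bar> <= nrm cellm (F i) * nrm cellm (pd i f)"
        by (intro L2_Cauchy_Schwarz L2_perD(3) F pL V(1)[OF f])
      also have "\<dots> <= nrm cellm (F i) * (V.N f / sqrt \<alpha>)" by (rule mult_left_mono[OF grad_N[OF f] nrm_nonneg])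
      finally show ?thesis .
    qed
    have "\<bar>l f\<bar> <= \<bar>LINT x|cellm. \<gamma> x * f x\<bar> + (\<Sum>i\<in>UNIV. \<bar>LINT x|cellm. F i x * pd i f x\<bar>)"
      unfolding l_def by (rule order_trans[OF abs_triangle_ineq add_left_mono[OF sum_abs]])
    also have "\<dots> <= nrm cellm \<gamma> * (2 * pi * real CARD('d) * (V.N f / sqrt \<alpha>)) + (\<Sum>i\<in>UNIV. nrm cellm (F i) * (V.N f / sqrt \<alpha>))"
      by (intro add_mono sum_mono 1 2)
    also have "\<dots> = Cl * V.N f" by (simp add: Cl_def sum_distrib_right add_divide_distrib sum_divide_distrib distrib_right)
    finally show ?thesis .
  qed
  obtain s where s: "!!n. s n \<in> V" and sl: "!!v. v \<in> V ==> (%n. Q (s n) v) \<longlonglongrightarrow> l v"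
    and sc: "!!e. e > 0 ==> \<exists>K. \<forall>m\<ge>K. \<forall>n\<ge>K. Q (%x. s m x - s n x) (%x. s m x - s n x) < e"
    by (rule V.riesz_sequence[of l Cl]) (use l_lin V l_bd in blast)+
  have sp: "smooth_per (s n)" for n by (rule V(1)[OF s])
  have dV: "(%x. s m x - s n x) \<in> V" for m n using V.V_lin[OF s s, of m "-1" n] by simp
  have pdd: "pd i (%x. s m x - s n x) = (%x. pd i (s m) x - pd i (s n) x)" for i m n
    using pdl[OF sp sp, of i m "-1" n] by simp
  have pdd2: "pd i (pd j (%x. s m x - s n x)) = (%x. pd i (pd j (s m)) x - pd i (pd j (s n)) x)" for i j m n
    using pdl2[OF sp sp, of i j m "-1" n] by simp
  have cauchy1: "\<exists>K. \<forall>m\<ge>K. \<forall>n\<ge>K. (LINT x|cellm. (pd i (s m) x - pd i (s n) x)\<^sup>2) < e" if "e > 0" for e i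
  proof -
    have "e * \<alpha> > 0" using that \<alpha> by simp
    from sc[OF this] obtain K where K: "\<forall>m\<ge>K. \<forall>n\<ge>K. Q (%x. s m x - s n x) (%x. s m x - s n x) < e * \<alpha>" ..
    have "(LINT x|cellm. (pd i (s m) x - pd i (s n) x)\<^sup>2) < e" if "m >= K" "n >= K" for m n
    proof -
      have "(LINT x|cellm. (pd i (s m) x - pd i (s n) x)\<^sup>2) <= Q (%x. s m x - s n x) (%x. s m x - s n x) / \<alpha>"
        using grad_le[OF V(1)[OF dV[of m n]], of i] by (simp add: nrm_sq pdd)
      also have "\<dots> < e" using K that \<alpha> by (simp add: divide_less_eq)
      finally show ?thesis .
    qed
    thus ?thesis by blast
  qed
  have cauchy0: "\<exists>K. \<forall>m\<ge>K. \<forall>n\<ge>K. (LINT x|cellm. (s m x - s n x)\<^sup>2) < e" if e: "e > 0" for e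
  proof -
    let ?c = "2 * pi * real CARD('d)"
    have c: "?c > 0" by simp
    have "e * \<alpha> / ?c\<^sup>2 > 0" using e \<alpha> c by simp
    from sc[OF this] obtain K where K: "\<forall>m\<ge>K. \<forall>n\<ge>K. Q (%x. s m x - s n x) (%x. s m x - s n x) < e * \<alpha> / ?c\<^sup>2" ..
    have "(LINT x|cellm. (s m x - s n x)\<^sup>2) < e" if "m >= K" "n >= K" for m n
    proof -
      let ?f = "%x. s m x - s n x"
      have "nrm cellm ?f <= 2 * pi * (\<Sum>i\<in>UNIV. nrm cellm (pd i ?f))" using poincare_inequality[OF V(1)[OF dV]] V(2)[OF dV] by simp
      also have "\<dots> <= 2 * pi * (\<Sum>i\<in>(UNIV::'d set). V.N ?f / sqrt \<alpha>)"
        by (intro mult_left_mono sum_mono grad_N[OF dV]) simp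
      finally have "nrm cellm ?f <= ?c * (V.N ?f / sqrt \<alpha>)" by (simp add: mult.assoc)
      hence "(nrm cellm ?f)\<^sup>2 <= (?c * (V.N ?f / sqrt \<alpha>))\<^sup>2" by (rule power_mono[OF _ nrm_nonneg])
      also have "\<dots> = ?c\<^sup>2 * (Q ?f ?f / \<alpha>)" using V.N_sq[OF dV, of m n] \<alpha> by (simp add: power_mult_distrib power_divide)
      also have "\<dots> < e"
      proof -
        have "Q ?f ?f < e * \<alpha> / ?c\<^sup>2" using K that by blast
        hence "Q ?f ?f * ?c\<^sup>2 < e * \<alpha>" using c by (simp only: less_divide_eq zero_less_power if_True)
        thus ?thesis using \<alpha> by (simp add: divide_less_eq mult.commute)
      qed
      finally show ?thesis by (simp add: nrm_sq)
    qed
    thus ?thesis by blast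
  qed
  obtain w where w: "w \<in> L2_per" "(%n. nrm cellm (%x. s n x - w x)) \<longlonglongrightarrow> 0"
    by (rule periodic_closed[OF sp cauchy0]) blast
  have "\<forall>i. \<exists>D. D \<in> L2_per & (%n. nrm cellm (%x. pd i (s n) x - D x)) \<longlonglongrightarrow> 0"
  proof
    fix i show "\<exists>D. D \<in> L2_per & (%n. nrm cellm (%x. pd i (s n) x - D x)) \<longlonglongrightarrow> 0"
      by (rule periodic_closed[OF smooth_per_pd[OF sp, of i] cauchy1]) (assumption, intro exI conjI)
  qed
  from choice[OF this] obtain D where D: "\<forall>i. D i \<in> L2_per & (%n. nrm cellm (%x. pd i (s n) x - D i x)) \<longlonglongrightarrow> 0" ..
  have "\<forall>i. \<exists>G. \<forall>j. \<rho> ~= 0 --> G j \<in> L2_per & (%n. nrm cellm (%x. pd i (pd j (s n)) x - G j x)) \<longlonglongrightarrow> 0"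
  proof
    fix i
    have "\<forall>j. \<exists>G. \<rho> ~= 0 --> G \<in> L2_per & (%n. nrm cellm (%x. pd i (pd j (s n)) x - G x)) \<longlonglongrightarrow> 0"
    proof
      fix j
      show "\<exists>G. \<rho> ~= 0 --> G \<in> L2_per & (%n. nrm cellm (%x. pd i (pd j (s n)) x - G x)) \<longlonglongrightarrow> 0"
      proof (cases "\<rho> = 0")
        case False
        have ca: "\<exists>K. \<forall>m\<ge>K. \<forall>n\<ge>K. (LINT x|cellm. (pd i (pd j (s m)) x - pd i (pd j (s n)) x)\<^sup>2) < e" if "e > 0" for e
        proof -
          have "e * \<rho>\<^sup>2 > 0" using that False by simp
          from sc[OF this] obtain K where K: "\<forall>m\<ge>K. \<forall>n\<ge>K. Q (%x. s m x - s n x) (%x. s m x - s n x) < e * \<rho>\<^sup>2" ..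
          have "(LINT x|cellm. (pd i (pd j (s m)) x - pd i (pd j (s n)) x)\<^sup>2) < e" if "m >= K" "n >= K" for m n
          proof -
            have "\<rho>\<^sup>2 * (LINT x|cellm. (pd i (pd j (s m)) x - pd i (pd j (s n)) x)\<^sup>2) <= Q (%x. s m x - s n x) (%x. s m x - s n x)"
              using hess_le[OF V(1)[OF dV[of m n]], of i j] by (simp add: nrm_sq pdd2)
            also have "\<dots> < e * \<rho>\<^sup>2" using K that by blast
            finally have "\<rho>\<^sup>2 * (LINT x|cellm. (pd i (pd j (s m)) x - pd i (pd j (s n)) x)\<^sup>2) < \<rho>\<^sup>2 * e" by (simp add: mult.commute)
            thus ?thesis using False by (subst (asm) mult_less_cancel_left_pos) auto
          qed
          thus ?thesis by blast
        qed
        show ?thesis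
          by (rule periodic_closed[OF smooth_per_pd[OF smooth_per_pd[OF sp, of j], of i] ca]) (assumption, intro exI conjI impI)
      qed simp
    qed
    from choice[OF this] show "\<exists>G. \<forall>j. \<rho> ~= 0 --> G j \<in> L2_per & (%n. nrm cellm (%x. pd i (pd j (s n)) x - G j x)) \<longlonglongrightarrow> 0" .
  qed
  from choice[OF this] obtain E where E: "\<forall>i j. \<rho> ~= 0 --> E i j \<in> L2_per & (%n. nrm cellm (%x. pd i (pd j (s n)) x - E i j x)) \<longlonglongrightarrow> 0" ..
  show thesis
  proof (rule that[of w D E])
    show "w \<in> L2_per" by (rule w)
    show "D i \<in> L2_per" for i using D by blast
    show "has_weak_pd UNIV i w (D i)" for i
      by (rule periodic_weak_pd_limit[OF sp w(1) _ w(2)]) (use D in blast)+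
    show "E i j \<in> L2_per" if "\<rho> ~= 0" for i j using E that by blast
    show "has_weak_pd UNIV i (D j) (E i j)" if "\<rho> ~= 0" for i j
      by (rule periodic_weak_pd_limit[of "%n. pd j (s n)"]) (simp_all add: smooth_per_pd sp D E that)
    show "mean w = 0"
    proof -
      have "(%n. LINT x|cellm. s n x * 1) \<longlonglongrightarrow> (LINT x|cellm. w x * 1)"
        by (rule L2_ip_tendsto[OF L2_perD(3)[OF w(1)] _ _ w(2)]) (intro L2_perD(3) smooth_per_L2_per sp L2_per_const)+
      moreover have "(LINT x|cellm. s n x * 1) = 0" for n
        using V(2)[OF s[of n]] cell_pos[where 'd='d] by (simp add: mean_def)
      ultimately have "(LINT x|cellm. w x) = 0" by (simp add: LIMSEQ_const_iff)
      thus ?thesis by (simp add: mean_def)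
    qed
    fix \<phi> :: "real^'d => real" assume \<phi>: "\<phi> \<in> test_functions UNIV"
    define \<Phi> where "\<Phi> = periodize \<phi>"
    have P: "smooth_per \<Phi>" unfolding \<Phi>_def by (rule periodize_smooth[OF \<phi>])
    define \<Phi>0 where "\<Phi>0 = (%x. \<Phi> x + (- mean \<Phi>) * 1)"
    have P0: "smooth_per \<Phi>0" unfolding \<Phi>0_def by (intro smooth_per_lin P smooth_per_const)
    have pd0: "pd i \<Phi>0 = pd i \<Phi>" for i
      unfolding \<Phi>0_def by (subst pdl[OF P smooth_per_const]) (simp add: pd_const)
    have "mean \<Phi>0 = 0"
      unfolding \<Phi>0_def
      using mean_lin[OF smooth_per_sqint(2)[OF P] smooth_per_sqint(2)[OF smooth_per_const[of 1]], of "- mean \<Phi>"]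
      by (simp add: mean_const)
    hence P0V: "\<Phi>0 \<in> V" using P0 by (simp add: V_def)
    have l0: "l \<Phi>0 = (LINT x|cellm. \<gamma> x * \<Phi> x) + (\<Sum>i\<in>UNIV. LINT x|cellm. F i x * pd i \<Phi> x)"
    proof -
      have "(LINT x|cellm. \<gamma> x * \<Phi>0 x) = (LINT x|cellm. \<gamma> x * \<Phi> x - mean \<Phi> * (\<gamma> x * 1))"
        by (intro Bochner_Integration.integral_cong refl) (simp add: \<Phi>0_def algebra_simps)
      also have "\<dots> = (LINT x|cellm. \<gamma> x * \<Phi> x) - mean \<Phi> * (LINT x|cellm. \<gamma> x * 1)"
        using cell_mult_integrable[OF \<gamma> smooth_per_L2_per[OF P]] cell_mult_integrable[OF \<gamma> L2_per_const[of 1]]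
        by (subst Bochner_Integration.integral_diff) auto
      finally show ?thesis unfolding l_def pd0 using \<gamma>0 by simp
    qed
    have Qn: "Q (s n) \<Phi>0 = \<rho>\<^sup>2 * (\<Sum>i\<in>UNIV. \<Sum>j\<in>UNIV. LINT x|cellm. s n x * pd j (pd j (pd i (pd i \<Phi>))) x)
       + (\<Sum>i\<in>UNIV. \<Sum>k\<in>UNIV. LINT x|cellm. pd k (s n) x * (B x $ i $ k * pd i \<Phi> x))" for n
    proof -
      have "(LINT x|cellm. pd i (pd j (s n)) x * pd i (pd j \<Phi>0) x) = (LINT x|cellm. s n x * pd j (pd j (pd i (pd i \<Phi>))) x)" for i j
      proof -
        have "(LINT x|cellm. pd i (pd j (s n)) x * pd i (pd j \<Phi>0) x) = - (LINT x|cellm. pd j (s n) x * pd i (pd i (pd j \<Phi>0)) x)"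
          using cell_by_parts[of "pd j (s n)" "pd i (pd j \<Phi>0)" i] by (simp add: smooth_per_pd sp P0)
        also have "\<dots> = (LINT x|cellm. s n x * pd j (pd i (pd i (pd j \<Phi>0))) x)"
          using cell_by_parts[of "s n" "pd i (pd i (pd j \<Phi>0))" j] by (simp add: smooth_per_pd sp P0)
        also have "pd j (pd i (pd i (pd j \<Phi>0))) = pd j (pd j (pd i (pd i \<Phi>)))"
        proof -
          note sm = smooth_perD(1)[OF P]
          show ?thesis unfolding pd0 by (simp only: pd_commute[OF sm, of i j] pd_commute[OF smoothD(3)[OF sm], of i j])
        qed
        finally show ?thesis .
      qed
      thus ?thesis unfolding Q_def pd0 by (simp add: mult_ac)
    qed
    have sq: "sqint cellm (s n)" "sqint cellm (pd i (s n))" for n i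
      by (intro L2_perD(3) smooth_per_L2_per smooth_per_pd sp)+
    have "(%n. Q (s n) \<Phi>0) \<longlonglongrightarrow> \<rho>\<^sup>2 * (\<Sum>i\<in>UNIV. \<Sum>j\<in>UNIV. LINT x|cellm. w x * pd j (pd j (pd i (pd i \<Phi>))) x)
       + (\<Sum>i\<in>UNIV. \<Sum>k\<in>UNIV. LINT x|cellm. D k x * (B x $ i $ k * pd i \<Phi> x))"
      unfolding Qn
    proof (intro tendsto_intros)
      show "(%n. LINT x|cellm. s n x * pd j (pd j (pd i (pd i \<Phi>))) x) \<longlonglongrightarrow> (LINT x|cellm. w x * pd j (pd j (pd i (pd i \<Phi>))) x)" for i j
        by (rule L2_ip_tendsto[OF L2_perD(3)[OF w(1)] sq(1) _ w(2)]) (intro L2_perD(3) smooth_per_L2_per smooth_per_pd P)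
      show "(%n. LINT x|cellm. pd k (s n) x * (B x $ i $ k * pd i \<Phi> x)) \<longlonglongrightarrow> (LINT x|cellm. D k x * (B x $ i $ k * pd i \<Phi> x))" for i k
        by (rule L2_ip_tendsto[OF _ sq(2)]) (use D in \<open>auto intro!: L2_perD(3) BL pL P\<close>)
    qed
    from LIMSEQ_unique[OF this sl[OF P0V]]
    have main: "\<rho>\<^sup>2 * (\<Sum>i\<in>UNIV. \<Sum>j\<in>UNIV. LINT x|cellm. w x * pd j (pd j (pd i (pd i \<Phi>))) x)
       + (\<Sum>i\<in>UNIV. \<Sum>k\<in>UNIV. LINT x|cellm. D k x * (B x $ i $ k * pd i \<Phi> x))
      = (LINT x|cellm. \<gamma> x * \<Phi> x) + (\<Sum>i\<in>UNIV. LINT x|cellm. F i x * pd i \<Phi> x)" unfolding l0 .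
    have u: "(LINT x|lebesgue. f x * \<phi>' x) = (LINT x|cellm. f x * periodize \<phi>' x)" if "f \<in> L2_per" "\<phi>' \<in> test_functions UNIV" for f \<phi>'
      by (rule integral_periodize[OF L2_perD[OF that(1)] that(2)])
    have p1: "periodize (pd i \<phi>) = pd i \<Phi>" for i unfolding \<Phi>_def by (rule periodize_smooth(2)[OF \<phi>, symmetric])
    have p4: "periodize (pd j (pd j (pd i (pd i \<phi>)))) = pd j (pd j (pd i (pd i \<Phi>)))" for i j
      unfolding \<Phi>_def by (simp only: periodize_smooth(2)[OF \<phi>] periodize_smooth(2)[OF test_pd[OF \<phi>]]
          periodize_smooth(2)[OF test_pd[OF test_pd[OF \<phi>]]] periodize_smooth(2)[OF test_pd[OF test_pd[OF test_pd[OF \<phi>]]]])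
    have DL: "D k \<in> L2_per" for k using D by blast
    have BD: "(%x. \<Sum>k\<in>UNIV. B x $ i $ k * D k x) \<in> L2_per" for i by (intro L2_per_sum BL DL) simp
    have t4: "pd j (pd j (pd i (pd i \<phi>))) \<in> test_functions UNIV" for i j by (intro test_pd \<phi>)
    have BDs: "(LINT x|cellm. (\<Sum>k\<in>UNIV. B x $ i $ k * D k x) * pd i \<Phi> x) = (\<Sum>k\<in>UNIV. LINT x|cellm. D k x * (B x $ i $ k * pd i \<Phi> x))" for i
    proof -
      have "(LINT x|cellm. (\<Sum>k\<in>UNIV. B x $ i $ k * D k x) * pd i \<Phi> x) = (LINT x|cellm. (\<Sum>k\<in>UNIV. D k x * (B x $ i $ k * pd i \<Phi> x)))"
      proof (intro Bochner_Integration.integral_cong refl)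
        fix x
        show "(\<Sum>k\<in>UNIV. B x $ i $ k * D k x) * pd i \<Phi> x = (\<Sum>k\<in>UNIV. D k x * (B x $ i $ k * pd i \<Phi> x))"
          unfolding sum_distrib_right by (rule sum.cong[OF refl]) (simp add: mult_ac)
      qed
      also have "\<dots> = (\<Sum>k\<in>UNIV. LINT x|cellm. D k x * (B x $ i $ k * pd i \<Phi> x))"
        by (intro Bochner_Integration.integral_sum cell_mult_integrable DL BL pL P)
      finally show ?thesis .
    qed
    show "\<rho>\<^sup>2 * (\<Sum>i\<in>UNIV. \<Sum>j\<in>UNIV. LINT x|lebesgue. w x * pd j (pd j (pd i (pd i \<phi>))) x)
       + (\<Sum>i\<in>UNIV. LINT x|lebesgue. (\<Sum>k\<in>UNIV. B x $ i $ k * D k x) * pd i \<phi> x)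
       = (LINT x|lebesgue. \<gamma> x * \<phi> x) + (\<Sum>i\<in>UNIV. LINT x|lebesgue. F i x * pd i \<phi> x)"
      unfolding u[OF w(1) t4] u[OF BD test_pd[OF \<phi>]] u[OF \<gamma> \<phi>] u[OF F test_pd[OF \<phi>]] p4 p1 \<Phi>_def[symmetric] BDs by (rule main)
  qed
qed

section \<open>Correctors\<close>

text \<open>Periodic functions are not square integrable over the whole space, so the fundamental lemma is applied on balls.\<close>
lemma L2_per_unique:
  fixes u v :: "real^'d => real"
  assumes u: "u \<in> L2_per" and v: "v \<in> L2_per"
    and eq: "!!\<phi>. \<phi> \<in> test_functions UNIV ==> (LINT x|lebesgue. u x * \<phi> x) = (LINT x|lebesgue. v x * \<phi> x)"
  shows "AE x in lebesgue. u x = v x"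
proof -
  define d where "d x = u x + (-1) * v x" for x
  have d: "d \<in> L2_per" unfolding d_def by (rule L2_per_lin[OF u v])
  have loc: "sqint lebesgue (%x. indicator (cball 0 R) x * f x)" if "f \<in> L2_per" for R and f :: "real^'d => real"
    by (rule periodic_loc_sqint[OF L2_perD[OF that]])
  have int: "integrable lebesgue (%x. f x * \<phi> x)" if f: "f \<in> L2_per" and \<phi>: "\<phi> \<in> test_functions UNIV" for f \<phi> :: "real^'d => real"
  proof -
    obtain R where R: "R > 0" "!!x. norm x > R ==> \<phi> x = 0" by (rule test_support_ball[OF \<phi>]) blast
    have "integrable lebesgue (%x. (indicator (cball 0 R) x * f x) * \<phi> x)"
      by (rule sqint_mult[OF loc[OF f] test_sqint(1)[OF \<phi>]])
    moreover have "(indicator (cball 0 R) x * f x) * \<phi> x = f x * \<phi> x" for x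
      using R(2)[of x] by (cases "norm x > R") auto
    ultimately show ?thesis by simp
  qed
  have ae: "AE x in lebesgue. x \<in> ball 0 (real n) --> d x = 0" for n :: nat
  proof -
    let ?B = "ball (0::real^'d) (real n)"
    have Bs: "?B \<in> sets lebesgue" by simp
    have "sqint (lebesgue_on ?B) (%x. indicator (cball 0 (real n)) x * d x)"
      by (rule sqint_restrictI[OF Bs loc[OF d]])
    hence sq: "sqint (lebesgue_on ?B) d"
      unfolding sqint_restrict[OF Bs]
      by (rule arg_cong[where f="sqint lebesgue", THEN iffD1, rotated]) (auto simp: indicator_def)
    have "AE x in lebesgue_on ?B. d x = 0"
    proof (rule fundamental_lemma[OF sq open_ball])
      fix \<phi> assume \<phi>: "\<phi> \<in> test_functions ?B"
      have \<phi>U: "\<phi> \<in> test_functions UNIV" by (rule test_mono[OF \<phi>]) simp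
      have "(LINT x|lebesgue_on ?B. d x * \<phi> x) = (LINT x|lebesgue. d x * \<phi> x)"
        by (rule integral_on_eq[OF Bs]) (simp add: test_outside[OF \<phi>])
      also have "\<dots> = (LINT x|lebesgue. u x * \<phi> x - v x * \<phi> x)" by (simp add: d_def algebra_simps)
      also have "\<dots> = (LINT x|lebesgue. u x * \<phi> x) - (LINT x|lebesgue. v x * \<phi> x)"
        by (rule Bochner_Integration.integral_diff[OF int[OF u \<phi>U] int[OF v \<phi>U]])
      finally show "(LINT x|lebesgue_on ?B. d x * \<phi> x) = 0" using eq[OF \<phi>U] by simp
    qed
    thus ?thesis using Bs by (subst (asm) AE_restrict_space_iff) auto
  qed
  have "AE x in lebesgue. \<forall>n::nat. x \<in> ball 0 (real n) --> d x = 0"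
    unfolding AE_all_countable by (intro allI ae)
  thus ?thesis
  proof eventually_elim
    case (elim x)
    obtain n :: nat where "norm x < real n" using reals_Archimedean2 by blast
    thus ?case using elim by (auto simp: d_def)
  qed
qed

lemma weak_pd_perI:
  assumes D: "D \<in> L2_per" "has_weak_pd UNIV i w D"
  shows "weak_pd L2_per UNIV i w \<in> L2_per" "has_weak_pd UNIV i w (weak_pd L2_per UNIV i w)"
    "AE x in lebesgue. weak_pd L2_per UNIV i w x = D x"
proof -
  have "weak_pd L2_per UNIV i w \<in> L2_per & has_weak_pd UNIV i w (weak_pd L2_per UNIV i w)"
    unfolding weak_pd_def by (rule someI[of _ D]) (use D in blast)
  thus 1: "weak_pd L2_per UNIV i w \<in> L2_per" and 2: "has_weak_pd UNIV i w (weak_pd L2_per UNIV i w)" by auto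
  show "AE x in lebesgue. weak_pd L2_per UNIV i w x = D x"
    by (rule L2_per_unique[OF 1 D(1)]) (use 2 D(2) in \<open>auto simp: has_weak_pd_UNIV\<close>)
qed

definition flux :: "(real^'d => real^'d^'d) => 'd => ('d => real^'d => real) => 'd => real^'d => real" where
  "flux A j D i x = (\<Sum>k\<in>UNIV. A x $ i $ k * (axis j 1 $ k + D k x))"

lemma flux_split: "flux A j D i x = A x $ i $ j + (\<Sum>k\<in>UNIV. A x $ i $ k * D k x)"
  by (simp add: flux_def distrib_left sum.distrib axis_def if_distrib[of "%a. _ * a"] cong: if_cong)

text \<open>The corrector equation in terms of integrals against derivatives of test functions, which is the form that
  mollification and periodization act on.\<close>
lemma corrector_equation_iff:
  fixes A :: "real^'d => real^'d^'d"
  shows "distr_eq UNIV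
       (%\<phi>. \<rho>\<^sup>2 * distr_laplace (distr_laplace (distr_of UNIV w)) \<phi>
            - distr_div UNIV (%y. A y *v (axis j 1 + grad_per w y)) \<phi>)
       (%\<phi>. 0) \<longleftrightarrow>
   (\<forall>\<phi>\<in>test_functions UNIV. \<rho>\<^sup>2 * (\<Sum>i\<in>UNIV. \<Sum>j\<in>UNIV. LINT x|lebesgue. w x * pd j (pd j (pd i (pd i \<phi>))) x)
       + (\<Sum>i\<in>UNIV. LINT x|lebesgue. flux A j (%k. weak_pd L2_per UNIV k w) i x * pd i \<phi> x) = 0)"
proof -
  have "(A y *v (axis j 1 + grad_per w y)) $ i = flux A j (%k. weak_pd L2_per UNIV k w) i y" for y i
    by (simp add: matrix_vector_mult_def flux_def weak_grad_def)
  thus ?thesis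
    unfolding distr_eq_def distr_laplace_def distr_div_def distr_pd_def distr_of_def
    by (simp add: lebesgue_on_UNIV_eq sum_negf)
qed

lemma A_entry_L2_per:
  assumes "periodic_elliptic A" shows "(%x. A x $ i $ k) \<in> L2_per"
proof -
  obtain M where M: "(%y. A y $ i $ k) \<in> borel_measurable lebesgue" "periodic (%y. A y $ i $ k)"
    "AE y in lebesgue. \<bar>A y $ i $ k\<bar> <= M" by (rule periodic_ellipticE[OF assms]) blast
  from L2_per_bounded_mult[OF M L2_per_const[of 1]] show ?thesis by simp
qed

lemma A_mult_L2_per:
  assumes "periodic_elliptic A" "u \<in> L2_per" shows "(%x. A x $ i $ k * u x) \<in> L2_per"
proof -
  obtain M where M: "(%y. A y $ i $ k) \<in> borel_measurable lebesgue" "periodic (%y. A y $ i $ k)"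
    "AE y in lebesgue. \<bar>A y $ i $ k\<bar> <= M" by (rule periodic_ellipticE[OF assms(1)]) blast
  from L2_per_bounded_mult[OF M assms(2)] show ?thesis .
qed

lemma flux_L2_per:
  assumes A: "periodic_elliptic A" and D: "!!k. D k \<in> L2_per" shows "flux A j D i \<in> L2_per"
proof -
  have "(%x. A x $ i $ j + 1 * (\<Sum>k\<in>UNIV. A x $ i $ k * D k x)) \<in> L2_per"
    by (intro L2_per_lin A_entry_L2_per[OF A] L2_per_sum A_mult_L2_per[OF A] D) simp
  moreover have "flux A j D i = (%x. A x $ i $ j + 1 * (\<Sum>k\<in>UNIV. A x $ i $ k * D k x))" by (auto simp: flux_split)
  ultimately show ?thesis by simp
qed

lemma per_test_integrable:
  assumes f: "f \<in> L2_per" and \<phi>: "\<phi> \<in> test_functions UNIV" shows "integrable lebesgue (%x. f x * \<phi> x)"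
proof -
  obtain R where R: "R > 0" "!!x. norm x > R ==> \<phi> x = 0" by (rule test_support_ball[OF \<phi>]) blast
  have "integrable lebesgue (%x. (indicator (cball 0 R) x * f x) * \<phi> x)"
    by (rule sqint_mult[OF periodic_loc_sqint[OF L2_perD[OF f]] test_sqint(1)[OF \<phi>]])
  moreover have "(indicator (cball 0 R) x * f x) * \<phi> x = f x * \<phi> x" for x
    using R(2)[of x] by (cases "norm x > R") auto
  ultimately show ?thesis by simp
qed

lemma corrector_exists:
  fixes A :: "real^'d => real^'d^'d"
  assumes A: "periodic_elliptic A" and \<rho>: "\<rho> >= 0"
  shows "is_corrector A \<rho> j (corrector A \<rho> j)"
proof -
  have F: "(%x. (-1) * (A x $ i $ j)) \<in> L2_per" for i by (rule L2_per_scale[OF A_entry_L2_per[OF A]])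
  obtain w D E where w: "w \<in> L2_per" "mean w = 0" and D: "!!i. D i \<in> L2_per" "!!i. has_weak_pd UNIV i w (D i)"
    and E: "!!i j. \<rho> ~= 0 ==> E i j \<in> L2_per" "!!i j. \<rho> ~= 0 ==> has_weak_pd UNIV i (D j) (E i j)"
    and eq: "!!\<phi>. \<phi> \<in> test_functions UNIV ==>
       \<rho>\<^sup>2 * (\<Sum>i\<in>UNIV. \<Sum>j\<in>UNIV. LINT x|lebesgue. w x * pd j (pd j (pd i (pd i \<phi>))) x)
       + (\<Sum>i\<in>UNIV. LINT x|lebesgue. (\<Sum>k\<in>UNIV. A x $ i $ k * D k x) * pd i \<phi> x)
       = (LINT x|lebesgue. 0 * \<phi> x) + (\<Sum>i\<in>UNIV. LINT x|lebesgue. ((-1) * (A x $ i $ j)) * pd i \<phi> x)"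
  proof (rule periodic_existence[where \<rho>=\<rho> and B=A and F="%i x. (-1) * (A x $ i $ j)" and \<gamma>="%x. 0"])
    show "(LINT x|(cellm :: (real^'d) measure). 0) = (0::real)" by simp
    fix w D E
    assume h: "w \<in> L2_per" "mean w = 0" "!!i. D i \<in> L2_per" "!!i. has_weak_pd UNIV i w (D i)"
      "!!i j. \<rho> ~= 0 ==> E i j \<in> L2_per" "!!i j. \<rho> ~= 0 ==> has_weak_pd UNIV i (D j) (E i j)"
      "!!\<phi>. \<phi> \<in> test_functions UNIV ==>
       \<rho>\<^sup>2 * (\<Sum>i\<in>UNIV. \<Sum>j\<in>UNIV. LINT x|lebesgue. w x * pd j (pd j (pd i (pd i \<phi>))) x)
       + (\<Sum>i\<in>UNIV. LINT x|lebesgue. (\<Sum>k\<in>UNIV. A x $ i $ k * D k x) * pd i \<phi> x)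
       = (LINT x|lebesgue. 0 * \<phi> x) + (\<Sum>i\<in>UNIV. LINT x|lebesgue. ((-1) * (A x $ i $ j)) * pd i \<phi> x)"
    show thesis by (rule that[of w D E, OF h])
  qed (rule A, rule F, rule L2_per_const)
  have wp: "weak_pd L2_per UNIV i w \<in> L2_per" "AE x in lebesgue. weak_pd L2_per UNIV i w x = D i x" for i
    using weak_pd_perI[OF D(1,2)] by blast+
  have "is_corrector A \<rho> j w"
    unfolding is_corrector_def corrector_equation_iff
  proof (intro conjI ballI)
    show "mean w = 0" by (rule w)
    show "w \<in> H_per (if \<rho> > 0 then 2 else 1)"
    proof (cases "\<rho> > 0")
      case True
      have "\<exists>v\<in>L2_per. has_weak_pd UNIV k (D i) v" for k i
        by (rule bexI[of _ "E k i"]) (use E True in auto)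
      hence s1: "D i \<in> sobolev L2_per UNIV (Suc 0)" for i using D(1) by simp
      have "\<exists>v\<in>sobolev L2_per UNIV (Suc 0). has_weak_pd UNIV k w v" for k
        by (rule bexI[of _ "D k"]) (use D(2) s1 in blast)+
      hence "w \<in> sobolev L2_per UNIV (Suc (Suc 0))" using w(1) by (subst sobolev.simps(2)) blast
      thus ?thesis using True by (simp add: numeral_2_eq_2)
    next
      case False thus ?thesis using w(1) D by auto
    qed
    fix \<phi> :: "real^'d => real" assume \<phi>: "\<phi> \<in> test_functions UNIV"
    have "(LINT x|lebesgue. flux A j (%k. weak_pd L2_per UNIV k w) i x * pd i \<phi> x)
        = (LINT x|lebesgue. (\<Sum>k\<in>UNIV. A x $ i $ k * D k x) * pd i \<phi> x) - (LINT x|lebesgue. ((-1) * (A x $ i $ j)) * pd i \<phi> x)" for i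
    proof -
      have SL: "(%x. \<Sum>k\<in>UNIV. A x $ i $ k * D k x) \<in> L2_per" by (intro L2_per_sum A_mult_L2_per[OF A] D) simp
      have a: "AE x in lebesgue. \<forall>k. weak_pd L2_per UNIV k w x = D k x" using wp(2) by (simp add: AE_all_countable)
      have i1: "integrable lebesgue (%x. flux A j (%k. weak_pd L2_per UNIV k w) i x * pd i \<phi> x)"
        by (intro per_test_integrable flux_L2_per A wp test_pd \<phi>)
      have i2: "integrable lebesgue (%x. (\<Sum>k\<in>UNIV. A x $ i $ k * D k x) * pd i \<phi> x)" by (intro per_test_integrable SL test_pd \<phi>)
      have i3: "integrable lebesgue (%x. ((-1) * (A x $ i $ j)) * pd i \<phi> x)" by (intro per_test_integrable F test_pd \<phi>)
      have "(LINT x|lebesgue. flux A j (%k. weak_pd L2_per UNIV k w) i x * pd i \<phi> x)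
         = (LINT x|lebesgue. (\<Sum>k\<in>UNIV. A x $ i $ k * D k x) * pd i \<phi> x - ((-1) * (A x $ i $ j)) * pd i \<phi> x)"
      proof (rule integral_cong_AE)
        show "AE x in lebesgue. flux A j (%k. weak_pd L2_per UNIV k w) i x * pd i \<phi> x = (\<Sum>k\<in>UNIV. A x $ i $ k * D k x) * pd i \<phi> x - ((-1) * (A x $ i $ j)) * pd i \<phi> x"
          using a by eventually_elim (simp add: flux_split algebra_simps)
        show "(%x. flux A j (%k. weak_pd L2_per UNIV k w) i x * pd i \<phi> x) \<in> borel_measurable lebesgue"
          by (rule borel_measurable_integrable[OF i1])
        show "(%x. (\<Sum>k\<in>UNIV. A x $ i $ k * D k x) * pd i \<phi> x - ((-1) * (A x $ i $ j)) * pd i \<phi> x) \<in> borel_measurable lebesgue"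
          by (rule borel_measurable_integrable[OF Bochner_Integration.integrable_diff[OF i2 i3]])
      qed
      also have "\<dots> = (LINT x|lebesgue. (\<Sum>k\<in>UNIV. A x $ i $ k * D k x) * pd i \<phi> x) - (LINT x|lebesgue. ((-1) * (A x $ i $ j)) * pd i \<phi> x)"
        by (rule Bochner_Integration.integral_diff[OF i2 i3])
      finally show ?thesis .
    qed
    hence "(\<Sum>i\<in>UNIV. LINT x|lebesgue. flux A j (%k. weak_pd L2_per UNIV k w) i x * pd i \<phi> x)
       = (\<Sum>i\<in>UNIV. LINT x|lebesgue. (\<Sum>k\<in>UNIV. A x $ i $ k * D k x) * pd i \<phi> x) - (\<Sum>i\<in>UNIV. LINT x|lebesgue. ((-1) * (A x $ i $ j)) * pd i \<phi> x)"
      by (simp only: sum_subtractf)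
    thus "\<rho>\<^sup>2 * (\<Sum>i\<in>UNIV. \<Sum>j\<in>UNIV. LINT x|lebesgue. w x * pd j (pd j (pd i (pd i \<phi>))) x)
       + (\<Sum>i\<in>UNIV. LINT x|lebesgue. flux A j (%k. weak_pd L2_per UNIV k w) i x * pd i \<phi> x) = 0"
      using eq[OF \<phi>] by simp
  qed
  thus ?thesis unfolding corrector_def by (rule someI[where P="is_corrector A \<rho> j" and x=w])
qed

lemma corrector_props:
  fixes A :: "real^'d => real^'d^'d" and j :: 'd
  assumes A: "periodic_elliptic A" and \<rho>: "\<rho> >= 0"
  defines "w \<equiv> corrector A \<rho> j" and "D \<equiv> (%k. weak_pd L2_per UNIV k (corrector A \<rho> j))"
  shows "w \<in> L2_per" "!!k. D k \<in> L2_per" "!!k. has_weak_pd UNIV k w (D k)"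
    "!!\<phi>. \<phi> \<in> test_functions UNIV ==> \<rho>\<^sup>2 * (\<Sum>i\<in>UNIV. \<Sum>j\<in>UNIV. LINT x|lebesgue. w x * pd j (pd j (pd i (pd i \<phi>))) x)
       + (\<Sum>i\<in>UNIV. LINT x|lebesgue. flux A j D i x * pd i \<phi> x) = 0"
    "corrected_mean A \<rho> $ i $ j = mean (flux A j D i)"
proof -
  have c: "is_corrector A \<rho> j w" unfolding w_def by (rule corrector_exists[OF A \<rho>])
  hence H: "w \<in> H_per (if \<rho> > 0 then 2 else 1)" by (simp add: is_corrector_def)
  obtain n where n: "(if \<rho> > 0 then 2 else 1) = Suc n" and n01: "n = 0 \<or> n = Suc 0" by (cases "\<rho> > 0") auto
  have w1: "w \<in> L2_per & (\<forall>k. \<exists>v\<in>sobolev L2_per UNIV n. has_weak_pd UNIV k w v)" using H unfolding n by auto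
  have sub: "sobolev L2_per UNIV n \<subseteq> L2_per" using n01 by auto
  show "w \<in> L2_per" using w1 by simp
  have ex: "\<exists>v. v \<in> L2_per & has_weak_pd UNIV k w v" for k using w1 sub by blast
  show "D k \<in> L2_per" "has_weak_pd UNIV k w (D k)" for k
    using someI_ex[OF ex[of k]] unfolding D_def weak_pd_def w_def by blast+
  show "\<rho>\<^sup>2 * (\<Sum>i\<in>UNIV. \<Sum>j\<in>UNIV. LINT x|lebesgue. w x * pd j (pd j (pd i (pd i \<phi>))) x)
       + (\<Sum>i\<in>UNIV. LINT x|lebesgue. flux A j D i x * pd i \<phi> x) = 0" if "\<phi> \<in> test_functions UNIV" for \<phi>
    using c that unfolding is_corrector_def corrector_equation_iff D_def w_def by blast
  have "axis i 1 \<bullet> (A y *v axis j 1) + axis i 1 \<bullet> (A y *v grad_per (corrector A \<rho> j) y) = flux A j D i y" for y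
  proof -
    have "axis i 1 \<bullet> (A y *v axis j 1) + axis i 1 \<bullet> (A y *v grad_per (corrector A \<rho> j) y) = (A y *v (axis j 1 + grad_per (corrector A \<rho> j) y)) $ i"
      by (simp add: inner_axis' matrix_vector_right_distrib)
    also have "\<dots> = flux A j D i y" by (simp add: matrix_vector_mult_def flux_def weak_grad_def D_def)
    finally show ?thesis .
  qed
  thus "corrected_mean A \<rho> $ i $ j = mean (flux A j D i)" by (simp add: corrected_mean_def)
qed

section \<open>Smooth approximations\<close>

lemma L2_per_loc_integrable:
  assumes f: "f \<in> L2_per" shows "loc_integrable f"
  unfolding loc_integrable_def
proof (intro conjI allI)
  show "f \<in> borel_measurable lebesgue" by (rule L2_perD(1)[OF f])
  fix R
  have sq: "sqint lebesgue (%x. indicator (cball 0 R) x * f x)"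
    by (rule periodic_loc_sqint[OF L2_perD[OF f]])
  have "loc_integrable (%x. indicator (cball 0 R) x * f x)" by (rule sqint_loc_integrable[OF sq])
  hence "integrable lebesgue (%x. indicator (cball 0 R) x * (indicator (cball 0 R) x * f x))" by (simp add: loc_integrable_def)
  moreover have "indicator (cball 0 R) x * (indicator (cball 0 R) x * f x) = indicator (cball 0 R) x * f x" for x by (simp add: indicator_def)
  ultimately show "integrable lebesgue (%x. indicator (cball 0 R) x * f x)" by simp
qed

lemma conv_smooth_per:
  fixes v :: "real^'d => real"
  assumes \<eta>: "\<eta> \<in> test_functions UNIV" and v: "v \<in> L2_per"
  shows "smooth_per (conv \<eta> v)"
  unfolding smooth_per_def
proof
  note loc = L2_per_loc_integrable[OF v]
  show "smooth (conv \<eta> v)" by (rule conv_smooth(1)[OF \<eta> loc])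
  show "zperiodic (conv \<eta> v)" unfolding zperiodic_def
  proof (intro ballI allI)
    fix p x assume p: "p \<in> (lattice :: (real^'d) set)"
    let ?q = "(2 * pi) *\<^sub>R p"
    have i: "integrable lebesgue (%y. \<eta> (x - y) * v y)" for x by (rule conv_integrable[OF \<eta> loc])
    have m: "(%y. \<eta> ((x + ?q) - y) * v y) \<in> borel_measurable lebesgue" by (rule borel_measurable_integrable[OF i])
    have "conv \<eta> v (x + ?q) = (LINT y|lebesgue. \<eta> ((x + ?q) - (y + ?q)) * v (y + ?q))"
      unfolding conv_def by (rule integral_lebesgue_translate[OF m, symmetric])
    also have "\<dots> = (LINT y|lebesgue. \<eta> (x - y) * v y)"
    proof (rule integral_cong_AE)
      show "AE y in lebesgue. \<eta> ((x + ?q) - (y + ?q)) * v (y + ?q) = \<eta> (x - y) * v y"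
        using periodicD[OF L2_perD(2)[OF v] p] by eventually_elim simp
      show "(%y. \<eta> ((x + ?q) - (y + ?q)) * v (y + ?q)) \<in> borel_measurable lebesgue"
        by (rule measurable_translate[OF m])
      show "(%y. \<eta> (x - y) * v y) \<in> borel_measurable lebesgue" by (rule borel_measurable_integrable[OF i])
    qed
    finally show "conv \<eta> v (x + ?q) = conv \<eta> v x" by (simp add: conv_def)
  qed
qed

lemma conv_cell_tendsto:
  fixes v :: "real^'d => real"
  assumes m: "mollifiers \<eta>" and v: "v \<in> L2_per"
  shows "(%n. nrm cellm (%x. conv (\<eta> n) v x - v x)) \<longlonglongrightarrow> 0"
  by (rule mollify_loc(1)[OF m periodic_loc_sqint[OF L2_perD[OF v]] cell_sets cell_subset_ball])

text \<open>Testing the equation against \<open>y \<mapsto> \<eta> (x - y)\<close> shows that the mollified functions satisfy it pointwise.\<close>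
lemma conv_equation:
  fixes w :: "real^'d => real" and q :: "'d => real^'d => real"
  assumes \<eta>: "\<eta> \<in> test_functions UNIV" and w: "w \<in> L2_per" and q: "!!i. q i \<in> L2_per"
    and eq: "!!\<phi>. \<phi> \<in> test_functions UNIV ==> c * (\<Sum>i\<in>UNIV. \<Sum>j\<in>UNIV. LINT x|lebesgue. w x * pd j (pd j (pd i (pd i \<phi>))) x)
       + (\<Sum>i\<in>UNIV. LINT x|lebesgue. q i x * pd i \<phi> x) = 0"
  shows "(\<Sum>i\<in>UNIV. pd i (conv \<eta> (q i)) x) = c * (\<Sum>i\<in>UNIV. \<Sum>j\<in>UNIV. pd j (pd j (pd i (pd i (conv \<eta> w)))) x)"
proof -
  let ?\<phi> = "%y. \<eta> (x - y)"
  have t: "?\<phi> \<in> test_functions UNIV" by (rule test_reflect(1)[OF \<eta>])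
  have p: "pd i (%y. \<eta> (x - y)) = (%y. - pd i \<eta> (x - y))" if "\<eta> \<in> test_functions UNIV" for \<eta> i by (rule test_reflect(2)[OF that])
  have neg: "pd i (%y. - f y) = (%y. - pd i f y)" if "smooth f" for f :: "real^'d => real" and i
    using smooth_pd_scale[OF that, of i "-1"] by simp
  have p2: "pd j (pd i (%y. \<zeta> (x - y))) = (%y. pd j (pd i \<zeta>) (x - y))" if z: "\<zeta> \<in> test_functions UNIV" for \<zeta> i j
  proof -
    have sm: "smooth (%y. pd i \<zeta> (x - y))" by (rule test_smooth[OF test_reflect(1)[OF test_pd[OF z]]])
    show ?thesis unfolding p[OF z] neg[OF sm] p[OF test_pd[OF z]] by simp
  qed
  have p4: "pd j (pd j (pd i (pd i ?\<phi>))) = (%y. pd j (pd j (pd i (pd i \<eta>))) (x - y))" for i j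
    unfolding p2[OF \<eta>] by (rule p2[OF test_pd[OF test_pd[OF \<eta>]]])
  note lw = L2_per_loc_integrable[OF w] and lq = L2_per_loc_integrable[OF q]
  have c4: "pd j (pd j (pd i (pd i (conv \<eta> w)))) = conv (pd j (pd j (pd i (pd i \<eta>)))) w" for i j
    by (simp only: conv_smooth(2)[OF \<eta> lw] conv_smooth(2)[OF test_pd[OF \<eta>] lw] conv_smooth(2)[OF test_pd[OF test_pd[OF \<eta>]] lw]
        conv_smooth(2)[OF test_pd[OF test_pd[OF test_pd[OF \<eta>]]] lw])
  have "c * (\<Sum>i\<in>UNIV. \<Sum>j\<in>UNIV. LINT y|lebesgue. w y * pd j (pd j (pd i (pd i ?\<phi>))) y) + (\<Sum>i\<in>UNIV. LINT y|lebesgue. q i y * pd i ?\<phi> y) = 0"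
    by (rule eq[OF t])
  note h1 = this[unfolded p4]
  note h2 = h1[unfolded p[OF \<eta>]]
  have "c * (\<Sum>i\<in>UNIV. \<Sum>j\<in>UNIV. conv (pd j (pd j (pd i (pd i \<eta>)))) w x) - (\<Sum>i\<in>UNIV. conv (pd i \<eta>) (q i) x) = 0"
    using h2 by (simp add: conv_def sum_negf mult.commute)
  thus ?thesis unfolding c4 conv_smooth(2)[OF \<eta> lq] by simp
qed

text \<open>Corrector and flux are mollified by the same kernel. The mollified flux is not the flux of the
  mollified corrector, since \<open>A\<close> does not commute with convolution; but it is close to it in \<open>L\<^sup>2\<close>, and the
  identity between its divergence and the bilaplacian is exact.\<close>
lemma corrector_approx:
  fixes A :: "real^'d => real^'d^'d"
  assumes A: "periodic_elliptic A" and \<rho>: "\<rho> >= 0"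
  defines "D \<equiv> (%j k. weak_pd L2_per UNIV k (corrector A \<rho> j))"
  obtains \<psi> g where "!!n j. smooth_per (\<psi> n j)" "!!n j i. smooth_per (g n j i)"
    "!!n j x. (\<Sum>i\<in>UNIV. pd i (g n j i) x) = \<rho>\<^sup>2 * (\<Sum>i\<in>UNIV. \<Sum>k\<in>UNIV. pd k (pd k (pd i (pd i (\<psi> n j)))) x)"
    "!!j k. (%n. nrm cellm (%x. pd k (\<psi> n j) x - D j k x)) \<longlonglongrightarrow> 0"
    "!!j i. (%n. nrm cellm (%x. g n j i x - flux A j (D j) i x)) \<longlonglongrightarrow> 0"
proof -
  obtain \<eta> :: "nat => real^'d => real" where m: "mollifiers \<eta>" using mollifiers_exist by blast
  hence \<eta>: "\<eta> n \<in> test_functions UNIV" for n by (simp add: mollifiers_def)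
  note cp = corrector_props[OF A \<rho>, folded D_def]
  have D: "D j k \<in> L2_per" "has_weak_pd UNIV k (corrector A \<rho> j) (D j k)" for j k unfolding D_def by (rule corrector_props[OF A \<rho>])+
  have fl: "flux A j (D j) i \<in> L2_per" for i j by (rule flux_L2_per[OF A D(1)])
  have w: "corrector A \<rho> j \<in> L2_per" for j by (rule corrector_props[OF A \<rho>])
  show thesis
  proof (rule that[of "%n j. conv (\<eta> n) (corrector A \<rho> j)" "%n j i. conv (\<eta> n) (flux A j (D j) i)"])
    show "smooth_per (conv (\<eta> n) (corrector A \<rho> j))" for n j by (rule conv_smooth_per[OF \<eta> w])
    show "smooth_per (conv (\<eta> n) (flux A j (D j) i))" for n j i by (rule conv_smooth_per[OF \<eta> fl])
    show "(\<Sum>i\<in>UNIV. pd i (conv (\<eta> n) (flux A j (D j) i)) x) = \<rho>\<^sup>2 * (\<Sum>i\<in>UNIV. \<Sum>k\<in>UNIV. pd k (pd k (pd i (pd i (conv (\<eta> n) (corrector A \<rho> j))))) x)" for n j x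
      by (rule conv_equation[OF \<eta> w fl]) (unfold D_def, rule corrector_props[OF A \<rho>])
    show "(%n. nrm cellm (%x. pd k (conv (\<eta> n) (corrector A \<rho> j)) x - D j k x)) \<longlonglongrightarrow> 0" for j k
    proof -
      have "pd k (conv (\<eta> n) (corrector A \<rho> j)) = conv (\<eta> n) (D j k)" for n
        unfolding conv_smooth(2)[OF \<eta> L2_per_loc_integrable[OF w]] by (rule conv_weak_pd[OF \<eta> D(2)])
      thus ?thesis using conv_cell_tendsto[OF m D(1)] by simp
    qed
    show "(%n. nrm cellm (%x. conv (\<eta> n) (flux A j (D j) i) x - flux A j (D j) i x)) \<longlonglongrightarrow> 0" for j i
      by (rule conv_cell_tendsto[OF m fl])
  qed
qed

lemma periodic_elliptic_id: "periodic_elliptic (%y::real^'d. mat 1 :: real^'d^'d)"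
proof -
  have "\<bar>(mat 1 :: real^'d^'d) $ j $ k\<bar> <= 1" for j k by (simp add: mat_def)
  hence "\<exists>M. AE y in (lebesgue :: (real^'d) measure). \<forall>j k. \<bar>(mat 1 :: real^'d^'d) $ j $ k\<bar> <= M"
    by (intro exI[of _ 1] always_eventually allI)
  moreover have "\<exists>\<alpha>>0. AE y in (lebesgue :: (real^'d) measure). \<forall>\<xi>. ((mat 1 :: real^'d^'d) *v \<xi>) \<bullet> \<xi> >= \<alpha> * (norm \<xi>)\<^sup>2"
    by (intro exI[of _ 1]) (simp add: matrix_vector_mul_lid power2_norm_eq_inner)
  ultimately show ?thesis
    unfolding periodic_elliptic_def by (simp add: transpose_mat periodic_const)
qed

lemma mat1_sum: "(\<Sum>k\<in>UNIV. (mat 1 :: real^'d^'d) $ i $ k * f k) = f i"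
proof -
  have "(\<Sum>k\<in>UNIV. (mat 1 :: real^'d^'d) $ i $ k * f k) = (\<Sum>k\<in>UNIV. if k = i then f i else 0)"
    by (rule sum.cong[OF refl]) (simp add: mat_def)
  thus ?thesis by simp
qed

text \<open>Solve \<open>- \<Delta>w = \<gamma>\<close> on the torus and mollify \<open>- \<nabla>w\<close>: the divergence of the result is the mollification of \<open>\<gamma>\<close>.\<close>
lemma antidivergence:
  fixes \<gamma> :: "real^'d => real"
  assumes \<gamma>: "\<gamma> \<in> L2_per" and \<gamma>0: "(LINT x|cellm. \<gamma> x) = 0" and e: "e > 0"
  obtains G where "!!i. smooth_per (G i)" "nrm cellm (%x. \<gamma> x - (\<Sum>i\<in>UNIV. pd i (G i) x)) < e"
proof -
  obtain D where D: "!!i. D i \<in> L2_per"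
    and eq: "!!\<phi>. \<phi> \<in> test_functions UNIV ==>
       (\<Sum>i\<in>UNIV. LINT x|lebesgue. (\<Sum>k\<in>UNIV. (mat 1 :: real^'d^'d) $ i $ k * D k x) * pd i \<phi> x) = (LINT x|lebesgue. \<gamma> x * \<phi> x)"
  proof (rule periodic_existence[where \<rho>=0 and B="%y. mat 1" and F="%i x. 0" and \<gamma>=\<gamma>])
    fix w D E
    assume "!!i. D i \<in> L2_per"
      and "!!\<phi>. \<phi> \<in> test_functions UNIV ==>
           0\<^sup>2 * (\<Sum>i\<in>UNIV. \<Sum>j\<in>UNIV. LINT x|lebesgue. w x * pd j (pd j (pd i (pd i \<phi>))) x) +
           (\<Sum>i\<in>UNIV. LINT x|lebesgue. (\<Sum>k\<in>UNIV. (mat 1 :: real^'d^'d) $ i $ k * D k x) * pd i \<phi> x) =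
           (LINT x|lebesgue. \<gamma> x * \<phi> x) + (\<Sum>i\<in>UNIV. LINT x|lebesgue. 0 * pd i \<phi> x)"
    thus thesis by (intro that[of D]) simp_all
  qed (rule periodic_elliptic_id, rule L2_per_const, rule \<gamma>, rule \<gamma>0)
  obtain \<eta> :: "nat => real^'d => real" where m: "mollifiers \<eta>" using mollifiers_exist by blast
  hence \<eta>: "\<eta> n \<in> test_functions UNIV" for n by (simp add: mollifiers_def)
  have id: "conv (\<eta> n) \<gamma> x = (\<Sum>i\<in>UNIV. pd i (%y. (-1) * conv (\<eta> n) (D i) y) x)" for n x
  proof -
    have "(\<Sum>i\<in>UNIV. LINT y|lebesgue. D i y * (- pd i (\<eta> n) (x - y))) = (LINT y|lebesgue. \<gamma> y * \<eta> n (x - y))"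
      using eq[OF test_reflect(1)[OF \<eta>, of n x]] unfolding mat1_sum test_reflect(2)[OF \<eta>] .
    hence "conv (\<eta> n) \<gamma> x = - (\<Sum>i\<in>UNIV. conv (pd i (\<eta> n)) (D i) x)"
      by (simp add: conv_def sum_negf mult.commute)
    also have "\<dots> = (\<Sum>i\<in>UNIV. (-1) * pd i (conv (\<eta> n) (D i)) x)"
      using conv_smooth(2)[OF \<eta> L2_per_loc_integrable[OF D]] by (simp add: sum_negf)
    also have "\<dots> = (\<Sum>i\<in>UNIV. pd i (%y. (-1) * conv (\<eta> n) (D i) y) x)"
      by (subst smooth_pd_scale[OF conv_smooth(1)[OF \<eta> L2_per_loc_integrable[OF D]]]) simp
    finally show ?thesis .
  qed
  have "\<forall>\<^sub>F n in sequentially. nrm cellm (%x. conv (\<eta> n) \<gamma> x - \<gamma> x) < e"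
    by (rule order_tendstoD(2)[OF conv_cell_tendsto[OF m \<gamma>] e])
  then obtain n where n: "nrm cellm (%x. conv (\<eta> n) \<gamma> x - \<gamma> x) < e" by (auto simp: eventually_sequentially)
  show thesis
  proof (rule that[of "%i y. (-1) * conv (\<eta> n) (D i) y"])
    show "smooth_per (%y. (-1) * conv (\<eta> n) (D i) y)" for i
      by (rule smooth_per_scale[OF conv_smooth_per[OF \<eta> D]])
    show "nrm cellm (%x. \<gamma> x - (\<Sum>i\<in>UNIV. pd i (%y. (-1) * conv (\<eta> n) (D i) y) x)) < e"
      unfolding id[symmetric] using n nrm_minus_commute[of cellm \<gamma>] by simp
  qed
qed

lemma mean_tendsto:
  fixes u :: "real^'d => real"
  assumes "u \<in> L2_per" "!!n. s n \<in> L2_per" "(%n. nrm cellm (%x. s n x - u x)) \<longlonglongrightarrow> 0"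
  shows "(%n. mean (s n)) \<longlonglongrightarrow> mean u"
proof -
  have "(%n. LINT x|cellm. s n x * 1) \<longlonglongrightarrow> (LINT x|cellm. u x * 1)"
    by (rule L2_ip_tendsto[OF L2_perD(3)[OF assms(1)] L2_perD(3)[OF assms(2)] L2_perD(3)[OF L2_per_const] assms(3)])
  thus ?thesis unfolding mean_def by (intro tendsto_mult_left) simp
qed

lemma L2_ip_tendsto2:
  assumes u: "sqint M u" "!!n. sqint M (s n)" "(%n. nrm M (%x. s n x - u x)) \<longlonglongrightarrow> 0"
    and v: "sqint M v" "!!n. sqint M (t n)" "(%n. nrm M (%x. t n x - v x)) \<longlonglongrightarrow> 0"
  shows "(%n. LINT x|M. s n x * t n x) \<longlonglongrightarrow> (LINT x|M. u x * v x)"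
proof -
  have d: "(LINT x|M. s n x * t n x) = (LINT x|M. u x * t n x) + (LINT x|M. (s n x - u x) * t n x)" for n
    using sqint_mult[OF u(1) v(2)[of n]] sqint_mult[OF u(2)[of n] v(2)[of n]]
    by (simp add: left_diff_distrib)
  have 1: "(%n. LINT x|M. u x * t n x) \<longlonglongrightarrow> (LINT x|M. u x * v x)"
    using L2_ip_tendsto[OF v(1,2) u(1) v(3)] by (simp add: mult.commute)
  have tb: "nrm M (t n) <= nrm M v + nrm M (%x. t n x - v x)" for n
    using nrm_triangle[OF v(1) sqint_diff[OF v(2)[of n] v(1)]] by simp
  have 2: "(%n. LINT x|M. (s n x - u x) * t n x) \<longlonglongrightarrow> 0"
  proof (rule Lim_null_comparison)
    show "\<forall>\<^sub>F n in sequentially. norm (LINT x|M. (s n x - u x) * t n x) <= nrm M (%x. s n x - u x) * (nrm M v + nrm M (%x. t n x - v x))"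
    proof (intro always_eventually allI)
      fix n
      have "norm (LINT x|M. (s n x - u x) * t n x) <= nrm M (%x. s n x - u x) * nrm M (t n)"
        using L2_Cauchy_Schwarz[OF sqint_diff[OF u(2)[of n] u(1)] v(2)[of n]] by simp
      also have "\<dots> <= nrm M (%x. s n x - u x) * (nrm M v + nrm M (%x. t n x - v x))"
        by (rule mult_left_mono[OF tb nrm_nonneg])
      finally show "norm (LINT x|M. (s n x - u x) * t n x) <= nrm M (%x. s n x - u x) * (nrm M v + nrm M (%x. t n x - v x))" .
    qed
    have "(%n. nrm M (%x. s n x - u x) * (nrm M v + nrm M (%x. t n x - v x))) \<longlonglongrightarrow> 0 * (nrm M v + 0)"
      by (intro tendsto_intros u(3) v(3))
    thus "(%n. nrm M (%x. s n x - u x) * (nrm M v + nrm M (%x. t n x - v x))) \<longlonglongrightarrow> 0" by simp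
  qed
  show ?thesis unfolding d using tendsto_add[OF 1 2] by simp
qed

definition laplace :: "(real^'d => real) => real^'d => real" where
  "laplace \<psi> x = (\<Sum>i\<in>UNIV. pd i (pd i \<psi>) x)"

lemma laplace_smooth_per: "smooth_per \<psi> ==> smooth_per (laplace \<psi>)"
proof -
  assume p: "smooth_per \<psi>"
  have "smooth_per (%x. \<Sum>i\<in>UNIV. pd i (pd i \<psi>) x)" by (intro smooth_per_sum smooth_per_pd p) simp
  thus ?thesis by (simp add: laplace_def[abs_def])
qed

lemma laplace_laplace:
  assumes p: "smooth_per \<psi>"
  shows "laplace (laplace \<psi>) x = (\<Sum>i\<in>UNIV. \<Sum>k\<in>UNIV. pd k (pd k (pd i (pd i \<psi>))) x)"
proof -
  have sm: "smooth (pd i (pd i \<psi>))" "smooth (pd k (pd i (pd i \<psi>)))" for i k by (intro smoothD(3) smooth_perD(1)[OF p])+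
  have "pd k (laplace \<psi>) = (%x. \<Sum>i\<in>UNIV. pd k (pd i (pd i \<psi>)) x)" for k
    unfolding laplace_def[abs_def] by (rule smooth_pd_sum) (simp_all add: sm)
  moreover have "pd k (%x. \<Sum>i\<in>UNIV. pd k (pd i (pd i \<psi>)) x) = (%x. \<Sum>i\<in>UNIV. pd k (pd k (pd i (pd i \<psi>))) x)" for k
    by (rule smooth_pd_sum) (simp_all add: sm)
  ultimately have "laplace (laplace \<psi>) x = (\<Sum>k\<in>UNIV. \<Sum>i\<in>UNIV. pd k (pd k (pd i (pd i \<psi>))) x)"
    unfolding laplace_def[of "laplace \<psi>"] by simp
  thus ?thesis by (simp add: sum.swap[of "%k i. pd k (pd k (pd i (pd i \<psi>))) x"])
qed

lemma flux_diff_nrm: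
  fixes A :: "real^'d => real^'d^'d"
  assumes A: "periodic_elliptic A" and D: "!!k. D k \<in> L2_per" and s: "!!n k. s n k \<in> L2_per"
    and l: "!!k. (%n. nrm cellm (%x. s n k x - D k x)) \<longlonglongrightarrow> 0"
  shows "(%n. nrm cellm (%x. flux A j (s n) i x - flux A j D i x)) \<longlonglongrightarrow> 0"
proof -
  obtain M where M: "M > 0" "!!j k. (%y. A y $ j $ k) \<in> borel_measurable lebesgue"
    "!!j k. AE y in lebesgue. \<bar>A y $ j $ k\<bar> <= M" by (rule periodic_ellipticE[OF A]) blast
  have dL: "(%x. s n k x - D k x) \<in> L2_per" for n k using L2_per_lin[OF s D, of n k "-1" k] by simp
  have AEc: "AE x in cellm. \<bar>A x $ i $ k\<bar> <= M" for k
    using M(3)[of i k] cell_sets by (subst AE_restrict_space_iff) (auto elim: eventually_mono)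
  have b: "nrm cellm (%x. A x $ i $ k * (s n k x - D k x)) <= M * nrm cellm (%x. s n k x - D k x)" for n k
  proof -
    have "nrm cellm (%x. A x $ i $ k * (s n k x - D k x)) <= nrm cellm (%x. M * (s n k x - D k x))"
    proof (rule nrm_mono)
      show "sqint cellm (%x. M * (s n k x - D k x))" by (intro sqint_scale L2_perD(3) dL)
      show "(%x. A x $ i $ k * (s n k x - D k x)) \<in> borel_measurable cellm"
        using L2_perD(3)[OF A_mult_L2_per[OF A dL]] by (simp add: sqint_def)
      show "AE x in cellm. \<bar>A x $ i $ k * (s n k x - D k x)\<bar> <= \<bar>M * (s n k x - D k x)\<bar>"
        using AEc[of k] by eventually_elim (use M(1) in \<open>auto simp: abs_mult intro!: mult_right_mono\<close>)
    qed
    thus ?thesis using M(1) by (simp add: nrm_scale)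
  qed
  have e: "flux A j (s n) i x - flux A j D i x = (\<Sum>k\<in>UNIV. A x $ i $ k * (s n k x - D k x))" for n x
    by (simp add: flux_split right_diff_distrib sum_subtractf)
  show ?thesis
  proof (rule Lim_null_comparison)
    show "\<forall>\<^sub>F n in sequentially. norm (nrm cellm (%x. flux A j (s n) i x - flux A j D i x)) <= (\<Sum>k\<in>UNIV. M * nrm cellm (%x. s n k x - D k x))"
    proof (intro always_eventually allI)
      fix n
      have "nrm cellm (%x. flux A j (s n) i x - flux A j D i x) <= (\<Sum>k\<in>UNIV. nrm cellm (%x. A x $ i $ k * (s n k x - D k x)))"
        unfolding e by (rule nrm_sum) (simp_all add: L2_perD(3)[OF A_mult_L2_per[OF A dL]])
      also have "\<dots> <= (\<Sum>k\<in>UNIV. M * nrm cellm (%x. s n k x - D k x))" by (rule sum_mono[OF b])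
      finally show "norm (nrm cellm (%x. flux A j (s n) i x - flux A j D i x)) <= (\<Sum>k\<in>UNIV. M * nrm cellm (%x. s n k x - D k x))"
        by (simp add: nrm_nonneg)
    qed
    have "(%n. \<Sum>k\<in>UNIV. M * nrm cellm (%x. s n k x - D k x)) \<longlonglongrightarrow> (\<Sum>k\<in>(UNIV::'d set). M * 0)"
      by (intro tendsto_intros l)
    thus "(%n. \<Sum>k\<in>UNIV. M * nrm cellm (%x. s n k x - D k x)) \<longlonglongrightarrow> 0" by simp
  qed
qed

text \<open>Smooth substitutes for a corrector \<open>\<psi>\<close>, its flux \<open>g\<close> and a potential \<open>h\<close> of the divergence of the flux.
  The numbers \<open>m i\<close> are the means of the exact flux. The predicate \<open>P\<close> records the relation between \<open>\<psi>\<close> and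
  \<open>h\<close>, in which alone the regimes of \<open>\<kappa>/\<epsilon>\<close> differ.\<close>
definition approx_flux :: "(real^'d => real^'d^'d) => 'd => ('d => real) => ((real^'d => real) => (real^'d => real) => bool) => bool" where
  "approx_flux A j m P \<longleftrightarrow> (\<forall>e>0. \<exists>\<psi> g h. smooth_per \<psi> & (\<forall>i. smooth_per (g i)) & smooth_per h
     & (\<forall>x. (\<Sum>i\<in>UNIV. pd i (g i) x) = laplace h x) & P \<psi> h
     & (\<forall>i. nrm cellm (%x. flux A j (%k. pd k \<psi>) i x - g i x) < e) & (\<forall>i. \<bar>mean (g i) - m i\<bar> < e))"

lemma approx_flux_finite:
  fixes A :: "real^'d => real^'d^'d"
  assumes A: "periodic_elliptic A" and \<rho>: "\<rho> >= 0"
  shows "approx_flux A j (%i. corrected_mean A \<rho> $ i $ j) (%\<psi> h. h = (%x. \<rho>\<^sup>2 * laplace \<psi> x))"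
  unfolding approx_flux_def
proof (intro allI impI)
  fix e :: real assume e: "e > 0"
  define D where "D = (%j k. weak_pd L2_per UNIV k (corrector A \<rho> j))"
  obtain \<psi> g where sp: "!!n j. smooth_per (\<psi> n j)" "!!n j i. smooth_per (g n j i)"
    and div: "!!n j x. (\<Sum>i\<in>UNIV. pd i (g n j i) x) = \<rho>\<^sup>2 * (\<Sum>i\<in>UNIV. \<Sum>k\<in>UNIV. pd k (pd k (pd i (pd i (\<psi> n j)))) x)"
    and l1: "!!j k. (%n. nrm cellm (%x. pd k (\<psi> n j) x - D j k x)) \<longlonglongrightarrow> 0"
    and l2: "!!j i. (%n. nrm cellm (%x. g n j i x - flux A j (D j) i x)) \<longlonglongrightarrow> 0"
    unfolding D_def by (rule corrector_approx[OF A \<rho>]) blast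
  have DL: "D j k \<in> L2_per" for j k unfolding D_def by (rule corrector_props[OF A \<rho>])
  have fL: "flux A j (D j) i \<in> L2_per" for i by (rule flux_L2_per[OF A DL])
  have sL: "pd k (\<psi> n j) \<in> L2_per" for n k by (intro smooth_per_L2_per smooth_per_pd sp)
  have gL: "g n j i \<in> L2_per" for n i by (intro smooth_per_L2_per sp)
  have l3: "(%n. nrm cellm (%x. flux A j (%k. pd k (\<psi> n j)) i x - flux A j (D j) i x)) \<longlonglongrightarrow> 0" for i
    by (rule flux_diff_nrm[OF A DL sL l1])
  have l4: "(%n. nrm cellm (%x. flux A j (%k. pd k (\<psi> n j)) i x - g n j i x)) \<longlonglongrightarrow> 0" for i
  proof (rule Lim_null_comparison)
    show "\<forall>\<^sub>F n in sequentially. norm (nrm cellm (%x. flux A j (%k. pd k (\<psi> n j)) i x - g n j i x))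
       <= nrm cellm (%x. flux A j (%k. pd k (\<psi> n j)) i x - flux A j (D j) i x) + nrm cellm (%x. g n j i x - flux A j (D j) i x)"
    proof (intro always_eventually allI)
      fix n
      have "nrm cellm (%x. (flux A j (%k. pd k (\<psi> n j)) i x - flux A j (D j) i x) + (flux A j (D j) i x - g n j i x))
        <= nrm cellm (%x. flux A j (%k. pd k (\<psi> n j)) i x - flux A j (D j) i x) + nrm cellm (%x. flux A j (D j) i x - g n j i x)"
        by (intro nrm_triangle sqint_diff L2_perD(3) flux_L2_per[OF A] DL sL gL)
      thus "norm (nrm cellm (%x. flux A j (%k. pd k (\<psi> n j)) i x - g n j i x))
       <= nrm cellm (%x. flux A j (%k. pd k (\<psi> n j)) i x - flux A j (D j) i x) + nrm cellm (%x. g n j i x - flux A j (D j) i x)"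
        using nrm_minus_commute[of cellm "flux A j (D j) i" "g n j i"] by (simp add: nrm_nonneg)
    qed
    show "(%n. nrm cellm (%x. flux A j (%k. pd k (\<psi> n j)) i x - flux A j (D j) i x) + nrm cellm (%x. g n j i x - flux A j (D j) i x)) \<longlonglongrightarrow> 0"
      using tendsto_add[OF l3 l2] by simp
  qed
  have l5: "(%n. mean (g n j i)) \<longlonglongrightarrow> corrected_mean A \<rho> $ i $ j" for i
    using mean_tendsto[OF fL gL l2] corrector_props(5)[OF A \<rho>, of i j] by (simp add: D_def)
  have "\<forall>\<^sub>F n in sequentially. \<forall>i. nrm cellm (%x. flux A j (%k. pd k (\<psi> n j)) i x - g n j i x) < e"
    by (intro eventually_all_finite order_tendstoD(2)[OF l4 e])
  moreover have "\<forall>\<^sub>F n in sequentially. \<forall>i. \<bar>mean (g n j i) - corrected_mean A \<rho> $ i $ j\<bar> < e"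
    by (intro eventually_all_finite) (use l5 e in \<open>auto simp: tendsto_iff dist_real_def\<close>)
  ultimately have "\<forall>\<^sub>F n in sequentially. (\<forall>i. nrm cellm (%x. flux A j (%k. pd k (\<psi> n j)) i x - g n j i x) < e)
      & (\<forall>i. \<bar>mean (g n j i) - corrected_mean A \<rho> $ i $ j\<bar> < e)" by (rule eventually_conj)
  then obtain n where n: "\<forall>i. nrm cellm (%x. flux A j (%k. pd k (\<psi> n j)) i x - g n j i x) < e"
      "\<forall>i. \<bar>mean (g n j i) - corrected_mean A \<rho> $ i $ j\<bar> < e" by (auto simp: eventually_sequentially)
  define h where "h = (%x. \<rho>\<^sup>2 * laplace (\<psi> n j) x)"
  have "laplace h x = \<rho>\<^sup>2 * laplace (laplace (\<psi> n j)) x" for x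
  proof -
    have sm: "smooth (laplace (\<psi> n j))" by (intro smooth_perD(1) laplace_smooth_per sp)
    have p1: "pd i h = (%x. \<rho>\<^sup>2 * pd i (laplace (\<psi> n j)) x)" for i unfolding h_def by (rule smooth_pd_scale[OF sm])
    have "pd i (pd i h) = (%x. \<rho>\<^sup>2 * pd i (pd i (laplace (\<psi> n j))) x)" for i
      unfolding p1 by (rule smooth_pd_scale[OF smoothD(3)[OF sm]])
    thus ?thesis unfolding laplace_def[of h] laplace_def[of "laplace (\<psi> n j)"] by (simp add: sum_distrib_left)
  qed
  hence dv: "(\<Sum>i\<in>UNIV. pd i (g n j i) x) = laplace h x" for x
    using div[of n j x] laplace_laplace[OF sp(1)[of n j], of x] by simp
  have hp: "smooth_per h" unfolding h_def by (intro smooth_per_scale laplace_smooth_per sp)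
  show "\<exists>\<psi> g h. smooth_per \<psi> & (\<forall>i. smooth_per (g i)) & smooth_per h
     & (\<forall>x. (\<Sum>i\<in>UNIV. pd i (g i) x) = laplace h x) & h = (%x. \<rho>\<^sup>2 * laplace \<psi> x)
     & (\<forall>i. nrm cellm (%x. flux A j (%k. pd k \<psi>) i x - g i x) < e) & (\<forall>i. \<bar>mean (g i) - corrected_mean A \<rho> $ i $ j\<bar> < e)"
    by (intro exI[of _ "\<psi> n j"] exI[of _ "g n j"] exI[of _ h] conjI allI sp hp dv) (use n in \<open>simp_all add: h_def\<close>)
qed

text \<open>There is no corrector, and \<open>h\<close> is a mollified potential of the divergence of the \<open>j\<close>-th column of \<open>A\<close>.\<close>
lemma approx_flux_infinite:
  fixes A :: "real^'d => real^'d^'d"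
  assumes A: "periodic_elliptic A"
  shows "approx_flux A j (%i. mean (%y. A y $ i $ j)) (%\<psi> h. \<psi> = (%x. 0))"
  unfolding approx_flux_def
proof (intro allI impI)
  fix e :: real assume e: "e > 0"
  have aL: "(%y. A y $ i $ j) \<in> L2_per" for i by (rule A_entry_L2_per[OF A])
  obtain w D where w: "w \<in> L2_per" and D: "!!i. D i \<in> L2_per" and wD: "!!i. has_weak_pd UNIV i w (D i)"
    and eq: "!!\<phi>. \<phi> \<in> test_functions UNIV ==>
       (\<Sum>i\<in>UNIV. LINT x|lebesgue. (\<Sum>k\<in>UNIV. (mat 1 :: real^'d^'d) $ i $ k * D k x) * pd i \<phi> x) = (\<Sum>i\<in>UNIV. LINT x|lebesgue. A x $ i $ j * pd i \<phi> x)"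
  proof (rule periodic_existence[where \<rho>=0 and B="%y. mat 1" and F="%i x. A x $ i $ j" and \<gamma>="%x. 0"])
    show "(LINT x|(cellm :: (real^'d) measure). 0) = (0::real)" by simp
    fix w D E
    assume "w \<in> L2_per" "!!i. D i \<in> L2_per" "!!i. has_weak_pd UNIV i w (D i)"
      and "!!\<phi>. \<phi> \<in> test_functions UNIV ==>
           0\<^sup>2 * (\<Sum>i\<in>UNIV. \<Sum>j\<in>UNIV. LINT x|lebesgue. w x * pd j (pd j (pd i (pd i \<phi>))) x) +
           (\<Sum>i\<in>UNIV. LINT x|lebesgue. (\<Sum>k\<in>UNIV. (mat 1 :: real^'d^'d) $ i $ k * D k x) * pd i \<phi> x) =
           (LINT x|lebesgue. 0 * \<phi> x) + (\<Sum>i\<in>UNIV. LINT x|lebesgue. A x $ i $ j * pd i \<phi> x)"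
    thus thesis by (intro that[of w D]) simp_all
  qed (rule periodic_elliptic_id, rule aL, rule L2_per_const)
  obtain \<eta> :: "nat => real^'d => real" where m: "mollifiers \<eta>" using mollifiers_exist by blast
  hence \<eta>: "\<eta> n \<in> test_functions UNIV" for n by (simp add: mollifiers_def)
  let ?a = "%i y. A y $ i $ j"
  have l2: "(%n. nrm cellm (%x. conv (\<eta> n) (?a i) x - ?a i x)) \<longlonglongrightarrow> 0" for i by (rule conv_cell_tendsto[OF m aL])
  have gp: "smooth_per (conv (\<eta> n) (?a i))" for n i by (rule conv_smooth_per[OF \<eta> aL])
  have l5: "(%n. mean (conv (\<eta> n) (?a i))) \<longlonglongrightarrow> mean (?a i)" for i
    by (rule mean_tendsto[OF aL smooth_per_L2_per[OF gp] l2])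
  have "\<forall>\<^sub>F n in sequentially. \<forall>i. nrm cellm (%x. conv (\<eta> n) (?a i) x - ?a i x) < e"
    by (intro eventually_all_finite order_tendstoD(2)[OF l2 e])
  moreover have "\<forall>\<^sub>F n in sequentially. \<forall>i. \<bar>mean (conv (\<eta> n) (?a i)) - mean (?a i)\<bar> < e"
    by (intro eventually_all_finite) (use l5 e in \<open>auto simp: tendsto_iff dist_real_def\<close>)
  ultimately have "\<forall>\<^sub>F n in sequentially. (\<forall>i. nrm cellm (%x. conv (\<eta> n) (?a i) x - ?a i x) < e)
      & (\<forall>i. \<bar>mean (conv (\<eta> n) (?a i)) - mean (?a i)\<bar> < e)" by (rule eventually_conj)
  then obtain n where n: "\<forall>i. nrm cellm (%x. conv (\<eta> n) (?a i) x - ?a i x) < e"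
      "\<forall>i. \<bar>mean (conv (\<eta> n) (?a i)) - mean (?a i)\<bar> < e" by (auto simp: eventually_sequentially)
  have dv: "(\<Sum>i\<in>UNIV. pd i (conv (\<eta> n) (?a i)) x) = laplace (conv (\<eta> n) w) x" for x
  proof -
    have "(\<Sum>i\<in>UNIV. LINT y|lebesgue. D i y * (- pd i (\<eta> n) (x - y))) = (\<Sum>i\<in>UNIV. LINT y|lebesgue. ?a i y * (- pd i (\<eta> n) (x - y)))"
      using eq[OF test_reflect(1)[OF \<eta>, of n x]] unfolding mat1_sum test_reflect(2)[OF \<eta>] .
    hence "(\<Sum>i\<in>UNIV. conv (pd i (\<eta> n)) (D i) x) = (\<Sum>i\<in>UNIV. conv (pd i (\<eta> n)) (?a i) x)"
      by (simp add: conv_def sum_negf mult.commute)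
    moreover have "conv (pd i (\<eta> n)) (?a i) = pd i (conv (\<eta> n) (?a i))" for i
      by (rule conv_smooth(2)[OF \<eta> L2_per_loc_integrable[OF aL], symmetric])
    moreover have "conv (pd i (\<eta> n)) (D i) = pd i (pd i (conv (\<eta> n) w))" for i
      unfolding conv_smooth(2)[OF \<eta> L2_per_loc_integrable[OF w]] conv_smooth(2)[OF test_pd[OF \<eta>] L2_per_loc_integrable[OF w]]
      by (rule conv_weak_pd[OF test_pd[OF \<eta>] wD, symmetric])
    ultimately show ?thesis by (simp add: laplace_def)
  qed
  have fl: "flux A j (%k. pd k (%x. 0)) i x = ?a i x" for i x by (simp add: flux_split pd_const)
  show "\<exists>\<psi> g h. smooth_per \<psi> & (\<forall>i. smooth_per (g i)) & smooth_per h
     & (\<forall>x. (\<Sum>i\<in>UNIV. pd i (g i) x) = laplace h x) & \<psi> = (%x. 0)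
     & (\<forall>i. nrm cellm (%x. flux A j (%k. pd k \<psi>) i x - g i x) < e) & (\<forall>i. \<bar>mean (g i) - mean (?a i)\<bar> < e)"
  proof (rule exI[of _ "%x. 0"], rule exI[of _ "%i. conv (\<eta> n) (?a i)"], rule exI[of _ "conv (\<eta> n) w"], intro conjI allI refl gp dv smooth_per_const)
    show "smooth_per (conv (\<eta> n) w)" by (rule conv_smooth_per[OF \<eta> w])
    show "nrm cellm (%x. flux A j (%k. pd k (%x. 0)) i x - conv (\<eta> n) (?a i) x) < e" for i
      unfolding fl using n(1) nrm_minus_commute[of cellm "?a i"] by simp
    show "\<bar>mean (conv (\<eta> n) (?a i)) - mean (?a i)\<bar> < e" for i using n(2) by blast
  qed
qed

text \<open>The entry is, up to the volume of the cell and the energy of second derivatives, the symmetric form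
  \<open>\<integral> A (e\<^sub>a + \<nabla>\<chi>\<^sub>a) \<bullet> (e\<^sub>b + \<nabla>\<chi>\<^sub>b)\<close>. The correctors are not admissible as functions to test the equation with, so the
  identity is derived for their smooth approximations, where it is integration by parts, and passed to the limit.\<close>
lemma corrected_mean_symmetric:
  fixes A :: "real^'d => real^'d^'d"
  assumes A: "periodic_elliptic A" and \<rho>: "\<rho> >= 0"
  shows "corrected_mean A \<rho> $ a $ b = corrected_mean A \<rho> $ b $ a"
proof -
  define D where "D = (%j k. weak_pd L2_per UNIV k (corrector A \<rho> j))"
  obtain \<psi> g where sp: "!!n j. smooth_per (\<psi> n j)" "!!n j i. smooth_per (g n j i)"
    and div: "!!n j x. (\<Sum>i\<in>UNIV. pd i (g n j i) x) = \<rho>\<^sup>2 * (\<Sum>i\<in>UNIV. \<Sum>k\<in>UNIV. pd k (pd k (pd i (pd i (\<psi> n j)))) x)"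
    and l1: "!!j k. (%n. nrm cellm (%x. pd k (\<psi> n j) x - D j k x)) \<longlonglongrightarrow> 0"
    and l2: "!!j i. (%n. nrm cellm (%x. g n j i x - flux A j (D j) i x)) \<longlonglongrightarrow> 0"
    unfolding D_def by (rule corrector_approx[OF A \<rho>]) blast
  have DL: "D j k \<in> L2_per" for j k unfolding D_def by (rule corrector_props[OF A \<rho>])
  have fL: "flux A j (D j) i \<in> L2_per" for i j by (rule flux_L2_per[OF A DL])
  have sL: "pd k (\<psi> n j) \<in> L2_per" for n k j by (intro smooth_per_L2_per smooth_per_pd sp)
  have gL: "g n j i \<in> L2_per" for n i j by (intro smooth_per_L2_per sp)
  have eL: "(%x. axis j 1 $ i + u x) \<in> L2_per" if "u \<in> L2_per" for i j :: 'd and u :: "real^'d => real"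
    using L2_per_lin[OF L2_per_const that, of _ 1] by simp
  define X where "X n j k = (\<Sum>i\<in>UNIV. LINT x|cellm. g n j i x * (axis k 1 $ i + pd i (\<psi> n k) x))" for n j k
  define Y where "Y j k = (\<Sum>i\<in>UNIV. LINT x|cellm. flux A j (D j) i x * (axis k 1 $ i + D k i x))" for j k
  have XY: "(%n. X n j k) \<longlonglongrightarrow> Y j k" for j k
    unfolding X_def Y_def
    by (intro tendsto_sum L2_ip_tendsto2 L2_perD(3) fL gL eL DL sL l2) (simp add: l1)
  \<comment> \<open>The energy form is symmetric because \<open>A\<close> is.\<close>
  have Ysym: "Y j k = Y k j" for j k
  proof -
    have i1: "integrable cellm (%x. flux A j (D j) i x * (axis k 1 $ i + D k i x))" for i j k
      by (intro cell_mult_integrable fL eL DL)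
    have "Y j k = (LINT x|cellm. (\<Sum>i\<in>UNIV. flux A j (D j) i x * (axis k 1 $ i + D k i x)))" for j k
      unfolding Y_def by (rule Bochner_Integration.integral_sum[OF i1, symmetric])
    moreover have "(LINT x|cellm. (\<Sum>i\<in>UNIV. flux A j (D j) i x * (axis k 1 $ i + D k i x))) = (LINT x|cellm. (\<Sum>i\<in>UNIV. flux A k (D k) i x * (axis j 1 $ i + D j i x)))"
    proof (rule integral_cong_AE)
      show "(%x. \<Sum>i\<in>UNIV. flux A j (D j) i x * (axis k 1 $ i + D k i x)) \<in> borel_measurable cellm"
        "(%x. \<Sum>i\<in>UNIV. flux A k (D k) i x * (axis j 1 $ i + D j i x)) \<in> borel_measurable cellm"
        by (intro borel_measurable_integrable Bochner_Integration.integrable_sum i1)+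
      have "!!i k. AE y in lebesgue. A y $ i $ k = A y $ k $ i" by (rule periodic_ellipticE[OF A]) blast
      hence "AE y in lebesgue. \<forall>i k. A y $ i $ k = A y $ k $ i" by (simp add: AE_all_countable)
      hence "AE y in cellm. \<forall>i k. A y $ i $ k = A y $ k $ i" using cell_sets by (subst AE_restrict_space_iff) (auto elim: eventually_mono)
      thus "AE x in cellm. (\<Sum>i\<in>UNIV. flux A j (D j) i x * (axis k 1 $ i + D k i x)) = (\<Sum>i\<in>UNIV. flux A k (D k) i x * (axis j 1 $ i + D j i x))"
      proof eventually_elim
        case (elim x)
        have "(\<Sum>i\<in>UNIV. flux A j (D j) i x * (axis k 1 $ i + D k i x))
            = (\<Sum>i\<in>UNIV. \<Sum>l\<in>UNIV. A x $ i $ l * (axis j 1 $ l + D j l x) * (axis k 1 $ i + D k i x))"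
          by (simp add: flux_def sum_distrib_right)
        also have "\<dots> = (\<Sum>l\<in>UNIV. \<Sum>i\<in>UNIV. A x $ i $ l * (axis j 1 $ l + D j l x) * (axis k 1 $ i + D k i x))"
          by (rule sum.swap)
        also have "\<dots> = (\<Sum>l\<in>UNIV. \<Sum>i\<in>UNIV. A x $ l $ i * (axis k 1 $ i + D k i x) * (axis j 1 $ l + D j l x))"
        proof (intro sum.cong refl)
          fix l i
          have "A x $ i $ l = A x $ l $ i" using elim by blast
          thus "A x $ i $ l * (axis j 1 $ l + D j l x) * (axis k 1 $ i + D k i x) = A x $ l $ i * (axis k 1 $ i + D k i x) * (axis j 1 $ l + D j l x)" by simp
        qed
        also have "\<dots> = (\<Sum>i\<in>UNIV. flux A k (D k) i x * (axis j 1 $ i + D j i x))"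
          by (simp add: flux_def sum_distrib_right)
        finally show ?case .
      qed
    qed
    ultimately show ?thesis by simp
  qed
  let ?c = "measure lebesgue (cell :: (real^'d) set)"
  have c0: "?c > 0" by (rule cell_pos)
  \<comment> \<open>Integration by parts: what separates the energy from the mean of the flux is again symmetric in \<open>j\<close> and \<open>k\<close>.\<close>
  have Xe: "X n j k - ?c * mean (g n j k) = - \<rho>\<^sup>2 * (LINT x|cellm. laplace (laplace (\<psi> n j)) x * \<psi> n k x)" for n j k
  proof -
    have i1: "integrable cellm (%x. g n j i x * pd i (\<psi> n k) x)" for i by (intro cell_mult_integrable gL sL)
    have i2: "integrable cellm (%x. axis k 1 $ i * g n j i x)" for i
      by (intro integrable_mult_right smooth_per_sqint sp)
    have "(LINT x|cellm. g n j i x * (axis k 1 $ i + pd i (\<psi> n k) x)) = axis k 1 $ i * (LINT x|cellm. g n j i x) - (LINT x|cellm. pd i (g n j i) x * \<psi> n k x)" for i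
    proof -
      have "(LINT x|cellm. g n j i x * (axis k 1 $ i + pd i (\<psi> n k) x)) = (LINT x|cellm. axis k 1 $ i * g n j i x + g n j i x * pd i (\<psi> n k) x)"
        by (simp add: algebra_simps)
      also have "\<dots> = (LINT x|cellm. axis k 1 $ i * g n j i x) + (LINT x|cellm. g n j i x * pd i (\<psi> n k) x)"
        by (rule Bochner_Integration.integral_add[OF i2 i1])
      finally show ?thesis using cell_by_parts[OF sp(2) sp(1), of n j i i n k] by simp
    qed
    hence "X n j k = (\<Sum>i\<in>UNIV. axis k 1 $ i * (LINT x|cellm. g n j i x)) - (\<Sum>i\<in>UNIV. LINT x|cellm. pd i (g n j i) x * \<psi> n k x)"
      unfolding X_def by (simp add: sum_subtractf)
    also have "(\<Sum>i\<in>UNIV. axis k 1 $ i * (LINT x|cellm. g n j i x)) = ?c * mean (g n j k)"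
      using c0 by (simp add: axis_def mean_def if_distrib[of "%a. a * _"] cong: if_cong)
    also have "(\<Sum>i\<in>UNIV. LINT x|cellm. pd i (g n j i) x * \<psi> n k x) = (LINT x|cellm. (\<Sum>i\<in>UNIV. pd i (g n j i) x * \<psi> n k x))"
      by (intro Bochner_Integration.integral_sum[symmetric] cell_mult_integrable smooth_per_L2_per smooth_per_pd sp)
    also have "\<dots> = (LINT x|cellm. \<rho>\<^sup>2 * (laplace (laplace (\<psi> n j)) x * \<psi> n k x))"
      by (simp only: sum_distrib_right[symmetric] div laplace_laplace[OF sp(1), symmetric] mult.assoc)
    finally show ?thesis by simp
  qed
  have lapsym: "(LINT x|cellm. laplace u x * v x) = (LINT x|cellm. u x * laplace v x)" if "smooth_per u" "smooth_per v" for u v :: "real^'d => real"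
  proof -
    have "(LINT x|cellm. pd i (pd i u) x * v x) = (LINT x|cellm. u x * pd i (pd i v) x)" for i
      using cell_by_parts[OF smooth_per_pd[OF that(1)] that(2), of i i] cell_by_parts[OF that(1) smooth_per_pd[OF that(2)], of i i] by simp
    moreover have "(LINT x|cellm. laplace u x * v x) = (\<Sum>i\<in>UNIV. LINT x|cellm. pd i (pd i u) x * v x)"
      unfolding laplace_def sum_distrib_right
      by (intro Bochner_Integration.integral_sum cell_mult_integrable smooth_per_L2_per smooth_per_pd that)
    moreover have "(LINT x|cellm. u x * laplace v x) = (\<Sum>i\<in>UNIV. LINT x|cellm. u x * pd i (pd i v) x)"
      unfolding laplace_def sum_distrib_left
      by (intro Bochner_Integration.integral_sum cell_mult_integrable smooth_per_L2_per smooth_per_pd that)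
    ultimately show ?thesis by simp
  qed
  have Xd: "X n a b - ?c * mean (g n a b) = X n b a - ?c * mean (g n b a)" for n
    unfolding Xe using lapsym[OF laplace_smooth_per[OF sp(1)] sp(1), of n a n b] lapsym[OF sp(1) laplace_smooth_per[OF sp(1)], of n a n b]
    by (simp add: mult.commute)
  have mg: "(%n. mean (g n j i)) \<longlonglongrightarrow> corrected_mean A \<rho> $ i $ j" for i j
    using mean_tendsto[OF fL gL l2] corrector_props(5)[OF A \<rho>, of i j] by (simp add: D_def)
  have L1: "(%n. X n a b - ?c * mean (g n a b)) \<longlonglongrightarrow> Y a b - ?c * corrected_mean A \<rho> $ b $ a" by (intro tendsto_intros XY mg)
  have L2: "(%n. X n a b - ?c * mean (g n a b)) \<longlonglongrightarrow> Y b a - ?c * corrected_mean A \<rho> $ a $ b" unfolding Xd by (intro tendsto_intros XY mg)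
  have "Y a b - ?c * corrected_mean A \<rho> $ b $ a = Y b a - ?c * corrected_mean A \<rho> $ a $ b" by (rule LIMSEQ_unique[OF L1 L2])
  thus ?thesis using Ysym[of a b] c0 by simp
qed

section \<open>Oscillating test functions\<close>

definition sc :: "real => (real^'d => real) => real^'d => real" where
  "sc eps h x = h ((1 / eps) *\<^sub>R x)"

lemma sc_smooth: "smooth h ==> smooth (sc eps h)"
  using smooth_affine[of h 0 "1/eps"] by (simp add: sc_def[abs_def])

lemma sc_pd: "smooth h ==> pd i (sc eps h) = (%x. (1/eps) * sc eps (pd i h) x)"
  using smooth_pd_affine[of h i 0 "1/eps"] by (simp add: sc_def[abs_def])

lemma sc_pd2:
  assumes "smooth h" shows "pd i (pd i (sc eps h)) = (%x. (1/eps) * ((1/eps) * sc eps (pd i (pd i h)) x))"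
  unfolding sc_pd[OF assms] by (subst smooth_pd_scale[OF sc_smooth[OF smoothD(3)[OF assms]]]) (simp add: sc_pd[OF smoothD(3)[OF assms]])

lemma pd_product2:
  assumes a: "smooth a" and b: "smooth b"
  shows "pd i (pd i (%x. a x * b x)) = (%x. a x * pd i (pd i b) x + 2 * (pd i a x * pd i b x) + pd i (pd i a) x * b x)"
proof -
  have s: "smooth (%x. a x * pd i b x)" "smooth (%x. pd i a x * b x)" by (intro smooth_mult smoothD(3) a b)+
  show ?thesis
    unfolding smooth_pd_mult[OF a b] smooth_pd_add[OF s] smooth_pd_mult[OF a smoothD(3)[OF b]] smooth_pd_mult[OF smoothD(3)[OF a] b]
    by (auto simp: algebra_simps)
qed

text \<open>The constant depends on the test function only through its support and its maximum.\<close>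
lemma scaled_test_bound:
  fixes \<phi> :: "real^'d => real"
  assumes O: "\<Omega> \<in> sets lebesgue" and \<phi>: "\<phi> \<in> test_functions \<Omega>"
  obtains K :: real where "K >= 0" "!!g eps. g \<in> L2_per ==> 0 < eps ==> eps <= 1 ==>
     sqint (lebesgue_on \<Omega>) (%x. sc eps g x * \<phi> x) & nrm (lebesgue_on \<Omega>) (%x. sc eps g x * \<phi> x) <= K * nrm cellm g"
proof -
  obtain R where R: "R > 0" "!!x. norm x > R ==> \<phi> x = 0" by (rule test_support_ball[OF \<phi>]) blast
  obtain B where B: "B > 0" "!!x. \<bar>\<phi> x\<bar> <= B" by (rule test_bounded[OF \<phi>]) blast
  obtain C where C0: "C >= 0" and C: "!!(g::real^'d => real) eps. g \<in> borel_measurable lebesgue ==> periodic g ==> sqint (lebesgue_on cell) g ==> 0 < eps ==> eps <= 1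
      ==> sqint lebesgue (%x. indicator (cball 0 R) x * g ((1 / eps) *\<^sub>R x))
        & nrm lebesgue (%x. indicator (cball 0 R) x * g ((1 / eps) *\<^sub>R x)) <= C * nrm (lebesgue_on cell) g"
    by (rule periodic_scaled_bound[OF less_imp_le[OF R(1)], where 'd='d]) blast
  show thesis
  proof (rule that[of "B * C"])
    show "B * C >= 0" using B(1) C0 by simp
    fix g :: "real^'d => real" and eps :: real assume g: "g \<in> L2_per" and e: "0 < eps" "eps <= 1"
    let ?h = "%x. indicator (cball 0 R) x * g ((1 / eps) *\<^sub>R x)"
    have h: "sqint lebesgue ?h" "nrm lebesgue ?h <= C * nrm cellm g" using C[OF L2_perD[OF g] e] by auto
    have eq: "sc eps g x * \<phi> x = \<phi> x * ?h x" for x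
      using R(2)[of x] by (cases "norm x > R") (auto simp: sc_def)
    have sq: "sqint lebesgue (%x. sc eps g x * \<phi> x)"
      unfolding eq by (rule sqint_bounded_mult[OF h(1) smooth_measurable[OF test_smooth[OF \<phi>]], of B]) (use B(2) in auto)
    have "nrm lebesgue (%x. sc eps g x * \<phi> x) <= nrm lebesgue (%x. B * ?h x)"
    proof (rule nrm_mono)
      show "sqint lebesgue (%x. B * ?h x)" by (rule sqint_scale[OF h(1)])
      show "(%x. sc eps g x * \<phi> x) \<in> borel_measurable lebesgue" by (rule sqintD(1)[OF sq])
      have "\<bar>\<phi> x * ?h x\<bar> <= \<bar>B * ?h x\<bar>" for x
        unfolding abs_mult[of "\<phi> x"] abs_mult[of B] using B by (intro mult_right_mono) auto
      thus "AE x in lebesgue. \<bar>sc eps g x * \<phi> x\<bar> <= \<bar>B * ?h x\<bar>" unfolding eq by (intro always_eventually allI)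
    qed
    also have "\<dots> = B * nrm lebesgue ?h" using B(1) by (simp add: nrm_scale)
    also have "\<dots> <= B * (C * nrm cellm g)" using h(2) B(1) by (intro mult_left_mono) auto
    finally have n: "nrm lebesgue (%x. sc eps g x * \<phi> x) <= B * C * nrm cellm g" by simp
    have "(LINT x|lebesgue_on \<Omega>. (sc eps g x * \<phi> x)\<^sup>2) = (LINT x|lebesgue. (sc eps g x * \<phi> x)\<^sup>2)"
      by (rule integral_on_eq[OF O]) (simp add: test_outside[OF \<phi>])
    hence "nrm (lebesgue_on \<Omega>) (%x. sc eps g x * \<phi> x) = nrm lebesgue (%x. sc eps g x * \<phi> x)" by (simp add: nrm_def)
    thus "sqint (lebesgue_on \<Omega>) (%x. sc eps g x * \<phi> x) & nrm (lebesgue_on \<Omega>) (%x. sc eps g x * \<phi> x) <= B * C * nrm cellm g"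
      using n sqint_restrictI[OF O sq] by simp
  qed
qed

text \<open>Bounded for all sufficiently small \<open>\<epsilon> > 0\<close>. Terms of the expansions that are multiplied by a vanishing
  factor need no more than this.\<close>
definition ebdd :: "(real => real) => bool" where
  "ebdd X \<longleftrightarrow> (\<exists>K. \<forall>\<^sub>F eps in at_right 0. \<bar>X eps\<bar> <= K)"

lemma ebdd_zero:
  assumes "ebdd X" "(c \<longlongrightarrow> 0) (at_right 0)" shows "((%eps. c eps * X eps) \<longlongrightarrow> 0) (at_right (0::real))"
proof -
  obtain K where K: "\<forall>\<^sub>F eps in at_right 0. \<bar>X eps\<bar> <= K" using assms(1) by (auto simp: ebdd_def)
  have z: "((%eps. \<bar>c eps\<bar> * K) \<longlongrightarrow> 0) (at_right 0)"
    by (rule tendsto_mult_left_zero) (rule tendsto_rabs_zero[OF assms(2)])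
  show ?thesis
    by (rule Lim_null_comparison[OF _ z]) (use K in eventually_elim, simp add: abs_mult mult_left_mono)
qed

lemma ebdd_add: "ebdd X ==> ebdd Y ==> ebdd (%eps. X eps + Y eps)"
proof -
  assume "ebdd X" "ebdd Y"
  then obtain K L where K: "\<forall>\<^sub>F eps in at_right 0. \<bar>X eps\<bar> <= K" and L: "\<forall>\<^sub>F eps in at_right 0. \<bar>Y eps\<bar> <= L" by (auto simp: ebdd_def)
  have "\<forall>\<^sub>F eps in at_right 0. \<bar>X eps + Y eps\<bar> <= K + L" using K L by eventually_elim linarith
  thus ?thesis by (auto simp: ebdd_def)
qed

lemma ebdd_const: "ebdd (%eps. c)" unfolding ebdd_def by (intro exI[of _ "\<bar>c\<bar>"]) simp

lemma ebdd_sum: "finite S ==> (!!i. i \<in> S ==> ebdd (X i)) ==> ebdd (%eps. \<Sum>i\<in>S. X i eps)"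
proof (induction S rule: finite_induct)
  case empty show ?case by (simp add: ebdd_const)
next
  case (insert i S)
  have "ebdd (%eps. X i eps + (\<Sum>i\<in>S. X i eps))" by (rule ebdd_add) (use insert in blast)+
  thus ?case using insert by simp
qed

text \<open>The decomposition may depend on \<open>e\<close>: it is obtained by approximating the cell functions up to an
  error of size \<open>e\<close>, which fixes the smooth functions before the limit is taken.\<close>
lemma tendsto_zero_approx:
  fixes X :: "real => real"
  assumes "!!e. e > 0 ==> \<exists>Y Z. (\<forall>\<^sub>F eps in at_right 0. X eps = Y eps + Z eps) & (Y \<longlongrightarrow> 0) (at_right 0) & (\<forall>\<^sub>F eps in at_right 0. \<bar>Z eps\<bar> <= e)"
  shows "(X \<longlongrightarrow> 0) (at_right 0)"
proof (rule tendstoI)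
  fix e :: real assume e: "e > 0"
  then obtain Y Z where Y: "\<forall>\<^sub>F eps in at_right 0. X eps = Y eps + Z eps" "(Y \<longlongrightarrow> 0) (at_right 0)" "\<forall>\<^sub>F eps in at_right 0. \<bar>Z eps\<bar> <= e/2"
    using assms[of "e/2"] by auto
  have "\<forall>\<^sub>F eps in at_right 0. dist (Y eps) 0 < e/2" by (rule tendstoD[OF Y(2)]) (use e in simp)
  with Y(1,3) show "\<forall>\<^sub>F eps in at_right 0. dist (X eps) 0 < e"
    by eventually_elim (simp add: dist_real_def)
qed

lemma at_right_01: "\<forall>\<^sub>F eps in at_right (0::real). 0 < eps & eps <= 1"
  unfolding eventually_at_right_field by (intro exI[of _ 1]) auto

text \<open>The hypotheses of the theorem, expressed by integrals: \<open>DU\<close> and \<open>LU\<close> stand for gradient and Laplacian of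
  the solutions \<open>U\<close>, and \<open>D0\<close> for the gradient of the limit \<open>u0\<close>. Of the weak convergence only that of \<open>U\<close> itself
  against test functions is retained; what converges in the gradients is recovered by integration by
  parts.\<close>
locale oscillating_family =
  fixes \<Omega> :: "(real^'d) set" and A :: "real^'d => real^'d^'d" and f :: "real^'d => real" and \<kappa> :: "real => real"
    and U :: "real => real^'d => real" and DU :: "real => 'd => real^'d => real" and LU :: "real => real^'d => real"
    and u0 :: "real^'d => real" and D0 :: "'d => real^'d => real" and C :: real
  assumes O: "open \<Omega>" and A: "periodic_elliptic A" and fsq: "sqint (lebesgue_on \<Omega>) f"
    and kpos: "!!eps. eps > 0 ==> \<kappa> eps > 0" and k0: "(\<kappa> \<longlongrightarrow> 0) (at_right 0)"
    and Usq: "!!eps. eps > 0 ==> sqint (lebesgue_on \<Omega>) (U eps)"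
    and DUsq: "!!eps i. eps > 0 ==> sqint (lebesgue_on \<Omega>) (DU eps i)"
    and LUsq: "!!eps. eps > 0 ==> sqint (lebesgue_on \<Omega>) (LU eps)"
    and wp: "!!eps t i. eps > 0 ==> t \<in> test_functions \<Omega> ==> L2_ip (lebesgue_on \<Omega>) (U eps) (pd i t) = - L2_ip (lebesgue_on \<Omega>) (DU eps i) t"
    and wl: "!!eps t. eps > 0 ==> t \<in> test_functions \<Omega> ==> (\<Sum>i\<in>UNIV. L2_ip (lebesgue_on \<Omega>) (DU eps i) (pd i t)) = - L2_ip (lebesgue_on \<Omega>) (LU eps) t"
    and eqn: "!!eps t. eps > 0 ==> t \<in> test_functions \<Omega> ==>
        (\<kappa> eps)\<^sup>2 * (\<Sum>i\<in>UNIV. L2_ip (lebesgue_on \<Omega>) (LU eps) (pd i (pd i t)))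
        + (\<Sum>i\<in>UNIV. L2_ip (lebesgue_on \<Omega>) (%x. \<Sum>k\<in>UNIV. A ((1/eps) *\<^sub>R x) $ i $ k * DU eps k x) (pd i t)) = L2_ip (lebesgue_on \<Omega>) f t"
    and bU: "\<forall>\<^sub>F eps in at_right 0. nrm (lebesgue_on \<Omega>) (U eps) <= C"
    and bDU: "!!i. \<forall>\<^sub>F eps in at_right 0. nrm (lebesgue_on \<Omega>) (DU eps i) <= C"
    and bLU: "\<forall>\<^sub>F eps in at_right 0. nrm (lebesgue_on \<Omega>) (%x. \<kappa> eps * LU eps x) <= C"
    and limU: "!!t. t \<in> test_functions \<Omega> ==> ((%eps. L2_ip (lebesgue_on \<Omega>) (U eps) t) \<longlongrightarrow> L2_ip (lebesgue_on \<Omega>) u0 t) (at_right 0)"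
    and w0: "!!t i. t \<in> test_functions \<Omega> ==> L2_ip (lebesgue_on \<Omega>) u0 (pd i t) = - L2_ip (lebesgue_on \<Omega>) (D0 i) t"
begin

abbreviation "M \<equiv> lebesgue_on \<Omega>"
abbreviation "I \<equiv> L2_ip M"

definition AU :: "real => 'd => real^'d => real" where
  "AU eps i x = (\<Sum>k\<in>UNIV. A ((1/eps) *\<^sub>R x) $ i $ k * DU eps k x)"

lemma Os: "\<Omega> \<in> sets lebesgue" using O by simp

lemma test_sq: "t \<in> test_functions \<Omega> ==> sqint M t"
  by (rule test_sqint_on[OF _ Os])

lemma I_add: "sqint M v ==> sqint M a ==> sqint M b ==> I v (%x. a x + b x) = I v a + I v b"
  using L2.B_lin_right[of a M b v 1] by simp
lemma I_scale: "sqint M v ==> sqint M a ==> I v (%x. c * a x) = c * I v a"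
  using L2.B_lin_right[of "%x. 0" M a v c] by (simp add: sqint_0 L2_ip_def)
lemma I_diff: "sqint M v ==> sqint M a ==> sqint M b ==> I v (%x. a x - b x) = I v a - I v b"
  using L2.B_lin_right[of a M b v "-1"] by simp
lemma I_sum: "sqint M v ==> (!!i. sqint M (a i)) ==> I v (%x. \<Sum>i\<in>UNIV. a i x) = (\<Sum>i\<in>(UNIV::'e::finite set). I v (a i))"
  unfolding L2_ip_def sum_distrib_left
  by (intro Bochner_Integration.integral_sum sqint_mult)
lemma I_scale_left: "I (%x. c * v x) a = c * I v a"
  by (simp add: L2_ip_def mult.assoc)

lemma I_CS: "sqint M v ==> sqint M a ==> \<bar>I v a\<bar> <= nrm M v * nrm M a"
  unfolding L2_ip_def by (rule L2_Cauchy_Schwarz)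

lemma sc_test: "smooth h ==> t \<in> test_functions \<Omega> ==> (%x. sc eps h x * t x) \<in> test_functions \<Omega>"
  by (rule test_smooth_mult[OF sc_smooth])

lemma I_sc_bound:
  assumes v: "sqint M v" and g: "smooth g" "!!y. \<bar>g y\<bar> <= B" and t: "t \<in> test_functions \<Omega>"
  shows "\<bar>I v (%x. sc eps g x * t x)\<bar> <= nrm M v * (B * nrm M t)"
proof -
  have st: "sqint M (%x. sc eps g x * t x)" by (rule test_sq[OF sc_test[OF g(1) t]])
  have B0: "B >= 0" using g(2)[of 0] by simp
  have "nrm M (%x. sc eps g x * t x) <= nrm M (%x. B * t x)"
  proof (rule nrm_mono)
    show "sqint M (%x. B * t x)" by (rule sqint_scale[OF test_sq[OF t]])
    show "(%x. sc eps g x * t x) \<in> borel_measurable M" by (rule sqintD(1)[OF st])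
    have "\<bar>sc eps g x * t x\<bar> <= \<bar>B * t x\<bar>" for x
      unfolding abs_mult using g(2)[of "(1/eps) *\<^sub>R x"] B0 by (intro mult_right_mono) (auto simp: sc_def)
    thus "AE x in M. \<bar>sc eps g x * t x\<bar> <= \<bar>B * t x\<bar>" by (intro always_eventually allI)
  qed
  hence "nrm M (%x. sc eps g x * t x) <= B * nrm M t" using B0 by (simp add: nrm_scale)
  hence "nrm M v * nrm M (%x. sc eps g x * t x) <= nrm M v * (B * nrm M t)" by (rule mult_left_mono[OF _ nrm_nonneg])
  thus ?thesis using I_CS[OF v st] by linarith
qed

lemma ebdd_I:
  assumes v: "!!eps. eps > 0 ==> sqint M (v eps)" and b: "\<forall>\<^sub>F eps in at_right 0. nrm M (v eps) <= L"
    and g: "smooth_per g" and t: "t \<in> test_functions \<Omega>"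
  shows "ebdd (%eps. I (v eps) (%x. sc eps g x * t x))"
proof -
  obtain B where B: "B > 0" "!!y. \<bar>g y\<bar> <= B" by (rule smooth_per_bounded[OF g]) blast
  have "\<forall>\<^sub>F eps in at_right 0. \<bar>I (v eps) (%x. sc eps g x * t x)\<bar> <= L * (B * nrm M t)"
    using b at_right_01
  proof eventually_elim
    case (elim eps)
    have "\<bar>I (v eps) (%x. sc eps g x * t x)\<bar> <= nrm M (v eps) * (B * nrm M t)"
      by (rule I_sc_bound[OF v smooth_perD(1)[OF g] B(2) t]) (use elim in simp)
    also have "\<dots> <= L * (B * nrm M t)" using elim B(1) nrm_nonneg[of M t] by (intro mult_right_mono) auto
    finally show ?case .
  qed
  thus ?thesis by (auto simp: ebdd_def)
qed

text \<open>The derivative is moved from \<open>U\<close> to the product of \<open>g\<^sub>i(x/\<epsilon>)\<close> and \<open>t\<close>. The dangerous term carries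
  \<open>1/\<epsilon>\<close> times the divergence \<open>(\<Delta>h)(x/\<epsilon>)\<close>. Since \<open>(\<Delta>h)(x/\<epsilon>) = \<epsilon>\<^sup>2 \<Delta>(h(x/\<epsilon>))\<close>, two further integrations
  by parts turn it into terms with a factor \<open>\<epsilon>\<close>, one of which contains the Laplacian of \<open>U\<close> and is not
  negligible, because that Laplacian is only bounded after multiplication by \<open>\<kappa>\<close>.\<close>
lemma DU_identity:
  assumes e: "eps > 0" and g: "!!i. smooth (g i)" and h: "smooth h" and div: "!!x. (\<Sum>i\<in>UNIV. pd i (g i) x) = laplace h x"
    and t: "t \<in> test_functions \<Omega>"
  shows "(\<Sum>i\<in>UNIV. I (DU eps i) (%x. sc eps (g i) x * t x)) =
    - (\<Sum>i\<in>UNIV. I (U eps) (%x. sc eps (g i) x * pd i t x))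
    - eps * (I (LU eps) (%x. sc eps h x * t x) + 2 * (\<Sum>i\<in>UNIV. I (DU eps i) (%x. sc eps h x * pd i t x))
       + (\<Sum>i\<in>UNIV. I (U eps) (%x. sc eps h x * pd i (pd i t) x)))"
proof -
  note st = test_smooth[OF t]
  note Uq = Usq[OF e]
  let ?H = "sc eps h"
  have sH: "smooth ?H" by (rule sc_smooth[OF h])
  have q: "sqint M (%x. sc eps k x * s x)" if "smooth k" "s \<in> test_functions \<Omega>" for k s
    by (rule test_sq[OF sc_test[OF that]])
  have step1: "I (DU eps i) (%x. sc eps (g i) x * t x) = - I (U eps) (%x. sc eps (g i) x * pd i t x) - (1/eps) * I (U eps) (%x. sc eps (pd i (g i)) x * t x)" for i
  proof -
    have "I (DU eps i) (%x. sc eps (g i) x * t x) = - I (U eps) (pd i (%x. sc eps (g i) x * t x))"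
      by (simp add: wp[OF e sc_test[OF g t]])
    also have "pd i (%x. sc eps (g i) x * t x) = (%x. sc eps (g i) x * pd i t x + (1/eps) * (sc eps (pd i (g i)) x * t x))"
      unfolding smooth_pd_mult[OF sc_smooth[OF g] st] sc_pd[OF g] by (simp add: mult.assoc)
    also have "I (U eps) \<dots> = I (U eps) (%x. sc eps (g i) x * pd i t x) + I (U eps) (%x. (1/eps) * (sc eps (pd i (g i)) x * t x))"
      by (rule I_add[OF Uq q[OF g test_pd[OF t]] sqint_scale[OF q[OF smoothD(3)[OF g] t]]])
    also have "I (U eps) (%x. (1/eps) * (sc eps (pd i (g i)) x * t x)) = (1/eps) * I (U eps) (%x. sc eps (pd i (g i)) x * t x)"
      by (rule I_scale[OF Uq q[OF smoothD(3)[OF g] t]])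
    finally show ?thesis by simp
  qed
  have hess: "I (U eps) (%x. pd i (pd i ?H) x * t x) = - I (DU eps i) (pd i (%x. ?H x * t x)) + 2 * I (DU eps i) (%x. ?H x * pd i t x) + I (U eps) (%x. ?H x * pd i (pd i t) x)" for i
  proof -
    have tH: "(%x. ?H x * t x) \<in> test_functions \<Omega>" by (rule sc_test[OF h t])
    have tr: "(%x. ?H x * pd i t x) \<in> test_functions \<Omega>" by (rule sc_test[OF h test_pd[OF t]])
    have pw: "pd i (pd i ?H) x * t x = pd i (pd i (%x. ?H x * t x)) x + (- 2) * pd i (%x. ?H x * pd i t x) x + ?H x * pd i (pd i t) x" for x
      unfolding pd_product2[OF sH st] smooth_pd_mult[OF sH smoothD(3)[OF st]] by (simp add: algebra_simps)
    have q1: "sqint M (pd i (pd i (%x. ?H x * t x)))" by (intro test_sq test_pd tH)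
    have q2: "sqint M (%x. (- 2) * pd i (%x. ?H x * pd i t x) x)" by (intro sqint_scale test_sq test_pd tr)
    have "I (U eps) (%x. pd i (pd i ?H) x * t x) = I (U eps) (%x. (pd i (pd i (%x. ?H x * t x)) x + (- 2) * pd i (%x. ?H x * pd i t x) x) + ?H x * pd i (pd i t) x)"
      by (simp only: pw)
    also have "\<dots> = I (U eps) (%x. pd i (pd i (%x. ?H x * t x)) x + (- 2) * pd i (%x. ?H x * pd i t x) x) + I (U eps) (%x. ?H x * pd i (pd i t) x)"
      by (rule I_add[OF Uq sqint_add[OF q1 q2] q[OF h test_pd[OF test_pd[OF t]]]])
    also have "I (U eps) (%x. pd i (pd i (%x. ?H x * t x)) x + (- 2) * pd i (%x. ?H x * pd i t x) x) = I (U eps) (pd i (pd i (%x. ?H x * t x))) + I (U eps) (%x. (- 2) * pd i (%x. ?H x * pd i t x) x)"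
      by (rule I_add[OF Uq q1 q2])
    also have "I (U eps) (%x. (- 2) * pd i (%x. ?H x * pd i t x) x) = (- 2) * I (U eps) (pd i (%x. ?H x * pd i t x))"
      by (rule I_scale[OF Uq test_sq[OF test_pd[OF tr]]])
    finally show ?thesis by (simp add: wp[OF e test_pd[OF tH]] wp[OF e tr])
  qed
  have step2: "(1/eps) * I (U eps) (%x. sc eps (laplace h) x * t x) = eps * (\<Sum>i\<in>UNIV. I (U eps) (%x. pd i (pd i ?H) x * t x))"
  proof -
    have "I (U eps) (%x. pd i (pd i ?H) x * t x) = (1/eps) * ((1/eps) * I (U eps) (%x. sc eps (pd i (pd i h)) x * t x))" for i
    proof -
      have E: "(%x. pd i (pd i ?H) x * t x) = (%x. (1/eps * (1/eps)) * (sc eps (pd i (pd i h)) x * t x))" unfolding sc_pd2[OF h] by (simp add: mult.assoc)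
      show ?thesis unfolding E I_scale[OF Uq q[OF smoothD(3)[OF smoothD(3)[OF h]] t]] by (simp only: mult.assoc)
    qed
    moreover have "I (U eps) (%x. sc eps (laplace h) x * t x) = (\<Sum>i\<in>UNIV. I (U eps) (%x. sc eps (pd i (pd i h)) x * t x))"
    proof -
      have E: "(%x. sc eps (laplace h) x * t x) = (%x. \<Sum>i\<in>UNIV. sc eps (pd i (pd i h)) x * t x)" by (simp add: sc_def laplace_def sum_distrib_right)
      show ?thesis unfolding E by (rule I_sum[OF Uq q[OF smoothD(3)[OF smoothD(3)[OF h]] t]])
    qed
    ultimately show ?thesis using e by (simp add: sum_distrib_left)
  qed
  have sumg: "(\<Sum>i\<in>UNIV. I (U eps) (%x. sc eps (pd i (g i)) x * t x)) = I (U eps) (%x. sc eps (laplace h) x * t x)"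
  proof -
    have E: "(%x. sc eps (laplace h) x * t x) = (%x. \<Sum>i\<in>UNIV. sc eps (pd i (g i)) x * t x)" by (simp add: sc_def div[symmetric] sum_distrib_right)
    show ?thesis unfolding E by (rule I_sum[OF Uq q[OF smoothD(3)[OF g] t], symmetric])
  qed
  have "(\<Sum>i\<in>UNIV. I (DU eps i) (%x. sc eps (g i) x * t x)) = - (\<Sum>i\<in>UNIV. I (U eps) (%x. sc eps (g i) x * pd i t x)) - (1/eps) * I (U eps) (%x. sc eps (laplace h) x * t x)"
    unfolding step1 sumg[symmetric] by (simp add: sum_subtractf sum_negf sum_distrib_left)
  also have "(1/eps) * I (U eps) (%x. sc eps (laplace h) x * t x) = eps * (I (LU eps) (%x. ?H x * t x) + 2 * (\<Sum>i\<in>UNIV. I (DU eps i) (%x. ?H x * pd i t x))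
       + (\<Sum>i\<in>UNIV. I (U eps) (%x. ?H x * pd i (pd i t) x)))"
    unfolding step2 hess using wl[OF e sc_test[OF h t], of eps] by (simp add: sum.distrib sum_subtractf sum_distrib_left)
  finally show ?thesis .
qed

lemma AU_sq:
  assumes e: "eps > 0"
  shows "sqint M (AU eps i)"
proof -
  obtain B where B: "B > 0" "!!j k. (%y. A y $ j $ k) \<in> borel_measurable lebesgue"
    "!!j k. AE y in lebesgue. \<bar>A y $ j $ k\<bar> <= B" by (rule periodic_ellipticE[OF A]) blast
  have ee: "1/eps ~= 0" using e by simp
  have "sqint M (%x. A ((1/eps) *\<^sub>R x) $ i $ k * DU eps k x)" for k
  proof (rule sqint_bounded_mult[OF DUsq[OF e], of _ B])
    show "(%x. A ((1/eps) *\<^sub>R x) $ i $ k) \<in> borel_measurable M"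
      using measurable_restrict_space1[OF measurable_lebesgue_affine[OF B(2)[of i k] ee, of 0]] by simp
    show "AE x in M. \<bar>A ((1/eps) *\<^sub>R x) $ i $ k\<bar> <= B"
      using AE_lebesgue_affine[OF B(3)[of i k] ee, of 0] Os by (subst AE_restrict_space_iff) (auto elim: eventually_mono)
  qed
  thus ?thesis unfolding AU_def[abs_def] by (intro sqint_sum) auto
qed

lemma AU_bound: obtains L where "!!i. \<forall>\<^sub>F eps in at_right 0. nrm M (AU eps i) <= L"
proof -
  obtain B where B: "B > 0" "!!j k. (%y. A y $ j $ k) \<in> borel_measurable lebesgue"
    "!!j k. AE y in lebesgue. \<bar>A y $ j $ k\<bar> <= B" by (rule periodic_ellipticE[OF A]) blast
  have b: "nrm M (AU eps i) <= (\<Sum>k\<in>UNIV. B * nrm M (DU eps k))" if e: "eps > 0" for eps i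
  proof -
    have ee: "1/eps ~= 0" using e by simp
    have am: "(%x. A ((1/eps) *\<^sub>R x) $ i $ k) \<in> borel_measurable M" for k
      using measurable_restrict_space1[OF measurable_lebesgue_affine[OF B(2)[of i k] ee, of 0]] by simp
    have ab: "AE x in M. \<bar>A ((1/eps) *\<^sub>R x) $ i $ k\<bar> <= B" for k
      using AE_lebesgue_affine[OF B(3)[of i k] ee, of 0] Os by (subst AE_restrict_space_iff) (auto elim: eventually_mono)
    have sq: "sqint M (%x. A ((1/eps) *\<^sub>R x) $ i $ k * DU eps k x)" for k
      by (rule sqint_bounded_mult[OF DUsq[OF e] am ab])
    have "nrm M (AU eps i) <= (\<Sum>k\<in>UNIV. nrm M (%x. A ((1/eps) *\<^sub>R x) $ i $ k * DU eps k x))"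
      unfolding AU_def[abs_def] by (rule nrm_sum) (simp_all add: sq)
    also have "\<dots> <= (\<Sum>k\<in>UNIV. B * nrm M (DU eps k))"
    proof (rule sum_mono)
      fix k
      have "nrm M (%x. A ((1/eps) *\<^sub>R x) $ i $ k * DU eps k x) <= nrm M (%x. B * DU eps k x)"
      proof (rule nrm_mono[OF sqint_scale[OF DUsq[OF e]] sqintD(1)[OF sq]])
        show "AE x in M. \<bar>A ((1/eps) *\<^sub>R x) $ i $ k * DU eps k x\<bar> <= \<bar>B * DU eps k x\<bar>"
          using ab[of k] by eventually_elim (use B(1) in \<open>auto simp: abs_mult intro!: mult_right_mono\<close>)
      qed
      thus "nrm M (%x. A ((1/eps) *\<^sub>R x) $ i $ k * DU eps k x) <= B * nrm M (DU eps k)" using B(1) by (simp add: nrm_scale)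
    qed
    finally show ?thesis .
  qed
  have all: "\<forall>\<^sub>F eps in at_right 0. \<forall>k. nrm M (DU eps k) <= C" by (intro eventually_all_finite bDU)
  show thesis
  proof (rule that[of "\<Sum>k\<in>(UNIV::'d set). B * C"])
    fix i
    show "\<forall>\<^sub>F eps in at_right 0. nrm M (AU eps i) <= (\<Sum>k\<in>(UNIV::'d set). B * C)"
      using all at_right_01
    proof eventually_elim
      case (elim eps)
      have "nrm M (AU eps i) <= (\<Sum>k\<in>UNIV. B * nrm M (DU eps k))" by (rule b) (use elim in simp)
      also have "\<dots> <= (\<Sum>k\<in>(UNIV::'d set). B * C)" using elim B(1) by (intro sum_mono mult_left_mono) auto
      finally show ?case .
    qed
  qed
qed

text \<open>The equation tested with \<open>\<epsilon> \<psi>(x/\<epsilon>) t\<close>, with all derivatives of the product expanded.\<close>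
lemma AU_identity:
  assumes e: "eps > 0" and p: "smooth \<psi>" and t: "t \<in> test_functions \<Omega>"
  shows "(\<Sum>i\<in>UNIV. I (AU eps i) (%x. sc eps (pd i \<psi>) x * t x)) =
    eps * I f (%x. sc eps \<psi> x * t x) - eps * (\<Sum>i\<in>UNIV. I (AU eps i) (%x. sc eps \<psi> x * pd i t x))
    - ((\<kappa> eps)\<^sup>2 / eps) * I (LU eps) (%x. sc eps (laplace \<psi>) x * t x)
    - 2 * (\<kappa> eps)\<^sup>2 * (\<Sum>i\<in>UNIV. I (LU eps) (%x. sc eps (pd i \<psi>) x * pd i t x))
    - (\<kappa> eps)\<^sup>2 * eps * (\<Sum>i\<in>UNIV. I (LU eps) (%x. sc eps \<psi> x * pd i (pd i t) x))"
proof -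
  note st = test_smooth[OF t]
  note Lq = LUsq[OF e]
  let ?P = "sc eps \<psi>"
  have sP: "smooth ?P" by (rule sc_smooth[OF p])
  have q: "sqint M (%x. sc eps k x * s x)" if "smooth k" "s \<in> test_functions \<Omega>" for k s
    by (rule test_sq[OF sc_test[OF that]])
  have p1: "I (AU eps i) (pd i (%x. ?P x * t x)) = I (AU eps i) (%x. ?P x * pd i t x) + (1/eps) * I (AU eps i) (%x. sc eps (pd i \<psi>) x * t x)" for i
  proof -
    have "pd i (%x. ?P x * t x) = (%x. ?P x * pd i t x + (1/eps) * (sc eps (pd i \<psi>) x * t x))"
      unfolding smooth_pd_mult[OF sP st] sc_pd[OF p] by (simp add: mult.assoc)
    hence "I (AU eps i) (pd i (%x. ?P x * t x)) = I (AU eps i) (%x. ?P x * pd i t x) + I (AU eps i) (%x. (1/eps) * (sc eps (pd i \<psi>) x * t x))"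
      by (simp only: I_add[OF AU_sq[OF e] q[OF p test_pd[OF t]] sqint_scale[OF q[OF smoothD(3)[OF p] t]]])
    thus ?thesis by (simp only: I_scale[OF AU_sq[OF e] q[OF smoothD(3)[OF p] t]])
  qed
  have p2: "I (LU eps) (pd i (pd i (%x. ?P x * t x))) = I (LU eps) (%x. ?P x * pd i (pd i t) x) + (2/eps) * I (LU eps) (%x. sc eps (pd i \<psi>) x * pd i t x)
      + (1/eps * (1/eps)) * I (LU eps) (%x. sc eps (pd i (pd i \<psi>)) x * t x)" for i
  proof -
    have eq: "pd i (pd i (%x. ?P x * t x)) = (%x. (?P x * pd i (pd i t) x + (2/eps) * (sc eps (pd i \<psi>) x * pd i t x)) + (1/eps * (1/eps)) * (sc eps (pd i (pd i \<psi>)) x * t x))"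
      unfolding pd_product2[OF sP st] sc_pd2[OF p] by (simp add: sc_pd[OF p] mult.assoc)
    have q1: "sqint M (%x. ?P x * pd i (pd i t) x)" by (rule q[OF p test_pd[OF test_pd[OF t]]])
    have q2: "sqint M (%x. sc eps (pd i \<psi>) x * pd i t x)" by (rule q[OF smoothD(3)[OF p] test_pd[OF t]])
    have q3: "sqint M (%x. sc eps (pd i (pd i \<psi>)) x * t x)" by (rule q[OF smoothD(3)[OF smoothD(3)[OF p]] t])
    show ?thesis unfolding eq
      by (simp only: I_add[OF Lq sqint_add[OF q1 sqint_scale[OF q2]] sqint_scale[OF q3]]
        I_add[OF Lq q1 sqint_scale[OF q2]] I_scale[OF Lq q2] I_scale[OF Lq q3])
  qed
  have lap: "(\<Sum>i\<in>UNIV. I (LU eps) (%x. sc eps (pd i (pd i \<psi>)) x * t x)) = I (LU eps) (%x. sc eps (laplace \<psi>) x * t x)"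
  proof -
    have E: "(%x. sc eps (laplace \<psi>) x * t x) = (%x. \<Sum>i\<in>UNIV. sc eps (pd i (pd i \<psi>)) x * t x)" by (simp add: sc_def laplace_def sum_distrib_right)
    show ?thesis unfolding E by (rule I_sum[OF Lq q[OF smoothD(3)[OF smoothD(3)[OF p]] t], symmetric])
  qed
  define a where "a = (\<Sum>i\<in>UNIV. I (AU eps i) (%x. sc eps (pd i \<psi>) x * t x))"
  define b where "b = (\<Sum>i\<in>UNIV. I (AU eps i) (%x. ?P x * pd i t x))"
  define c where "c = (\<Sum>i\<in>UNIV. I (LU eps) (%x. ?P x * pd i (pd i t) x))"
  define d where "d = (\<Sum>i\<in>UNIV. I (LU eps) (%x. sc eps (pd i \<psi>) x * pd i t x))"
  define l where "l = I (LU eps) (%x. sc eps (laplace \<psi>) x * t x)"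
  have s1: "(\<Sum>i\<in>UNIV. I (LU eps) (pd i (pd i (%x. ?P x * t x)))) = c + (2/eps) * d + (1/eps * (1/eps)) * l"
    unfolding p2 c_def d_def l_def lap[symmetric] by (simp only: sum.distrib sum_distrib_left)
  have s2: "(\<Sum>i\<in>UNIV. I (AU eps i) (pd i (%x. ?P x * t x))) = b + (1/eps) * a"
    unfolding p1 a_def b_def by (simp only: sum.distrib sum_distrib_left)
  have "(\<kappa> eps)\<^sup>2 * (c + (2/eps) * d + (1/eps * (1/eps)) * l) + (b + (1/eps) * a) = I f (%x. ?P x * t x)"
    using eqn[OF e sc_test[OF p t], of eps] s1 s2 unfolding AU_def[abs_def] by simp
  hence "eps * ((\<kappa> eps)\<^sup>2 * (c + (2/eps) * d + (1/eps * (1/eps)) * l) + (b + (1/eps) * a)) = eps * I f (%x. ?P x * t x)" by simp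
  moreover have "eps * ((\<kappa> eps)\<^sup>2 * (c + (2/eps) * d + (1/eps * (1/eps)) * l) + (b + (1/eps) * a))
      = (\<kappa> eps)\<^sup>2 * eps * c + 2 * (\<kappa> eps)\<^sup>2 * d + ((\<kappa> eps)\<^sup>2 / eps) * l + eps * b + a"
    using e by (simp add: field_simps power2_eq_square)
  ultimately have "a = eps * I f (%x. ?P x * t x) - eps * b - ((\<kappa> eps)\<^sup>2 / eps) * l - 2 * (\<kappa> eps)\<^sup>2 * d - (\<kappa> eps)\<^sup>2 * eps * c"by linarith
  thus ?thesis unfolding a_def b_def c_def d_def l_def .
qed

text \<open>A divergence of smooth periodic functions, evaluated at \<open>x/\<epsilon>\<close>, is \<open>\<epsilon>\<close> times a derivative in \<open>x\<close>, which is moved to \<open>U\<close> and \<open>t\<close>.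
  By \<open>antidivergence\<close> such functions approximate every \<open>g - mean g\<close>.\<close>
lemma oscillation_mean:
  assumes g: "smooth_per g" and t: "t \<in> test_functions \<Omega>"
  shows "((%eps. I (U eps) (%x. sc eps g x * t x)) \<longlongrightarrow> mean g * I u0 t) (at_right 0)"
proof -
  let ?m = "mean g"
  define \<gamma> where "\<gamma> y = g y + (- ?m) * 1" for y
  have gL: "g \<in> L2_per" by (rule smooth_per_L2_per[OF g])
  have \<gamma>p: "smooth_per \<gamma>" unfolding \<gamma>_def by (rule smooth_per_lin[OF g smooth_per_const])
  have \<gamma>L: "\<gamma> \<in> L2_per" by (rule smooth_per_L2_per[OF \<gamma>p])
  have "mean \<gamma> = 0" unfolding \<gamma>_def
    using mean_lin[OF smooth_per_sqint(2)[OF g] smooth_per_sqint(2)[OF smooth_per_const[of 1]], of "- ?m"]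
    by (simp add: mean_const)
  hence \<gamma>0: "(LINT x|cellm. \<gamma> x) = 0" using cell_pos[where 'd='d] by (simp add: mean_def)
  obtain K where K: "K >= 0" "!!g eps. g \<in> L2_per ==> 0 < eps ==> eps <= 1 ==>
     sqint M (%x. sc eps g x * t x) & nrm M (%x. sc eps g x * t x) <= K * nrm cellm g"
    by (rule scaled_test_bound[OF Os t]) blast
  have main: "((%eps. I (U eps) (%x. sc eps \<gamma> x * t x)) \<longlongrightarrow> 0) (at_right 0)"
  proof (rule tendsto_zero_approx)
    fix e :: real assume e: "e > 0"
    define e' where "e' = e / (\<bar>C\<bar> * K + 1)"
    have CK: "\<bar>C\<bar> * K + 1 > 0" using K(1) by (simp add: add_nonneg_pos)
    have e': "e' > 0" using e CK by (simp add: e'_def)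
    obtain G where G: "!!i. smooth_per (G i)" "nrm cellm (%x. \<gamma> x - (\<Sum>i\<in>UNIV. pd i (G i) x)) < e'"
      by (rule antidivergence[OF \<gamma>L \<gamma>0 e']) blast
    define d where "d = (%x. \<gamma> x - (\<Sum>i\<in>UNIV. pd i (G i) x))"
    have dp: "smooth_per d" unfolding d_def by (intro smooth_per_diff \<gamma>p smooth_per_sum smooth_per_pd G) simp
    have Gs: "smooth (G i)" for i by (rule smooth_perD(1)[OF G(1)])
    define Y where "Y eps = eps * (- (\<Sum>i\<in>UNIV. I (DU eps i) (%x. sc eps (G i) x * t x)) - (\<Sum>i\<in>UNIV. I (U eps) (%x. sc eps (G i) x * pd i t x)))" for eps
    define Z where "Z eps = I (U eps) (%x. sc eps d x * t x)" for eps
    have eq: "I (U eps) (%x. sc eps \<gamma> x * t x) = Y eps + Z eps" if ep: "eps > 0" for eps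
    proof -
      have q: "sqint M (%x. sc eps k x * s x)" if "smooth k" "s \<in> test_functions \<Omega>" for k s
        by (rule test_sq[OF sc_test[OF that]])
      note Uq = Usq[OF ep]
      have "I (U eps) (%x. sc eps (pd i (G i)) x * t x) = eps * (- I (DU eps i) (%x. sc eps (G i) x * t x) - I (U eps) (%x. sc eps (G i) x * pd i t x))" for i
      proof -
        have tt: "(%x. sc eps (G i) x * t x) \<in> test_functions \<Omega>" by (rule sc_test[OF Gs t])
        have "(%x. sc eps (pd i (G i)) x * t x) = (%x. eps * (pd i (%x. sc eps (G i) x * t x) x - sc eps (G i) x * pd i t x))"
          unfolding smooth_pd_mult[OF sc_smooth[OF Gs] test_smooth[OF t]] sc_pd[OF Gs] using ep by simp
        thus ?thesis
          using I_scale[OF Uq sqint_diff[OF test_sq[OF test_pd[OF tt]] q[OF Gs test_pd[OF t]]]]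
            I_diff[OF Uq test_sq[OF test_pd[OF tt]] q[OF Gs test_pd[OF t]]] wp[OF ep tt, of i] by simp
      qed
      hence "(\<Sum>i\<in>UNIV. I (U eps) (%x. sc eps (pd i (G i)) x * t x)) = Y eps"
        unfolding Y_def by (simp add: sum_distrib_left[symmetric] sum_subtractf sum_negf)
      moreover have "I (U eps) (%x. \<Sum>i\<in>UNIV. sc eps (pd i (G i)) x * t x) = (\<Sum>i\<in>UNIV. I (U eps) (%x. sc eps (pd i (G i)) x * t x))"
        by (rule I_sum[OF Uq q[OF smoothD(3)[OF Gs] t]])
      moreover have "(%x. sc eps \<gamma> x * t x) = (%x. (\<Sum>i\<in>UNIV. sc eps (pd i (G i)) x * t x) + sc eps d x * t x)"
        by (simp add: sc_def d_def left_diff_distrib sum_distrib_right)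
      moreover have "I (U eps) (%x. (\<Sum>i\<in>UNIV. sc eps (pd i (G i)) x * t x) + sc eps d x * t x) = I (U eps) (%x. \<Sum>i\<in>UNIV. sc eps (pd i (G i)) x * t x) + Z eps"
        unfolding Z_def by (intro I_add Uq sqint_sum q smoothD(3) Gs t smooth_perD(1)[OF dp]) simp
      ultimately show ?thesis by simp
    qed
    have Y0: "(Y \<longlongrightarrow> 0) (at_right 0)"
    proof -
      have "ebdd (%eps. (\<Sum>i\<in>UNIV. (-1) * I (DU eps i) (%x. sc eps (G i) x * t x)) + (\<Sum>i\<in>UNIV. (-1) * I (U eps) (%x. sc eps (G i) x * pd i t x)))"
      proof (intro ebdd_add ebdd_sum)
        have neg: "ebdd (%eps. (-1) * X eps)" if "ebdd X" for X using that by (simp add: ebdd_def)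
        show "ebdd (%eps. (-1) * I (DU eps i) (%x. sc eps (G i) x * t x))" for i
          by (rule neg, rule ebdd_I[OF DUsq bDU G(1) t])
        show "ebdd (%eps. (-1) * I (U eps) (%x. sc eps (G i) x * pd i t x))" for i
          by (rule neg, rule ebdd_I[OF Usq bU G(1) test_pd[OF t]])
      qed simp_all
      from ebdd_zero[OF this, of "%eps. eps"] show ?thesis unfolding Y_def by (simp add: sum_negf tendsto_ident_at)
    qed
    have Z: "\<forall>\<^sub>F eps in at_right 0. \<bar>Z eps\<bar> <= e"
      using bU at_right_01
    proof eventually_elim
      case (elim eps)
      hence ep: "eps > 0" "eps <= 1" by auto
      note k = K(2)[OF smooth_per_L2_per[OF dp] ep]
      have "\<bar>Z eps\<bar> <= nrm M (U eps) * nrm M (%x. sc eps d x * t x)" unfolding Z_def by (rule I_CS[OF Usq[OF ep(1)]]) (use k in simp)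
      also have "\<dots> <= \<bar>C\<bar> * (K * e')"
      proof (rule mult_mono)
        show "nrm M (U eps) <= \<bar>C\<bar>" using elim by simp
        have "nrm M (%x. sc eps d x * t x) <= K * nrm cellm d" using k by simp
        also have "\<dots> <= K * e'" using G(2) K(1) by (intro mult_left_mono) (simp_all add: d_def)
        finally show "nrm M (%x. sc eps d x * t x) <= K * e'" .
      qed (simp_all add: nrm_nonneg)
      also have "\<dots> <= (\<bar>C\<bar> * K + 1) * e'" using e' by (simp add: algebra_simps)
      also have "\<dots> = e" using CK by (simp add: e'_def)
      finally show ?case .
    qed
    show "\<exists>Y Z. (\<forall>\<^sub>F eps in at_right 0. I (U eps) (%x. sc eps \<gamma> x * t x) = Y eps + Z eps) & (Y \<longlongrightarrow> 0) (at_right 0) & (\<forall>\<^sub>F eps in at_right 0. \<bar>Z eps\<bar> <= e)"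
    proof (intro exI conjI)
      show "\<forall>\<^sub>F eps in at_right 0. I (U eps) (%x. sc eps \<gamma> x * t x) = Y eps + Z eps" using at_right_01 by eventually_elim (simp add: eq)
    qed (rule Y0, rule Z)
  qed
  have eq: "I (U eps) (%x. sc eps g x * t x) = I (U eps) (%x. sc eps \<gamma> x * t x) + ?m * I (U eps) t" if ep: "eps > 0" for eps
  proof -
    have "(%x. sc eps g x * t x) = (%x. sc eps \<gamma> x * t x + ?m * t x)" by (simp add: sc_def \<gamma>_def algebra_simps)
    thus ?thesis using I_add[OF Usq[OF ep] test_sq[OF sc_test[OF smooth_perD(1)[OF \<gamma>p] t]] sqint_scale[OF test_sq[OF t]]]
        I_scale[OF Usq[OF ep] test_sq[OF t]] by simp
  qed
  have "((%eps. I (U eps) (%x. sc eps \<gamma> x * t x) + ?m * I (U eps) t) \<longlongrightarrow> 0 + ?m * I u0 t) (at_right 0)"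
    by (intro tendsto_intros main limU t)
  hence "((%eps. I (U eps) (%x. sc eps \<gamma> x * t x) + ?m * I (U eps) t) \<longlongrightarrow> ?m * I u0 t) (at_right 0)" by simp
  thus ?thesis
    by (rule Lim_transform_eventually) (use at_right_01 in eventually_elim, simp add: eq)
qed

end

lemma ebdd_scale: "ebdd X ==> ebdd (%eps. c * X eps)"
proof -
  assume "ebdd X"
  then obtain K where K: "\<forall>\<^sub>F eps in at_right 0. \<bar>X eps\<bar> <= K" by (auto simp: ebdd_def)
  have "\<forall>\<^sub>F eps in at_right 0. \<bar>c * X eps\<bar> <= \<bar>c\<bar> * K" using K by eventually_elim (simp add: abs_mult mult_left_mono)
  thus ?thesis by (auto simp: ebdd_def)
qed

context oscillating_family
begin

text \<open>The flux of \<open>\<psi>\<close> is split as \<open>A (e\<^sub>j + \<nabla>\<psi>) = g + (A (e\<^sub>j + \<nabla>\<psi>) - g)\<close>. Symmetry of \<open>A\<close> lets it act on the gradient of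
  the solution instead of on \<open>e\<^sub>j + \<nabla>\<psi>\<close>.\<close>
lemma flux_identity:
  assumes e: "0 < eps" "eps <= 1" and p: "smooth_per \<psi>" and g: "!!i. smooth_per (g i)" and t: "t \<in> test_functions \<Omega>"
  shows "I (AU eps j) t = (\<Sum>k\<in>UNIV. I (DU eps k) (%x. sc eps (g k) x * t x))
    + (\<Sum>k\<in>UNIV. I (DU eps k) (%x. sc eps (%y. flux A j (%k. pd k \<psi>) k y - g k y) x * t x))
    - (\<Sum>i\<in>UNIV. I (AU eps i) (%x. sc eps (pd i \<psi>) x * t x))"
proof -
  let ?d = "%k y. flux A j (%k. pd k \<psi>) k y - g k y"
  obtain K where K: "K >= 0" "!!g eps. g \<in> L2_per ==> 0 < eps ==> eps <= 1 ==>
     sqint M (%x. sc eps g x * t x) & nrm M (%x. sc eps g x * t x) <= K * nrm cellm g"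
    by (rule scaled_test_bound[OF Os t]) blast
  have fL: "flux A j (%k. pd k \<psi>) k \<in> L2_per" for k by (rule flux_L2_per[OF A smooth_per_L2_per[OF smooth_per_pd[OF p]]])
  have dL: "?d k \<in> L2_per" for k using L2_per_lin[OF fL smooth_per_L2_per[OF g], of k "-1" k] by simp
  have i1: "integrable M (%x. AU eps j x * t x)" by (rule sqint_mult[OF AU_sq[OF e(1)] test_sq[OF t]])
  have i2: "integrable M (%x. AU eps i x * (sc eps (pd i \<psi>) x * t x))" for i
    by (rule sqint_mult[OF AU_sq[OF e(1)] test_sq[OF sc_test[OF smooth_perD(1)[OF smooth_per_pd[OF p]] t]]])
  have i3: "integrable M (%x. DU eps k x * (sc eps (g k) x * t x))" for k
    by (rule sqint_mult[OF DUsq[OF e(1)] test_sq[OF sc_test[OF smooth_perD(1)[OF g] t]]])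
  have i4: "integrable M (%x. DU eps k x * (sc eps (?d k) x * t x))" for k
    by (rule sqint_mult[OF DUsq[OF e(1)]]) (use K(2)[OF dL e] in blast)
  have i2s: "integrable M (%x. \<Sum>i\<in>UNIV. AU eps i x * (sc eps (pd i \<psi>) x * t x))"
    by (rule Bochner_Integration.integrable_sum) (rule i2)
  have i3s: "integrable M (%x. \<Sum>k\<in>UNIV. DU eps k x * (sc eps (g k) x * t x))"
    by (rule Bochner_Integration.integrable_sum) (rule i3)
  have i4s: "integrable M (%x. \<Sum>k\<in>UNIV. DU eps k x * (sc eps (?d k) x * t x))"
    by (rule Bochner_Integration.integrable_sum) (rule i4)
  have l: "I (AU eps j) t + (\<Sum>i\<in>UNIV. I (AU eps i) (%x. sc eps (pd i \<psi>) x * t x))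
     = (LINT x|M. AU eps j x * t x + (\<Sum>i\<in>UNIV. AU eps i x * (sc eps (pd i \<psi>) x * t x)))"
    unfolding Bochner_Integration.integral_add[OF i1 i2s] Bochner_Integration.integral_sum[OF i2] L2_ip_def ..
  have r: "(\<Sum>k\<in>UNIV. I (DU eps k) (%x. sc eps (g k) x * t x)) + (\<Sum>k\<in>UNIV. I (DU eps k) (%x. sc eps (?d k) x * t x))
     = (LINT x|M. (\<Sum>k\<in>UNIV. DU eps k x * (sc eps (g k) x * t x)) + (\<Sum>k\<in>UNIV. DU eps k x * (sc eps (?d k) x * t x)))"
    unfolding Bochner_Integration.integral_add[OF i3s i4s] Bochner_Integration.integral_sum[OF i3] Bochner_Integration.integral_sum[OF i4] L2_ip_def ..
  have sym: "AE y in lebesgue. \<forall>a b. A y $ a $ b = A y $ b $ a"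
    using A unfolding periodic_elliptic_def
    by (elim conjE, elim eventually_mono) (auto simp: transpose_def vec_eq_iff)
  have "AE x in lebesgue. \<forall>a b. A (0 + (1/eps) *\<^sub>R x) $ a $ b = A (0 + (1/eps) *\<^sub>R x) $ b $ a"
    by (rule AE_lebesgue_affine[OF sym]) (use e in simp)
  hence AEs: "AE x in M. \<forall>a b. A ((1/eps) *\<^sub>R x) $ a $ b = A ((1/eps) *\<^sub>R x) $ b $ a"
    using Os by (subst AE_restrict_space_iff) (auto elim: eventually_mono)
  have "(LINT x|M. AU eps j x * t x + (\<Sum>i\<in>UNIV. AU eps i x * (sc eps (pd i \<psi>) x * t x)))
     = (LINT x|M. (\<Sum>k\<in>UNIV. DU eps k x * (sc eps (g k) x * t x)) + (\<Sum>k\<in>UNIV. DU eps k x * (sc eps (?d k) x * t x)))"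
  proof (rule integral_cong_AE)
    show "(%x. AU eps j x * t x + (\<Sum>i\<in>UNIV. AU eps i x * (sc eps (pd i \<psi>) x * t x))) \<in> borel_measurable M"
      by (rule borel_measurable_integrable[OF Bochner_Integration.integrable_add[OF i1 i2s]])
    show "(%x. (\<Sum>k\<in>UNIV. DU eps k x * (sc eps (g k) x * t x)) + (\<Sum>k\<in>UNIV. DU eps k x * (sc eps (?d k) x * t x))) \<in> borel_measurable M"
      by (rule borel_measurable_integrable[OF Bochner_Integration.integrable_add[OF i3s i4s]])
    show "AE x in M. AU eps j x * t x + (\<Sum>i\<in>UNIV. AU eps i x * (sc eps (pd i \<psi>) x * t x))
      = (\<Sum>k\<in>UNIV. DU eps k x * (sc eps (g k) x * t x)) + (\<Sum>k\<in>UNIV. DU eps k x * (sc eps (?d k) x * t x))"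
      using AEs
    proof eventually_elim
      case (elim x)
      let ?y = "(1/eps) *\<^sub>R x"
      have AU': "AU eps i x = (\<Sum>k\<in>UNIV. A ?y $ k $ i * DU eps k x)" for i
        unfolding AU_def by (intro sum.cong refl) (use elim in simp)
      have "(\<Sum>k\<in>UNIV. DU eps k x * (sc eps (g k) x * t x)) + (\<Sum>k\<in>UNIV. DU eps k x * (sc eps (?d k) x * t x))
        = (\<Sum>k\<in>UNIV. DU eps k x * (flux A j (%k. pd k \<psi>) k ?y * t x))"
        unfolding sum.distrib[symmetric] by (intro sum.cong refl) (simp add: sc_def algebra_simps)
      also have "\<dots> = (\<Sum>k\<in>UNIV. A ?y $ k $ j * DU eps k x * t x + (\<Sum>i\<in>UNIV. A ?y $ k $ i * DU eps k x * (pd i \<psi> ?y * t x)))"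
        unfolding flux_split by (intro sum.cong refl) (simp add: distrib_left distrib_right sum_distrib_left sum_distrib_right mult_ac)
      also have "\<dots> = (\<Sum>k\<in>UNIV. A ?y $ k $ j * DU eps k x * t x) + (\<Sum>i\<in>UNIV. \<Sum>k\<in>UNIV. A ?y $ k $ i * DU eps k x * (pd i \<psi> ?y * t x))"
        unfolding sum.distrib by (subst (2) sum.swap) (rule refl)
      also have "\<dots> = AU eps j x * t x + (\<Sum>i\<in>UNIV. AU eps i x * (sc eps (pd i \<psi>) x * t x))"
        unfolding AU' sum_distrib_right sc_def ..
      finally show ?case by simp
    qed
  qed
  thus ?thesis using l r by linarith
qed

text \<open>Combination of \<open>flux_identity\<close> with the expansions \<open>DU_identity\<close> and \<open>AU_identity\<close>.
  The terms with the Laplacian of the solution that carry \<open>\<epsilon>\<close> and \<open>\<kappa>\<^sup>2/\<epsilon>\<close> are collected into one, and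
  the hypothesis on \<open>P\<close> says precisely that this one vanishes in the limit.\<close>
lemma flux_limit:
  assumes ap: "approx_flux A j m P"
    and P: "!!\<psi> h. smooth_per \<psi> ==> smooth_per h ==> P \<psi> h ==>
       \<exists>\<delta>. (\<delta> \<longlongrightarrow> 0) (at_right 0) & (\<forall>\<^sub>F eps in at_right 0. \<forall>y. \<bar>(\<kappa> eps / eps) * laplace \<psi> y - (eps / \<kappa> eps) * h y\<bar> <= \<delta> eps)"
    and t: "t \<in> test_functions \<Omega>"
  shows "((%eps. I (AU eps j) t) \<longlongrightarrow> (\<Sum>i\<in>UNIV. m i * I (D0 i) t)) (at_right 0)"
proof -
  obtain L where L: "!!i. \<forall>\<^sub>F eps in at_right 0. nrm M (AU eps i) <= L" by (rule AU_bound) blast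
  obtain K where K: "K >= 0" "!!g eps. g \<in> L2_per ==> 0 < eps ==> eps <= 1 ==>
     sqint M (%x. sc eps g x * t x) & nrm M (%x. sc eps g x * t x) <= K * nrm cellm g"
    by (rule scaled_test_bound[OF Os t]) blast
  let ?VL = "%eps x. \<kappa> eps * LU eps x"
  have VL: "sqint M (?VL eps)" if "eps > 0" for eps by (rule sqint_scale[OF LUsq[OF that]])
  have "((%eps. I (AU eps j) t - (\<Sum>i\<in>UNIV. m i * I (D0 i) t)) \<longlongrightarrow> 0) (at_right 0)"
  proof (rule tendsto_zero_approx)
    fix e :: real assume e: "e > 0"
    define S where "S = (\<Sum>i\<in>UNIV. \<bar>I (D0 i) t\<bar>)"
    \<comment> \<open>The total factor in front of the approximation error \<open>e\'\<close>: from the flux, from the means, and \<open>1\<close> to make it positive.\<close>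
    define T where "T = real CARD('d) * (\<bar>C\<bar> * K) + S + 1"
    have S0: "S >= 0" unfolding S_def by (simp add: sum_nonneg)
    have "real CARD('d) * (\<bar>C\<bar> * K) >= 0" using K(1) by simp
    hence T0: "T > 0" using S0 by (simp add: T_def)
    define e' where "e' = e / T"
    have e': "e' > 0" using e T0 by (simp add: e'_def)
    obtain \<psi> g h where p: "smooth_per \<psi>" and g: "!!i. smooth_per (g i)" and h: "smooth_per h"
      and div: "!!x. (\<Sum>i\<in>UNIV. pd i (g i) x) = laplace h x" and Ph: "P \<psi> h"
      and fe: "!!i. nrm cellm (%x. flux A j (%k. pd k \<psi>) i x - g i x) < e'" and me: "!!i. \<bar>mean (g i) - m i\<bar> < e'"
      using ap[unfolded approx_flux_def, rule_format, OF e'] by (elim exE conjE) blast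
    obtain \<delta> where \<delta>: "(\<delta> \<longlongrightarrow> 0) (at_right 0)"
        "\<forall>\<^sub>F eps in at_right 0. \<forall>y. \<bar>(\<kappa> eps / eps) * laplace \<psi> y - (eps / \<kappa> eps) * h y\<bar> <= \<delta> eps"
      using P[OF p h Ph] by blast
    note ps = smooth_perD(1)[OF p] and hs = smooth_perD(1)[OF h] and gs = smooth_perD(1)[OF g]
    have lp: "smooth_per (laplace \<psi>)" by (rule laplace_smooth_per[OF p])
    note ls = smooth_perD(1)[OF lp]
    define d where "d = (%k y. flux A j (%k. pd k \<psi>) k y - g k y)"
    have fL: "flux A j (%k. pd k \<psi>) k \<in> L2_per" for k by (rule flux_L2_per[OF A smooth_per_L2_per[OF smooth_per_pd[OF p]]])
    have dL: "d k \<in> L2_per" for k unfolding d_def using L2_per_lin[OF fL smooth_per_L2_per[OF g], of k "-1" k] by simp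
    \<comment> \<open>The bracket in which the two terms with the Laplacian of the solution are collected.\<close>
    define gg where "gg eps y = (\<kappa> eps / eps) * laplace \<psi> y - (eps / \<kappa> eps) * h y" for eps y
    have ggs: "smooth (gg eps)" for eps unfolding gg_def
      by (rule smooth_perD(1)) (intro smooth_per_diff smooth_per_scale lp h)
    define a where "a eps = (\<Sum>i\<in>UNIV. I (U eps) (%x. sc eps (g i) x * pd i t x))" for eps
    define b where "b eps = (\<Sum>i\<in>UNIV. I (DU eps i) (%x. sc eps h x * pd i t x))" for eps
    define c where "c eps = (\<Sum>i\<in>UNIV. I (U eps) (%x. sc eps h x * pd i (pd i t) x))" for eps
    define f1 where "f1 eps = I f (%x. sc eps \<psi> x * t x)" for eps
    define q where "q eps = (\<Sum>i\<in>UNIV. I (AU eps i) (%x. sc eps \<psi> x * pd i t x))" for eps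
    define r where "r eps = (\<Sum>i\<in>UNIV. I (?VL eps) (%x. sc eps (pd i \<psi>) x * pd i t x))" for eps
    define s where "s eps = (\<Sum>i\<in>UNIV. I (?VL eps) (%x. sc eps \<psi> x * pd i (pd i t) x))" for eps
    define w where "w eps = I (?VL eps) (%x. sc eps (gg eps) x * t x)" for eps
    define z where "z eps = (\<Sum>k\<in>UNIV. I (DU eps k) (%x. sc eps (d k) x * t x))" for eps
    define G where "G = (\<Sum>i\<in>UNIV. mean (g i) * I (D0 i) t)"
    define y where "y = (\<Sum>i\<in>UNIV. (mean (g i) - m i) * I (D0 i) t)"
    have eq: "I (AU eps j) t = z eps - a eps - eps * (2 * b eps + c eps) - eps * (f1 eps - q eps) + \<kappa> eps * (2 * r eps + eps * s eps) + w eps"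
      if ep: "0 < eps" "eps <= 1" for eps
    proof -
      have kp: "\<kappa> eps > 0" by (rule kpos[OF ep(1)])
      note Vq = VL[OF ep(1)]
      have qh: "sqint M (%x. sc eps h x * t x)" and ql: "sqint M (%x. sc eps (laplace \<psi>) x * t x)"
        by (rule test_sq[OF sc_test[OF hs t]], rule test_sq[OF sc_test[OF ls t]])
      have "(%x. sc eps (gg eps) x * t x) = (%x. (\<kappa> eps / eps) * (sc eps (laplace \<psi>) x * t x) - (eps / \<kappa> eps) * (sc eps h x * t x))"
        by (simp add: sc_def gg_def algebra_simps)
      hence "w eps = (\<kappa> eps / eps) * I (?VL eps) (%x. sc eps (laplace \<psi>) x * t x) - (eps / \<kappa> eps) * I (?VL eps) (%x. sc eps h x * t x)"
        unfolding w_def by (simp only: I_diff[OF Vq sqint_scale[OF ql] sqint_scale[OF qh]] I_scale[OF Vq ql] I_scale[OF Vq qh])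
      hence w: "w eps = ((\<kappa> eps)\<^sup>2 / eps) * I (LU eps) (%x. sc eps (laplace \<psi>) x * t x) - eps * I (LU eps) (%x. sc eps h x * t x)"
        unfolding I_scale_left using kp by (simp add: power2_eq_square)
      have r': "\<kappa> eps * (2 * r eps) = 2 * (\<kappa> eps)\<^sup>2 * (\<Sum>i\<in>UNIV. I (LU eps) (%x. sc eps (pd i \<psi>) x * pd i t x))"
        unfolding r_def I_scale_left sum_distrib_left[symmetric] by (simp add: power2_eq_square)
      have s': "\<kappa> eps * (eps * s eps) = (\<kappa> eps)\<^sup>2 * eps * (\<Sum>i\<in>UNIV. I (LU eps) (%x. sc eps \<psi> x * pd i (pd i t) x))"
        unfolding s_def I_scale_left sum_distrib_left[symmetric] by (simp add: power2_eq_square)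
      show ?thesis
        using flux_identity[OF ep p, where g=g and j=j, OF g t] DU_identity[OF ep(1) gs hs div t] AU_identity[OF ep(1) ps t] w r' s'
        unfolding z_def d_def a_def b_def c_def f1_def q_def distrib_left right_diff_distrib by linarith
    qed
    define Y where "Y eps = - (a eps + G) - eps * (2 * b eps + c eps + f1 eps + (-1) * q eps) + \<kappa> eps * (2 * r eps) + (\<kappa> eps * eps) * s eps + w eps" for eps
    have w0': "(w \<longlongrightarrow> 0) (at_right 0)"
    proof (rule Lim_null_comparison)
      show "\<forall>\<^sub>F eps in at_right 0. norm (w eps) <= \<bar>C\<bar> * nrm M t * \<bar>\<delta> eps\<bar>"
        using \<delta>(2) bLU at_right_01
      proof eventually_elim
        case (elim eps)
        have "\<bar>w eps\<bar> <= nrm M (?VL eps) * (\<bar>\<delta> eps\<bar> * nrm M t)" unfolding w_def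
        proof (rule I_sc_bound[OF VL ggs _ t])
          show "eps > 0" using elim by simp
          show "\<bar>gg eps y\<bar> <= \<bar>\<delta> eps\<bar>" for y unfolding gg_def using elim(1) by (meson abs_ge_self order_trans)
        qed
        also have "\<dots> <= \<bar>C\<bar> * (\<bar>\<delta> eps\<bar> * nrm M t)" using elim(2) nrm_nonneg[of M t] by (intro mult_right_mono) auto
        finally show ?case by (simp add: mult_ac)
      qed
      show "((%eps. \<bar>C\<bar> * nrm M t * \<bar>\<delta> eps\<bar>) \<longlongrightarrow> 0) (at_right 0)"
        by (rule tendsto_mult_right_zero) (rule tendsto_rabs_zero[OF \<delta>(1)])
    qed
    have a0: "((%eps. a eps + G) \<longlongrightarrow> 0) (at_right 0)"
    proof -
      have "(a \<longlongrightarrow> (\<Sum>i\<in>UNIV. mean (g i) * I u0 (pd i t))) (at_right 0)"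
        unfolding a_def by (intro tendsto_sum oscillation_mean g test_pd t)
      moreover have "(\<Sum>i\<in>UNIV. mean (g i) * I u0 (pd i t)) = - G" unfolding G_def by (simp add: w0[OF t] sum_negf)
      ultimately have "((%eps. a eps + G) \<longlongrightarrow> - G + G) (at_right 0)" by (intro tendsto_intros) simp
      thus ?thesis by simp
    qed
    have eb: "ebdd b" "ebdd c" "ebdd f1" "ebdd q" "ebdd r" "ebdd s"
    proof -
      show "ebdd b" unfolding b_def by (intro ebdd_sum ebdd_I[OF DUsq bDU h test_pd[OF t]]) simp
      show "ebdd c" unfolding c_def by (intro ebdd_sum ebdd_I[OF Usq bU h test_pd[OF test_pd[OF t]]]) simp
      show "ebdd f1" unfolding f1_def by (rule ebdd_I[where L="nrm M f", OF _ _ p t]) (simp_all add: fsq)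
      show "ebdd q" unfolding q_def by (intro ebdd_sum ebdd_I[OF AU_sq L p test_pd[OF t]]) simp
      show "ebdd r" unfolding r_def by (intro ebdd_sum ebdd_I[OF VL bLU smooth_per_pd[OF p] test_pd[OF t]]) simp
      show "ebdd s" unfolding s_def by (intro ebdd_sum ebdd_I[OF VL bLU p test_pd[OF test_pd[OF t]]]) simp
    qed
    have i0: "((%eps::real. eps) \<longlongrightarrow> 0) (at_right 0)" by (simp add: tendsto_ident_at)
    have "((%eps. - (a eps + G) - eps * (2 * b eps + c eps + f1 eps + (-1) * q eps) + \<kappa> eps * (2 * r eps) + (\<kappa> eps * eps) * s eps + w eps) \<longlongrightarrow> - 0 - 0 + 0 + 0 + 0) (at_right 0)"
    proof (intro tendsto_add tendsto_diff tendsto_minus a0 w0')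
      show "((%eps. eps * (2 * b eps + c eps + f1 eps + (-1) * q eps)) \<longlongrightarrow> 0) (at_right 0)"
        by (rule ebdd_zero[OF _ i0]) (intro ebdd_add ebdd_scale eb)
      show "((%eps. \<kappa> eps * (2 * r eps)) \<longlongrightarrow> 0) (at_right 0)"
        by (rule ebdd_zero[OF ebdd_scale[OF eb(5)] k0])
      show "((%eps. (\<kappa> eps * eps) * s eps) \<longlongrightarrow> 0) (at_right 0)"
        by (rule ebdd_zero[OF eb(6)]) (rule tendsto_mult_zero[OF k0 i0])
    qed
    hence Y0: "(Y \<longlongrightarrow> 0) (at_right 0)" unfolding Y_def[abs_def] by simp
    have yS: "\<bar>y\<bar> <= e' * S"
    proof -
      have "\<bar>y\<bar> <= (\<Sum>i\<in>UNIV. \<bar>(mean (g i) - m i) * I (D0 i) t\<bar>)" unfolding y_def by (rule sum_abs)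
      also have "\<dots> <= (\<Sum>i\<in>UNIV. e' * \<bar>I (D0 i) t\<bar>)"
        unfolding abs_mult by (intro sum_mono mult_right_mono less_imp_le[OF me]) simp
      finally show ?thesis by (simp add: S_def sum_distrib_left)
    qed
    have all: "\<forall>\<^sub>F eps in at_right 0. \<forall>k. nrm M (DU eps k) <= C" by (intro eventually_all_finite bDU)
    have Z: "\<forall>\<^sub>F eps in at_right 0. \<bar>z eps + y\<bar> <= e"
      using all at_right_01
    proof eventually_elim
      case (elim eps)
      hence ep: "0 < eps" "eps <= 1" by auto
      have "\<bar>I (DU eps k) (%x. sc eps (d k) x * t x)\<bar> <= \<bar>C\<bar> * (K * e')" for k
      proof -
        note k = K(2)[OF dL[of k] ep]
        have "\<bar>I (DU eps k) (%x. sc eps (d k) x * t x)\<bar> <= nrm M (DU eps k) * nrm M (%x. sc eps (d k) x * t x)"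
          by (rule I_CS[OF DUsq[OF ep(1)]]) (use k in simp)
        also have "\<dots> <= \<bar>C\<bar> * (K * e')"
        proof (rule mult_mono)
          show "nrm M (DU eps k) <= \<bar>C\<bar>" using elim(1)[rule_format, of k] by simp
          have "nrm M (%x. sc eps (d k) x * t x) <= K * nrm cellm (d k)" using k by simp
          also have "\<dots> <= K * e'" using fe[of k] K(1) by (intro mult_left_mono) (simp_all add: d_def)
          finally show "nrm M (%x. sc eps (d k) x * t x) <= K * e'" .
        qed (simp_all add: nrm_nonneg)
        finally show ?thesis .
      qed
      hence "(\<Sum>k\<in>UNIV. \<bar>I (DU eps k) (%x. sc eps (d k) x * t x)\<bar>) <= (\<Sum>k\<in>(UNIV::'d set). \<bar>C\<bar> * (K * e'))" by (intro sum_mono)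
      hence "\<bar>z eps\<bar> <= real CARD('d) * (\<bar>C\<bar> * (K * e'))" unfolding z_def by (intro order_trans[OF sum_abs]) simp
      moreover have "real CARD('d) * (\<bar>C\<bar> * (K * e')) + e' * S + e' = T * e'" by (simp add: T_def algebra_simps)
      moreover have "T * e' = e" using T0 by (simp add: e'_def)
      ultimately show ?case using yS e' by linarith
    qed
    show "\<exists>Y Z. (\<forall>\<^sub>F eps in at_right 0. I (AU eps j) t - (\<Sum>i\<in>UNIV. m i * I (D0 i) t) = Y eps + Z eps) & (Y \<longlongrightarrow> 0) (at_right 0) & (\<forall>\<^sub>F eps in at_right 0. \<bar>Z eps\<bar> <= e)"
    proof (rule exI[of _ Y], rule exI[of _ "%eps. z eps + y"], intro conjI Y0 Z)
      have yG: "(\<Sum>i\<in>UNIV. m i * I (D0 i) t) = G - y" unfolding G_def y_def by (simp add: left_diff_distrib sum_subtractf)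
      show "\<forall>\<^sub>F eps in at_right 0. I (AU eps j) t - (\<Sum>i\<in>UNIV. m i * I (D0 i) t) = Y eps + (z eps + y)"
        using at_right_01 by eventually_elim (simp add: eq yG Y_def algebra_simps)
    qed
  qed
  thus ?thesis by (rule LIM_zero_cancel)
qed

text \<open>In the equation the fourth order term, with one Laplacian moved to the test function, is \<open>\<kappa>\<close> times a
  bounded quantity.\<close>
lemma homogenized_equation:
  assumes F: "!!i t. t \<in> test_functions \<Omega> ==> ((%eps. I (AU eps i) t) \<longlongrightarrow> I (F i) t) (at_right 0)"
    and t: "t \<in> test_functions \<Omega>"
  shows "(\<Sum>i\<in>UNIV. I (F i) (pd i t)) = I f t"
proof -
  let ?VL = "%eps x. \<kappa> eps * LU eps x"
  have VL: "sqint M (?VL eps)" if "eps > 0" for eps by (rule sqint_scale[OF LUsq[OF that]])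
  \<comment> \<open>The constant function \<open>1\<close> is rescaled only to bring the sum into the form of \<open>ebdd_I\<close>.\<close>
  define s where "s eps = (\<Sum>i\<in>UNIV. I (?VL eps) (%x. sc eps (%y. 1) x * pd i (pd i t) x))" for eps
  have "ebdd s" unfolding s_def by (intro ebdd_sum ebdd_I[OF VL bLU smooth_per_const test_pd[OF test_pd[OF t]]]) simp
  hence "((%eps. \<kappa> eps * s eps + (\<Sum>i\<in>UNIV. I (AU eps i) (pd i t))) \<longlongrightarrow> 0 + (\<Sum>i\<in>UNIV. I (F i) (pd i t))) (at_right 0)"
    by (intro tendsto_add ebdd_zero k0 tendsto_sum F test_pd t)
  moreover have "\<forall>\<^sub>F eps in at_right 0. \<kappa> eps * s eps + (\<Sum>i\<in>UNIV. I (AU eps i) (pd i t)) = I f t"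
    using at_right_01
  proof eventually_elim
    case (elim eps)
    have "\<kappa> eps * s eps = (\<kappa> eps)\<^sup>2 * (\<Sum>i\<in>UNIV. I (LU eps) (pd i (pd i t)))"
      unfolding s_def I_scale_left sum_distrib_left[symmetric] by (simp add: power2_eq_square sc_def)
    thus ?case using eqn[of eps t] elim t unfolding AU_def[abs_def] by simp
  qed
  ultimately have "((%eps::real. I f t) \<longlongrightarrow> 0 + (\<Sum>i\<in>UNIV. I (F i) (pd i t))) (at_right 0)" by (rule Lim_transform_eventually)
  from tendsto_unique[OF _ this tendsto_const] show ?thesis by simp
qed

end

section \<open>Sobolev functions on the domain\<close>

lemma L2_iff: "u \<in> L2 \<Omega> \<longleftrightarrow> sqint (lebesgue_on \<Omega>) u" for u :: "real^'d => real"
  by (simp add: L2_def sqint_def)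

lemma L2_norm_eq: "L2_norm \<Omega> u = nrm (lebesgue_on \<Omega>) u" for u :: "real^'d => real"
  by (simp add: L2_norm_def nrm_def)

lemma norm_vec_sq: "(norm (v :: real^'d))\<^sup>2 = (\<Sum>i\<in>UNIV. (v $ i)\<^sup>2)"
  unfolding power2_norm_eq_inner inner_vec_def by (simp add: power2_eq_square)

lemma L2_vecI:
  fixes F :: "real^'d => real^'d"
  assumes "!!i. sqint (lebesgue_on \<Omega>) (%x. F x $ i)" shows "F \<in> L2 \<Omega>"
proof -
  have "F \<in> borel_measurable (lebesgue_on \<Omega>)"
    by (subst borel_measurable_euclidean_space)
      (use assms in \<open>auto simp: Basis_vec_def inner_axis sqint_def\<close>)
  moreover have "integrable (lebesgue_on \<Omega>) (%x. (norm (F x))\<^sup>2)"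
    unfolding norm_vec_sq by (rule Bochner_Integration.integrable_sum) (rule sqintD(2)[OF assms])
  ultimately show ?thesis by (simp add: L2_def)
qed

lemma L2_norm_vec:
  fixes F :: "real^'d => real^'d"
  assumes "!!i. sqint (lebesgue_on \<Omega>) (%x. F x $ i)"
  shows "(L2_norm \<Omega> F)\<^sup>2 = (\<Sum>i\<in>UNIV. (nrm (lebesgue_on \<Omega>) (%x. F x $ i))\<^sup>2)"
proof -
  have "(L2_norm \<Omega> F)\<^sup>2 = (LINT x|lebesgue_on \<Omega>. (\<Sum>i\<in>UNIV. (F x $ i)\<^sup>2))"
    unfolding L2_norm_def norm_vec_sq by (simp add: integral_nonneg_AE sum_nonneg)
  also have "\<dots> = (\<Sum>i\<in>UNIV. (nrm (lebesgue_on \<Omega>) (%x. F x $ i))\<^sup>2)"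
    unfolding nrm_sq by (rule Bochner_Integration.integral_sum) (rule sqintD(2)[OF assms])
  finally show ?thesis .
qed

lemma has_weak_pd_iff: "has_weak_pd \<Omega> i u v \<longleftrightarrow>
    (\<forall>\<phi>\<in>test_functions \<Omega>. L2_ip (lebesgue_on \<Omega>) u (pd i \<phi>) = - L2_ip (lebesgue_on \<Omega>) v \<phi>)"
  by (auto simp: has_weak_pd_def distr_eq_def distr_pd_def distr_of_def L2_ip_def minus_equation_iff[of "integral\<^sup>L _ _"] eq_commute)

lemma sobolev_subset: "sobolev B \<Omega> k \<subseteq> B" by (cases k) auto

lemma weak_pd_H:
  assumes "u \<in> H (Suc k) \<Omega>"
  shows "sqint (lebesgue_on \<Omega>) (weak_pd (L2 \<Omega>) \<Omega> i u)" "has_weak_pd \<Omega> i u (weak_pd (L2 \<Omega>) \<Omega> i u)"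
proof -
  obtain v where "v \<in> H k \<Omega>" "has_weak_pd \<Omega> i u v" using assms by auto
  hence "v \<in> L2 \<Omega> & has_weak_pd \<Omega> i u v" using sobolev_subset by blast
  hence "weak_pd (L2 \<Omega>) \<Omega> i u \<in> L2 \<Omega> & has_weak_pd \<Omega> i u (weak_pd (L2 \<Omega>) \<Omega> i u)"
    unfolding weak_pd_def by (rule someI[where P="%v. v \<in> L2 \<Omega> & has_weak_pd \<Omega> i u v"])
  thus "sqint (lebesgue_on \<Omega>) (weak_pd (L2 \<Omega>) \<Omega> i u)" "has_weak_pd \<Omega> i u (weak_pd (L2 \<Omega>) \<Omega> i u)"
    by (auto simp: L2_iff)
qed

lemma weak_pd_AE_unique:
  fixes v w :: "real^'d => real"
  assumes O: "open \<Omega>" and v: "sqint (lebesgue_on \<Omega>) v" and w: "sqint (lebesgue_on \<Omega>) w"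
    and vw: "has_weak_pd \<Omega> i u v" "has_weak_pd \<Omega> i u w"
  shows "AE x in lebesgue_on \<Omega>. v x = w x"
proof -
  have Os: "\<Omega> \<in> sets lebesgue" using O by simp
  have "AE x in lebesgue_on \<Omega>. v x - w x = 0"
  proof (rule fundamental_lemma[OF sqint_diff[OF v w] O])
    fix \<phi> assume t: "\<phi> \<in> test_functions \<Omega>"
    have tq: "sqint (lebesgue_on \<Omega>) \<phi>" by (rule test_sqint_on[OF t Os])
    have "L2_ip (lebesgue_on \<Omega>) v \<phi> = L2_ip (lebesgue_on \<Omega>) w \<phi>"
      using vw t unfolding has_weak_pd_iff by fastforce
    thus "(LINT x|lebesgue_on \<Omega>. (v x - w x) * \<phi> x) = 0"
      using Bochner_Integration.integral_diff[OF sqint_mult[OF v tq] sqint_mult[OF w tq]]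
      by (simp add: L2_ip_def left_diff_distrib)
  qed
  thus ?thesis by simp
qed

lemma L2_ip_cong_AE:
  assumes "AE x in M. v x = w x" "sqint M v" "sqint M w" "t \<in> borel_measurable M"
  shows "L2_ip M v t = L2_ip M w t"
  unfolding L2_ip_def
proof (rule integral_cong_AE)
  show "(%x. v x * t x) \<in> borel_measurable M" "(%x. w x * t x) \<in> borel_measurable M"
    using assms(4) sqintD(1)[OF assms(2)] sqintD(1)[OF assms(3)] by auto
  show "AE x in M. v x * t x = w x * t x" using assms(1) by eventually_elim simp
qed

lemma test_borel_on: "open \<Omega> ==> t \<in> test_functions \<Omega> ==> sqint (lebesgue_on \<Omega>) t"
  by (rule test_sqint_on) simp_all

text \<open>The chosen first derivative agrees only almost everywhere with the one whose derivatives are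
  provided by the definition of the space.\<close>
lemma weak_pd2_H:
  fixes u :: "real^'d => real" and i k :: 'd
  assumes O: "open \<Omega>" and u: "u \<in> H 2 \<Omega>"
  defines "w \<equiv> weak_pd (L2 \<Omega>) \<Omega> i u"
  shows "sqint (lebesgue_on \<Omega>) (weak_pd (L2 \<Omega>) \<Omega> k w)" "has_weak_pd \<Omega> k w (weak_pd (L2 \<Omega>) \<Omega> k w)"
proof -
  have u2: "u \<in> H (Suc (Suc 0)) \<Omega>" using u by (simp only: numeral_2_eq_2)
  obtain v where v: "v \<in> H (Suc 0) \<Omega>" "has_weak_pd \<Omega> i u v" using u2 unfolding sobolev.simps(2)[of _ _ "Suc 0"] by blast
  have vq: "sqint (lebesgue_on \<Omega>) v" using v(1) sobolev_subset[of "L2 \<Omega>"] by (auto simp: L2_iff)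
  have wq: "sqint (lebesgue_on \<Omega>) w" and wu: "has_weak_pd \<Omega> i u w" unfolding w_def by (rule weak_pd_H[OF u2])+
  have ae: "AE x in lebesgue_on \<Omega>. v x = w x" by (rule weak_pd_AE_unique[OF O vq wq v(2) wu])
  let ?z = "weak_pd (L2 \<Omega>) \<Omega> k v"
  have z: "sqint (lebesgue_on \<Omega>) ?z" "has_weak_pd \<Omega> k v ?z" by (rule weak_pd_H[OF v(1)])+
  have "has_weak_pd \<Omega> k w ?z" unfolding has_weak_pd_iff
  proof
    fix \<phi> assume t: "\<phi> \<in> test_functions \<Omega>"
    have "L2_ip (lebesgue_on \<Omega>) v (pd k \<phi>) = L2_ip (lebesgue_on \<Omega>) w (pd k \<phi>)"
      by (rule L2_ip_cong_AE[OF ae vq wq sqintD(1)[OF test_borel_on[OF O test_pd[OF t]]]])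
    thus "L2_ip (lebesgue_on \<Omega>) w (pd k \<phi>) = - L2_ip (lebesgue_on \<Omega>) ?z \<phi>" using z(2) t by (simp add: has_weak_pd_iff)
  qed
  hence "?z \<in> L2 \<Omega> & has_weak_pd \<Omega> k w ?z" using z(1) by (simp add: L2_iff)
  hence "weak_pd (L2 \<Omega>) \<Omega> k w \<in> L2 \<Omega> & has_weak_pd \<Omega> k w (weak_pd (L2 \<Omega>) \<Omega> k w)"
    unfolding weak_pd_def[of _ _ k w] by (rule someI[where P="%v. v \<in> L2 \<Omega> & has_weak_pd \<Omega> k w v"])
  thus "sqint (lebesgue_on \<Omega>) (weak_pd (L2 \<Omega>) \<Omega> k w)" "has_weak_pd \<Omega> k w (weak_pd (L2 \<Omega>) \<Omega> k w)"
    by (auto simp: L2_iff)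
qed

lemma H_Suc0_lin:
  fixes u v :: "real^'d => real"
  assumes O: "open \<Omega>" and u: "u \<in> H (Suc 0) \<Omega>" and v: "v \<in> H (Suc 0) \<Omega>"
  defines "D \<equiv> %i u. weak_pd (L2 \<Omega>) \<Omega> i u"
  shows "(%x. u x + c * v x) \<in> H (Suc 0) \<Omega>"
    "AE x in lebesgue_on \<Omega>. D i (%x. u x + c * v x) x = D i u x + c * D i v x"
proof -
  have uq: "sqint (lebesgue_on \<Omega>) u" and vq: "sqint (lebesgue_on \<Omega>) v"
    using u v sobolev_subset[of "L2 \<Omega>" \<Omega> "Suc 0"] by (auto simp: L2_iff)
  have Dq: "sqint (lebesgue_on \<Omega>) (D i u)" "sqint (lebesgue_on \<Omega>) (D i v)" for i
    unfolding D_def by (rule weak_pd_H[OF u], rule weak_pd_H[OF v])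
  have lq: "sqint (lebesgue_on \<Omega>) (%x. D i u x + c * D i v x)" for i by (rule sqint_lin[OF Dq])
  have ip: "L2_ip (lebesgue_on \<Omega>) (%x. f x + c * g x) t = L2_ip (lebesgue_on \<Omega>) f t + c * L2_ip (lebesgue_on \<Omega>) g t"
    if "sqint (lebesgue_on \<Omega>) f" "sqint (lebesgue_on \<Omega>) g" "t \<in> test_functions \<Omega>" for f g t
    using L2.B_lin[of f "lebesgue_on \<Omega>" g t c] that test_borel_on[OF O that(3)] by simp
  have w: "has_weak_pd \<Omega> i (%x. u x + c * v x) (%x. D i u x + c * D i v x)" for i
    unfolding has_weak_pd_iff
  proof
    fix \<phi> assume t: "\<phi> \<in> test_functions \<Omega>"
    have "L2_ip (lebesgue_on \<Omega>) u (pd i \<phi>) = - L2_ip (lebesgue_on \<Omega>) (D i u) \<phi>" "L2_ip (lebesgue_on \<Omega>) v (pd i \<phi>) = - L2_ip (lebesgue_on \<Omega>) (D i v) \<phi>"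
      using weak_pd_H(2)[OF u, of i] weak_pd_H(2)[OF v, of i] t unfolding has_weak_pd_iff D_def by auto
    thus "L2_ip (lebesgue_on \<Omega>) (%x. u x + c * v x) (pd i \<phi>) = - L2_ip (lebesgue_on \<Omega>) (%x. D i u x + c * D i v x) \<phi>"
      by (simp add: ip[OF uq vq test_pd[OF t]] ip[OF Dq t])
  qed
  have aL: "(%x. u x + c * v x) \<in> L2 \<Omega>" unfolding L2_iff by (rule sqint_lin[OF uq vq])
  have bL: "(%x. D i u x + c * D i v x) \<in> L2 \<Omega>" for i unfolding L2_iff by (rule lq)
  show H1: "(%x. u x + c * v x) \<in> H (Suc 0) \<Omega>"
    unfolding sobolev.simps mem_Collect_eq by (intro conjI allI aL) (rule bexI[OF _ bL], rule w)
  show "AE x in lebesgue_on \<Omega>. D i (%x. u x + c * v x) x = D i u x + c * D i v x"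
    by (rule weak_pd_AE_unique[OF O _ lq _ w]) (unfold D_def, (rule weak_pd_H[OF H1])+)
qed

definition H1_ip :: "(real^'d) set => (real^'d => real) => (real^'d => real) => real" where
  "H1_ip \<Omega> u v = L2_ip (lebesgue_on \<Omega>) u v
    + (\<Sum>i\<in>UNIV. L2_ip (lebesgue_on \<Omega>) (weak_pd (L2 \<Omega>) \<Omega> i u) (weak_pd (L2 \<Omega>) \<Omega> i v))"

lemma semi_inner_H1:
  assumes O: "open (\<Omega> :: (real^'d) set)"
  shows "semi_inner (H (Suc 0) \<Omega>) (H1_ip \<Omega>)"
proof
  have sq: "sqint (lebesgue_on \<Omega>) u" if "u \<in> H (Suc 0) \<Omega>" for u :: "real^'d => real"
    using that sobolev_subset[of "L2 \<Omega>" \<Omega> "Suc 0"] by (auto simp: L2_iff)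
  have w: "has_weak_pd \<Omega> i (%x. 0) (%x. 0)" for i by (simp add: has_weak_pd_iff L2_ip_def)
  have z: "(%x::real^'d. 0::real) \<in> L2 \<Omega>" unfolding L2_iff by (rule sqint_0)
  show "(%x. 0) \<in> H (Suc 0) \<Omega>" unfolding sobolev.simps mem_Collect_eq by (intro conjI allI z) (rule bexI[OF _ z], rule w)
  show "(%x. f x + c * g x) \<in> H (Suc 0) \<Omega>" if "f \<in> H (Suc 0) \<Omega>" "g \<in> H (Suc 0) \<Omega>" for f g c
    by (rule H_Suc0_lin[OF O that])
  show "H1_ip \<Omega> f g = H1_ip \<Omega> g f" for f g by (simp add: H1_ip_def L2_ip_def mult.commute)
  show "H1_ip \<Omega> f f >= 0" for f by (simp add: H1_ip_def L2_ip_def add_nonneg_nonneg sum_nonneg)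
  fix f g h c assume V: "f \<in> H (Suc 0) \<Omega>" "g \<in> H (Suc 0) \<Omega>" "h \<in> H (Suc 0) \<Omega>"
  let ?D = "%i u. weak_pd (L2 \<Omega>) \<Omega> i u"
  have ip: "L2_ip (lebesgue_on \<Omega>) (%x. a x + c * b x) t = L2_ip (lebesgue_on \<Omega>) a t + c * L2_ip (lebesgue_on \<Omega>) b t"
    if "sqint (lebesgue_on \<Omega>) a" "sqint (lebesgue_on \<Omega>) b" "sqint (lebesgue_on \<Omega>) t" for a b t
    using L2.B_lin[of a "lebesgue_on \<Omega>" b t c] that by simp
  have "L2_ip (lebesgue_on \<Omega>) (?D i (%x. f x + c * g x)) (?D i h) = L2_ip (lebesgue_on \<Omega>) (?D i f) (?D i h) + c * L2_ip (lebesgue_on \<Omega>) (?D i g) (?D i h)" for i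
  proof -
    have "L2_ip (lebesgue_on \<Omega>) (?D i (%x. f x + c * g x)) (?D i h) = L2_ip (lebesgue_on \<Omega>) (%x. ?D i f x + c * ?D i g x) (?D i h)"
      by (rule L2_ip_cong_AE[OF H_Suc0_lin(2)[OF O V(1,2)] weak_pd_H(1)[OF H_Suc0_lin(1)[OF O V(1,2)]]
        sqint_lin[OF weak_pd_H(1)[OF V(1)] weak_pd_H(1)[OF V(2)]] sqintD(1)[OF weak_pd_H(1)[OF V(3)]]])
    thus ?thesis using ip[OF weak_pd_H(1)[OF V(1)] weak_pd_H(1)[OF V(2)] weak_pd_H(1)[OF V(3)]] by simp
  qed
  thus "H1_ip \<Omega> (%x. f x + c * g x) h = H1_ip \<Omega> f h + c * H1_ip \<Omega> g h"
    unfolding H1_ip_def ip[OF sq[OF V(1)] sq[OF V(2)] sq[OF V(3)]] by (simp add: sum.distrib sum_distrib_left distrib_left)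
qed

text \<open>This identifies the norm of \<open>H\<^sup>1(\<Omega>)\<close> with the seminorm of the form \<open>H1_ip\<close>.\<close>
lemma H1_norm_sq:
  assumes "u \<in> H (Suc 0) \<Omega>"
  shows "(H1_norm \<Omega> u)\<^sup>2 = (nrm (lebesgue_on \<Omega>) u)\<^sup>2 + (\<Sum>i\<in>UNIV. (nrm (lebesgue_on \<Omega>) (weak_pd (L2 \<Omega>) \<Omega> i u))\<^sup>2)"
proof -
  have q: "sqint (lebesgue_on \<Omega>) (%x. grad \<Omega> u x $ i)" for i
    using weak_pd_H(1)[OF assms, of i] by (simp add: weak_grad_def)
  have "(H1_norm \<Omega> u)\<^sup>2 = (L2_norm \<Omega> u)\<^sup>2 + (L2_norm \<Omega> (grad \<Omega> u))\<^sup>2" unfolding H1_norm_def by (rule real_sqrt_pow2) simp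
  thus ?thesis unfolding L2_norm_vec[OF q] L2_norm_eq by (simp add: weak_grad_def)
qed

lemma H1_norm_bounds:
  assumes "u \<in> H (Suc 0) \<Omega>"
  shows "nrm (lebesgue_on \<Omega>) u <= H1_norm \<Omega> u" "nrm (lebesgue_on \<Omega>) (weak_pd (L2 \<Omega>) \<Omega> i u) <= H1_norm \<Omega> u"
proof -
  have H0: "H1_norm \<Omega> u >= 0" by (simp add: H1_norm_def)
  show "nrm (lebesgue_on \<Omega>) u <= H1_norm \<Omega> u"
    by (rule power2_le_imp_le[OF _ H0]) (simp add: H1_norm_sq[OF assms] sum_nonneg)
  have "(nrm (lebesgue_on \<Omega>) (weak_pd (L2 \<Omega>) \<Omega> i u))\<^sup>2 <= (\<Sum>i\<in>UNIV. (nrm (lebesgue_on \<Omega>) (weak_pd (L2 \<Omega>) \<Omega> i u))\<^sup>2)"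
    by (rule member_le_sum) auto
  hence "(nrm (lebesgue_on \<Omega>) (weak_pd (L2 \<Omega>) \<Omega> i u))\<^sup>2 <= (H1_norm \<Omega> u)\<^sup>2"
    unfolding H1_norm_sq[OF assms] using zero_le_power2[of "nrm (lebesgue_on \<Omega>) u"] by linarith
  thus "nrm (lebesgue_on \<Omega>) (weak_pd (L2 \<Omega>) \<Omega> i u) <= H1_norm \<Omega> u" by (rule power2_le_imp_le[OF _ H0])
qed

text \<open>Otherwise there is a sequence \<open>\<epsilon>\<^sub>n \<rightarrow> 0\<close> along which the norms grow like \<open>4\<^sup>n\<close>, while every functional converges
  along it. A family indexed by \<open>\<epsilon>\<close> need only be bounded near zero.\<close>
lemma weakly_convergent_bounded:
  fixes u :: "real => real^'d => real"
  assumes O: "open \<Omega>" and uH: "!!eps. eps > 0 ==> u eps \<in> H (Suc 0) \<Omega>"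
    and wc: "weakly_tendsto (H (Suc 0) \<Omega>) (H1_norm \<Omega>) u u\<^sub>0 (at_right 0)"
  obtains C where "\<forall>\<^sub>F eps in at_right 0. H1_norm \<Omega> (u eps) <= C"
proof (rule ccontr)
  assume no: "\<not> thesis"
  interpret H1: semi_inner "H (Suc 0) \<Omega>" "H1_ip \<Omega>" by (rule semi_inner_H1[OF O])
  have Neq: "H1.N v = H1_norm \<Omega> v" if "v \<in> H (Suc 0) \<Omega>" for v
  proof -
    have "H1_ip \<Omega> v v = (H1_norm \<Omega> v)\<^sup>2" unfolding H1_norm_sq[OF that] nrm_sq H1_ip_def L2_ip_def by (simp add: power2_eq_square)
    thus ?thesis by (simp add: H1.N_def H1_norm_def)
  qed
  have "\<forall>n. \<exists>eps. 0 < eps & eps < 1 / real (Suc n) & H1_norm \<Omega> (u eps) >= 4^n"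
  proof (rule allI, rule ccontr)
    fix n assume a: "\<not> (\<exists>eps. 0 < eps & eps < 1 / real (Suc n) & H1_norm \<Omega> (u eps) >= 4^n)"
    have "\<forall>\<^sub>F eps in at_right 0. H1_norm \<Omega> (u eps) <= 4^n"
      unfolding eventually_at_right_field
    proof (intro exI[of _ "1 / real (Suc n)"] conjI allI impI)
      fix eps :: real assume "0 < eps" "eps < 1 / real (Suc n)"
      with a have "\<not> H1_norm \<Omega> (u eps) >= 4^n" by blast
      thus "H1_norm \<Omega> (u eps) <= 4^n" by linarith
    qed simp
    with no that show False by blast
  qed
  from choice[OF this] obtain s where s: "\<forall>n. 0 < s n & s n < 1 / real (Suc n) & H1_norm \<Omega> (u (s n)) >= 4^n" ..
  have s0: "s \<longlonglongrightarrow> 0"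
  proof (rule Lim_null_comparison)
    have "norm (s n) <= 1 / real (Suc n)" for n using s[rule_format, of n] by simp
    thus "\<forall>\<^sub>F n in sequentially. norm (s n) <= 1 / real (Suc n)" by (intro always_eventually allI)
    show "(%n. 1 / real (Suc n)) \<longlonglongrightarrow> 0" using LIMSEQ_Suc[OF lim_1_over_n[where 'a=real]] by simp
  qed
  have fl: "filterlim s (at_right 0) sequentially"
  proof -
    have sp: "s n \<in> {0<..}" "s n ~= 0" for n using s[rule_format, of n] by simp_all
    show ?thesis unfolding filterlim_at by (intro conjI always_eventually allI s0 sp)
  qed
  have "\<not> (\<forall>k. H1.N (u (s k)) >= 4^k)"
  proof (rule H1.uniform_boundedness)
    show "u (s n) \<in> H (Suc 0) \<Omega>" for n by (rule uH) (use s in blast)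
    fix l assume l: "bounded_functional (H (Suc 0) \<Omega>) H1.N l"
    have "bounded_functional (H (Suc 0) \<Omega>) (H1_norm \<Omega>) l" using l unfolding bounded_functional_def by (simp add: Neq cong: ball_cong)
    hence "((%eps. l (u eps)) \<longlongrightarrow> l u\<^sub>0) (at_right 0)" using wc unfolding weakly_tendsto_def by blast
    from filterlim_compose[OF this fl] show "Bseq (%n. l (u (s n)))" by (intro convergent_imp_Bseq convergentI)
  qed
  moreover have "H1.N (u (s k)) >= 4^k" for k using s[rule_format, of k] Neq[OF uH[of "s k"]] by simp
  ultimately show False by blast
qed

lemma weakly_convergent_L2_ip:
  fixes u :: "real => real^'d => real"
  assumes wc: "weakly_tendsto (H (Suc 0) \<Omega>) (H1_norm \<Omega>) u u\<^sub>0 F" and t: "sqint (lebesgue_on \<Omega>) t"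
  shows "((%eps. L2_ip (lebesgue_on \<Omega>) (u eps) t) \<longlongrightarrow> L2_ip (lebesgue_on \<Omega>) u\<^sub>0 t) F"
proof -
  let ?M = "lebesgue_on \<Omega>"
  have sq: "sqint ?M u" if "u \<in> H (Suc 0) \<Omega>" for u :: "real^'d => real"
    using that sobolev_subset[of "L2 \<Omega>" \<Omega> "Suc 0"] by (auto simp: L2_iff)
  have "bounded_functional (H (Suc 0) \<Omega>) (H1_norm \<Omega>) (%v. L2_ip ?M v t)"
    unfolding bounded_functional_def
  proof (intro conjI ballI allI exI)
    fix f g :: "real^'d => real" assume fg: "f \<in> H (Suc 0) \<Omega>" "g \<in> H (Suc 0) \<Omega>"
    show "L2_ip ?M (%x. f x + g x) t = L2_ip ?M f t + L2_ip ?M g t"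
      using L2.B_lin[of f ?M g t 1] sq[OF fg(1)] sq[OF fg(2)] t by simp
  next
    fix c and f :: "real^'d => real"
    show "L2_ip ?M (%x. c *\<^sub>R f x) t = c * L2_ip ?M f t" by (simp add: L2_ip_def mult.assoc)
  next
    fix f :: "real^'d => real" assume f: "f \<in> H (Suc 0) \<Omega>"
    have "\<bar>L2_ip ?M f t\<bar> <= nrm ?M f * nrm ?M t" unfolding L2_ip_def by (rule L2_Cauchy_Schwarz[OF sq[OF f] t])
    also have "\<dots> <= H1_norm \<Omega> f * nrm ?M t" by (rule mult_right_mono[OF H1_norm_bounds(1)[OF f] nrm_nonneg])
    finally show "\<bar>L2_ip ?M f t\<bar> <= nrm ?M t * H1_norm \<Omega> f" by (simp add: mult.commute)
  qed
  thus ?thesis using wc unfolding weakly_tendsto_def by blast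
qed

text \<open>A functional on vector fields is a sum of functionals of the components, each represented by an \<open>L\<^sup>2\<close>
  function; by boundedness the latter may be replaced by a test function.\<close>
lemma weakly_tendsto_L2_vecI:
  fixes F :: "real => real^'d => real^'d" and F\<^sub>0 :: "real^'d => real^'d"
  assumes O: "open \<Omega>" and Fq: "!!eps i. eps > 0 ==> sqint (lebesgue_on \<Omega>) (%x. F eps x $ i)"
    and F0q: "!!i. sqint (lebesgue_on \<Omega>) (%x. F\<^sub>0 x $ i)"
    and bd: "!!i. \<forall>\<^sub>F eps in at_right 0. nrm (lebesgue_on \<Omega>) (%x. F eps x $ i) <= L"
    and lim: "!!i t. t \<in> test_functions \<Omega> ==>
      ((%eps. L2_ip (lebesgue_on \<Omega>) (%x. F eps x $ i) t) \<longlongrightarrow> L2_ip (lebesgue_on \<Omega>) (%x. F\<^sub>0 x $ i) t) (at_right 0)"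
  shows "weakly_tendsto (L2 \<Omega>) (L2_norm \<Omega>) F F\<^sub>0 (at_right 0)"
  unfolding weakly_tendsto_def
proof (intro conjI allI impI)
  let ?M = "lebesgue_on \<Omega>"
  show "\<forall>\<^sub>F eps in at_right 0. F eps \<in> L2 \<Omega>" using at_right_01 by eventually_elim (intro L2_vecI Fq, simp)
  show "F\<^sub>0 \<in> L2 \<Omega>" by (rule L2_vecI[OF F0q])
  fix l :: "(real^'d => real^'d) => real" assume l: "bounded_functional (L2 \<Omega>) (L2_norm \<Omega>) l"
  have l_add: "l (%x. f x + g x) = l f + l g" if "f \<in> L2 \<Omega>" "g \<in> L2 \<Omega>" for f g using l that unfolding bounded_functional_def by blast
  have l_scale: "l (%x. c *\<^sub>R f x) = c * l f" if "f \<in> L2 \<Omega>" for f c using l that unfolding bounded_functional_def by blast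
  obtain K where K: "!!f. f \<in> L2 \<Omega> ==> \<bar>l f\<bar> <= K * L2_norm \<Omega> f" using l unfolding bounded_functional_def by blast
  \<comment> \<open>The vector field with \<open>i\<close>-th component \<open>h\<close> and all others zero.\<close>
  define E where "E i h = (%x. h x *\<^sub>R (axis i 1 :: real^'d))" for i and h :: "real^'d => real"
  have Ec: "E i h x $ k = (if k = i then 1 else 0) * h x" for i h x k by (simp add: E_def axis_def)
  have Eq: "sqint ?M (%x. E i h x $ k)" if "sqint ?M h" for i h k
    unfolding Ec by (rule sqint_scale[OF that])
  have EL: "E i h \<in> L2 \<Omega>" if "sqint ?M h" for i h by (rule L2_vecI[OF Eq[OF that]])
  have EN: "L2_norm \<Omega> (E i h) = nrm ?M h" if "sqint ?M h" for i h
  proof -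
    have "(L2_norm \<Omega> (E i h))\<^sup>2 = (\<Sum>k\<in>UNIV. (nrm ?M (%x. (if k = i then 1 else 0) * h x))\<^sup>2)"
      using L2_norm_vec[OF Eq[OF that]] unfolding Ec .
    also have "\<dots> = (\<Sum>k\<in>UNIV. if k = i then (nrm ?M h)\<^sup>2 else 0)" by (intro sum.cong refl) (simp add: nrm_scale)
    also have "\<dots> = (nrm ?M h)\<^sup>2" by simp
    finally show ?thesis by (rule power2_eq_imp_eq) (simp_all add: L2_norm_def nrm_nonneg integral_nonneg_AE)
  qed
  have "\<exists>g. sqint ?M g & (\<forall>h. sqint ?M h --> l (E i h) = L2_ip ?M h g)" for i
  proof -
    have lin: "l (E i (%x. f x + c * g x)) = l (E i f) + c * l (E i g)" if "sqint ?M f" "sqint ?M g" for f g c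
    proof -
      have 1: "E i (%x. f x + c * g x) = (%x. E i f x + E i (%x. c * g x) x)" by (simp add: E_def scaleR_add_left)
      have 2: "E i (%x. c * g x) = (%x. c *\<^sub>R E i g x)" by (simp add: E_def)
      have "l (E i (%x. f x + c * g x)) = l (E i f) + l (E i (%x. c * g x))"
        unfolding 1 by (rule l_add[OF EL[OF that(1)] EL[OF sqint_scale[OF that(2)]]])
      also have "l (E i (%x. c * g x)) = c * l (E i g)" unfolding 2 by (rule l_scale[OF EL[OF that(2)]])
      finally show ?thesis .
    qed
    have bnd: "\<bar>l (E i f)\<bar> <= K * nrm ?M f" if "sqint ?M f" for f using K[OF EL[OF that]] EN[OF that] by simp
    show ?thesis
    proof (rule L2_riesz[where l="%h. l (E i h)", OF lin bnd])
      fix g assume g: "sqint ?M g" "!!f. sqint ?M f ==> l (E i f) = (LINT x|?M. f x * g x)"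
      show "\<exists>g. sqint ?M g & (\<forall>h. sqint ?M h --> l (E i h) = L2_ip ?M h g)"
        by (rule exI[of _ g]) (simp add: g L2_ip_def)
    qed
  qed
  hence "\<forall>i. \<exists>g. sqint ?M g & (\<forall>h. sqint ?M h --> l (E i h) = L2_ip ?M h g)" ..
  from choice[OF this] obtain g where g: "\<forall>i. sqint ?M (g i) & (\<forall>h. sqint ?M h --> l (E i h) = L2_ip ?M h (g i))" ..
  have gq: "sqint ?M (g i)" for i using g by blast
  have rep: "l G = (\<Sum>i\<in>UNIV. L2_ip ?M (%x. G x $ i) (g i))" if G: "!!i. sqint ?M (%x. G x $ i)" for G
  proof -
    have "l (%x. \<Sum>i\<in>S. E i (%x. G x $ i) x) = (\<Sum>i\<in>S. l (E i (%x. G x $ i))) & (%x. \<Sum>i\<in>S. E i (%x. G x $ i) x) \<in> L2 \<Omega>" if "finite S" for S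
      using that
    proof (induction S rule: finite_induct)
      case empty
      have z: "(%x. 0 :: real^'d) \<in> L2 \<Omega>" by (rule L2_vecI) (simp add: sqint_0)
      have "l (%x. 0) = 0" using l_scale[OF z, of 0] by simp
      thus ?case using z by simp
    next
      case (insert i S)
      have "l (%x. E i (%x. G x $ i) x + (\<Sum>i\<in>S. E i (%x. G x $ i) x)) = l (E i (%x. G x $ i)) + (\<Sum>i\<in>S. l (E i (%x. G x $ i)))"
        using l_add[OF EL[OF G, of i i]] insert.IH by auto
      moreover have "(%x. E i (%x. G x $ i) x + (\<Sum>i\<in>S. E i (%x. G x $ i) x)) \<in> L2 \<Omega>"
      proof (rule L2_vecI)
        fix k
        have "sqint ?M (%x. \<Sum>a\<in>insert i S. E a (%x. G x $ a) x $ k)"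
          by (rule sqint_sum) (use insert Eq[OF G] in auto)
        thus "sqint ?M (%x. (E i (%x. G x $ i) x + (\<Sum>i\<in>S. E i (%x. G x $ i) x)) $ k)" using insert by simp
      qed
      ultimately show ?case using insert by simp
    qed
    from conjunct1[OF this[of UNIV]] have "l (%x. \<Sum>i\<in>UNIV. E i (%x. G x $ i) x) = (\<Sum>i\<in>UNIV. l (E i (%x. G x $ i)))" by simp
    moreover have "(%x. \<Sum>i\<in>UNIV. E i (%x. G x $ i) x) = G" by (rule ext) (simp add: vec_eq_iff Ec if_distrib[of "%c. c * _"] cong: if_cong)
    ultimately show ?thesis using g G by simp
  qed
  have one: "((%eps. L2_ip ?M (%x. F eps x $ i) (g i)) \<longlongrightarrow> L2_ip ?M (%x. F\<^sub>0 x $ i) (g i)) (at_right 0)" for i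
  proof -
    let ?f = "%eps x. F eps x $ i" and ?w = "%x. F\<^sub>0 x $ i"
    have "((%eps. L2_ip ?M (?f eps) (g i) - L2_ip ?M ?w (g i)) \<longlongrightarrow> 0) (at_right 0)"
    proof (rule tendsto_zero_approx)
      fix e :: real assume e: "e > 0"
      define B where "B = \<bar>L\<bar> + nrm ?M ?w + 1"
      have B: "B > 0" using nrm_nonneg[of ?M ?w] by (simp add: B_def)
      obtain t where t: "t \<in> test_functions \<Omega>" "nrm ?M (%x. t x - g i x) < e / B"
        using test_dense_L2[OF O gq, of "e / B" i] e B by auto
      have tq: "sqint ?M t" by (rule test_borel_on[OF O t(1)])
      let ?d = "%x. t x - g i x"
      have dq: "sqint ?M ?d" by (rule sqint_diff[OF tq gq])
      have split: "L2_ip ?M v (g i) = L2_ip ?M v t - L2_ip ?M v ?d" if "sqint ?M v" for v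
        using L2.B_lin_right[of t ?M "g i" v "-1"] that tq gq by simp
      have CS: "\<bar>L2_ip ?M v ?d\<bar> <= nrm ?M v * (e / B)" if "sqint ?M v" for v
        using L2_Cauchy_Schwarz[OF that dq] mult_left_mono[OF less_imp_le[OF t(2)] nrm_nonneg[of ?M v]] by (simp add: L2_ip_def)
      show "\<exists>Y Z. (\<forall>\<^sub>F eps in at_right 0. L2_ip ?M (?f eps) (g i) - L2_ip ?M ?w (g i) = Y eps + Z eps)
          & (Y \<longlongrightarrow> 0) (at_right 0) & (\<forall>\<^sub>F eps in at_right 0. \<bar>Z eps\<bar> <= e)"
      proof (rule exI[of _ "%eps. L2_ip ?M (?f eps) t - L2_ip ?M ?w t"], rule exI[of _ "%eps. L2_ip ?M ?w ?d - L2_ip ?M (?f eps) ?d"], intro conjI)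
        show "\<forall>\<^sub>F eps in at_right 0. L2_ip ?M (?f eps) (g i) - L2_ip ?M ?w (g i) = L2_ip ?M (?f eps) t - L2_ip ?M ?w t + (L2_ip ?M ?w ?d - L2_ip ?M (?f eps) ?d)"
          using at_right_01 by eventually_elim (simp add: split Fq F0q)
        show "((%eps. L2_ip ?M (?f eps) t - L2_ip ?M ?w t) \<longlongrightarrow> 0) (at_right 0)" by (rule LIM_zero[OF lim[OF t(1)]])
        show "\<forall>\<^sub>F eps in at_right 0. \<bar>L2_ip ?M ?w ?d - L2_ip ?M (?f eps) ?d\<bar> <= e"
          using bd[of i] at_right_01
        proof eventually_elim
          case (elim eps)
          have "nrm ?M (?f eps) * (e / B) <= \<bar>L\<bar> * (e / B)" by (rule mult_right_mono) (use elim e B in auto)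
          hence "\<bar>L2_ip ?M ?w ?d - L2_ip ?M (?f eps) ?d\<bar> <= nrm ?M ?w * (e / B) + \<bar>L\<bar> * (e / B)"
            using CS[OF F0q[of i]] CS[OF Fq[of eps i]] elim by linarith
          also have "\<dots> <= B * (e / B)" unfolding distrib_right[symmetric] by (rule mult_right_mono) (use e B in \<open>auto simp: B_def\<close>)
          also have "\<dots> = e" using B by simp
          finally show ?case .
        qed
      qed
    qed
    thus ?thesis by (rule LIM_zero_cancel)
  qed
  have "((%eps. \<Sum>i\<in>UNIV. L2_ip ?M (%x. F eps x $ i) (g i)) \<longlongrightarrow> (\<Sum>i\<in>UNIV. L2_ip ?M (%x. F\<^sub>0 x $ i) (g i))) (at_right 0)"
    by (rule tendsto_sum[OF one])
  hence "((%eps. \<Sum>i\<in>UNIV. L2_ip ?M (%x. F eps x $ i) (g i)) \<longlongrightarrow> l F\<^sub>0) (at_right 0)" by (simp only: rep[OF F0q])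
  thus "((%eps. l (F eps)) \<longlongrightarrow> l F\<^sub>0) (at_right 0)"
  proof (rule Lim_transform_eventually)
    show "\<forall>\<^sub>F eps in at_right 0. (\<Sum>i\<in>UNIV. L2_ip ?M (%x. F eps x $ i) (g i)) = l (F eps)"
      using at_right_01 by eventually_elim (rule rep[OF Fq, symmetric], simp)
  qed
qed

text \<open>The distributional bilaplacian with two of its four derivatives moved back to \<open>u\<close>, as \<open>u\<close> has no more.\<close>
lemma bilaplace_weak:
  fixes u :: "real^'d => real"
  assumes O: "open \<Omega>" and u: "u \<in> H 2 \<Omega>" and t: "t \<in> test_functions \<Omega>"
  shows "(\<Sum>j\<in>UNIV. L2_ip (lebesgue_on \<Omega>) (weak_pd (L2 \<Omega>) \<Omega> j u) (pd j t)) = - L2_ip (lebesgue_on \<Omega>) (laplacian \<Omega> u) t"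
    "distr_laplace (distr_laplace (distr_of \<Omega> u)) t = (\<Sum>i\<in>UNIV. L2_ip (lebesgue_on \<Omega>) (laplacian \<Omega> u) (pd i (pd i t)))"
proof -
  let ?M = "lebesgue_on \<Omega>" and ?D = "%i u. weak_pd (L2 \<Omega>) \<Omega> i u"
  have u2: "u \<in> H (Suc (Suc 0)) \<Omega>" using u by (simp only: numeral_2_eq_2)
  have q: "sqint ?M (?D j (?D j u))" for j by (rule weak_pd2_H(1)[OF O u])
  have L: "(\<Sum>j\<in>UNIV. L2_ip ?M (?D j (?D j u)) s) = L2_ip ?M (laplacian \<Omega> u) s" if s: "s \<in> test_functions \<Omega>" for s
  proof -
    have sq: "sqint ?M s" by (rule test_borel_on[OF O s])
    have "L2_ip ?M (laplacian \<Omega> u) s = (LINT x|?M. (\<Sum>j\<in>UNIV. ?D j (?D j u) x * s x))" by (simp add: L2_ip_def laplacian_def sum_distrib_right)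
    also have "\<dots> = (\<Sum>j\<in>UNIV. L2_ip ?M (?D j (?D j u)) s)"
      unfolding L2_ip_def by (rule Bochner_Integration.integral_sum) (rule sqint_mult[OF q sq])
    finally show ?thesis by simp
  qed
  have d: "L2_ip ?M (?D j u) (pd j s) = - L2_ip ?M (?D j (?D j u)) s" if "s \<in> test_functions \<Omega>" for j s
    using weak_pd2_H(2)[OF O u, of j j] that unfolding has_weak_pd_iff by blast
  show "(\<Sum>j\<in>UNIV. L2_ip ?M (?D j u) (pd j t)) = - L2_ip ?M (laplacian \<Omega> u) t"
    by (simp add: d[OF t] sum_negf L[OF t])
  have "L2_ip ?M u (pd j (pd j s)) = L2_ip ?M (?D j (?D j u)) s" if "s \<in> test_functions \<Omega>" for j s
    using weak_pd_H(2)[OF u2, of j] test_pd[OF that, of j] d[OF that] unfolding has_weak_pd_iff by fastforce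
  hence L': "(\<Sum>j\<in>UNIV. L2_ip ?M u (pd j (pd j s))) = L2_ip ?M (laplacian \<Omega> u) s" if "s \<in> test_functions \<Omega>" for s
    using L[OF that] that by simp
  have "distr_laplace (distr_laplace (distr_of \<Omega> u)) t = (\<Sum>i\<in>UNIV. \<Sum>j\<in>UNIV. L2_ip ?M u (pd j (pd j (pd i (pd i t)))))"
    by (simp add: distr_laplace_def distr_pd_def distr_of_def L2_ip_def)
  thus "distr_laplace (distr_laplace (distr_of \<Omega> u)) t = (\<Sum>i\<in>UNIV. L2_ip ?M (laplacian \<Omega> u) (pd i (pd i t)))"
    by (simp add: L'[OF test_pd[OF test_pd[OF t]]])
qed

lemma neg_distr_div: "- distr_div \<Omega> F t = (\<Sum>i\<in>UNIV. L2_ip (lebesgue_on \<Omega>) (%x. F x $ i) (pd i t))"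
  by (simp add: distr_div_def distr_pd_def distr_of_def L2_ip_def sum_negf)

lemma A_hom_eq: "\<theta> ~= \<infinity> ==> A_hom A \<theta> = corrected_mean A (enn2real \<theta>)"
  by (simp add: A_hom_def)

lemma A_hom_symmetric:
  assumes A: "periodic_elliptic A" shows "A_hom A \<theta> $ a $ b = A_hom A \<theta> $ b $ a"
proof (cases "\<theta> = \<infinity>")
  case True
  have "AE y in lebesgue. A y $ a $ b = A y $ b $ a"
    using A unfolding periodic_elliptic_def
    by (elim conjE, elim eventually_mono) (auto simp: transpose_def vec_eq_iff)
  hence "AE y in cellm. A y $ a $ b = A y $ b $ a"
    using cell_sets by (subst AE_restrict_space_iff) (auto elim: eventually_mono)
  hence "(LINT y|cellm. A y $ a $ b) = (LINT y|cellm. A y $ b $ a)"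
    by (intro integral_cong_AE sqintD(1) L2_perD(3) A_entry_L2_per[OF A])
  thus ?thesis using True by (simp add: A_hom_def mean_def)
next
  case False
  show ?thesis unfolding A_hom_eq[OF False] by (rule corrected_mean_symmetric[OF A]) simp
qed

context oscillating_family
begin

text \<open>For finite \<open>\<rho>\<close> the bracket is \<open>(\<kappa>/\<epsilon> - \<rho>\<^sup>2 \<epsilon>/\<kappa>) \<Delta>\<psi>\<close>, and its factor tends to \<open>\<rho> - \<rho>\<^sup>2/\<rho> = 0\<close>; for \<open>\<rho> = 0\<close> the second
  term is absent. For \<open>\<kappa>/\<epsilon> \<rightarrow> \<infinity>\<close> it is \<open>- (\<epsilon>/\<kappa>) h\<close>.\<close>
lemma flux_limit_A_hom:
  assumes lim: "((%eps. ennreal (\<kappa> eps / eps)) \<longlongrightarrow> \<theta>) (at_right 0)" and t: "t \<in> test_functions \<Omega>"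
  shows "((%eps. I (AU eps j) t) \<longlongrightarrow> (\<Sum>i\<in>UNIV. A_hom A \<theta> $ i $ j * I (D0 i) t)) (at_right 0)"
proof (cases "\<theta> = \<infinity>")
  case True
  have "filterlim (%eps. \<kappa> eps / eps) at_top (at_right 0)" using lim True by (simp add: ennreal_tendsto_top_eq_at_top)
  from tendsto_inverse_0_at_top[OF this] have k: "((%eps. eps / \<kappa> eps) \<longlongrightarrow> 0) (at_right 0)" by simp
  have "((%eps. I (AU eps j) t) \<longlongrightarrow> (\<Sum>i\<in>UNIV. mean (%y. A y $ i $ j) * I (D0 i) t)) (at_right 0)"
  proof (rule flux_limit[OF approx_flux_infinite[OF A] _ t])
    fix \<psi> h :: "real^'d => real" assume h: "smooth_per h" and p: "\<psi> = (%x. 0)"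
    obtain B where B: "B > 0" "!!y. \<bar>h y\<bar> <= B" by (rule smooth_per_bounded[OF h]) blast
    have l0: "laplace \<psi> y = 0" for y by (simp add: laplace_def p pd_const)
    show "\<exists>\<delta>. (\<delta> \<longlongrightarrow> 0) (at_right 0) & (\<forall>\<^sub>F eps in at_right 0. \<forall>y. \<bar>(\<kappa> eps / eps) * laplace \<psi> y - (eps / \<kappa> eps) * h y\<bar> <= \<delta> eps)"
    proof (rule exI[of _ "%eps. \<bar>eps / \<kappa> eps\<bar> * B"], intro conjI always_eventually allI)
      show "((%eps. \<bar>eps / \<kappa> eps\<bar> * B) \<longlongrightarrow> 0) (at_right 0)" by (rule tendsto_mult_left_zero[OF tendsto_rabs_zero[OF k]])
      fix eps y
      have "\<bar>(\<kappa> eps / eps) * laplace \<psi> y - (eps / \<kappa> eps) * h y\<bar> = \<bar>eps / \<kappa> eps\<bar> * \<bar>h y\<bar>" by (simp add: l0 abs_mult)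
      also have "\<dots> <= \<bar>eps / \<kappa> eps\<bar> * B" by (rule mult_left_mono[OF B(2)]) simp
      finally show "\<bar>(\<kappa> eps / eps) * laplace \<psi> y - (eps / \<kappa> eps) * h y\<bar> <= \<bar>eps / \<kappa> eps\<bar> * B" .
    qed
  qed
  thus ?thesis using True by (simp add: A_hom_def)
next
  case False
  define \<rho> where "\<rho> = enn2real \<theta>"
  have \<rho>0: "\<rho> >= 0" by (simp add: \<rho>_def)
  have \<theta>: "\<theta> = ennreal \<rho>" using False by (simp add: \<rho>_def top.not_eq_extremum)
  have k: "((%eps. \<kappa> eps / eps) \<longlongrightarrow> \<rho>) (at_right 0)"
  proof (rule tendsto_ennrealD[OF _ _ \<rho>0])
    show "((%eps. ennreal (\<kappa> eps / eps)) \<longlongrightarrow> ennreal \<rho>) (at_right 0)" using lim by (simp only: \<theta>)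
    show "\<forall>\<^sub>F eps in at_right 0. 0 <= \<kappa> eps / eps" using at_right_01
      by eventually_elim (simp add: kpos less_imp_le)
  qed
  have d0: "((%eps. \<kappa> eps / eps - \<rho>\<^sup>2 * (eps / \<kappa> eps)) \<longlongrightarrow> 0) (at_right 0)"
  proof (cases "\<rho> = 0")
    case True thus ?thesis using k by simp
  next
    case False
    have "((%eps. \<kappa> eps / eps - \<rho>\<^sup>2 * inverse (\<kappa> eps / eps)) \<longlongrightarrow> \<rho> - \<rho>\<^sup>2 * inverse \<rho>) (at_right 0)"
      by (intro tendsto_intros k False)
    moreover have "\<rho> - \<rho>\<^sup>2 * inverse \<rho> = 0" using False by (simp add: power2_eq_square)
    ultimately show ?thesis by (simp only: inverse_divide)
  qed
  have "((%eps. I (AU eps j) t) \<longlongrightarrow> (\<Sum>i\<in>UNIV. corrected_mean A \<rho> $ i $ j * I (D0 i) t)) (at_right 0)"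
  proof (rule flux_limit[OF approx_flux_finite[OF A \<rho>0] _ t])
    fix \<psi> h :: "real^'d => real" assume p: "smooth_per \<psi>" and h: "h = (%x. \<rho>\<^sup>2 * laplace \<psi> x)"
    obtain B where B: "B > 0" "!!y. \<bar>laplace \<psi> y\<bar> <= B" by (rule smooth_per_bounded[OF laplace_smooth_per[OF p]]) blast
    let ?c = "%eps. \<kappa> eps / eps - \<rho>\<^sup>2 * (eps / \<kappa> eps)"
    show "\<exists>\<delta>. (\<delta> \<longlongrightarrow> 0) (at_right 0) & (\<forall>\<^sub>F eps in at_right 0. \<forall>y. \<bar>(\<kappa> eps / eps) * laplace \<psi> y - (eps / \<kappa> eps) * h y\<bar> <= \<delta> eps)"
    proof (rule exI[of _ "%eps. \<bar>?c eps\<bar> * B"], intro conjI always_eventually allI)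
      show "((%eps. \<bar>?c eps\<bar> * B) \<longlongrightarrow> 0) (at_right 0)" by (rule tendsto_mult_left_zero[OF tendsto_rabs_zero[OF d0]])
      fix eps y
      have "(\<kappa> eps / eps) * laplace \<psi> y - (eps / \<kappa> eps) * h y = ?c eps * laplace \<psi> y" by (simp only: h left_diff_distrib) simp
      hence "\<bar>(\<kappa> eps / eps) * laplace \<psi> y - (eps / \<kappa> eps) * h y\<bar> = \<bar>?c eps\<bar> * \<bar>laplace \<psi> y\<bar>" by (simp only: abs_mult)
      also have "\<dots> <= \<bar>?c eps\<bar> * B" by (rule mult_left_mono[OF B(2)]) simp
      finally show "\<bar>(\<kappa> eps / eps) * laplace \<psi> y - (eps / \<kappa> eps) * h y\<bar> <= \<bar>?c eps\<bar> * B" .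
    qed
  qed
  thus ?thesis unfolding A_hom_eq[OF False] \<rho>_def .
qed

end

theorem theorem8p1:
  fixes A :: "real^'d \<Rightarrow> real^'d^'d"
    and \<Omega> :: "(real^'d) set"
    and f ustar :: "real^'d \<Rightarrow> real"
    and u :: "real \<Rightarrow> real^'d \<Rightarrow> real"
    and \<kappa> :: "real \<Rightarrow> real"
    and \<theta> :: ennreal
  assumes "periodic_elliptic A"
    and "open \<Omega>" and "connected \<Omega>" and "\<Omega> \<noteq> {}"
    and "f \<in> L2 \<Omega>"
    and "\<And>\<epsilon>. \<epsilon> > 0 \<Longrightarrow> \<kappa> \<epsilon> > 0"
    and "(\<kappa> \<longlongrightarrow> 0) (at_right 0)"
    and "((\<lambda>\<epsilon>. ennreal (\<kappa> \<epsilon> / \<epsilon>)) \<longlongrightarrow> \<theta>) (at_right 0)"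
    and "\<And>\<epsilon>. \<epsilon> > 0 \<Longrightarrow> u \<epsilon> \<in> H 2 \<Omega>"
    and "weakly_tendsto (H 1 \<Omega>) (H1_norm \<Omega>) u ustar (at_right 0)"
    and "\<exists>C. \<forall>\<epsilon>>0. L2_norm \<Omega> (\<lambda>x. \<kappa> \<epsilon> * laplacian \<Omega> (u \<epsilon>) x) \<le> C"
    and "\<And>\<epsilon>. \<epsilon> > 0 \<Longrightarrow>
      distr_eq \<Omega>
        (\<lambda>\<phi>. (\<kappa> \<epsilon>)\<^sup>2 * distr_laplace (distr_laplace (distr_of \<Omega> (u \<epsilon>))) \<phi>
             - distr_div \<Omega> (\<lambda>x. A ((1 / \<epsilon>) *\<^sub>R x) *v grad \<Omega> (u \<epsilon>) x) \<phi>)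
        (distr_of \<Omega> f)"
  shows "weakly_tendsto (L2 \<Omega>) (L2_norm \<Omega>)
           (\<lambda>\<epsilon> x. A ((1 / \<epsilon>) *\<^sub>R x) *v grad \<Omega> (u \<epsilon>) x)
           (\<lambda>x. A_hom A \<theta> *v grad \<Omega> ustar x)
           (at_right 0)
       \<and> distr_eq \<Omega>
           (\<lambda>\<phi>. - distr_div \<Omega> (\<lambda>x. A_hom A \<theta> *v grad \<Omega> ustar x) \<phi>)
           (distr_of \<Omega> f)"
proof -
  note O = assms(2) and uH = assms(9)
  let ?D = "%i. weak_pd (L2 \<Omega>) \<Omega> i" and ?M = "lebesgue_on \<Omega>"
  have u2: "u eps \<in> H (Suc (Suc 0)) \<Omega>" if "eps > 0" for eps using uH[OF that] by (simp only: numeral_2_eq_2)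
  have u1: "u eps \<in> H (Suc 0) \<Omega>" if e: "eps > 0" for eps
  proof -
    have "u eps \<in> L2 \<Omega>" using u2[OF e] sobolev_subset[of "L2 \<Omega>"] by blast
    moreover have "\<exists>v\<in>L2 \<Omega>. has_weak_pd \<Omega> i (u eps) v" for i using weak_pd_H[OF u2[OF e], of i] L2_iff by blast
    ultimately show ?thesis by simp
  qed
  have wc: "weakly_tendsto (H (Suc 0) \<Omega>) (H1_norm \<Omega>) u ustar (at_right 0)" using assms(10) by (simp only: One_nat_def)
  have us: "ustar \<in> H (Suc 0) \<Omega>" using wc unfolding weakly_tendsto_def by blast
  obtain C1 where C1: "\<forall>\<^sub>F eps in at_right 0. H1_norm \<Omega> (u eps) <= C1" by (rule weakly_convergent_bounded[OF O u1 wc]) blast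
  obtain C2 where C2: "\<forall>eps>0. L2_norm \<Omega> (%x. \<kappa> eps * laplacian \<Omega> (u eps) x) <= C2" using assms(11) by blast
  define C where "C = max C1 C2"
  have AD: "(A ((1 / eps) *\<^sub>R x) *v grad \<Omega> (u eps) x) $ i = (\<Sum>k\<in>UNIV. A ((1/eps) *\<^sub>R x) $ i $ k * ?D k (u eps) x)" for eps x i
    by (simp add: matrix_vector_mult_def weak_grad_def)
  interpret osc: oscillating_family \<Omega> A f \<kappa> u "%eps i. ?D i (u eps)" "%eps. laplacian \<Omega> (u eps)" ustar "%i. ?D i ustar" C
  proof
    show "open \<Omega>" "periodic_elliptic A" "(\<kappa> \<longlongrightarrow> 0) (at_right 0)" by fact+
    show "sqint ?M f" using assms(5) by (simp add: L2_iff)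
    show "\<kappa> eps > 0" if "eps > 0" for eps by (rule assms(6)[OF that])
    show "sqint ?M (u eps)" if "eps > 0" for eps using u2[OF that] sobolev_subset[of "L2 \<Omega>"] L2_iff by blast
    show "sqint ?M (?D i (u eps))" if "eps > 0" for eps i by (rule weak_pd_H(1)[OF u1[OF that]])
    show "sqint ?M (laplacian \<Omega> (u eps))" if "eps > 0" for eps
      unfolding laplacian_def[abs_def] by (intro sqint_sum weak_pd2_H(1)[OF O uH[OF that]]) simp
    show "L2_ip ?M (u eps) (pd i t) = - L2_ip ?M (?D i (u eps)) t" if "eps > 0" "t \<in> test_functions \<Omega>" for eps t i
      using weak_pd_H(2)[OF u1[OF that(1)], of i] that(2) unfolding has_weak_pd_iff by blast
    show "(\<Sum>i\<in>UNIV. L2_ip ?M (?D i (u eps)) (pd i t)) = - L2_ip ?M (laplacian \<Omega> (u eps)) t" if "eps > 0" "t \<in> test_functions \<Omega>" for eps t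
      by (rule bilaplace_weak(1)[OF O uH[OF that(1)] that(2)])
    show "(\<kappa> eps)\<^sup>2 * (\<Sum>i\<in>UNIV. L2_ip ?M (laplacian \<Omega> (u eps)) (pd i (pd i t)))
        + (\<Sum>i\<in>UNIV. L2_ip ?M (%x. \<Sum>k\<in>UNIV. A ((1/eps) *\<^sub>R x) $ i $ k * ?D k (u eps) x) (pd i t)) = L2_ip ?M f t"
      if e: "eps > 0" and t: "t \<in> test_functions \<Omega>" for eps t
    proof -
      have "(\<kappa> eps)\<^sup>2 * distr_laplace (distr_laplace (distr_of \<Omega> (u eps))) t
        + - distr_div \<Omega> (%x. A ((1 / eps) *\<^sub>R x) *v grad \<Omega> (u eps) x) t = distr_of \<Omega> f t"
        using assms(12)[OF e] t by (auto simp: distr_eq_def)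
      thus ?thesis unfolding neg_distr_div AD bilaplace_weak(2)[OF O uH[OF e] t] by (simp add: distr_of_def L2_ip_def)
    qed
    show "\<forall>\<^sub>F eps in at_right 0. nrm ?M (u eps) <= C"
      using C1 at_right_01 by eventually_elim (use H1_norm_bounds(1)[OF u1] in \<open>fastforce simp: C_def\<close>)
    show "\<forall>\<^sub>F eps in at_right 0. nrm ?M (?D i (u eps)) <= C" for i
      using C1 at_right_01 by eventually_elim (use H1_norm_bounds(2)[OF u1, of _ i] in \<open>fastforce simp: C_def\<close>)
    show "\<forall>\<^sub>F eps in at_right 0. nrm ?M (%x. \<kappa> eps * laplacian \<Omega> (u eps) x) <= C"
      using at_right_01 by eventually_elim (use C2 in \<open>auto simp: C_def L2_norm_eq\<close>)
    show "((%eps. L2_ip ?M (u eps) t) \<longlongrightarrow> L2_ip ?M ustar t) (at_right 0)" if "t \<in> test_functions \<Omega>" for t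
      by (rule weakly_convergent_L2_ip[OF wc test_borel_on[OF O that]])
    show "L2_ip ?M ustar (pd i t) = - L2_ip ?M (?D i ustar) t" if "t \<in> test_functions \<Omega>" for t i
      using weak_pd_H(2)[OF us, of i] that unfolding has_weak_pd_iff by blast
  qed
  let ?F0 = "%x. A_hom A \<theta> *v grad \<Omega> ustar x"
  have Dq: "sqint ?M (?D i ustar)" for i by (rule weak_pd_H(1)[OF us])
  have F0: "?F0 x $ j = (\<Sum>i\<in>UNIV. A_hom A \<theta> $ i $ j * ?D i ustar x)" for x j
    by (simp add: matrix_vector_mult_def weak_grad_def A_hom_symmetric[OF assms(1), of \<theta> j])
  have F0q: "sqint ?M (%x. ?F0 x $ j)" for j
    unfolding F0 by (intro sqint_sum sqint_scale Dq) simp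
  have AU: "osc.AU eps i = (%x. (A ((1 / eps) *\<^sub>R x) *v grad \<Omega> (u eps) x) $ i)" for eps i
    unfolding AD osc.AU_def[abs_def] ..
  have lim: "((%eps. L2_ip ?M (osc.AU eps j) t) \<longlongrightarrow> L2_ip ?M (%x. ?F0 x $ j) t) (at_right 0)" if t: "t \<in> test_functions \<Omega>" for j t
  proof -
    have tq: "sqint ?M t" by (rule test_borel_on[OF O t])
    have "L2_ip ?M (%x. ?F0 x $ j) t = (LINT x|?M. (\<Sum>i\<in>UNIV. A_hom A \<theta> $ i $ j * (?D i ustar x * t x)))"
      unfolding F0 L2_ip_def by (simp add: sum_distrib_right mult.assoc)
    also have "\<dots> = (\<Sum>i\<in>UNIV. A_hom A \<theta> $ i $ j * L2_ip ?M (?D i ustar) t)"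
      by (subst Bochner_Integration.integral_sum) (simp_all add: L2_ip_def sqint_mult[OF Dq tq])
    finally show ?thesis using osc.flux_limit_A_hom[OF assms(8) t, of j] by simp
  qed
  obtain L where L: "!!i. \<forall>\<^sub>F eps in at_right 0. nrm ?M (osc.AU eps i) <= L" by (rule osc.AU_bound) blast
  have "weakly_tendsto (L2 \<Omega>) (L2_norm \<Omega>) (%eps x. A ((1 / eps) *\<^sub>R x) *v grad \<Omega> (u eps) x) ?F0 (at_right 0)"
    by (rule weakly_tendsto_L2_vecI[OF O osc.AU_sq[unfolded AU] F0q L[unfolded AU] lim[unfolded AU]])
  moreover have "distr_eq \<Omega> (%\<phi>. - distr_div \<Omega> ?F0 \<phi>) (distr_of \<Omega> f)"
    unfolding distr_eq_def neg_distr_div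
    using osc.homogenized_equation[OF lim] by (auto simp: distr_of_def L2_ip_def)
  ultimately show ?thesis ..
qed

end
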